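(* Let $\Phi$, $a$, $\kappa$, $\omega$, $\nu$ and the class $\mathcal{D}(\omega)$ be as in the context. Assume: (1) there exist $0\le\mathfrak{p}\le1/2$ and $c>0$ with $\Phi(m,m')\le c(m^{\mathfrak{p}}+m'^{\mathfrak{p}})1_{[m>0,m'>0]}$ for all $m,m'\ge 0$; (2) $a(m)^{-1/2}\omega(m)$ is a subadditive function of $m\in(0,\infty)$; (3) there is a finite measure $\nu^*(dm)$ on $\mathbb{R}_+$ such that $\nu(dx,dm)\le\nu^*(dm)\,dx$ and $\big\langle m+\frac{a(m)^2}{m},\nu^*\big\rangle<\infty$. Then for any $T\ge0$ there is at most one solution $\{\mu_t\}_{0\le t\le T}$ in $\mathcal{D}(\omega)$ of the equation $$\langle f,\mu_t\rangle-\langle f,\nu\rangle=\int_0^t\Big\langle\frac12 a(m)\frac{\partial^2 f}{\partial x^2},\mu_s\Big\rangle ds+\int_0^t\int_{\mathbb{T}}\int_{\mathbb{R}_+\times\mathbb{R}_+}\frac{f(x,m+m')-f(x,m)}{m'}\,\kappa(m,m')\,\upsilon_s(x,dm)\,\upsilon_s(x,dm')\,dx\,ds$$ (for all $f\in C_b^2(\mathbb{T}\times\mathbb{R}_+)$ and all $t\in[0,T]$), where $\mu_s(dx,dm)=\upsilon_s(x,dm)\,dx$.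
   Context: $\mathbb{T}$ is the one-dimensional torus, $\mathbb{R}_+=[0,\infty)$; $\mathcal{M}_f(\mathbb{T}\times\mathbb{R}_+)$ is the space of positive finite measures on $\mathbb{T}\times\mathbb{R}_+$ (weak topology) and $\mathcal{M}_1$ the subset of probability measures; $\langle f,\mu\rangle$ is the integral of $f$ against $\mu$. $C_b^2(\mathbb{T}\times\mathbb{R}_+)$ is the space of bounded continuous functions $f(x,m)$ having continuous bounded derivatives in the space variable $x$ up to second order. $\Phi:\mathbb{R}_+\times\mathbb{R}_+\to\mathbb{R}_+$ is a nonnegative symmetric kernel vanishing when either coordinate is $0$. For each $L>0$ there is $\Gamma(L)>0$ with $|\Phi(m+m'',m')-\Phi(m,m')|\le\Gamma(L)m''$ for all $m',m''\ge0$ whenever $m>L$ (standing assumption). $a:(0,\infty)\to(0,\infty)$ is nonincreasing and $a(0)=0$. $\kappa(m,m')=\Phi(m,m')[a(m)+a(m')]$, and $\omega(m)=[1+c+a(1)][m^{\mathfrak{p}}+a(m)+1]$ with $c,\mathfrak{p}$ the constants in assumption (1) of the claim. $\nu\in\mathcal{M}_1(\mathbb{T}\times\mathbb{R}_+)$ is the initial profile. $\mathcal{D}(\omega)$ is the set of paths $\eta\in C(\mathbb{R}_+,\mathcal{M}_f(\mathbb{T}\times\mathbb{R}_+))$ whose marginal satisfies $\eta_t(dx,\mathbb{R}_+)\ll dx$ for all $t$, so $\eta_t(dx,dm)=\upsilon_t(x,dm)\,dx$, and such that $$\sup_{t\ge0}\Big\|\int_{\mathbb{R}_+}\frac{\omega(m)}{m}\upsilon_t(\cdot,dm)\Big\|_{L^\infty(\mathbb{T})}<\infty\quad\text{and}\quad\sup_{t\le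 T}\langle m,\eta_t\rangle<\infty\ \text{ for every }T>0.$$ A path $\{\mu_t\}_{0\le t\le T}$ is said to be in $\mathcal{D}(\omega)$ if it is continuous on $[0,T]$ and has these properties with $t$ restricted to $[0,T]$. *)

theory Defs
  imports "HOL-Probability.Probability"
begin

(* The torus is R/Z with fundamental domain [0,1): measures live on [0,1), carrying Lebesgue
   measure dx, while functions on the torus are 1-periodic functions on the real line. *)

definition torus :: "real measure" where
  "torus = restrict_space lborel {0..<1}"

definition halfline :: "real measure" where
  "halfline = restrict_space borel {0..}"

definition finite_measures :: "(real \<times> real) measure set" where
  "finite_measures = {\<mu>. sets \<mu> = sets (torus \<Otimes>\<^sub>M halfline) \<and> finite_measure \<mu>}"

definition probability_measures :: "(real \<times> real) measure set" where
  "probability_measures = {\<mu>. sets \<mu> = sets (torus \<Otimes>\<^sub>M halfline) \<and> prob_space \<mu>}"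

definition pairing :: "(real \<Rightarrow> real \<Rightarrow> real) \<Rightarrow> (real \<times> real) measure \<Rightarrow> real" where
  "pairing f \<mu> = (\<integral>(x, m). f x m \<partial>\<mu>)"

definition Cb :: "(real \<Rightarrow> real \<Rightarrow> real) set" where
  "Cb = {f. continuous_on (UNIV \<times> {0..}) (\<lambda>(x, m). f x m) \<and>
            bounded ((\<lambda>(x, m). f x m) ` (UNIV \<times> {0..})) \<and>
            (\<forall>x. \<forall>m\<ge>0. f (x + 1) m = f x m)}"

definition deriv_x :: "(real \<Rightarrow> real \<Rightarrow> real) \<Rightarrow> real \<Rightarrow> real \<Rightarrow> real" where
  "deriv_x f x m = deriv (\<lambda>y. f y m) x"

definition Cb2 :: "(real \<Rightarrow> real \<Rightarrow> real) set" where
  "Cb2 = {f. f \<in> Cb \<and> deriv_x f \<in> Cb \<and> deriv_x (deriv_x f) \<in> Cb \<and>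
             (\<forall>x. \<forall>m\<ge>0. (\<lambda>y. f y m) differentiable at x \<and> (\<lambda>y. deriv_x f y m) differentiable at x)}"

definition weak_topology :: "(real \<times> real) measure topology" where
  "weak_topology =
     topology_generated_by {{\<mu> \<in> finite_measures. pairing f \<mu> \<in> U} | f U. f \<in> Cb \<and> open U}"

(* eta(dx,dm) = upsilon(x,dm) dx with upsilon a measurable kernel. *)

definition disintegrates :: "(real \<times> real) measure \<Rightarrow> (real \<Rightarrow> real measure) \<Rightarrow> bool" where
  "disintegrates \<eta> \<upsilon> \<longleftrightarrow>
     (\<forall>x\<in>space torus. sets (\<upsilon> x) = sets halfline \<and> finite_measure (\<upsilon> x)) \<and>
     (\<forall>B\<in>sets halfline. (\<lambda>x. emeasure (\<upsilon> x) B) \<in> borel_measurable torus) \<and>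
     (\<forall>A\<in>sets torus. \<forall>B\<in>sets halfline.
        emeasure \<eta> (A \<times> B) = (\<integral>\<^sup>+x\<in>A. emeasure (\<upsilon> x) B \<partial>torus))"

(* The kernel is determined by eta up to a Lebesgue-null set of x, so the choice of version
   does not affect any of the integrals in x below. *)

definition kernel :: "(real \<times> real) measure \<Rightarrow> real \<Rightarrow> real measure" where
  "kernel \<eta> = (SOME \<upsilon>. disintegrates \<eta> \<upsilon>)"

(* Paths are restricted to the time set I: I = {0..} gives D(W), I = {0..T} its version on [0,T].
   The quotient W m / m is formed in ennreal, so that it is infinite at m = 0 when W 0 > 0. *)

definition class_D :: "(real \<Rightarrow> real) \<Rightarrow> real set \<Rightarrow> (real \<Rightarrow> (real \<times> real) measure) set" where
  "class_D W I = {\<eta>.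
     continuous_map (top_of_set I) weak_topology \<eta> \<and>
     (\<forall>t\<in>I. absolutely_continuous torus (distr (\<eta> t) torus fst) \<and>
            (\<exists>\<upsilon>. disintegrates (\<eta> t) \<upsilon>)) \<and>
     (SUP t\<in>I. esssup torus (\<lambda>x. \<integral>\<^sup>+m. ennreal (W m) / ennreal m \<partial>kernel (\<eta> t) x)) < \<infinity> \<and>
     (\<forall>T>0. (SUP t\<in>I \<inter> {..T}. \<integral>\<^sup>+(x, m). ennreal m \<partial>\<eta> t) < \<infinity>)}"

definition kappa :: "(real \<Rightarrow> real \<Rightarrow> real) \<Rightarrow> (real \<Rightarrow> real) \<Rightarrow> real \<Rightarrow> real \<Rightarrow> real" where
  "kappa \<Phi> a m m' = \<Phi> m m' * (a m + a m')"

definition omega :: "real \<Rightarrow> real \<Rightarrow> (real \<Rightarrow> real) \<Rightarrow> real \<Rightarrow> real" where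
  "omega c p a m = (1 + c + a 1) * (m powr p + a m + 1)"

definition diffusion_term ::
  "(real \<Rightarrow> real) \<Rightarrow> (real \<Rightarrow> real \<Rightarrow> real) \<Rightarrow> (real \<times> real) measure \<Rightarrow> real" where
  "diffusion_term a f \<mu> = pairing (\<lambda>x m. 1/2 * a m * deriv_x (deriv_x f) x m) \<mu>"

definition collision_term ::
  "(real \<Rightarrow> real \<Rightarrow> real) \<Rightarrow> (real \<Rightarrow> real) \<Rightarrow> (real \<Rightarrow> real \<Rightarrow> real) \<Rightarrow>
   (real \<times> real) measure \<Rightarrow> real" where
  "collision_term \<Phi> a f \<mu> =
     (\<integral>x. (\<integral>(m, m'). (f x (m + m') - f x m) / m' * kappa \<Phi> a m m'
             \<partial>(kernel \<mu> x \<Otimes>\<^sub>M kernel \<mu> x)) \<partial>torus)"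

(* The time integrals are required to exist, because a Bochner integral that does not exist
   is 0 by convention. *)

definition solves ::
  "(real \<Rightarrow> real \<Rightarrow> real) \<Rightarrow> (real \<Rightarrow> real) \<Rightarrow> (real \<times> real) measure \<Rightarrow> real \<Rightarrow>
   (real \<Rightarrow> (real \<times> real) measure) \<Rightarrow> bool" where
  "solves \<Phi> a \<nu> T \<mu> \<longleftrightarrow>
     (\<forall>f\<in>Cb2. \<forall>t\<in>{0..T}.
        set_integrable lborel {0..t} (\<lambda>s. diffusion_term a f (\<mu> s)) \<and>
        set_integrable lborel {0..t} (\<lambda>s. collision_term \<Phi> a f (\<mu> s)) \<and>
        pairing f (\<mu> t) - pairing f \<nu> =
          (LINT s:{0..t}|lborel. diffusion_term a f (\<mu> s)) +
          (LINT s:{0..t}|lborel. collision_term \<Phi> a f (\<mu> s)))"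

end

theory Submission
  imports Defs
begin

text \<open>
The idea is to compare two solutions in a weighted total variation norm, after passing from mass to
particle number. Since \<open>om m / m\<close> is integrable, \<open>\<upsilon>\<^sub>s(x,dm) / m\<close> is a finite measure \<open>nk s x\<close>; put \<open>N s = nk s x dx\<close>.
Testing the equation with \<open>m * f\<close> turns the collision term into the symmetric Smoluchowski form
\<open>coll s f\<close>, the integral of \<open>\<kappa>/2 * (f(m+m') - f(m) - f(m'))\<close> against two copies of \<open>nk s x\<close>.

The equation is first put in mild form (\<open>mild_bounded\<close>): the heat flow acts at fixed mass, waves in \<open>x\<close> are its
eigenfunctions, Duhamel's formula for waves follows by a second order increment estimate, and linear
combinations of waves and mass weights determine all bounded Borel functions.

The mild form gives bounds uniform in \<open>x\<close>. For \<open>g \<ge> 0\<close> the heat flow at diffusivity \<open>a\<close>,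
multiplied by \<open>sqrt a\<close>, is nondecreasing in \<open>a\<close>. Hence if \<open>ph / sqrt a\<close> is subadditive, collisions do not increase the integral of
\<open>ph P\<^sub>r g\<close> (\<open>merge_le\<close>), so its bound by the initial majorant persists (\<open>bnd_tame\<close>). This applies to \<open>om\<close> and to \<open>a\<^sup>2\<close>.
The weight \<open>om * m powr p\<close> is not of this kind, but its gain is linear in the quantity itself
(\<open>collision_gain_le\<close>), and a Gronwall argument on truncations controls it. Together these bound
\<open>om\<^sup>2\<close> against \<open>nk s x\<close> for almost every \<open>x\<close> (\<open>kernel_om_sq\<close>).

For two solutions, the difference of the collision terms is the integral against \<open>N s - N' s\<close> of a linear
operator whose kernel is the sum of both solutions. Its diagonal part is a loss with a good sign. With the
sign of \<open>N s - N' s\<close> inserted in the other part, the norm grows at a rate bounded by the second moment. To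
make this rigorous the norm is truncated to masses in \<open>{1/k..k}\<close>, where the loss rate is bounded and an explicit
Euler step is legitimate (\<open>NB_step\<close>); the error is a tail of \<open>om\<^sup>2\<close> that vanishes uniformly in time as \<open>k\<close> grows
(\<open>tail_tendsto\<close>). A discrete Gronwall argument yields that the number measures, hence the solutions, agree.
\<close>

abbreviation HH :: "(real \<times> real) measure" where "HH == halfline \<Otimes>\<^sub>M halfline"

lemmas pair_space = space_pair_measure and bochner_cong = Bochner_Integration.integral_cong

abbreviation Borel :: "'a measure => ('a => 'b::topological_space) set" where "Borel == borel_measurable"

abbreviation total :: "(real => real) => ennreal" where "total g == (\<integral>\<^sup>+x. ennreal (g x) \<partial>torus)"

section \<open>Bounded Borel functions and finite kernels\<close>

definition closed_class :: "'a measure => (('a => real) => bool) => bool" where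
 "closed_class M P \<longleftrightarrow>
   (\<forall>f g al \<beta>. P f --> P g --> f : Borel M --> g : Borel M --> P (%x. al * f x + \<beta> * g x)) \<and>
   (\<forall>F f C. (\<forall>i::nat. P (F i) & F i : Borel M) --> (\<forall>i. \<forall>x\<in>space M. \<bar>F i x\<bar> <= C) \<longrightarrow>
    (\<forall>x\<in>space M. (%i. F i x) \<longlonglongrightarrow> f x) --> P f)"

lemma closed_classI:
 assumes "!!f g al \<beta>. P f ==> P g ==> f : Borel M ==> g : Borel M ==>
    P (%x. al * f x + \<beta> * g x)"
  and "!!F f C. (!!i::nat. P (F i)) ==> (!!i. F i : Borel M) ==>
    (!!i x. x : space M ==> \<bar>F i x\<bar> <= C) ==>
    (!!x. x : space M ==> (%i. F i x) \<longlonglongrightarrow> f x) ==> P f"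
 shows "closed_class M P" unfolding closed_class_def using assms by blast

lemma closed_class_linear:
 assumes "closed_class M P" "P f" "P g" "f : Borel M" "g : Borel M"
 shows "P (%x. al * f x + \<beta> * g x)" using assms unfolding closed_class_def by blast

lemma closed_class_limit:
 assumes "closed_class M P" "!!i::nat. P (F i)" "!!i. F i : Borel M"
  "!!i x. x : space M ==> \<bar>F i x\<bar> <= C" "!!x. x : space M ==> (%i. F i x) \<longlonglongrightarrow> f x"
 shows "P f" using assms unfolding closed_class_def by blast

text \<open>A functional monotone class theorem: Dynkin's lemma gives indicators of measurable sets, and simple functions approximate
uniformly.\<close>
lemma bounded_functional_closure:
 fixes P :: "('a => real) => bool" and f :: "'a => real"
 assumes G: "Int_stable G" "G \<subseteq> Pow (space M)" "sets M = sigma_sets (space M) G"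
  and one: "P (%_. 1)"
  and gen: "!!A. A : G ==> P (indicator A)"
  and cl: "closed_class M P"
  and f: "f : Borel M" "!!x. x : space M ==> \<bar>f x\<bar> <= C"
 shows "P f"
proof -
 note lin = closed_class_linear[OF cl] and lim = closed_class_limit[OF cl]
 have cong: "P g" if "P h" "h : Borel M" "!!x. x : space M ==> h x = g x"
  "!!x. x : space M ==> \<bar>h x\<bar> <= C" for g h C by (rule lim[of "%_. h" C]) (use that in auto)
 have zero: "P (%_. 0)" using lin[OF one one, of 0 0] by simp
 have add: "P (%x. f x + g x)" if "P f" "P g" "f : Borel M" "g : Borel M" for f g using lin[OF that, of 1 1] by simp
 have scale: "P (%x. al * f x)" if "P f" "f : Borel M" for f al using lin[OF that(1) that(1) that(2) that(2), of al 0] by simp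
 have sums: "P (%x. \<Sum>i\<in>I. f i x)" if "finite I" "!!i. i : I ==> P (f i)" "!!i. i : I ==> f i : Borel M"
  for f :: "'i => 'a => real" and I using that
 proof (induction I)
  case (insert i I)
  thus ?case using add[of "f i" "%x. \<Sum>i\<in>I. f i x"] by (auto intro!: borel_measurable_sum)
 qed (simp add: zero)
 have sub: "sigma_sets (space M) G = sets M" using G by simp
 have ind: "P (indicator A)" if "A : sets M" for A
 proof -
  have "A : sigma_sets (space M) G" using that G by simp
  with G(1,2) show ?thesis
  proof (induct rule: sigma_sets_induct_disjoint)
   case (basic A) thus ?case by (rule gen)
  next
   case empty thus ?case using zero by (simp add: indicator_def)
  next
   case (compl A)
   hence A: "A : sets M" using sub by simp
   have "P (%x. 1 * 1 + (-1) * indicator A x)" by (rule lin[OF one compl(2)]) (use A in auto)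
   thus ?case by (rule cong[where C=1]) (use A in \<open>auto simp: indicator_def\<close>)
  next
   case (union A)
   hence A: "A i : sets M" for i using sub by auto
   have P: "P (%x. \<Sum>i<n. indicator (A i) x)" for n by (rule sums) (use union A in auto)
   have eq: "(\<Sum>i<n. indicator (A i) x) = (indicator (\<Union>i<n. A i) x :: real)" for n x
    using union(1) by (subst indicator_UN_disjoint) (auto simp: disjoint_family_on_def)
   show ?case
   proof (rule lim[OF P, where C=1])
    show "(%x. \<Sum>i<n. indicator (A i) x :: real) : Borel M" for n using A by (intro borel_measurable_sum) auto
    show "\<bar>\<Sum>i<n. indicator (A i) x :: real\<bar> <= 1" for n x unfolding eq by (auto simp: indicator_def)
    show "(%n. \<Sum>i<n. indicator (A i) x :: real) \<longlonglongrightarrow> indicator (\<Union>i. A i) x" for x unfolding eq by (rule LIMSEQ_indicator_UN)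
   qed
  qed
 qed
 define N where "N j = \<lceil>real (Suc j) * \<bar>C\<bar>\<rceil> + 1" for j :: nat
 define A where "A j k = {x : space M. \<lfloor>real (Suc j) * f x\<rfloor> = k}" for j :: nat and k
 define F where "F j x = (\<Sum>k\<in>{-N j..N j}. (real_of_int k / real (Suc j)) * indicator (A j k) x)" for j x
 have A: "A j k : sets M" for j k unfolding A_def using f(1) by measurable
 have FP: "P (F j)" for j unfolding F_def by (rule sums) (use A in \<open>auto intro!: scale ind simp del: times_divide_eq_left\<close>)
 have FM: "F j : Borel M" for j unfolding F_def by (intro borel_measurable_sum borel_measurable_times) (use A in auto)
 have FE: "F j x = real_of_int \<lfloor>real (Suc j) * f x\<rfloor> / real (Suc j)" if x: "x : space M" for j x
 proof -
  let ?k = "\<lfloor>real (Suc j) * f x\<rfloor>"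
  have b: "\<bar>real (Suc j) * f x\<bar> <= real (Suc j) * \<bar>C\<bar>" using f(2)[OF x] by (auto simp: abs_mult intro!: mult_left_mono)
  have "\<lfloor>y\<rfloor> : {- (\<lceil>c\<rceil> + 1)..\<lceil>c\<rceil> + 1}" if "\<bar>y\<bar> <= c" for y c :: real using that by (auto; linarith)
  from this[OF b] have "?k : {-N j..N j}" unfolding N_def .
  moreover have "(real_of_int k / real (Suc j)) * indicator (A j k) x = (if k = ?k then real_of_int ?k / real (Suc j) else 0)" for k
   using x by (auto simp: A_def indicator_def)
  ultimately show ?thesis unfolding F_def by simp
 qed
 have Fd: "\<bar>F j x - f x\<bar> <= 1 / real (Suc j)" if x: "x : space M" for j x
 proof -
  have "\<bar>real_of_int \<lfloor>real (Suc j) * f x\<rfloor> - real (Suc j) * f x\<bar> <= 1" by linarith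
  moreover have "F j x - f x = (real_of_int \<lfloor>real (Suc j) * f x\<rfloor> - real (Suc j) * f x) / real (Suc j)" unfolding FE[OF x] by (simp add: field_simps)
  ultimately show ?thesis by (simp add: divide_right_mono)
 qed
 show ?thesis
 proof (rule lim[OF FP FM, where C="C + 1"])
  fix j x assume x: "x : space M"
  have "1 / real (Suc j) <= 1" by simp
  thus "\<bar>F j x\<bar> <= C + 1" using Fd[OF x, of j] f(2)[OF x] by linarith
 next
  fix x assume x: "x : space M"
  have "(%j. F j x - f x) \<longlonglongrightarrow> 0" by (rule Lim_null_comparison[OF _ LIMSEQ_Suc[OF lim_1_over_n]]) (use Fd[OF x] in auto)
  thus "(%j. F j x) \<longlonglongrightarrow> f x" by (simp add: LIM_zero_iff)
 qed
qed

definition finite_kernel :: "'a measure => 'b measure => ('a => 'b measure) => bool" where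
 "finite_kernel M N k \<longleftrightarrow>
   (\<forall>x\<in>space M. sets (k x) = sets N & finite_measure (k x)) \<and>
   (\<forall>B\<in>sets N. (%x. emeasure (k x) B) : Borel M)"

lemma finite_kernelD:
 assumes "finite_kernel M N k"
 shows "x : space M ==> sets (k x) = sets N" "x : space M ==> finite_measure (k x)"
  "x : space M ==> space (k x) = space N"
  "B : sets N ==> (%x. emeasure (k x) B) : Borel M" using assms by (auto simp: finite_kernel_def dest: sets_eq_imp_space_eq)

lemma finite_kernel_measurable:
 assumes k: "finite_kernel M N k" and x: "x : space M" and f: "f : measurable (M \<Otimes>\<^sub>M N) L"
 shows "(%y. f (x, y)) : measurable (k x) L"
proof -
 have "(%y. f (x, y)) : measurable N L" using f x by measurable
 thus ?thesis using finite_kernelD(1)[OF k x] measurable_cong_sets by blast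
qed

lemma finite_kernel_emeasure:
 assumes k: "finite_kernel M N k" and A: "A : sets (M \<Otimes>\<^sub>M N)"
 shows "(%x. emeasure (k x) (Pair x -` A)) : Borel M"
proof -
 note kD = finite_kernelD[OF k]
 have "A : sigma_sets (space M \<times> space N) {a \<times> b |a b. a : sets M & b : sets N}" using A unfolding sets_pair_measure .
 with Int_stable_pair_measure_generator pair_measure_closed show ?thesis
 proof (induct rule: sigma_sets_induct_disjoint)
  case (basic A)
  then obtain a b where ab: "A = a \<times> b" "a : sets M" "b : sets N" by auto
  have "emeasure (k x) (Pair x -` A) = indicator a x * emeasure (k x) b" if "x : space M" for x using ab by (auto simp: indicator_def vimage_def)
  thus ?case using ab kD(4)[OF ab(3)] by (simp cong: measurable_cong)
 next
  case empty thus ?case by simp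
 next
  case (compl A)
  have A: "A : sets (M \<Otimes>\<^sub>M N)" using compl(1) unfolding sets_pair_measure .
  have "emeasure (k x) (Pair x -` (space M \<times> space N - A)) = emeasure (k x) (space N) - emeasure (k x) (Pair x -` A)"
   if x: "x : space M" for x
  proof -
   interpret finite_measure "k x" using kD x by auto
   have s: "Pair x -` A : sets (k x)" using sets_Pair1[OF A, of x] kD(1)[OF x] by simp
   have "Pair x -` (space M \<times> space N - A) = space (k x) - Pair x -` A" using x kD(3)[OF x] by auto
   thus ?thesis using emeasure_compl[OF s] kD(3)[OF x] by simp
  qed
  thus ?case using kD(4)[of "space N"] compl(2) by (simp cong: measurable_cong)
 next
  case (union A)
  have A: "A i : sets (M \<Otimes>\<^sub>M N)" for i using union(2) unfolding sets_pair_measure by auto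
  have "emeasure (k x) (Pair x -` (\<Union>i. A i)) = (\<Sum>i. emeasure (k x) (Pair x -` A i))" if x: "x : space M" for x unfolding vimage_UN
   by (rule suminf_emeasure[symmetric])
    (use union(1) sets_Pair1[OF A, of x] kD(1)[OF x] in \<open>auto simp: disjoint_family_on_def\<close>)
  thus ?case using union(3) by (simp cong: measurable_cong)
 qed
qed

lemma finite_kernel_nn_integral [measurable (raw)]:
 assumes k: "finite_kernel M N k" and f: "f : Borel (M \<Otimes>\<^sub>M N)"
 shows "(%x. \<integral>\<^sup>+y. f (x, y) \<partial>k x) : Borel M" using f
proof (induct f rule: borel_measurable_induct)
 case (cong f g)
 hence "(\<integral>\<^sup>+y. f (x, y) \<partial>k x) = (\<integral>\<^sup>+y. g (x, y) \<partial>k x)" if "x : space M" for x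
  using that finite_kernelD(3)[OF k that] by (intro nn_integral_cong) (auto simp: pair_space)
 thus ?case using cong by (simp cong: measurable_cong)
next
 case (set A)
 have "(\<integral>\<^sup>+y. indicator A (x, y) \<partial>k x) = emeasure (k x) (Pair x -` A)" if "x : space M" for x
 proof -
  have "(%y. indicator A (x, y) :: ennreal) = indicator (Pair x -` A)" by (auto simp: indicator_def)
  thus ?thesis using sets_Pair1[OF set, of x] finite_kernelD(1)[OF k that] by simp
 qed
 thus ?case using finite_kernel_emeasure[OF k set] by (simp cong: measurable_cong)
next
 case (mult u c)
 have "(\<integral>\<^sup>+y. c * u (x, y) \<partial>k x) = c * (\<integral>\<^sup>+y. u (x, y) \<partial>k x)" if "x : space M" for x
  by (rule nn_integral_cmult) (rule finite_kernel_measurable[OF k that mult(2)])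
 thus ?case using mult by (simp cong: measurable_cong)
next
 case (add u v)
 have "(\<integral>\<^sup>+y. v (x, y) + u (x, y) \<partial>k x) = (\<integral>\<^sup>+y. v (x, y) \<partial>k x) + (\<integral>\<^sup>+y. u (x, y) \<partial>k x)" if "x : space M" for x
  by (rule nn_integral_add) (rule finite_kernel_measurable[OF k that], fact)+
 thus ?case using add by (simp cong: measurable_cong)
next
 case (seq U)
 have "(\<integral>\<^sup>+y. (SUP i. U i) (x, y) \<partial>k x) = (SUP i. \<integral>\<^sup>+y. U i (x, y) \<partial>k x)" if x: "x : space M" for x
  unfolding SUP_apply by (rule nn_integral_monotone_convergence_SUP)
   (use seq in \<open>auto simp: incseq_def le_fun_def intro: finite_kernel_measurable[OF k x seq(1)]\<close>)
 thus ?case using seq by (simp cong: measurable_cong)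
qed

text \<open>The measure \<open>k x (dy) M(dx)\<close> obtained by integrating a kernel. It is defined on the product so that densities and integrals can be
computed fibre by fibre.\<close>
definition kint :: "'a measure => 'b measure => ('a => 'b measure) => ('a \<times> 'b) measure" where
 "kint M N k = measure_of (space M \<times> space N) (sets (M \<Otimes>\<^sub>M N))
   (%A. \<integral>\<^sup>+x. emeasure (k x) (Pair x -` A) \<partial>M)"

lemma sets_kint [simp, measurable_cong]: "sets (kint M N k) = sets (M \<Otimes>\<^sub>M N)"
 and space_kint [simp]: "space (kint M N k) = space M \<times> space N"
proof -
 have *: "sets (M \<Otimes>\<^sub>M N) \<subseteq> Pow (space M \<times> space N)" using sets.space_closed[of "M \<Otimes>\<^sub>M N"] by (simp add: pair_space)
 thus "space (kint M N k) = space M \<times> space N" unfolding kint_def by simp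
 have "sets (kint M N k) = sigma_sets (space M \<times> space N) (sets (M \<Otimes>\<^sub>M N))" unfolding kint_def using * by simp
 thus "sets (kint M N k) = sets (M \<Otimes>\<^sub>M N)" using sets.sigma_sets_eq[of "M \<Otimes>\<^sub>M N"] by (simp add: pair_space)
qed

lemma emeasure_kint:
 assumes k: "finite_kernel M N k" and A: "A : sets (M \<Otimes>\<^sub>M N)"
 shows "emeasure (kint M N k) A = (\<integral>\<^sup>+x. emeasure (k x) (Pair x -` A) \<partial>M)"
proof -
 note kD = finite_kernelD[OF k]
 have "sigma_algebra (space M \<times> space N) (sets (M \<Otimes>\<^sub>M N))" using sets.sigma_algebra_axioms[of "M \<Otimes>\<^sub>M N"] by (simp add: pair_space)
 moreover have "positive (sets (M \<Otimes>\<^sub>M N)) (%A. \<integral>\<^sup>+x. emeasure (k x) (Pair x -` A) \<partial>M)" by (simp add: positive_def)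
 moreover have "countably_additive (sets (M \<Otimes>\<^sub>M N)) (%A. \<integral>\<^sup>+x. emeasure (k x) (Pair x -` A) \<partial>M)"
 proof (rule countably_additiveI)
  fix A :: "nat => _" assume A: "range A \<subseteq> sets (M \<Otimes>\<^sub>M N)" "disjoint_family A"
  have "(\<Sum>i. \<integral>\<^sup>+x. emeasure (k x) (Pair x -` A i) \<partial>M) = (\<integral>\<^sup>+x. (\<Sum>i. emeasure (k x) (Pair x -` A i)) \<partial>M)"
   by (rule nn_integral_suminf[symmetric], rule finite_kernel_emeasure[OF k]) (use A in auto)
  also have "... = (\<integral>\<^sup>+x. emeasure (k x) (Pair x -` (\<Union>i. A i)) \<partial>M)"
  proof (rule nn_integral_cong)
   fix x assume x: "x : space M"
   show "(\<Sum>i. emeasure (k x) (Pair x -` A i)) = emeasure (k x) (Pair x -` (\<Union>i. A i))" unfolding vimage_UN by (rule suminf_emeasure)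
     (use A sets_Pair1[of "A _" M N x] kD(1)[OF x] in \<open>auto simp: disjoint_family_on_def\<close>)
  qed
  finally show "(\<Sum>i. \<integral>\<^sup>+x. emeasure (k x) (Pair x -` A i) \<partial>M) = (\<integral>\<^sup>+x. emeasure (k x) (Pair x -` (\<Union>i. A i)) \<partial>M)" .
 qed
 ultimately show ?thesis unfolding kint_def using A by (rule emeasure_measure_of_sigma)
qed

lemma nn_integral_kint:
 assumes k: "finite_kernel M N k" and f: "f : Borel (M \<Otimes>\<^sub>M N)"
 shows "(\<integral>\<^sup>+z. f z \<partial>kint M N k) = (\<integral>\<^sup>+x. \<integral>\<^sup>+y. f (x, y) \<partial>k x \<partial>M)" using f
proof (induct f rule: borel_measurable_induct)
 case (cong f g)
 have "(\<integral>\<^sup>+z. f z \<partial>kint M N k) = (\<integral>\<^sup>+z. g z \<partial>kint M N k)"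
  using cong(3) by (intro nn_integral_cong) (auto simp: pair_space)
 moreover have "(\<integral>\<^sup>+x. \<integral>\<^sup>+y. f (x, y) \<partial>k x \<partial>M) = (\<integral>\<^sup>+x. \<integral>\<^sup>+y. g (x, y) \<partial>k x \<partial>M)"
  using cong(3) finite_kernelD(3)[OF k] by (intro nn_integral_cong) (auto simp: pair_space)
 ultimately show ?case using cong by simp
next
 case (set A)
 have "(\<integral>\<^sup>+y. indicator A (x, y) \<partial>k x) = emeasure (k x) (Pair x -` A)" if "x : space M" for x
 proof -
  have "(%y. indicator A (x, y) :: ennreal) = indicator (Pair x -` A)" by (auto simp: indicator_def)
  thus ?thesis using sets_Pair1[OF set, of x] finite_kernelD(1)[OF k that] by simp
 qed
 hence "(\<integral>\<^sup>+x. \<integral>\<^sup>+y. indicator A (x, y) \<partial>k x \<partial>M) = (\<integral>\<^sup>+x. emeasure (k x) (Pair x -` A) \<partial>M)"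
  by (intro nn_integral_cong) auto
 thus ?case using emeasure_kint[OF k set] set by simp
next
 case (mult u c)
 have "(\<integral>\<^sup>+x. \<integral>\<^sup>+y. c * u (x, y) \<partial>k x \<partial>M) = (\<integral>\<^sup>+x. c * (\<integral>\<^sup>+y. u (x, y) \<partial>k x) \<partial>M)"
  by (intro nn_integral_cong nn_integral_cmult finite_kernel_measurable[OF k _ mult(2)])
 also have "... = c * (\<integral>\<^sup>+x. \<integral>\<^sup>+y. u (x, y) \<partial>k x \<partial>M)"
  by (rule nn_integral_cmult) (rule finite_kernel_nn_integral[OF k mult(2)])
 finally show ?case using mult by (simp add: nn_integral_cmult)
next
 case (add u v)
 have "(\<integral>\<^sup>+x. \<integral>\<^sup>+y. v (x, y) + u (x, y) \<partial>k x \<partial>M) = (\<integral>\<^sup>+x. (\<integral>\<^sup>+y. v (x, y) \<partial>k x) + (\<integral>\<^sup>+y. u (x, y) \<partial>k x) \<partial>M)"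
  by (intro nn_integral_cong nn_integral_add finite_kernel_measurable[OF k]) (use add in auto)
 also have "... = (\<integral>\<^sup>+x. \<integral>\<^sup>+y. v (x, y) \<partial>k x \<partial>M) + (\<integral>\<^sup>+x. \<integral>\<^sup>+y. u (x, y) \<partial>k x \<partial>M)"
  by (rule nn_integral_add) (rule finite_kernel_nn_integral[OF k], use add in simp)+
 finally show ?case using add by (simp add: nn_integral_add)
next
 case (seq U)
 have "(\<integral>\<^sup>+x. \<integral>\<^sup>+y. (SUP i. U i) (x, y) \<partial>k x \<partial>M) = (\<integral>\<^sup>+x. (SUP i. \<integral>\<^sup>+y. U i (x, y) \<partial>k x) \<partial>M)"
  unfolding SUP_apply by (intro nn_integral_cong nn_integral_monotone_convergence_SUP)
   (use seq in \<open>auto simp: incseq_def le_fun_def intro: finite_kernel_measurable[OF k _ seq(1)]\<close>)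
 also have "... = (SUP i. \<integral>\<^sup>+x. \<integral>\<^sup>+y. U i (x, y) \<partial>k x \<partial>M)" by (intro nn_integral_monotone_convergence_SUP)
   (use seq finite_kernel_nn_integral[OF k] in \<open>auto simp: incseq_def le_fun_def intro!: nn_integral_mono\<close>)
 also have "... = (\<integral>\<^sup>+z. (SUP i. U i z) \<partial>kint M N k)" using seq by (subst nn_integral_monotone_convergence_SUP) auto
 finally show ?case unfolding SUP_apply by simp
qed

lemma finite_kernel_integral:
 fixes f :: "'a \<times> 'b => real"
 assumes k: "finite_kernel M N k" and f: "f : Borel (M \<Otimes>\<^sub>M N)"
 shows "(%x. \<integral>y. f (x, y) \<partial>k x) : Borel M"
proof -
 let ?D = "%x. \<integral>\<^sup>+y. ennreal (norm (f (x, y))) \<partial>k x"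
 have eq: "(\<integral>y. f (x, y) \<partial>k x) = (if ?D x < \<infinity> then enn2real (\<integral>\<^sup>+y. ennreal (f (x, y)) \<partial>k x) - enn2real (\<integral>\<^sup>+y. ennreal (- f (x, y)) \<partial>k x) else 0)"
  if x: "x : space M" for x
 proof (cases "?D x < \<infinity>")
  case True
  hence "integrable (k x) (%y. f (x, y))" by (auto simp: integrable_iff_bounded finite_kernel_measurable[OF k x f])
  thus ?thesis using True by (simp add: real_lebesgue_integral_def)
 next
  case False
  hence "\<not> integrable (k x) (%y. f (x, y))" by (auto simp: integrable_iff_bounded)
  thus ?thesis using False by (simp add: not_integrable_integral_eq)
 qed
 have "(%x. if ?D x < \<infinity> then enn2real (\<integral>\<^sup>+y. ennreal (f (x, y)) \<partial>k x) - enn2real (\<integral>\<^sup>+y. ennreal (- f (x, y)) \<partial>k x) else 0)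
   : Borel M" using finite_kernel_nn_integral[OF k, of "%z. ennreal (norm (f z))"]
   finite_kernel_nn_integral[OF k, of "%z. ennreal (f z)"]
   finite_kernel_nn_integral[OF k, of "%z. ennreal (- f z)"] f by measurable
 thus ?thesis using eq by (simp cong: measurable_cong)
qed

lemma integral_kint:
 fixes f :: "'a \<times> 'b => real"
 assumes k: "finite_kernel M N k" and f: "integrable (kint M N k) f"
 shows "(\<integral>z. f z \<partial>kint M N k) = (\<integral>x. \<integral>y. f (x, y) \<partial>k x \<partial>M)"
  and "AE x in M. integrable (k x) (%y. f (x, y))"
  and "integrable M (%x. \<integral>y. f (x, y) \<partial>k x)"
proof -
 have fm [measurable]: "f : Borel (M \<Otimes>\<^sub>M N)" using borel_measurable_integrable[OF f] by simp
 define p where "p x = (\<integral>\<^sup>+y. ennreal (f (x, y)) \<partial>k x)" for x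
 define q where "q x = (\<integral>\<^sup>+y. ennreal (- f (x, y)) \<partial>k x)" for x
 have pm [measurable]: "p : Borel M" unfolding p_def by (rule finite_kernel_nn_integral[OF k, of "%z. ennreal (f z)"]) measurable
 have qm [measurable]: "q : Borel M" unfolding q_def by (rule finite_kernel_nn_integral[OF k, of "%z. ennreal (- f z)"]) measurable
 have p: "(\<integral>\<^sup>+z. ennreal (f z) \<partial>kint M N k) = (\<integral>\<^sup>+x. p x \<partial>M)"
  and q: "(\<integral>\<^sup>+z. ennreal (- f z) \<partial>kint M N k) = (\<integral>\<^sup>+x. q x \<partial>M)"
  unfolding p_def q_def by (subst nn_integral_kint[OF k]; simp)+
 have pf: "(\<integral>\<^sup>+x. p x \<partial>M) \<noteq> \<infinity>" and qf: "(\<integral>\<^sup>+x. q x \<partial>M) \<noteq> \<infinity>"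
  using f unfolding p[symmetric] q[symmetric] by (auto simp: real_integrable_def)
 have AEp: "AE x in M. p x \<noteq> \<infinity>" and AEq: "AE x in M. q x \<noteq> \<infinity>"
  using nn_integral_PInf_AE[OF pm pf] nn_integral_PInf_AE[OF qm qf] by auto
 have AE: "AE x in M. integrable (k x) (%y. f (x, y)) & (\<integral>y. f (x, y) \<partial>k x) = enn2real (p x) - enn2real (q x)" using AEp AEq AE_space
 proof eventually_elim
  case (elim x)
  hence "integrable (k x) (%y. f (x, y))" using finite_kernel_measurable[OF k _ fm] by (auto simp: real_integrable_def p_def q_def)
  thus ?case by (simp add: real_lebesgue_integral_def p_def q_def)
 qed
 thus "AE x in M. integrable (k x) (%y. f (x, y))" by auto
 have nn: "(\<integral>\<^sup>+x. ennreal (enn2real (r x)) \<partial>M) = (\<integral>\<^sup>+x. r x \<partial>M)" if "AE x in M. r x \<noteq> \<infinity>" for r :: "'a => ennreal"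
  by (rule nn_integral_cong_AE) (use that in \<open>auto simp: ennreal_enn2real_if\<close>)
 have ip: "integrable M (%x. enn2real (p x))" and iq: "integrable M (%x. enn2real (q x))"
  using nn[OF AEp] nn[OF AEq] pf qf by (auto simp: integrable_iff_bounded less_top)
 have vp: "(\<integral>x. enn2real (p x) \<partial>M) = enn2real (\<integral>\<^sup>+x. p x \<partial>M)"
  and vq: "(\<integral>x. enn2real (q x) \<partial>M) = enn2real (\<integral>\<^sup>+x. q x \<partial>M)"
  using nn[OF AEp] nn[OF AEq] by (auto simp: integral_eq_nn_integral)
 have m: "(%x. \<integral>y. f (x, y) \<partial>k x) : Borel M" by (rule finite_kernel_integral[OF k fm])
 show "integrable M (%x. \<integral>y. f (x, y) \<partial>k x)" by (rule integrable_cong_AE_imp[OF Bochner_Integration.integrable_diff[OF ip iq] m]) (use AE in auto)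
 have "(\<integral>x. \<integral>y. f (x, y) \<partial>k x \<partial>M) = (\<integral>x. enn2real (p x) - enn2real (q x) \<partial>M)"
  by (rule integral_cong_AE[OF m]) (use AE in auto)
 also have "... = (\<integral>z. f z \<partial>kint M N k)" unfolding real_lebesgue_integral_def[OF f] p q using ip iq vp vq by simp
 finally show "(\<integral>z. f z \<partial>kint M N k) = (\<integral>x. \<integral>y. f (x, y) \<partial>k x \<partial>M)" by simp
qed
lemma space_torus [simp]: "space torus = {0..<1}"
 and space_halfline [simp]: "space halfline = {0..}" by (auto simp: torus_def halfline_def space_restrict_space)

lemma sets_halfline_iff: "A : sets halfline \<longleftrightarrow> A : sets borel & A \<subseteq> {0..}" by (auto simp: halfline_def sets_restrict_space_iff)

interpretation torus: prob_space torus by standard (simp add: torus_def emeasure_restrict_space space_restrict_space)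

lemma measurable_ident_torus [measurable]: "(%x. x) : measurable torus borel" unfolding torus_def by (rule measurable_restrict_space1) simp

lemma measurable_ident_halfline [measurable]: "(%x. x) : measurable halfline borel" unfolding halfline_def by (rule measurable_restrict_space1) simp

lemma measurable_torusD: "f : measurable M torus ==> f : measurable M borel" using measurable_compose[OF _ measurable_ident_torus] by auto

lemma measurable_halflineD: "f : measurable M halfline ==> f : measurable M borel" using measurable_compose[OF _ measurable_ident_halfline] by auto

lemma measurable_frac_torus: "frac : measurable borel torus" unfolding torus_def
 by (rule measurable_restrict_space2) (auto simp: frac_lt_1, simp add: frac_def[abs_def] borel_measurable_real_floor borel_measurable_diff)

lemma borel_measurable_torus: "f : Borel borel ==> f : Borel torus" using measurable_compose[OF measurable_ident_torus] by auto

lemma borel_measurable_halfline: "f : Borel borel ==> f : Borel halfline" using measurable_compose[OF measurable_ident_halfline] by auto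

lemma nn_integral_torus:
 "f : Borel torus ==>
  (\<integral>\<^sup>+x. f x \<partial>torus) = (\<integral>\<^sup>+x. f x * indicator {0..<1} x \<partial>lborel)"
 unfolding torus_def by (rule nn_integral_restrict_space) simp

lemma nn_integral_lborel_shift:
 fixes f :: "real => ennreal"
 assumes "f : Borel borel"
 shows "(\<integral>\<^sup>+x. f (x + c) \<partial>lborel) = (\<integral>\<^sup>+x. f x \<partial>lborel)"
 using nn_integral_real_affine[OF assms, of 1 c] by (simp add: add.commute)

lemma nn_integral_torus_shift:
 assumes g: "g : Borel torus"
 shows "(\<integral>\<^sup>+x. g (frac (x + y)) \<partial>torus) = (\<integral>\<^sup>+x. g x \<partial>torus)"
proof -
 define c where "c = frac y"
 have c: "0 <= c" "c < 1" by (auto simp: c_def frac_lt_1)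
 define G where "G x = g (frac x)" for x
 have G [measurable]: "G : Borel borel" unfolding G_def by (rule measurable_compose[OF measurable_frac_torus g])
 have per: "G (x + 1) = G x" for x by (simp add: G_def frac_1_eq)
 have Gy: "g (frac (x + y)) = G (x + c)" for x
 proof -
  have "frac (x + y) = frac (x + c)" unfolding c_def by (simp add: frac_add_simps)
  thus ?thesis by (simp add: G_def)
 qed
 have shifted: "(%x. G (x + c) * indicator A (x + c)) : Borel lborel" if "A : sets borel" for A
  using measurable_compose[of "%x. x + c" lborel borel "%x. G x * indicator A x"] that by simp
 have "(\<integral>\<^sup>+x. g (frac (x + y)) \<partial>torus) = (\<integral>\<^sup>+x. G (x + c) * indicator {0..<1} x \<partial>lborel)"
  unfolding Gy by (rule nn_integral_torus) (auto intro!: borel_measurable_torus)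
 also have "... = (\<integral>\<^sup>+x. G (x + c) * indicator {c..<1} (x + c) + G (x + c) * indicator {1..<1 + c} (x + c) \<partial>lborel)"
  by (intro nn_integral_cong) (use c in \<open>auto simp: indicator_def\<close>)
 also have "... = (\<integral>\<^sup>+x. G (x + c) * indicator {c..<1} (x + c) \<partial>lborel) + (\<integral>\<^sup>+x. G (x + c) * indicator {1..<1 + c} (x + c) \<partial>lborel)"
  by (rule nn_integral_add) (intro shifted; simp)+
 also have "... = (\<integral>\<^sup>+x. G x * indicator {c..<1} x \<partial>lborel) + (\<integral>\<^sup>+x. G x * indicator {1..<1 + c} x \<partial>lborel)"
  using nn_integral_lborel_shift[of "%x. G x * indicator {c..<1} x" c]
   nn_integral_lborel_shift[of "%x. G x * indicator {1..<1 + c} x" c] by simp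
 also have "(\<integral>\<^sup>+x. G x * indicator {1..<1 + c} x \<partial>lborel) = (\<integral>\<^sup>+x. G x * indicator {0..<c} x \<partial>lborel)"
  using nn_integral_lborel_shift[of "%x. G x * indicator {1..<1 + c} x" 1] by (auto simp: per indicator_def)
 also have "(\<integral>\<^sup>+x. G x * indicator {c..<1} x \<partial>lborel) + (\<integral>\<^sup>+x. G x * indicator {0..<c} x \<partial>lborel)
   = (\<integral>\<^sup>+x. G x * indicator {c..<1} x + G x * indicator {0..<c} x \<partial>lborel)" by (rule nn_integral_add[symmetric]) (use G in simp_all)
 also have "... = (\<integral>\<^sup>+x. g x * indicator {0..<1} x \<partial>lborel)"
  by (intro nn_integral_cong) (use c in \<open>auto simp: indicator_def G_def frac_eq_id\<close>)
 also have "... = (\<integral>\<^sup>+x. g x \<partial>torus)" by (rule nn_integral_torus[OF g, symmetric])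
 finally show ?thesis .
qed

section \<open>Gaussian smoothing on the torus\<close>

abbreviation gauss :: "real measure" where "gauss \<equiv> std_normal_distribution"

interpretation gauss: real_distribution gauss by (rule real_dist_normal_dist)

text \<open>The heat semigroup on the circle at variance \<open>b\<close>, written as an average over a wrapped Gaussian step; for \<open>b = 0\<close> it is the
identity on the fundamental domain.\<close>
definition smooth :: "real => (real => real) => real => real" where
 "smooth b g x = (\<integral>z. g (frac (x + sqrt b * z)) \<partial>gauss)"

lemma smooth_integrable:
 fixes C :: real
 assumes g: "g : Borel torus" "!!x. x : {0..<1} ==> \<bar>g x\<bar> <= C"
 shows "integrable gauss (%z. g (frac (x + s * z)))"
proof (rule gauss.integrable_const_bound[where B=C])
 show "(%z. g (frac (x + s * z))) : Borel gauss" using measurable_compose[OF _ g(1), of "%z. frac (x + s * z)" gauss]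
   measurable_compose[OF _ measurable_frac_torus, of "%z. x + s * z" gauss] by simp
qed (use g(2) in \<open>auto simp: frac_lt_1\<close>)

lemma smooth_bound:
 fixes C :: real
 assumes g: "!!x. x : {0..<1} ==> \<bar>g x\<bar> <= C"
 shows "\<bar>smooth b g x\<bar> <= C"
proof -
 have C: "0 <= C" using g[of 0] by auto
 show ?thesis
 proof (cases "integrable gauss (%z. g (frac (x + sqrt b * z)))")
  case True
  have "\<bar>smooth b g x\<bar> <= (\<integral>z. \<bar>g (frac (x + sqrt b * z))\<bar> \<partial>gauss)" unfolding smooth_def by (rule integral_abs_bound)
  also have "... <= (\<integral>z. C \<partial>gauss)" by (rule integral_mono) (use True g in \<open>auto simp: frac_lt_1\<close>)
  finally show ?thesis using gauss.prob_space by simp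
 qed (simp add: smooth_def not_integrable_integral_eq C)
qed

lemma smooth_0: "x : {0..<1} ==> smooth 0 g x = g x" using gauss.prob_space by (simp add: smooth_def frac_eq_id)

lemma smooth_nonneg:
 assumes "!!x. x : {0..<1} ==> 0 <= g x"
 shows "0 <= smooth b g x" unfolding smooth_def by (rule Bochner_Integration.integral_nonneg) (use assms in \<open>auto simp: frac_lt_1\<close>)

lemma smooth_linear:
 fixes C C' :: real
 assumes "g : Borel torus" "!!x. x : {0..<1} ==> \<bar>g x\<bar> <= C"
  "h : Borel torus" "!!x. x : {0..<1} ==> \<bar>h x\<bar> <= C'"
 shows "smooth b (%x. al * g x + \<beta> * h x) x = al * smooth b g x + \<beta> * smooth b h x" unfolding smooth_def
 using smooth_integrable[OF assms(1,2), of x "sqrt b"] smooth_integrable[OF assms(3,4), of x "sqrt b"] by (simp add: Bochner_Integration.integral_add)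

lemma smooth_cmult: "smooth b (%x. al * g x) x = al * smooth b g x" unfolding smooth_def by simp

lemma smooth_lim:
 fixes C :: real and g :: "nat => real => real"
 assumes "!!i. g i : Borel torus" "!!i x. x : {0..<1} ==> \<bar>g i x\<bar> <= C"
  "!!x. x : {0..<1} ==> (%i. g i x) \<longlonglongrightarrow> h x" "h : Borel torus"
 shows "(%i. smooth b (g i) x) \<longlonglongrightarrow> smooth b h x" unfolding smooth_def
proof (rule integral_dominated_convergence[where w="%_. C"])
 have m: "(%z. frac (x + sqrt b * z)) : measurable gauss torus" using measurable_compose[OF _ measurable_frac_torus, of "%z. x + sqrt b * z" gauss] by simp
 show "(%z. h (frac (x + sqrt b * z))) : Borel gauss"
  "!!i. (%z. g i (frac (x + sqrt b * z))) : Borel gauss" using measurable_compose[OF m] assms by auto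
qed (use assms in \<open>auto simp: frac_lt_1\<close>)

lemma nn_integral_torus_smooth:
 assumes g: "g : Borel torus" "!!x. x : {0..<1} ==> \<bar>g x\<bar> <= C"
  and nn: "!!x. x : {0..<1} ==> 0 <= g x"
 shows "(\<integral>\<^sup>+x. ennreal (smooth b g x) \<partial>torus) = (total g)"
proof -
 have [measurable]: "g : Borel torus" by fact
 have [measurable]: "(%(x, z). frac (x + sqrt b * z)) : measurable (torus \<Otimes>\<^sub>M gauss) torus" unfolding split_beta'
  by (rule measurable_compose[OF _ measurable_frac_torus]) (auto intro: measurable_torusD)
 have "(\<integral>\<^sup>+x. ennreal (smooth b g x) \<partial>torus) = (\<integral>\<^sup>+x. \<integral>\<^sup>+z. ennreal (g (frac (x + sqrt b * z))) \<partial>gauss \<partial>torus)"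
  unfolding smooth_def by (intro nn_integral_cong nn_integral_eq_integral[symmetric] smooth_integrable[OF g])
   (use nn in \<open>auto simp: frac_lt_1\<close>)
 also have "... = (\<integral>\<^sup>+z. \<integral>\<^sup>+x. ennreal (g (frac (x + sqrt b * z))) \<partial>torus \<partial>gauss)"
 proof -
  interpret pair_sigma_finite gauss torus ..
  show ?thesis
   by (rule Fubini') (use measurable_compose[OF \<open>(%(x, z). frac (x + sqrt b * z)) : measurable (torus \<Otimes>\<^sub>M gauss) torus\<close>, of "%x. ennreal (g x)"] in \<open>auto simp: split_beta'\<close>)
 qed
 also have "... = (\<integral>\<^sup>+z. \<integral>\<^sup>+x. ennreal (g x) \<partial>torus \<partial>gauss)"
  by (intro nn_integral_cong nn_integral_torus_shift) measurable
 also have "... = (total g)" using gauss.emeasure_space_1 by simp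
 finally show ?thesis .
qed

text \<open>The density of a centred Gaussian of variance \<open>b\<close> times \<open>sqrt b\<close> is \<open>exp (-y\<^sup>2/(2b)) / sqrt (2 pi)\<close>, which is nondecreasing in \<open>b\<close>
for every \<open>y\<close>. This is the source of the exponent \<open>-1/2\<close> in the subadditivity assumption.\<close>
lemma smooth_compare:
 assumes g: "g : Borel torus" "!!x. x : {0..<1} ==> \<bar>g x\<bar> <= C"
  and nn: "!!x. x : {0..<1} ==> 0 <= g x"
  and b: "0 < b" "b <= b'"
 shows "sqrt b * smooth b g x <= sqrt b' * smooth b' g x"
proof -
 define G where "G y = g (frac (x + y))" for y
 have G [measurable]: "G : Borel borel"
  unfolding G_def using measurable_compose[OF measurable_compose[OF _ measurable_frac_torus] g(1), of "%y. x + y" borel] by simp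
 have eq: "ennreal (sqrt b * smooth b g x) = (\<integral>\<^sup>+y. ennreal (exp (- (y\<^sup>2 / (2 * b))) / sqrt (2 * pi) * G y) \<partial>lborel)" if b: "b > 0" for b
 proof -
  have s: "sqrt b > 0" using b by simp
  have "ennreal (smooth b g x) = (\<integral>\<^sup>+z. ennreal (G (sqrt b * z)) \<partial>gauss)" unfolding smooth_def G_def
   by (intro nn_integral_eq_integral[symmetric] smooth_integrable[OF g]) (use nn in \<open>auto simp: frac_lt_1\<close>)
  also have "... = (\<integral>\<^sup>+z. ennreal (std_normal_density z) * ennreal (G (sqrt b * z)) \<partial>lborel)" by (rule nn_integral_density) auto
  finally have 1: "ennreal (smooth b g x) = ..." .
  have "(\<integral>\<^sup>+y. ennreal (exp (- (y\<^sup>2 / (2 * b))) / sqrt (2 * pi) * G y) \<partial>lborel)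
    = ennreal \<bar>sqrt b\<bar> * (\<integral>\<^sup>+z. ennreal (exp (- ((0 + sqrt b * z)\<^sup>2 / (2 * b))) / sqrt (2 * pi) * G (0 + sqrt b * z)) \<partial>lborel)"
   by (rule nn_integral_real_affine) (use s in auto)
  also have "(%z. ennreal (exp (- ((0 + sqrt b * z)\<^sup>2 / (2 * b))) / sqrt (2 * pi) * G (0 + sqrt b * z)))
    = (%z. ennreal (std_normal_density z) * ennreal (G (sqrt b * z)))"
   using b nn by (auto simp: fun_eq_iff std_normal_density_def power_mult_distrib G_def frac_lt_1 ennreal_mult[symmetric] field_simps)
  also have "ennreal \<bar>sqrt b\<bar> * (\<integral>\<^sup>+z. ennreal (std_normal_density z) * ennreal (G (sqrt b * z)) \<partial>lborel) = ennreal (sqrt b * smooth b g x)"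
   unfolding 1[symmetric] using s by (simp add: ennreal_mult')
  finally show ?thesis by simp
 qed
 have "ennreal (sqrt b * smooth b g x) <= ennreal (sqrt b' * smooth b' g x)" using b nn unfolding eq[OF b(1)] eq[OF less_le_trans[OF b]]
  by (intro nn_integral_mono ennreal_leI mult_right_mono divide_right_mono)
   (auto simp: G_def frac_lt_1 intro!: divide_left_mono)
 moreover have "0 <= sqrt b' * smooth b' g x" using b smooth_nonneg[OF nn] by simp
 ultimately show ?thesis by (simp add: ennreal_le_iff)
qed

text \<open>Both sides are integrals of \<open>h\<close> against measures with equal characteristic functions.\<close>
lemma gauss_convolution:
 fixes h :: "real => real"
 assumes h [measurable]: "h : Borel borel" and hb: "!!x. \<bar>h x\<bar> <= C"
 shows "(\<integral>z. \<integral>z'. h (al * z + \<beta> * z') \<partial>gauss \<partial>gauss) = (\<integral>z. h (sqrt (al\<^sup>2 + \<beta>\<^sup>2) * z) \<partial>gauss)"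
proof -
 interpret gg: pair_prob_space gauss gauss ..
 let ?M1 = "distr (gauss \<Otimes>\<^sub>M gauss) borel (%(z, z'). al * z + \<beta> * z')"
 let ?M2 = "distr gauss borel (%z. sqrt (al\<^sup>2 + \<beta>\<^sup>2) * z)"
 have m1 [measurable]: "(%(z, z'). al * z + \<beta> * z') : Borel (gauss \<Otimes>\<^sub>M gauss)"
  unfolding split_beta' by (intro borel_measurable_add borel_measurable_times) auto
 have cg: "(\<integral>z. iexp (t * z) \<partial>gauss) = complex_of_real (exp (- (t\<^sup>2) / 2))" for t
  using char_std_normal_distribution unfolding char_def by (metis)
 have "?M1 = ?M2"
 proof (rule Levy_uniqueness)
  show "real_distribution ?M1" "real_distribution ?M2" by (auto intro!: gg.real_distribution_distr gauss.real_distribution_distr)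
  show "char ?M1 = char ?M2"
  proof
   fix t
   have "char ?M1 t = (\<integral>z. iexp (t * (al * fst z + \<beta> * snd z)) \<partial>(gauss \<Otimes>\<^sub>M gauss))"
    unfolding char_def by (subst integral_distr) (auto simp: split_beta')
   also have "... = (\<integral>z. \<integral>z'. iexp (t * (al * z + \<beta> * z')) \<partial>gauss \<partial>gauss)" by (subst gg.integral_fst'[symmetric])
     (auto intro!: gg.integrable_const_bound[where B=1] simp: split_beta')
   also have "... = (\<integral>z. iexp ((t * al) * z) * (\<integral>z'. iexp ((t * \<beta>) * z') \<partial>gauss) \<partial>gauss)"
    by (simp add: distrib_left exp_add mult.assoc flip: Bochner_Integration.integral_mult_right_zero)
   also have "... = (\<integral>z. iexp ((t * al) * z) \<partial>gauss) * (\<integral>z'. iexp ((t * \<beta>) * z') \<partial>gauss)"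
    by (rule integral_mult_left_zero)
   also have "... = complex_of_real (exp (- ((t * al)\<^sup>2) / 2)) * complex_of_real (exp (- ((t * \<beta>)\<^sup>2) / 2))" unfolding cg ..
   also have "... = complex_of_real (exp (- ((t * sqrt (al\<^sup>2 + \<beta>\<^sup>2))\<^sup>2) / 2))"
    by (simp flip: of_real_mult exp_add add: power_mult_distrib field_simps)
   also have "... = char ?M2 t" unfolding cg[symmetric] char_def by (subst integral_distr) (auto simp: mult.assoc)
   finally show "char ?M1 t = char ?M2 t" .
  qed
 qed
 have "(\<integral>z. \<integral>z'. h (al * z + \<beta> * z') \<partial>gauss \<partial>gauss) = (\<integral>z. h (al * fst z + \<beta> * snd z) \<partial>(gauss \<Otimes>\<^sub>M gauss))"
  by (subst gg.integral_fst'[symmetric])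
   (auto intro!: gg.integrable_const_bound[where B=C] simp: hb)
 also have "... = (\<integral>x. h x \<partial>?M1)" by (subst integral_distr) (auto simp: split_beta')
 also have "... = (\<integral>x. h x \<partial>?M2)" using \<open>?M1 = ?M2\<close> by simp
 also have "... = (\<integral>z. h (sqrt (al\<^sup>2 + \<beta>\<^sup>2) * z) \<partial>gauss)" by (subst integral_distr) auto
 finally show ?thesis .
qed

lemma smooth_smooth:
 assumes g: "g : Borel torus" "!!x. x : {0..<1} ==> \<bar>g x\<bar> <= C"
  and b: "0 <= b" "0 <= b'"
 shows "smooth b (smooth b' g) x = smooth (b + b') g x"
proof -
 have m: "(%y. g (frac (x + y))) : Borel borel" using measurable_compose[OF measurable_compose[OF _ measurable_frac_torus] g(1), of "%y. x + y" borel] by simp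
 have "smooth b (smooth b' g) x = (\<integral>z. \<integral>z'. g (frac (x + (sqrt b * z + sqrt b' * z'))) \<partial>gauss \<partial>gauss)"
  unfolding smooth_def by (simp add: frac_add_simps add.assoc)
 also have "... = (\<integral>z. g (frac (x + sqrt ((sqrt b)\<^sup>2 + (sqrt b')\<^sup>2) * z)) \<partial>gauss)"
  by (rule gauss_convolution[OF m, of C]) (use g in \<open>auto simp: frac_lt_1\<close>)
 finally show ?thesis using b by (simp add: smooth_def)
qed

lemma cos_frac: "cos (2 * pi * of_int k * frac x + th) = cos (2 * pi * of_int k * x + th)"
proof -
 have "2 * pi * of_int k * x + th = (2 * pi * of_int k * frac x + th) + 2 * pi * of_int (k * \<lfloor>x\<rfloor>)" by (simp add: frac_def algebra_simps)
 thus ?thesis by (simp only: cos_add cos_int_2pin sin_int_2pin) simp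
qed

lemma smooth_cos:
 assumes b: "0 <= b"
 shows "smooth b (%x. cos (2 * pi * of_int k * x + th)) x
   = exp (- (2 * pi\<^sup>2 * (of_int k)\<^sup>2 * b)) * cos (2 * pi * of_int k * x + th)"
proof -
 define A where "A = 2 * pi * of_int k * x + th"
 define B where "B = 2 * pi * of_int k * sqrt b"
 have cg: "(\<integral>z. iexp (B * z) \<partial>gauss) = complex_of_real (exp (- (B\<^sup>2) / 2))" using char_std_normal_distribution unfolding char_def by (metis)
 have ri: "Re (iexp y) = cos y" "Im (iexp y) = sin y" for y unfolding cis_conv_exp[symmetric] by simp_all
 have int: "integrable gauss (%z. iexp (B * z))" by (rule gauss.integrable_iexp) simp_all
 have c: "(\<integral>z. cos (B * z) \<partial>gauss) = exp (- (B\<^sup>2) / 2)" using integral_Re[OF int] unfolding cg ri by simp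
 have s: "(\<integral>z. sin (B * z) \<partial>gauss) = 0" using integral_Im[OF int] unfolding cg ri by simp
 have ic: "integrable gauss (%z. cos (B * z))" and isn: "integrable gauss (%z. sin (B * z))" by (auto intro!: gauss.integrable_const_bound[where B=1])
 have "smooth b (%x. cos (2 * pi * of_int k * x + th)) x = (\<integral>z. cos A * cos (B * z) - sin A * sin (B * z) \<partial>gauss)" unfolding smooth_def cos_frac
 proof (rule bochner_cong[OF refl])
  fix z
  have "2 * pi * of_int k * (x + sqrt b * z) + th = A + B * z" by (simp add: A_def B_def algebra_simps)
  thus "cos (2 * pi * of_int k * (x + sqrt b * z) + th) = cos A * cos (B * z) - sin A * sin (B * z)" by (simp add: cos_add)
 qed
 also have "... = cos A * exp (- (B\<^sup>2) / 2)" using ic isn by (simp add: c s)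
 also have "- (B\<^sup>2) / 2 = - (2 * pi\<^sup>2 * (of_int k)\<^sup>2 * b)" using b by (simp add: B_def power_mult_distrib)
 finally show ?thesis by (simp add: A_def)
qed
section \<open>Approximation by waves and weights\<close>

inductive trig_poly :: "(real => real) => bool" where
 mono: "trig_poly (%x. c * cos (2 * pi * of_int k * x + th))"
| add: "trig_poly p ==> trig_poly q ==> trig_poly (%x. p x + q x)"

lemma trig_poly_const: "trig_poly (%_. c)" using trig_poly.mono[of c 0 0] by simp

lemma trig_poly_mult_mono:
 assumes "trig_poly q"
 shows "trig_poly (%x. c * cos (2 * pi * of_int k * x + th) * q x)" using assms
proof induction
 case (mono d l ph)
 have "c * cos (2 * pi * of_int k * x + th) * (d * cos (2 * pi * of_int l * x + ph))
   = (c * d / 2) * cos (2 * pi * of_int (k - l) * x + (th - ph)) + (c * d / 2) * cos (2 * pi * of_int (k + l) * x + (th + ph))" for x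
 proof -
  have 1: "2 * pi * of_int (k - l) * x + (th - ph) = (2 * pi * of_int k * x + th) - (2 * pi * of_int l * x + ph)"
   and 2: "2 * pi * of_int (k + l) * x + (th + ph) = (2 * pi * of_int k * x + th) + (2 * pi * of_int l * x + ph)" by (simp_all add: algebra_simps)
  show ?thesis unfolding 1 2 cos_add cos_diff by (simp add: field_simps)
 qed
 thus ?case using trig_poly.add[OF trig_poly.mono[of "c * d / 2" "k - l" "th - ph"] trig_poly.mono[of "c * d / 2" "k + l" "th + ph"]] by (simp only:)
next
 case (add p q)
 thus ?case using trig_poly.add[OF add.IH] by (simp add: distrib_left)
qed

lemma trig_poly_mult:
 assumes "trig_poly p" "trig_poly q"
 shows "trig_poly (%x. p x * q x)" using assms(1)
proof induction
 case (mono c k th)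
 show ?case by (rule trig_poly_mult_mono[OF assms(2)])
next
 case (add p p') thus ?case using trig_poly.add[OF add.IH] by (simp add: distrib_right)
qed

lemma trig_poly_of_real_polynomial_function:
 assumes "real_polynomial_function (g :: complex => real)"
 shows "trig_poly (%x. g (cis (2 * pi * x)))" using assms
proof induction
 case (linear f)
 then interpret bounded_linear f .
 have "f (cis y) = f 1 * cos y + f \<i> * sin y" for y
 proof -
  have "cis y = cos y *\<^sub>R 1 + sin y *\<^sub>R \<i>" by (simp add: complex_eq_iff)
  thus ?thesis by (simp only: add scale) simp
 qed
 moreover have "sin y = cos (y + - pi / 2)" for y by (simp add: cos_diff)
 ultimately have eq: "(%x. f (cis (2 * pi * x))) =
   (%x. f 1 * cos (2 * pi * of_int 1 * x + 0) + f \<i> * cos (2 * pi * of_int 1 * x + - pi / 2))" by simp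
 show ?case unfolding eq by (rule trig_poly.add[of "%x. f 1 * cos (2 * pi * of_int 1 * x + 0)"
     "%x. f \<i> * cos (2 * pi * of_int 1 * x + - pi / 2)", OF trig_poly.mono trig_poly.mono])
next
 case (const c)
 show ?case by (rule trig_poly_const)
next
 case (add f g)
 show ?case by (rule trig_poly.add[OF add.IH])
next
 case (mult f g)
 show ?case by (rule trig_poly_mult[OF mult.IH])
qed

lemma trig_poly_approx:
 assumes q: "continuous_on {0..1} q" "q 0 = q 1" and e: "0 < e"
 obtains p where "trig_poly p" "!!x. x : {0..1} ==> \<bar>q x - p x\<bar> < e"
proof -
 define E where "E x = cis (2 * pi * x)" for x :: real
 define Q where "Q z = q (SOME x. x : {0..1} & E x = z)" for z
 have QE: "Q (E x) = q x" if x: "x : {0..1}" for x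
 proof -
  define y where "y = (SOME y. y : {0..1} & E y = E x)"
  have y: "y : {0..1}" "E y = E x" unfolding y_def using someI[of "%y. y : {0..1} & E y = E x" x] x by auto
  hence "sin (2 * pi * y) = sin (2 * pi * x) & cos (2 * pi * y) = cos (2 * pi * x)" by (simp add: E_def complex_eq_iff)
  then obtain n :: int where "2 * pi * y = 2 * pi * x + 2 * pi * n" using sin_cos_eq_iff by blast
  hence "y = x + n" by (simp flip: distrib_left)
  with x y(1) have "y = x \<or> (y = 0 & x = 1) \<or> (y = 1 & x = 0)"
  proof -
   have "\<bar>real_of_int n\<bar> <= 1" using x y(1) \<open>y = x + n\<close> by auto
   hence "n = 0 \<or> n = 1 \<or> n = -1" by linarith
   thus ?thesis using x y(1) \<open>y = x + n\<close> by auto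
  qed
  thus ?thesis unfolding Q_def y_def[symmetric] using q(2) by auto
 qed
 let ?S = "E ` {0..1}"
 have Ec: "continuous_on A E" for A unfolding E_def by (intro continuous_intros)
 have S: "compact ?S" by (rule compact_continuous_image[OF Ec]) simp
 have "continuous_on ?S Q" unfolding continuous_on_closed_vimage[OF compact_imp_closed[OF S]]
 proof (intro allI impI)
  fix C :: "real set" assume C: "closed C"
  have "closed ({0..1} \<inter> q -` C)" using q(1) C by (auto intro!: continuous_closed_preimage)
  hence "compact ({0..1} \<inter> q -` C)" by (metis compact_Icc compact_Int_closed inf.left_idem)
  hence "compact (E ` ({0..1} \<inter> q -` C))" by (rule compact_continuous_image[OF Ec])
  moreover have "Q -` C \<inter> ?S = E ` ({0..1} \<inter> q -` C)" using QE by auto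
  ultimately show "closed (Q -` C \<inter> ?S)" by (simp add: compact_imp_closed)
 qed
 from Stone_Weierstrass_real_polynomial_function[OF S this e]
 obtain g where g: "real_polynomial_function g" "!!z. z : ?S ==> \<bar>Q z - g z\<bar> < e" by blast
 show ?thesis
 proof (rule that)
  show "trig_poly (%x. g (E x))" unfolding E_def by (rule trig_poly_of_real_polynomial_function[OF g(1)])
  show "\<bar>q x - g (E x)\<bar> < e" if "x : {0..1}" for x using g(2)[of "E x"] QE[OF that] that by auto
 qed
qed

abbreviation TH :: "(real \<times> real) measure" where "TH \<equiv> torus \<Otimes>\<^sub>M halfline"

lemma sets_restrict_space_generator:
 fixes A :: "real set"
 assumes "A : sets borel"
 shows "sets (restrict_space borel A) = sigma_sets A (range (%(a, b). A \<inter> {a<..<b}))"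
proof -
 let ?I = "range (%(a, b). {a<..<b::real})"
 have "(%(a, b). box a b) = (%(a, b). {a<..<b::real})" by (auto simp: fun_eq_iff box_real)
 hence "(borel :: real measure) = sigma UNIV ?I" using borel_eq_box[where 'a=real] by simp
 hence b: "sets borel = sigma_sets UNIV ?I" by (metis sets_measure_of subset_UNIV Pow_UNIV)
 have "A : sigma_sets UNIV ?I" using assms unfolding b .
 from sigma_sets_Int[OF this] have
  eq: "(\<inter>) A ` sigma_sets UNIV ?I = sigma_sets A ((\<inter>) A ` ?I)" by blast
 have "sets (restrict_space borel A) = (\<inter>) A ` sets borel" unfolding sets_restrict_space ..
 also have "... = sigma_sets A ((\<inter>) A ` ?I)" unfolding b by (rule eq)
 also have "(\<inter>) A ` ?I = range (%(a, b). A \<inter> {a<..<b::real})" unfolding image_image by (rule image_cong) auto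
 finally show ?thesis .
qed

lemma Int_stable_restricted_intervals: "Int_stable (range (%(a, b). A \<inter> {a<..<b::real}))"
proof (rule Int_stableI_image)
 fix i j :: "real \<times> real"
 obtain a b c d where "i = (a, b)" "j = (c, d)" by fastforce
 thus "\<exists>k\<in>UNIV. (case i of (a, b) => A \<inter> {a<..<b}) \<inter> (case j of (a, b) => A \<inter> {a<..<b})
   = (case k of (a, b) => A \<inter> {a<..<b})" by (intro bexI[of _ "(max a c, min b d)"]) auto
qed

lemma trapezoid_tendsto_indicator:
 fixes x a b :: real
 shows "(%i. min 1 (real i * max 0 (min (x - a) (b - x)))) \<longlonglongrightarrow> indicator {a<..<b} x"
proof (cases "x : {a<..<b}")
 case True
 define d where "d = min (x - a) (b - x)"
 have d: "d > 0" using True by (auto simp: d_def)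
 obtain n where n: "1 / d < real n" using reals_Archimedean2 by blast
 have "min 1 (real i * max 0 d) = 1" if "i >= n" for i
 proof -
  have "1 / d <= real i" using n that by linarith
  hence "1 <= real i * d" using d by (simp add: field_simps)
  thus ?thesis using d by simp
 qed
 thus ?thesis using True unfolding d_def[symmetric] by (auto intro!: tendsto_eventually eventually_sequentiallyI[of n])
next
 case False
 hence "min (x - a) (b - x) <= 0" by auto
 thus ?thesis using False by (simp add: max_absorb1)
qed

text \<open>Indicators of intervals are bounded limits of continuous functions, which are uniform limits of trigonometric polynomials by the
Stone--Weierstrass theorem on the unit circle. The boundary point of the fundamental domain costs nothing because limits
are pointwise on \<open>{0..<1}\<close>.\<close>
lemma torus_functional_closure:
 fixes P :: "(real => real) => bool"
 assumes gen: "!!k th. P (%x. cos (2 * pi * of_int k * x + th))"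
  and cl: "closed_class torus P"
  and f: "f : Borel torus" "!!x. x : space torus ==> \<bar>f x\<bar> <= C"
 shows "P f"
proof (rule bounded_functional_closure[where P=P and M=torus and f=f and C=C and G="range (%(a, b). {0..<1} \<inter> {a<..<b})"])
 show "sets torus = sigma_sets (space torus) (range (%(a, b). {0..<1} \<inter> {a<..<b::real}))"
  unfolding torus_def using sets_restrict_space_generator[of "{0..<1}"] by (simp add: sets_restrict_space space_restrict_space)
 note lin = closed_class_linear[OF cl] and lim = closed_class_limit[OF cl]
 show "closed_class torus P" by (rule cl)
 have cm: "(%x. cos (2 * pi * of_int k * x + th)) : Borel torus" for k th by (rule borel_measurable_torus) simp
 show one: "P (%_. 1)" using gen[of 0 0] by simp
 have tm: "P p & p : Borel borel" if "trig_poly p" for p using that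
 proof induction
  case (mono c k th)
  show ?case using lin[OF gen gen cm cm, of c k th 0 0 0] by simp
 next
  case (add p q)
  thus ?case using lin[of p q 1 1] borel_measurable_torus by auto
 qed
 have cont: "P q" if q: "continuous_on {0..1} q" "q 0 = q 1" "!!x. x : {0..1} ==> \<bar>q x\<bar> <= 1" for q
 proof -
  have "\<exists>p. trig_poly p & (\<forall>x\<in>{0..1}. \<bar>q x - p x\<bar> < 1 / real (Suc i))" for i
   using trig_poly_approx[OF q(1,2), of "1 / real (Suc i)"] by (metis of_nat_0_less_iff zero_less_Suc zero_less_divide_1_iff)
  then obtain p where p: "!!i. trig_poly (p i)" "!!i x. x : {0..1} ==> \<bar>q x - p i x\<bar> < 1 / real (Suc i)" by metis
  show ?thesis
  proof (rule lim[of p 2])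
   show "P (p i)" "p i : Borel torus" for i using tm[OF p(1)] borel_measurable_torus by auto
   show "\<bar>p i x\<bar> <= 2" if "x : space torus" for i x
   proof -
    have "x : {0..1}" using that by simp
    moreover have "1 / real (Suc i) <= 1" by simp
    ultimately show ?thesis using p(2)[of x i] q(3)[of x] by linarith
   qed
   show "(%i. p i x) \<longlonglongrightarrow> q x" if "x : space torus" for x
   proof -
    have "x : {0..1}" using that by simp
    hence "(%i. p i x - q x) \<longlonglongrightarrow> 0" by (intro Lim_null_comparison[OF _ LIMSEQ_Suc[OF lim_1_over_n]])
      (use p(2)[of x] in \<open>auto simp: abs_minus_commute intro!: always_eventually less_imp_le\<close>)
    thus ?thesis by (simp add: LIM_zero_iff)
   qed
  qed
 qed
 have int: "P (indicator {a<..<b})" if ab: "0 <= a" "b <= 1" for a b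
 proof -
  define q where "q i x = min 1 (real i * max 0 (min (x - a) (b - x)))" for i :: nat and x
  show ?thesis
  proof (rule lim[of q 1])
   show "P (q i)" for i by (rule cont) (use ab in \<open>auto simp: q_def intro!: continuous_intros\<close>)
   show "q i : Borel torus" for i unfolding q_def by (rule borel_measurable_torus) measurable
   show "\<bar>q i x\<bar> <= 1" for i x by (auto simp: q_def)
   show "(%i. q i x) \<longlonglongrightarrow> indicator {a<..<b} x" for x unfolding q_def by (rule trapezoid_tendsto_indicator)
  qed
 qed
 have cl: "P (indicator {b..<1})" if "0 < b" for b
 proof (rule lim[of "%i. indicator {b - b / real (Suc i)<..<1}" 1])
  show "P (indicator {b - b / real (Suc i)<..<1})" for i by (rule int) (use that in \<open>auto simp: field_simps\<close>)
  show "indicator {b - b / real (Suc i)<..<1} : Borel torus" for i by (rule borel_measurable_torus) simp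
  show "(%i. indicator {b - b / real (Suc i)<..<1} x) \<longlonglongrightarrow> (indicator {b..<1} x :: real)" for x
  proof (cases "b <= x")
   case True
   hence "b - b / real (Suc i) < x" for i using that by (smt (verit) divide_pos_pos of_nat_0_less_iff zero_less_Suc)
   thus ?thesis using True by (simp add: indicator_def)
  next
   case False
   have "(%i. b * (1 / real (Suc i))) \<longlonglongrightarrow> b * 0" by (intro tendsto_mult tendsto_const LIMSEQ_Suc[OF lim_1_over_n])
   hence "\<forall>\<^sub>F i in sequentially. b * (1 / real (Suc i)) < b - x" using False by (intro order_tendstoD) auto
   hence "\<forall>\<^sub>F i in sequentially. indicator {b - b / real (Suc i)<..<1} x = (indicator {b..<1} x :: real)" by eventually_elim (use False in auto)
   thus ?thesis by (rule tendsto_eventually)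
  qed
 qed auto
 show "P (indicator A)" if "A : range (%(a, b). {0..<1} \<inter> {a<..<b::real})" for A
 proof -
  obtain a b where A: "A = {0..<1} \<inter> {a<..<b}" using \<open>A : _\<close> by auto
  have restr: "P g" if "P h" "h : Borel torus" "!!x. x : {0..<1} ==> h x = g x"
   "!!x. x : {0..<1} ==> \<bar>h x\<bar> <= C" for g h C by (rule lim[of "%_. h" C]) (use that in auto)
  have im: "indicator B : Borel torus" if "B : sets borel" for B :: "real set" by (rule borel_measurable_torus) (use that in simp)
  consider "0 <= a" | "a < 0" "b <= 0" | "a < 0" "0 < b" by linarith
  thus ?thesis
  proof cases
   case 1
   have "P (indicator {a<..<min b 1})" by (rule int) (use 1 in auto)
   thus ?thesis by (rule restr[OF _ im, where C=1]) (use 1 A in \<open>auto simp: indicator_def\<close>)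
  next
   case 2
   have "P (indicator {0<..<0})" by (rule int) auto
   thus ?thesis by (rule restr[OF _ im, where C=1]) (use 2 A in \<open>auto simp: indicator_def\<close>)
  next
   case 3
   have "P (%x. 1 * 1 + (-1) * indicator {b..<1} x)" by (rule lin[OF one cl[OF 3(2)] _ im]) auto
   thus ?thesis by (rule restr[where C=1]) (use 3 A im in \<open>auto simp: indicator_def\<close>)
  qed
 qed
 show "Int_stable (range (%(a, b). {0..<1} \<inter> {a<..<b::real}))" by (rule Int_stable_restricted_intervals)
qed (use f in auto)

lemma halfline_functional_closure:
 fixes P :: "(real => real) => bool" and C :: real
 assumes gen: "!!ps. continuous_on UNIV ps ==> (!!m. \<bar>ps m\<bar> <= 1) ==> P ps"
  and cl: "closed_class halfline P"
  and f: "f : Borel halfline" "!!m. m : space halfline ==> \<bar>f m\<bar> <= C"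
 shows "P f"
proof (rule bounded_functional_closure[where P=P and M=halfline and f=f and C=C and G="range (%(a, b). {0..} \<inter> {a<..<b})"])
 note lim = closed_class_limit[OF cl]
 show "closed_class halfline P" by (rule cl)
 show "sets halfline = sigma_sets (space halfline) (range (%(a, b). {0..} \<inter> {a<..<b::real}))"
  unfolding halfline_def using sets_restrict_space_generator[of "{0..}"] by (simp add: space_restrict_space)
 show "Int_stable (range (%(a, b). {0..} \<inter> {a<..<b::real}))" by (rule Int_stable_restricted_intervals)
 show "P (%_. 1)" by (rule gen) auto
 show "P (indicator A)" if "A : range (%(a, b). {0..} \<inter> {a<..<b::real})" for A
 proof -
  obtain a b where A: "A = {0..} \<inter> {a<..<b}" using \<open>A : _\<close> by auto
  show ?thesis
  proof (rule lim[of "%i m. min 1 (real i * max 0 (min (m - a) (b - m)))" 1])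
   show "P (%m. min 1 (real i * max 0 (min (m - a) (b - m))))" for i by (rule gen) (auto intro!: continuous_intros)
   show "(%m. min 1 (real i * max 0 (min (m - a) (b - m)))) : Borel halfline" for i by (rule borel_measurable_halfline) measurable
   show "(%i. min 1 (real i * max 0 (min (m - a) (b - m)))) \<longlonglongrightarrow> indicator A m" if "m : space halfline" for m
    using trapezoid_tendsto_indicator[of m a b] that by (simp add: A indicator_def)
  qed auto
 qed
qed (use f in auto)

lemma TH_functional_closure:
 fixes P :: "(real \<times> real => real) => bool"
 assumes gen: "!!k th B. B : sets halfline ==> P (%(x, m). cos (2 * pi * of_int k * x + th) * indicator B m)"
  and cl: "closed_class TH P"
  and f: "f : Borel TH" "!!x. x : space TH ==> \<bar>f x\<bar> <= C"
 shows "P f"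
proof -
 note lin = closed_class_linear[OF cl] and lim = closed_class_limit[OF cl]
 have pm: "(%(x, m). g x * indicator B m) : Borel TH" if "g : Borel torus" "B : sets halfline"
  for g :: "real => real" and B using that by measurable
 have tor: "P (%(x, m). g x * indicator B m)"
  if B: "B : sets halfline" and g: "g : Borel torus" "!!x. x : space torus ==> \<bar>g x\<bar> <= C" for g B and C :: real
 proof (rule torus_functional_closure[where f=g and C=C and P="%g. P (%(x, m). g x * indicator B m)"])
  show "P (%(x, m). cos (2 * pi * of_int k * x + th) * indicator B m)" for k th using gen B by auto
  show "closed_class torus (%g. P (%(x, m). g x * indicator B m))"
  proof (rule closed_classI)
   fix f g al \<beta>
   assume *: "P (%(x, m). f x * indicator B m)" "P (%(x, m). g x * indicator B m)"
    "f : Borel torus" "g : Borel torus"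
   show "P (%(x, m). (al * f x + \<beta> * g x) * indicator B m)" using lin[OF *(1,2) pm[OF *(3) B] pm[OF *(4) B], of al \<beta>]
    by (simp add: split_beta' algebra_simps)
  next
   fix F :: "nat => real => real" and f and C :: real
   assume *: "!!i. P (%(x, m). F i x * indicator B m)" "!!i. F i : Borel torus"
    "!!i x. x : space torus ==> \<bar>F i x\<bar> <= C" "!!x. x : space torus ==> (%i. F i x) \<longlonglongrightarrow> f x"
   show "P (%(x, m). f x * indicator B m)"
   proof (rule lim[OF *(1), where C=C])
    show "(%(x, m). F i x * indicator B m) : Borel TH" for i by (rule pm[OF *(2) B])
    fix z assume "z : space TH"
    hence z: "fst z : space torus" by (auto simp: pair_space)
    have "0 <= C" using *(3)[of 0 0] by simp
    thus "\<bar>case z of (x, m) => F i x * indicator B m\<bar> <= C" for i using *(3)[OF z, of i] by (auto simp: split_beta' indicator_def)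
    show "(%i. case z of (x, m) => F i x * indicator B m) \<longlonglongrightarrow> (case z of (x, m) => f x * indicator B m)"
     using *(4)[OF z] by (auto simp: split_beta' intro!: tendsto_intros)
   qed
  qed
 qed (use g in auto)
 show ?thesis
 proof (rule bounded_functional_closure[where P=P and M=TH and f=f and C=C and G="{a \<times> b |a b. a : sets torus & b : sets halfline}"])
  show "Int_stable {a \<times> b |a b. a : sets torus & b : sets halfline}" by (rule Int_stable_pair_measure_generator)
  show "closed_class TH P" by (rule cl)
  show "sets TH = sigma_sets (space TH) {a \<times> b |a b. a : sets torus & b : sets halfline}" by (simp add: sets_pair_measure pair_space)
  show "{a \<times> b |a b. a : sets torus & b : sets halfline} \<subseteq> Pow (space TH)" unfolding pair_space by (rule pair_measure_closed)
  have B: "{0..} : sets halfline" by (simp add: sets_halfline_iff)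
  show "P (%_. 1)"
  proof (rule lim[where C=1])
   show "P (%(x, m). 1 * indicator {0..} m)" for i :: nat by (rule tor[OF B, of "%_. 1" 1]) auto
   show "(%(x, m). 1 * indicator {0..} m :: real) : Borel TH" for i :: nat by (rule pm[OF _ B, of "%_. 1"]) simp
  qed (auto simp: pair_space indicator_def)
  show "P (indicator A)" if "A : {a \<times> b |a b. a : sets torus & b : sets halfline}" for A
  proof -
   obtain a b where A: "A = a \<times> b" "a : sets torus" "b : sets halfline" using \<open>A : _\<close> by auto
   have "P (%(x, m). indicator a x * indicator b m)" by (rule tor[OF A(3), of "indicator a" 1]) (use A in auto)
   moreover have "(%(x, m). indicator a x * indicator b m :: real) = indicator A" unfolding A(1) by (auto simp: fun_eq_iff indicator_def)
   ultimately show ?thesis by simp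
  qed
 qed (use f in auto)
qed

definition heat :: "(real => real) => real => (real \<times> real => real) => real \<times> real => real" where
 "heat a r f = (%(x, m). smooth (a m * r) (%y. f (y, m)) x)"

lemma heat_measurable [measurable]:
 assumes a [measurable]: "a : Borel halfline" and f [measurable]: "f : Borel TH"
 shows "heat a r f : Borel TH"
proof -
 have 1: "(%w. fst (fst w) + sqrt (a (snd (fst w)) * r) * snd w) : Borel (TH \<Otimes>\<^sub>M gauss)"
 proof -
  have [measurable]: "(%w. fst (fst w)) : Borel (TH \<Otimes>\<^sub>M gauss)" by (rule measurable_torusD) measurable
  show ?thesis by measurable
 qed
 have "(%w. (frac (fst (fst w) + sqrt (a (snd (fst w)) * r) * snd w), snd (fst w))) : measurable (TH \<Otimes>\<^sub>M gauss) TH"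
  by (intro measurable_Pair measurable_compose[OF 1 measurable_frac_torus]) measurable
 from measurable_compose[OF this f]
 have m: "(%(z, w). f (frac (fst z + sqrt (a (snd z) * r) * w), snd z)) : Borel (TH \<Otimes>\<^sub>M gauss)" by (simp add: split_beta')
 have "(%z. \<integral>w. f (frac (fst z + sqrt (a (snd z) * r) * w), snd z) \<partial>gauss) : Borel TH"
  by (rule gauss.borel_measurable_lebesgue_integral) (use m in \<open>simp add: split_beta'\<close>)
 thus ?thesis unfolding heat_def smooth_def by (simp add: split_beta')
qed
section \<open>Coefficients\<close>

lemma powr_subadditive:
 fixes x y :: real
 assumes "0 < x" "0 < y" "0 <= p" "p <= 1"
 shows "(x + y) powr p <= x powr p + y powr p"
proof -
 have *: "u * (x + y) powr (p - 1) <= u powr p" if "0 < u" "u <= x + y" for u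
 proof -
  have "(x + y) powr (p - 1) <= u powr (p - 1)" by (rule powr_mono2') (use assms that in auto)
  hence "u * (x + y) powr (p - 1) <= u * u powr (p - 1)" using that by simp
  also have "... = u powr p" using that by (simp add: powr_mult_base)
  finally show ?thesis .
 qed
 have "(x + y) powr p = (x + y) * (x + y) powr (p - 1)" using assms by (simp add: powr_mult_base)
 also have "... = x * (x + y) powr (p - 1) + y * (x + y) powr (p - 1)" by (simp add: distrib_right)
 also have "... <= x powr p + y powr p" using *[of x] *[of y] assms by (intro add_mono) auto
 finally show ?thesis .
qed

locale coagulation =
 fixes \<Phi> :: "real => real => real" and a :: "real => real" and c p :: real
 assumes Phi_nonneg: "!!m m'. m >= 0 ==> m' >= 0 ==> \<Phi> m m' >= 0"
  and Phi_sym: "!!m m'. m >= 0 ==> m' >= 0 ==> \<Phi> m m' = \<Phi> m' m"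
  and Phi_Lipschitz: "!!L. L > 0 ==> \<exists>\<Gamma>>0. \<forall>m m' m''. m > L --> m' >= 0 --> m'' >= 0 \<longrightarrow>
     \<bar>\<Phi> (m + m'') m' - \<Phi> m m'\<bar> <= \<Gamma> * m''"
  and a_pos: "!!m. m > 0 ==> a m > 0"
  and a_antimono: "antimono_on {0<..} a"
  and a_zero: "a 0 = 0"
  and p_range: "0 <= p" "p <= 1/2"
  and c_pos: "c > 0"
  and Phi_bound: "!!m m'. m >= 0 ==> m' >= 0 ==>
     \<Phi> m m' <= c * (m powr p + m' powr p) * of_bool (m > 0 & m' > 0)"
  and subadditive: "!!m m'. m > 0 ==> m' > 0 ==>
     a (m + m') powr (-1/2) * omega c p a (m + m') \<le>
     a m powr (-1/2) * omega c p a m + a m' powr (-1/2) * omega c p a m'"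
begin

abbreviation om :: "real => real" where "om \<equiv> omega c p a"
abbreviation \<kappa> :: "real => real => real" where "\<kappa> \<equiv> kappa \<Phi> a"

lemma a_nonneg: "m >= 0 ==> a m >= 0" using a_pos[of m] a_zero by (cases "m = 0") auto

lemma a_mono: "0 < m ==> m <= m' ==> a m' <= a m" using a_antimono by (auto simp: monotone_on_def)

lemma a_measurable [measurable]: "a : Borel halfline"
proof -
 have "mono_on {0<..} (%m. - a m)" using a_mono by (auto simp: monotone_on_def)
 hence "(%m. - a m) : Borel (restrict_space borel {0<..})" by (rule borel_measurable_mono_on_fnc)
 hence "(%m. indicator {0<..} m *\<^sub>R (- a m)) : Borel borel" by (subst (asm) borel_measurable_restrict_space_iff) auto
 hence "(%m. - (indicator {0<..} m *\<^sub>R (- a m))) : Borel halfline" by (intro borel_measurable_halfline borel_measurable_uminus)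
 thus ?thesis by (rule measurable_cong[THEN iffD1, rotated]) (auto simp: indicator_def a_zero)
qed

lemma om_measurable [measurable]: "om : Borel halfline" unfolding omega_def[abs_def] by measurable

lemma om_expand: "om m = (1 + c + a 1) * (m powr p + a m + 1)" by (simp add: omega_def)

lemma om_ge: "m >= 0 ==> m powr p + a m + 1 <= om m"
proof -
 assume m: "m >= 0"
 have "1 * (m powr p + a m + 1) <= (1 + c + a 1) * (m powr p + a m + 1)" using c_pos a_nonneg[OF m] a_pos[of 1] by (intro mult_right_mono) auto
 thus ?thesis by (simp add: om_expand)
qed

lemma om_ge1: "m >= 0 ==> 1 <= om m" using om_ge[of m] a_nonneg[of m] powr_ge_zero[of m p] by linarith

lemma om_subadditive: "0 < m ==> 0 < m' ==> om (m + m') <= om m + om m'"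
proof -
 assume m: "0 < m" "0 < m'"
 have "(m + m') powr p <= m powr p + m' powr p" by (rule powr_subadditive) (use m p_range in auto)
 moreover have "a (m + m') <= a m" using a_mono[of m "m + m'"] m by auto
 ultimately have "(m + m') powr p + a (m + m') + 1 <= (m powr p + a m + 1) + (m' powr p + a m' + 1)" using a_pos[OF m(2)] by linarith
 from mult_left_mono[OF this, of "1 + c + a 1"] show ?thesis using c_pos a_pos[of 1] by (simp add: om_expand distrib_left)
qed

lemma powr_times_a:
 assumes "0 < m" shows "m powr p * a m <= a m + a 1 * m powr p"
proof (cases "m <= 1")
 case True
 hence "m powr p <= 1" using assms p_range by (simp add: powr_le1)
 hence "m powr p * a m <= 1 * a m" using a_pos[OF assms] by (intro mult_right_mono) auto
 moreover have "0 <= a 1 * m powr p" using a_pos[of 1] by simp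
 ultimately show ?thesis by linarith
next
 case False
 hence "m powr p * a m <= m powr p * a 1" using a_mono[of 1 m] by (intro mult_left_mono) auto
 thus ?thesis using a_pos[OF assms] by (simp add: mult.commute)
qed

lemma Phi_vanishes: "m >= 0 ==> m' >= 0 ==> m <= 0 \<or> m' <= 0 ==> \<Phi> m m' = 0" using Phi_bound[of m m'] Phi_nonneg[of m m'] by auto

lemma \<kappa>_zero: "m >= 0 ==> m' >= 0 ==> m = 0 \<or> m' = 0 ==> \<kappa> m m' = 0" using Phi_vanishes[of m m'] by (auto simp: kappa_def)

lemma \<kappa>_nonneg: "m >= 0 ==> m' >= 0 ==> 0 <= \<kappa> m m'" using Phi_nonneg a_nonneg by (simp add: kappa_def)

lemma \<kappa>_sym: "m >= 0 ==> m' >= 0 ==> \<kappa> m m' = \<kappa> m' m" using Phi_sym by (simp add: kappa_def add.commute)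

lemma \<kappa>_le':
 assumes "0 < m" "0 < m'"
 shows "\<kappa> m m' <= c * (m powr p + m' powr p) * (a m + a m')" unfolding kappa_def
 using Phi_bound[of m m'] assms a_pos[of m] a_pos[of m'] by (intro mult_right_mono) auto

lemma \<kappa>_le:
 assumes "0 <= m" "0 <= m'"
 shows "\<kappa> m m' <= om m * om m'"
proof (cases "m = 0 \<or> m' = 0")
 case True
 thus ?thesis using \<kappa>_zero[OF assms] om_ge1[of m] om_ge1[of m'] assms by auto
next
 case False
 hence m: "0 < m" "0 < m'" using assms by auto
 define x y A B a1 where d: "x = m powr p" "y = m' powr p" "A = a m" "B = a m'" "a1 = a 1"
 have nn: "0 <= x" "0 <= y" "0 < A" "0 < B" "0 < a1" using a_pos m by (auto simp: d)
 have 1: "x * A <= A + a1 * x" "y * B <= B + a1 * y" using powr_times_a m by (auto simp: d)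
 have "(x + y) * (A + B) <= (A + a1 * x) + (B + a1 * y) + x * B + y * A" using 1 by (simp add: algebra_simps)
 also have "... <= (1 + a1) * (A + x + B + y + x * B + y * A)" using nn by (simp add: algebra_simps)
 also have "... <= (1 + a1) * ((x + A + 1) * (y + B + 1))" using nn by (intro mult_left_mono) (auto simp: algebra_simps)
 finally have "c * ((x + y) * (A + B)) <= c * ((1 + a1) * ((x + A + 1) * (y + B + 1)))" using c_pos by simp
 also have "... = (c * (1 + a1)) * ((x + A + 1) * (y + B + 1))" by simp
 also have "... <= ((1 + c + a1) * (1 + c + a1)) * ((x + A + 1) * (y + B + 1))" using nn c_pos by (intro mult_right_mono mult_mono) auto
 also have "... = om m * om m'" by (simp add: om_expand d)
 finally show ?thesis using \<kappa>_le'[OF m] by (simp add: d mult.assoc)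
qed

text \<open>The Lipschitz bound in one variable, with a constant independent of the other variable, and symmetry give joint continuity away from
the axes.\<close>
lemma Phi_continuous: "continuous_on ({0<..} \<times> {0<..}) (%(m, m'). \<Phi> m m')"
proof (rule continuous_at_imp_continuous_on, rule ballI)
 fix z :: "real \<times> real" assume "z : {0<..} \<times> {0<..}"
 then obtain m0 m0' where z: "z = (m0, m0')" and pos: "0 < m0" "0 < m0'" by auto
 define L where "L = min m0 m0' / 2"
 have L: "0 < L" "L < m0" "L < m0'" using pos by (auto simp: L_def min_def)
 obtain \<Gamma> where \<Gamma>: "\<Gamma> > 0" and lip: "!!m m' m''. m > L ==> m' >= 0 ==> m'' >= 0 ==> \<bar>\<Phi> (m + m'') m' - \<Phi> m m'\<bar> <= \<Gamma> * m''"
  using Phi_Lipschitz[OF L(1)] by blast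
 have lip1: "\<bar>\<Phi> u w - \<Phi> v w\<bar> <= \<Gamma> * \<bar>u - v\<bar>" if "u > L" "v > L" "w >= 0" for u v w
  using lip[of u w "v - u"] lip[of v w "u - v"] that by (cases "u <= v") auto
 have lip2: "\<bar>\<Phi> u w - \<Phi> m0 m0'\<bar> <= \<Gamma> * (\<bar>u - m0\<bar> + \<bar>w - m0'\<bar>)" if "u > L" "w > L" for u w
 proof -
  have "\<bar>\<Phi> u w - \<Phi> m0 m0'\<bar> <= \<bar>\<Phi> u w - \<Phi> m0 w\<bar> + \<bar>\<Phi> w m0 - \<Phi> m0' m0\<bar>"
   using Phi_sym[of m0 w] Phi_sym[of m0 m0'] that L pos by auto
  also have "... <= \<Gamma> * \<bar>u - m0\<bar> + \<Gamma> * \<bar>w - m0'\<bar>" using lip1[of u m0 w] lip1[of w m0' m0] that L pos by (intro add_mono) auto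
  finally show ?thesis by (simp add: distrib_left)
 qed
 have "((%y. \<Phi> (fst y) (snd y) - \<Phi> m0 m0') \<longlongrightarrow> 0) (at z)"
 proof (rule Lim_null_comparison)
  have "open ({L<..} \<times> {L<..})" by (intro open_Times) auto
  moreover have "z : {L<..} \<times> {L<..}" using z L by auto
  ultimately have "\<forall>\<^sub>F y in at z. y : {L<..} \<times> {L<..}" by (meson eventually_at_topological)
  thus "\<forall>\<^sub>F y in at z. norm (\<Phi> (fst y) (snd y) - \<Phi> m0 m0') <= \<Gamma> * (\<bar>fst y - m0\<bar> + \<bar>snd y - m0'\<bar>)"
   by eventually_elim (use lip2 in auto)
  have "((%y. \<Gamma> * (\<bar>fst y - m0\<bar> + \<bar>snd y - m0'\<bar>)) \<longlongrightarrow> \<Gamma> * (\<bar>fst z - m0\<bar> + \<bar>snd z - m0'\<bar>)) (at z)"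
   by (intro tendsto_intros)
  thus "((%y. \<Gamma> * (\<bar>fst y - m0\<bar> + \<bar>snd y - m0'\<bar>)) \<longlongrightarrow> 0) (at z)" using z by simp
 qed
 thus "isCont (%(m, m'). \<Phi> m m') z" using z by (simp add: isCont_def LIM_zero_iff split_beta')
qed

lemma Phi_measurable [measurable]: "(%z. \<Phi> (fst z) (snd z)) : Borel HH"
proof -
 have "(%z. indicator ({0<..} \<times> {0<..}) z *\<^sub>R (case z of (m, m') => \<Phi> m m')) : Borel borel"
  by (rule borel_measurable_continuous_on_indicator[OF _ Phi_continuous])
   (auto intro!: borel_open open_Times)
 hence "(%z. indicator ({0<..} \<times> {0<..}) z *\<^sub>R (case z of (m, m') => \<Phi> m m')) : Borel (borel \<Otimes>\<^sub>M borel)" by (simp add: borel_prod)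
 moreover have "(%z. (fst z, snd z)) : measurable HH (borel \<Otimes>\<^sub>M borel)" by (intro measurable_Pair measurable_halflineD) measurable
 ultimately have "(%z. indicator ({0<..} \<times> {0<..}) z *\<^sub>R (case z of (m, m') => \<Phi> m m')) : Borel HH"
  using measurable_compose[of "%z. (fst z, snd z)" "halfline \<Otimes>\<^sub>M halfline" "borel \<Otimes>\<^sub>M borel"] by simp
 thus ?thesis
 proof (rule measurable_cong[THEN iffD1, rotated])
  fix z assume "z : space HH"
  hence "0 <= fst z" "0 <= snd z" by (auto simp: pair_space)
  thus "indicator ({0<..} \<times> {0<..}) z *\<^sub>R (case z of (m, m') => \<Phi> m m') = \<Phi> (fst z) (snd z)" using Phi_vanishes[of "fst z" "snd z"]
   by (cases "0 < fst z & 0 < snd z") (auto simp: indicator_def split_beta' mem_Times_iff)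
 qed
qed

lemma \<kappa>_measurable [measurable]: "(%z. \<kappa> (fst z) (snd z)) : Borel HH" unfolding kappa_def by measurable

end
section \<open>The number measure and the collision measure\<close>

lemma finite_kernel_pair:
 assumes k: "finite_kernel M N k"
 shows "finite_kernel M (N \<Otimes>\<^sub>M N) (%x. k x \<Otimes>\<^sub>M k x)" unfolding finite_kernel_def
proof (intro conjI ballI)
 fix x assume x: "x : space M"
 interpret finite_measure "k x" by (rule finite_kernelD(2)[OF k x])
 interpret kk: pair_sigma_finite "k x" "k x" ..
 show "sets (k x \<Otimes>\<^sub>M k x) = sets (N \<Otimes>\<^sub>M N)" using finite_kernelD(1)[OF k x] by (intro sets_pair_measure_cong)
 show "finite_measure (k x \<Otimes>\<^sub>M k x)"
 proof
  have "emeasure (k x \<Otimes>\<^sub>M k x) (space (k x) \<times> space (k x)) = emeasure (k x) (space (k x)) * emeasure (k x) (space (k x))"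
   by (rule emeasure_pair_measure_Times) auto
  thus "emeasure (k x \<Otimes>\<^sub>M k x) (space (k x \<Otimes>\<^sub>M k x)) \<noteq> \<infinity>"
   using emeasure_finite by (simp add: pair_space ennreal_mult_eq_top_iff)
 qed
next
 fix B assume B: "B : sets (N \<Otimes>\<^sub>M N)"
 have k': "finite_kernel (M \<Otimes>\<^sub>M N) N (%(x, y). k x)" unfolding finite_kernel_def
 proof (intro conjI ballI)
  fix z assume "z : space (M \<Otimes>\<^sub>M N)"
  hence "fst z : space M" by (auto simp: pair_space)
  thus "sets (case z of (x, y) => k x) = sets N" "finite_measure (case z of (x, y) => k x)" using finite_kernelD(1,2)[OF k] by (auto simp: split_beta')
 next
  fix C assume "C : sets N"
  from measurable_compose[OF measurable_fst finite_kernelD(4)[OF k this], of N]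
  show "(%z. emeasure (case z of (x, y) => k x) C) : Borel (M \<Otimes>\<^sub>M N)" by (simp add: split_beta')
 qed
 have m: "(%w. indicator B (snd (fst w), snd w) :: ennreal) : Borel ((M \<Otimes>\<^sub>M N) \<Otimes>\<^sub>M N)" using B by measurable
 have m1: "(%z. \<integral>\<^sup>+w. indicator B (snd z, w) \<partial>k (fst z)) : Borel (M \<Otimes>\<^sub>M N)"
  using finite_kernel_nn_integral[OF k' m] by (simp add: split_beta')
 have m2: "(%x. \<integral>\<^sup>+y. \<integral>\<^sup>+w. indicator B (y, w) \<partial>k x \<partial>k x) : Borel M"
  using finite_kernel_nn_integral[OF k m1] by simp
 have "emeasure (k x \<Otimes>\<^sub>M k x) B = (\<integral>\<^sup>+y. \<integral>\<^sup>+w. indicator B (y, w) \<partial>k x \<partial>k x)" if x: "x : space M" for x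
 proof -
  interpret finite_measure "k x" by (rule finite_kernelD(2)[OF k x])
  have "sets (k x \<Otimes>\<^sub>M k x) = sets (N \<Otimes>\<^sub>M N)" using finite_kernelD(1)[OF k x] by (intro sets_pair_measure_cong)
  thus ?thesis using B by (intro emeasure_pair_measure) simp
 qed
 thus "(%x. emeasure (k x \<Otimes>\<^sub>M k x) B) : Borel M" using m2 by (simp cong: measurable_cong)
qed

lemma nn_integral_kint_pair:
 assumes k: "finite_kernel M N k" and F: "F : Borel (M \<Otimes>\<^sub>M (N \<Otimes>\<^sub>M N))"
 shows "(\<integral>\<^sup>+z. F z \<partial>kint M (N \<Otimes>\<^sub>M N) (%x. k x \<Otimes>\<^sub>M k x)) = (\<integral>\<^sup>+x. \<integral>\<^sup>+y. \<integral>\<^sup>+w. F (x, y, w) \<partial>k x \<partial>k x \<partial>M)"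
proof -
 have "(\<integral>\<^sup>+z. F z \<partial>kint M (N \<Otimes>\<^sub>M N) (%x. k x \<Otimes>\<^sub>M k x)) = (\<integral>\<^sup>+x. \<integral>\<^sup>+z. F (x, z) \<partial>(k x \<Otimes>\<^sub>M k x) \<partial>M)"
  by (rule nn_integral_kint[OF finite_kernel_pair[OF k] F])
 also have "... = (\<integral>\<^sup>+x. \<integral>\<^sup>+y. \<integral>\<^sup>+w. F (x, y, w) \<partial>k x \<partial>k x \<partial>M)"
 proof (rule nn_integral_cong)
  fix x assume x: "x : space M"
  interpret finite_measure "k x" by (rule finite_kernelD(2)[OF k x])
  show "(\<integral>\<^sup>+z. F (x, z) \<partial>(k x \<Otimes>\<^sub>M k x)) = (\<integral>\<^sup>+y. \<integral>\<^sup>+w. F (x, y, w) \<partial>k x \<partial>k x)"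
   using nn_integral_fst[of "%z. F (x, z)" "k x"] finite_kernel_measurable[OF finite_kernel_pair[OF k] x F] by simp
 qed
 finally show ?thesis .
qed

lemma disintegrates_finite_kernel: "disintegrates \<eta> \<upsilon> ==> finite_kernel torus halfline \<upsilon>" by (auto simp: disintegrates_def finite_kernel_def)

lemma disintegrates_kint:
 assumes \<eta>: "\<eta> : finite_measures" and d: "disintegrates \<eta> \<upsilon>"
 shows "\<eta> = kint torus halfline \<upsilon>"
proof (rule measure_eqI_generator_eq[where E="{a \<times> b |a b. a : sets torus & b : sets halfline}" and \<Omega>="space torus \<times> space halfline" and A="%_. space torus \<times> space halfline"])
 have s: "sets \<eta> = sets TH" and f: "finite_measure \<eta>" using \<eta> by (auto simp: finite_measures_def)
 show "Int_stable {a \<times> b |a b. a : sets torus & b : sets halfline}" by (rule Int_stable_pair_measure_generator)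
 show "{a \<times> b |a b. a : sets torus & b : sets halfline} \<subseteq> Pow (space torus \<times> space halfline)" by (rule pair_measure_closed)
 show "sets \<eta> = sigma_sets (space torus \<times> space halfline) {a \<times> b |a b. a : sets torus & b : sets halfline}"
  "sets (kint torus halfline \<upsilon>) = sigma_sets (space torus \<times> space halfline) {a \<times> b |a b. a : sets torus & b : sets halfline}"
  by (simp_all add: s sets_pair_measure)
 show "range (%_. space torus \<times> space halfline) \<subseteq> {a \<times> b |a b. a : sets torus & b : sets halfline}" by blast
 show "(\<Union>i::nat. space torus \<times> space halfline) = space torus \<times> space halfline" by simp
 show "emeasure \<eta> (space torus \<times> space halfline) \<noteq> \<infinity>" for i :: nat using finite_measure.emeasure_finite[OF f] by simp
 fix X assume "X : {a \<times> b |a b. a : sets torus & b : sets halfline}"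
 then obtain A B where X: "X = A \<times> B" "A : sets torus" "B : sets halfline" by auto
 have "emeasure \<eta> X = (\<integral>\<^sup>+x\<in>A. emeasure (\<upsilon> x) B \<partial>torus)" using d X by (auto simp: disintegrates_def)
 also have "... = (\<integral>\<^sup>+x. emeasure (\<upsilon> x) (Pair x -` X) \<partial>torus)" by (intro nn_integral_cong) (auto simp: X indicator_def vimage_def)
 also have "... = emeasure (kint torus halfline \<upsilon>) X" using X by (intro emeasure_kint[symmetric] disintegrates_finite_kernel[OF d]) auto
 finally show "emeasure \<eta> X = emeasure (kint torus halfline \<upsilon>) X" .
qed

abbreviation THH :: "(real \<times> real \<times> real) measure" where "THH \<equiv> torus \<Otimes>\<^sub>M HH"

lemma measurable_merge_mass [measurable]: "(%z. (fst z, fst (snd z) + snd (snd z))) : measurable THH TH"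
proof (intro measurable_Pair)
 have "(%z. fst (snd z) + snd (snd z)) : Borel THH" by (intro borel_measurable_add measurable_halflineD) measurable
 thus "(%z. fst (snd z) + snd (snd z)) : measurable THH halfline"
  unfolding halfline_def by (rule measurable_restrict_space2[rotated]) (auto simp: pair_space space_restrict_space)
qed measurable

locale coagulation_path = coagulation +
 fixes \<mu> :: "real => (real \<times> real) measure" and T K :: real
 assumes K1: "1 <= K" and T0: "0 <= T"
  and fin: "!!s. s : {0..T} ==> \<mu> s : finite_measures"
  and dis: "!!s. s : {0..T} ==> disintegrates (\<mu> s) (kernel (\<mu> s))"
  and Linf: "!!s. s : {0..T} ==>
    AE x in torus. (\<integral>\<^sup>+m. ennreal (omega c p a m) / ennreal m \<partial>kernel (\<mu> s) x) <= ennreal K"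
  and mass: "!!s. s : {0..T} ==> (\<integral>\<^sup>+z. ennreal (snd z) \<partial>\<mu> s) <= ennreal K"
begin

text \<open>The bound on \<open>om m / m\<close> holds for almost every \<open>x\<close>. Replacing the kernel by zero at the other points changes no integral over \<open>x\<close> and makes the
bound valid everywhere.\<close>
definition good :: "real => real => bool" where
 "good s x \<longleftrightarrow> s : {0..T} & (\<integral>\<^sup>+m. ennreal (om m) / ennreal m \<partial>kernel (\<mu> s) x) <= ennreal K"

definition nk :: "real => real => real measure" where
 "nk s x = (if good s x then density (kernel (\<mu> s) x) (%m. ennreal (1 / m)) else null_measure halfline)"

lemma kernel_mu: "s : {0..T} ==> finite_kernel torus halfline (kernel (\<mu> s))" by (rule disintegrates_finite_kernel[OF dis])

lemma measurable_good: "{x : space torus. good s x} : sets torus"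
proof (cases "s : {0..T}")
 case True
 define f where "f x = (\<integral>\<^sup>+m. ennreal (om m) / ennreal m \<partial>kernel (\<mu> s) x)" for x
 have "(%z. ennreal (om (snd z)) / ennreal (snd z)) : Borel TH" by measurable
 from finite_kernel_nn_integral[OF kernel_mu[OF True] this]
 have [measurable]: "f : Borel torus" by (simp add: f_def[abs_def])
 have "{x : space torus. f x <= ennreal K} : sets torus" by measurable
 moreover have "good s = (%x. f x <= ennreal K)" using True by (simp add: good_def f_def fun_eq_iff)
 ultimately show ?thesis by simp
next
 case False
 hence "\<not> good s x" for x by (auto simp: good_def)
 thus ?thesis by simp
qed

lemma AE_good: "s : {0..T} ==> AE x in torus. good s x" using Linf by (simp add: good_def)

lemma measurable_kernel_mu:
 assumes "good s x" "x : space torus" "f : measurable halfline L"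
 shows "f : measurable (kernel (\<mu> s) x) L"
proof -
 have "s : {0..T}" using assms(1) by (simp add: good_def)
 from finite_kernelD(1)[OF kernel_mu[OF this] assms(2)] show ?thesis using assms(3) measurable_cong_sets[of "kernel (\<mu> s) x" halfline L L] by blast
qed

lemma nn_integral_nk:
 assumes "good s x" "x : space torus" "f : Borel halfline"
 shows "(\<integral>\<^sup>+m. f m \<partial>nk s x) = (\<integral>\<^sup>+m. ennreal (1 / m) * f m \<partial>kernel (\<mu> s) x)"
 using assms by (simp add: nk_def nn_integral_density measurable_kernel_mu)

lemma sets_nk: "x : space torus ==> sets (nk s x) = sets halfline" using finite_kernelD(1)[OF kernel_mu] by (auto simp: nk_def good_def)

lemma space_nk: "x : space torus ==> space (nk s x) = space halfline" using sets_nk sets_eq_imp_space_eq by blast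

lemma nn_integral_nk_bad: "\<not> good s x ==> (\<integral>\<^sup>+m. f m \<partial>nk s x) = 0" by (simp add: nk_def)

lemma nk_om: "x : space torus ==> (\<integral>\<^sup>+m. ennreal (om m) \<partial>nk s x) <= ennreal K"
proof (cases "good s x")
 case True
 assume x: "x : space torus"
 have "(\<integral>\<^sup>+m. ennreal (om m) \<partial>nk s x) = (\<integral>\<^sup>+m. ennreal (1 / m) * ennreal (om m) \<partial>kernel (\<mu> s) x)"
  by (rule nn_integral_nk[OF True x]) measurable
 also have "... <= (\<integral>\<^sup>+m. ennreal (om m) / ennreal m \<partial>kernel (\<mu> s) x)"
 proof (rule nn_integral_mono)
  fix m assume "m : space (kernel (\<mu> s) x)"
  hence m: "0 <= m" using finite_kernelD(3)[OF kernel_mu x] True by (auto simp: good_def)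
  show "ennreal (1 / m) * ennreal (om m) <= ennreal (om m) / ennreal m" using m om_ge1[OF m] by (cases "m = 0") (auto simp: divide_ennreal ennreal_mult[symmetric])
 qed
 also have "... <= ennreal K" using True by (simp add: good_def)
 finally show ?thesis .
qed (simp add: nn_integral_nk_bad)

lemma nk_mass: "x : space torus ==> emeasure (nk s x) (space (nk s x)) <= ennreal K"
proof -
 assume x: "x : space torus"
 have "emeasure (nk s x) (space (nk s x)) = (\<integral>\<^sup>+m. 1 \<partial>nk s x)" by simp
 also have "... <= (\<integral>\<^sup>+m. ennreal (om m) \<partial>nk s x)" using space_nk[OF x] om_ge1 by (intro nn_integral_mono) auto
 finally show ?thesis using nk_om[OF x] order_trans by blast
qed

lemma finite_kernel_nk: "finite_kernel torus halfline (nk s)" unfolding finite_kernel_def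
proof (intro conjI ballI)
 fix x assume x: "x : space torus"
 show "sets (nk s x) = sets halfline" by (rule sets_nk[OF x])
 show "finite_measure (nk s x)" by standard (use nk_mass[OF x, of s] in \<open>auto simp: top_unique\<close>)
next
 fix B assume B: "B : sets halfline"
 show "(%x. emeasure (nk s x) B) : Borel torus"
 proof (cases "s : {0..T}")
  case True
  have m: "(%z. ennreal (1 / snd z) * indicator B (snd z)) : Borel TH" using B by measurable
  have m': "(%x. \<integral>\<^sup>+m. ennreal (1 / m) * indicator B m \<partial>kernel (\<mu> s) x) : Borel torus"
   using finite_kernel_nn_integral[OF kernel_mu[OF True] m] by simp
  have "(%x. if good s x then (\<integral>\<^sup>+m. ennreal (1 / m) * indicator B m \<partial>kernel (\<mu> s) x) else 0) : Borel torus"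
   by (rule measurable_If[OF m']) (use measurable_good in auto)
  moreover have "emeasure (nk s x) B = (if good s x then (\<integral>\<^sup>+m. ennreal (1 / m) * indicator B m \<partial>kernel (\<mu> s) x) else 0)"
   if x: "x : space torus" for x using nn_integral_nk[OF _ x, of s "indicator B"] B sets_nk[OF x, of s] by (auto simp: nk_def)
  ultimately show ?thesis by (rule measurable_cong[THEN iffD2, rotated])
 next
  case False
  hence "nk s = (%_. null_measure halfline)" by (auto simp: nk_def good_def fun_eq_iff)
  thus ?thesis by simp
 qed
qed

definition N :: "real => (real \<times> real) measure" where
 "N s = kint torus halfline (nk s)"

lemma sets_N [simp, measurable_cong]: "sets (N s) = sets TH"
 and space_N [simp]: "space (N s) = {0..<1} \<times> {0..}" by (simp_all add: N_def)

lemma nn_integral_N: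
 "f : Borel TH ==> (\<integral>\<^sup>+z. f z \<partial>N s) = (\<integral>\<^sup>+x. \<integral>\<^sup>+m. f (x, m) \<partial>nk s x \<partial>torus)"
 unfolding N_def by (rule nn_integral_kint[OF finite_kernel_nk])

lemma N_om: "(\<integral>\<^sup>+z. ennreal (om (snd z)) \<partial>N s) <= ennreal K"
proof -
 have "(\<integral>\<^sup>+z. ennreal (om (snd z)) \<partial>N s) = (\<integral>\<^sup>+x. \<integral>\<^sup>+m. ennreal (om m) \<partial>nk s x \<partial>torus)"
  by (subst nn_integral_N) auto
 also have "... <= (\<integral>\<^sup>+x. ennreal K \<partial>torus)" by (intro nn_integral_mono nk_om) auto
 also have "... = ennreal K" using torus.emeasure_space_1 by simp
 finally show ?thesis .
qed

lemma finite_N: "finite_measure (N s)"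
proof
 have "emeasure (N s) (space (N s)) = (\<integral>\<^sup>+z. 1 \<partial>N s)" by simp
 also have "... <= (\<integral>\<^sup>+z. ennreal (om (snd z)) \<partial>N s)" using om_ge1 by (intro nn_integral_mono) auto
 also have "... <= ennreal K" by (rule N_om)
 finally show "emeasure (N s) (space (N s)) \<noteq> \<infinity>" by (auto simp: top_unique)
qed

lemma AE_kernel_pos:
 assumes g: "good s x" and x: "x : space torus"
 shows "AE m in kernel (\<mu> s) x. 0 < m"
proof -
 have om': "(%m. ennreal (om m) / ennreal m) : Borel (kernel (\<mu> s) x)" by (rule measurable_kernel_mu[OF g x]) measurable
 have "(\<integral>\<^sup>+m. ennreal (om m) / ennreal m \<partial>kernel (\<mu> s) x) \<noteq> \<infinity>" using g by (auto simp: good_def top_unique)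
 from nn_integral_PInf_AE[OF om' this]
 show ?thesis
 proof (rule AE_mp, intro AE_I2 impI)
  fix m assume "m : space (kernel (\<mu> s) x)" and ne: "ennreal (om m) / ennreal m \<noteq> \<infinity>"
  hence m: "0 <= m" using finite_kernelD(3)[OF kernel_mu x] g by (auto simp: good_def)
  have "0 < ennreal (om m)" using om_ge1[OF m] by simp
  hence "m \<noteq> 0" using ne by (auto simp: ennreal_divide_eq_top_iff)
  thus "0 < m" using m by simp
 qed
qed

lemma kernel_density:
 assumes g: "good s x" and x: "x : space torus"
 shows "kernel (\<mu> s) x = density (nk s x) (%m. ennreal m)"
proof -
 have m: "(%m. ennreal (1 / m)) : Borel (kernel (\<mu> s) x)" "(%m. ennreal m) : Borel (kernel (\<mu> s) x)" by (rule measurable_kernel_mu[OF g x], measurable)+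
 have "density (nk s x) (%m. ennreal m) = density (kernel (\<mu> s) x) (%m. ennreal (1 / m) * ennreal m)" using g by (simp add: nk_def density_density_eq[OF m])
 also have "... = density (kernel (\<mu> s) x) (%_. 1)"
 proof (rule density_cong)
  show "AE m in kernel (\<mu> s) x. ennreal (1 / m) * ennreal m = 1" using AE_kernel_pos[OF g x] by eventually_elim (simp add: ennreal_mult[symmetric])
 qed (use m in simp_all)
 finally show ?thesis by (simp add: density_1)
qed

lemma nn_integral_mu:
 assumes s: "s : {0..T}" and f: "f : Borel TH"
 shows "(\<integral>\<^sup>+z. f z \<partial>\<mu> s) = (\<integral>\<^sup>+z. ennreal (snd z) * f z \<partial>N s)"
proof -
 note [measurable] = f
 have "(\<integral>\<^sup>+z. f z \<partial>\<mu> s) = (\<integral>\<^sup>+x. \<integral>\<^sup>+m. f (x, m) \<partial>kernel (\<mu> s) x \<partial>torus)"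
  by (subst disintegrates_kint[OF fin[OF s] dis[OF s]]) (rule nn_integral_kint[OF kernel_mu[OF s] f])
 also have "... = (\<integral>\<^sup>+x. \<integral>\<^sup>+m. ennreal m * f (x, m) \<partial>nk s x \<partial>torus)"
 proof (rule nn_integral_cong_AE)
  show "AE x in torus. (\<integral>\<^sup>+m. f (x, m) \<partial>kernel (\<mu> s) x) = (\<integral>\<^sup>+m. ennreal m * f (x, m) \<partial>nk s x)"
   using AE_good[OF s] AE_space
  proof eventually_elim
   case (elim x)
   hence g: "good s x" and x: "x : space torus" by auto
   note pos = AE_kernel_pos[OF g x]
   have m: "(%m. ennreal m * f (x, m)) : Borel halfline" using x by measurable
   have "(\<integral>\<^sup>+m. ennreal m * f (x, m) \<partial>nk s x) = (\<integral>\<^sup>+m. ennreal (1 / m) * (ennreal m * f (x, m)) \<partial>kernel (\<mu> s) x)"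
    by (rule nn_integral_nk[OF g x m])
   also have "... = (\<integral>\<^sup>+m. f (x, m) \<partial>kernel (\<mu> s) x)" by (rule nn_integral_cong_AE)
     (use pos in \<open>auto simp: mult.assoc[symmetric] ennreal_mult[symmetric]\<close>)
   finally show ?case by simp
  qed
 qed
 also have "... = (\<integral>\<^sup>+z. ennreal (snd z) * f z \<partial>N s)" by (subst nn_integral_N) auto
 finally show ?thesis .
qed

text \<open>The kernel gives no mass to \<open>0\<close>, because \<open>om 0 / 0\<close> is infinite; so dividing and multiplying by the mass is lossless.\<close>
lemma mu_density: "s : {0..T} ==> \<mu> s = density (N s) (%z. ennreal (snd z))"
proof (rule measure_eqI)
 assume s: "s : {0..T}"
 have sets: "sets (\<mu> s) = sets TH" using fin[OF s] by (auto simp: finite_measures_def)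
 thus "sets (\<mu> s) = sets (density (N s) (%z. ennreal (snd z)))" by simp
 fix A assume A: "A : sets (\<mu> s)"
 have "emeasure (\<mu> s) A = (\<integral>\<^sup>+z. indicator A z \<partial>\<mu> s)" using A by simp
 also have "... = (\<integral>\<^sup>+z. ennreal (snd z) * indicator A z \<partial>N s)" by (rule nn_integral_mu[OF s]) (use A sets in auto)
 also have "... = emeasure (density (N s) (%z. ennreal (snd z))) A" using A sets by (subst emeasure_density) auto
 finally show "emeasure (\<mu> s) A = emeasure (density (N s) (%z. ennreal (snd z))) A" .
qed

lemma N_mass2: "(\<integral>\<^sup>+z. ennreal ((snd z)\<^sup>2) \<partial>N s) <= ennreal K"
proof (cases "s : {0..T}")
 case True
 have "(\<integral>\<^sup>+z. ennreal ((snd z)\<^sup>2) \<partial>N s) = (\<integral>\<^sup>+z. ennreal (snd z) * ennreal (snd z) \<partial>N s)"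
  by (intro nn_integral_cong) (auto simp: power2_eq_square ennreal_mult)
 also have "... = (\<integral>\<^sup>+z. ennreal (snd z) \<partial>\<mu> s)" by (rule nn_integral_mu[OF True, symmetric]) measurable
 finally show ?thesis using mass[OF True] by simp
next
 case False
 thus ?thesis by (subst nn_integral_N) (auto simp: nn_integral_nk_bad good_def)
qed

text \<open>The law of colliding pairs. The factor \<open>1/2\<close> compensates for counting ordered pairs.\<close>
definition q :: "real => (real \<times> real \<times> real) measure" where
 "q s = density (kint torus HH (%x. nk s x \<Otimes>\<^sub>M nk s x))
   (%z. ennreal (\<kappa> (fst (snd z)) (snd (snd z)) / 2))"

lemma sets_q [simp, measurable_cong]: "sets (q s) = sets THH"
 and space_q [simp]: "space (q s) = {0..<1} \<times> {0..} \<times> {0..}" by (simp_all add: q_def pair_space)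

lemma nn_integral_q:
 assumes [measurable]: "F : Borel THH"
 shows "(\<integral>\<^sup>+z. F z \<partial>q s) = (\<integral>\<^sup>+x. \<integral>\<^sup>+m. \<integral>\<^sup>+m'. ennreal (\<kappa> m m' / 2) * F (x, m, m') \<partial>nk s x \<partial>nk s x \<partial>torus)"
proof -
 have [measurable]: "(%z. \<kappa> (fst (snd z)) (snd (snd z))) : Borel THH" using measurable_compose[OF measurable_snd \<kappa>_measurable, of torus] by simp
 show ?thesis unfolding q_def by (subst nn_integral_density) (auto simp: nn_integral_kint_pair[OF finite_kernel_nk])
qed

lemma q_le_fst:
 assumes [measurable]: "h : Borel TH"
 shows "(\<integral>\<^sup>+z. h (fst z, fst (snd z)) \<partial>q s) <= ennreal K * (\<integral>\<^sup>+z. ennreal (om (snd z)) * h z \<partial>N s)"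
proof -
 have mx: "(%m. h (x, m)) : Borel (nk s x)" if x: "x : space torus" for x by (rule finite_kernel_measurable[OF finite_kernel_nk x assms])
 have mo: "om : Borel (nk s x)" if x: "x : space torus" for x unfolding measurable_cong_sets[OF sets_nk[OF x] refl] by (rule om_measurable)
 have hm: "(%z. h (fst z, fst (snd z))) : Borel THH" by measurable
 have "(\<integral>\<^sup>+z. h (fst z, fst (snd z)) \<partial>q s) = (\<integral>\<^sup>+x. \<integral>\<^sup>+m. \<integral>\<^sup>+m'. ennreal (\<kappa> m m' / 2) * h (x, m) \<partial>nk s x \<partial>nk s x \<partial>torus)"
  using nn_integral_q[OF hm] by (simp only: fst_conv snd_conv)
 also have "... <= (\<integral>\<^sup>+x. \<integral>\<^sup>+m. \<integral>\<^sup>+m'. (ennreal (om m) * h (x, m)) * ennreal (om m') \<partial>nk s x \<partial>nk s x \<partial>torus)"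
 proof (intro nn_integral_mono)
  fix x m m' assume *: "x : space torus" "m : space (nk s x)" "m' : space (nk s x)"
  hence m: "0 <= m" "0 <= m'" using space_nk by auto
  have "ennreal (\<kappa> m m' / 2) <= ennreal (om m * om m')" using \<kappa>_le[OF m] \<kappa>_nonneg[OF m] by (intro ennreal_leI) auto
  also have "... = ennreal (om m) * ennreal (om m')" using om_ge1 m by (intro ennreal_mult) (auto intro: order_trans[OF zero_le_one])
  finally have "ennreal (\<kappa> m m' / 2) * h (x, m) <= (ennreal (om m) * ennreal (om m')) * h (x, m)" by (rule mult_right_mono) simp
  thus "ennreal (\<kappa> m m' / 2) * h (x, m) <= (ennreal (om m) * h (x, m)) * ennreal (om m')" by (simp add: ac_simps)
 qed
 also have "... = (\<integral>\<^sup>+x. (\<integral>\<^sup>+m. ennreal (om m) * h (x, m) \<partial>nk s x) * (\<integral>\<^sup>+m'. ennreal (om m') \<partial>nk s x) \<partial>torus)"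
 proof (rule nn_integral_cong)
  fix x assume x: "x : space torus"
  have 1: "(%m. ennreal (om m)) : Borel (nk s x)" using mo[OF x] by simp
  have 2: "(%m. ennreal (om m) * h (x, m)) : Borel (nk s x)" by (rule borel_measurable_times_ennreal[OF 1 mx[OF x]])
  show "(\<integral>\<^sup>+m. \<integral>\<^sup>+m'. (ennreal (om m) * h (x, m)) * ennreal (om m') \<partial>nk s x \<partial>nk s x)
    = (\<integral>\<^sup>+m. ennreal (om m) * h (x, m) \<partial>nk s x) * (\<integral>\<^sup>+m'. ennreal (om m') \<partial>nk s x)"
   unfolding nn_integral_cmult[OF 1] by (rule nn_integral_multc[OF 2])
 qed
 also have "... <= (\<integral>\<^sup>+x. (\<integral>\<^sup>+m. ennreal (om m) * h (x, m) \<partial>nk s x) * ennreal K \<partial>torus)"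
  by (intro nn_integral_mono mult_left_mono nk_om) auto
 also have "... = (\<integral>\<^sup>+x. \<integral>\<^sup>+m. ennreal (om m) * h (x, m) \<partial>nk s x \<partial>torus) * ennreal K"
  using finite_kernel_nn_integral[OF finite_kernel_nk, of "%z. ennreal (om (snd z)) * h z"] by (intro nn_integral_multc) simp
 also have "(\<integral>\<^sup>+x. \<integral>\<^sup>+m. ennreal (om m) * h (x, m) \<partial>nk s x \<partial>torus) = (\<integral>\<^sup>+z. ennreal (om (snd z)) * h z \<partial>N s)"
  by (subst nn_integral_N) auto
 finally show ?thesis by (simp add: mult.commute)
qed

lemma q_swap:
 assumes [measurable]: "F : Borel THH"
 shows "(\<integral>\<^sup>+z. F (fst z, snd (snd z), fst (snd z)) \<partial>q s) = (\<integral>\<^sup>+z. F z \<partial>q s)"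
proof -
 have Fm: "(%z. F (fst z, snd (snd z), fst (snd z))) : Borel THH" by measurable
 have "(\<integral>\<^sup>+z. F (fst z, snd (snd z), fst (snd z)) \<partial>q s) = (\<integral>\<^sup>+x. \<integral>\<^sup>+m. \<integral>\<^sup>+m'. ennreal (\<kappa> m m' / 2) * F (x, m', m) \<partial>nk s x \<partial>nk s x \<partial>torus)"
  using nn_integral_q[OF Fm] by (simp only: fst_conv snd_conv)
 also have "... = (\<integral>\<^sup>+x. \<integral>\<^sup>+m'. \<integral>\<^sup>+m. ennreal (\<kappa> m' m / 2) * F (x, m', m) \<partial>nk s x \<partial>nk s x \<partial>torus)"
 proof (rule nn_integral_cong)
  fix x assume x: "x : space torus"
  interpret finite_measure "nk s x" by (rule finite_kernelD(2)[OF finite_kernel_nk x])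
  interpret pair_sigma_finite "nk s x" "nk s x" ..
  have s: "sets (nk s x \<Otimes>\<^sub>M nk s x) = sets HH" using sets_nk[OF x] by (intro sets_pair_measure_cong)
  have "(%(m', m). ennreal (\<kappa> m m' / 2) * F (x, m', m)) : Borel (nk s x \<Otimes>\<^sub>M nk s x)" unfolding measurable_cong_sets[OF s refl] split_beta'
  proof (rule borel_measurable_times_ennreal)
   have "(%z. \<kappa> (snd z) (fst z)) : Borel HH"
    using measurable_compose[OF _ \<kappa>_measurable, of "%z. (snd z, fst z)" "halfline \<Otimes>\<^sub>M halfline"] by simp
   thus "(%z. ennreal (\<kappa> (snd z) (fst z) / 2)) : Borel HH" by simp
   show "(%z. F (x, fst z, snd z)) : Borel HH" using measurable_compose[OF measurable_Pair1'[OF x] assms] by simp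
  qed
  from Fubini'[OF this]
  have "(\<integral>\<^sup>+m. \<integral>\<^sup>+m'. ennreal (\<kappa> m m' / 2) * F (x, m', m) \<partial>nk s x \<partial>nk s x) = (\<integral>\<^sup>+m'. \<integral>\<^sup>+m. ennreal (\<kappa> m m' / 2) * F (x, m', m) \<partial>nk s x \<partial>nk s x)"
   by simp
  also have "... = (\<integral>\<^sup>+m'. \<integral>\<^sup>+m. ennreal (\<kappa> m' m / 2) * F (x, m', m) \<partial>nk s x \<partial>nk s x)"
   using space_nk[OF x] \<kappa>_sym by (intro nn_integral_cong) auto
  finally show "(\<integral>\<^sup>+m. \<integral>\<^sup>+m'. ennreal (\<kappa> m m' / 2) * F (x, m', m) \<partial>nk s x \<partial>nk s x) = ..." .
 qed
 also have "... = (\<integral>\<^sup>+z. F z \<partial>q s)" by (rule nn_integral_q[OF assms, symmetric])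
 finally show ?thesis .
qed

lemma q_le_snd:
 assumes [measurable]: "h : Borel TH"
 shows "(\<integral>\<^sup>+z. h (fst z, snd (snd z)) \<partial>q s) <= ennreal K * (\<integral>\<^sup>+z. ennreal (om (snd z)) * h z \<partial>N s)"
 using q_swap[of "%z. h (fst z, fst (snd z))" s] q_le_fst[OF assms] by simp

lemma finite_q: "finite_measure (q s)" and q_mass: "emeasure (q s) (space (q s)) <= ennreal (K * K)"
proof -
 have "emeasure (q s) (space (q s)) = (\<integral>\<^sup>+z. 1 \<partial>q s)" by simp
 also have "... <= ennreal K * (\<integral>\<^sup>+z. ennreal (om (snd z)) * 1 \<partial>N s)" by (rule q_le_fst) simp
 also have "... <= ennreal K * ennreal K" using N_om by (intro mult_left_mono) auto
 also have "... = ennreal (K * K)" using K1 by (simp add: ennreal_mult)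
 finally show *: "emeasure (q s) (space (q s)) <= ennreal (K * K)" .
 thus "finite_measure (q s)" by (intro finite_measureI) (auto simp: top_unique)
qed

lemma AE_q_pos: "AE z in q s. 0 < fst (snd z) & 0 < snd (snd z)"
proof -
 have [measurable]: "(%z. \<kappa> (fst (snd z)) (snd (snd z))) : Borel THH" using measurable_compose[OF measurable_snd \<kappa>_measurable, of torus] by simp
 show ?thesis unfolding q_def
 proof (subst AE_density)
  show "AE z in kint torus HH (%x. nk s x \<Otimes>\<^sub>M nk s x).
    0 < ennreal (\<kappa> (fst (snd z)) (snd (snd z)) / 2) --> 0 < fst (snd z) & 0 < snd (snd z)"
  proof (rule AE_I2, rule impI)
   fix z assume "z : space (kint torus HH (%x. nk s x \<Otimes>\<^sub>M nk s x))"
    and pos: "0 < ennreal (\<kappa> (fst (snd z)) (snd (snd z)) / 2)"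
   hence "0 <= fst (snd z)" "0 <= snd (snd z)" by (auto simp: pair_space)
   with pos \<kappa>_zero[of "fst (snd z)" "snd (snd z)"] show "0 < fst (snd z) & 0 < snd (snd z)" by (auto simp: less_le)
  qed
 qed measurable
qed

end
section \<open>Integrals in time and weak formulation for numbers\<close>

definition tint :: "real => real => (real => real) => real" where
 "tint t0 t g = (\<integral>s. indicator {t0<..t} s * g s \<partial>lborel)"

lemma tint_integrable:
 fixes g :: "real => real"
 assumes "g : Borel borel" "!!s. \<bar>g s\<bar> <= C"
 shows "integrable lborel (%s. indicator {t0<..t} s * g s)"
proof (rule Bochner_Integration.integrable_bound)
 show "integrable lborel (%s. indicator {t0<..t} s * C)" by (cases "t0 <= t") auto
 have "0 <= C" using assms(2)[of 0] by linarith
 thus "AE s in lborel. norm (indicator {t0<..t} s * g s) <= norm (indicator {t0<..t} s * C)" using assms(2) by (auto simp: indicator_def)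
qed (use assms in simp)

lemma tint_const: "t0 <= t ==> tint t0 t (%_. C) = C * (t - t0)" by (simp add: tint_def)

lemma tint_mono:
 fixes g h :: "real => real"
 assumes "g : Borel borel" "!!s. \<bar>g s\<bar> <= C"
  "h : Borel borel" "!!s. \<bar>h s\<bar> <= C'"
  and "!!s. t0 < s ==> s <= t ==> g s <= h s"
 shows "tint t0 t g <= tint t0 t h" unfolding tint_def by (rule integral_mono[OF tint_integrable[OF assms(1,2)] tint_integrable[OF assms(3,4)]])
  (use assms(5) in \<open>auto simp: indicator_def\<close>)

lemma tint_le:
 fixes g :: "real => real"
 assumes g: "g : Borel borel" "!!s. \<bar>g s\<bar> <= C"
  and le: "t0 <= t" "!!s. t0 < s ==> s <= t ==> g s <= B"
 shows "tint t0 t g <= B * (t - t0)" using tint_mono[OF g, of "%_. B" "\<bar>B\<bar>" t0 t] le tint_const[of t0 t B] by simp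

lemma tint_linear:
 fixes g h :: "real => real"
 assumes "g : Borel borel" "!!s. \<bar>g s\<bar> <= C"
  "h : Borel borel" "!!s. \<bar>h s\<bar> <= C'"
 shows "tint t0 t (%s. al * g s + \<beta> * h s) = al * tint t0 t g + \<beta> * tint t0 t h"
proof -
 note i = tint_integrable[OF assms(1,2), of t0 t] tint_integrable[OF assms(3,4), of t0 t]
 have "tint t0 t (%s. al * g s + \<beta> * h s) = (\<integral>s. al * (indicator {t0<..t} s * g s) + \<beta> * (indicator {t0<..t} s * h s) \<partial>lborel)"
  unfolding tint_def by (intro bochner_cong) (auto simp: algebra_simps)
 also have "... = al * tint t0 t g + \<beta> * tint t0 t h" unfolding tint_def using i by (subst Bochner_Integration.integral_add) auto
 finally show ?thesis .
qed

lemma tint_abs_le: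
 fixes g :: "real => real"
 assumes g: "g : Borel borel" "!!s. \<bar>g s\<bar> <= C"
  and le: "t0 <= t" "!!s. t0 < s ==> s <= t ==> \<bar>g s\<bar> <= B"
 shows "\<bar>tint t0 t g\<bar> <= B * (t - t0)"
proof -
 have 1: "tint t0 t g <= B * (t - t0)" by (rule tint_le[OF g le(1)]) (use le(2) in \<open>auto simp: abs_le_iff\<close>)
 have "tint t0 t (%s. - g s) <= B * (t - t0)" by (rule tint_le[OF _ _ le(1), of _ C]) (use g le(2) in \<open>auto simp: abs_le_iff\<close>)
 moreover have "tint t0 t (%s. - g s) = - tint t0 t g" by (simp add: tint_def)
 ultimately show ?thesis using 1 by linarith
qed

lemma tint_combine:
 fixes g :: "real => real"
 assumes g: "g : Borel borel" "!!s. \<bar>g s\<bar> <= C"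
  and "t0 <= t1" "t1 <= t2"
 shows "tint t0 t2 g = tint t0 t1 g + tint t1 t2 g"
proof -
 have "tint t0 t2 g = (\<integral>s. indicator {t0<..t1} s * g s + indicator {t1<..t2} s * g s \<partial>lborel)"
  unfolding tint_def by (intro bochner_cong) (use assms(3,4) in \<open>auto simp: indicator_def\<close>)
 also have "... = tint t0 t1 g + tint t1 t2 g" unfolding tint_def by (rule Bochner_Integration.integral_add[OF tint_integrable[OF g] tint_integrable[OF g]])
 finally show ?thesis .
qed

lemma tint_tendsto:
 fixes g :: "real => real" and G :: "nat => real => real"
 assumes G: "!!i. G i : Borel borel" "!!i s. \<bar>G i s\<bar> <= C"
  and g: "g : Borel borel" "!!s. t0 < s ==> s <= t ==> (%i. G i s) \<longlonglongrightarrow> g s"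
 shows "(%i. tint t0 t (G i)) \<longlonglongrightarrow> tint t0 t g" unfolding tint_def
proof (rule integral_dominated_convergence[where w="%s. indicator {t0<..t} s * C"])
 show "integrable lborel (%s. indicator {t0<..t} s * C)" by (cases "t0 <= t") auto
 show "AE s in lborel. (%i. indicator {t0<..t} s * G i s) \<longlonglongrightarrow> indicator {t0<..t} s * g s"
  using g(2) by (intro AE_I2) (auto simp: indicator_def)
 show "AE s in lborel. norm (indicator {t0<..t} s * G i s) <= indicator {t0<..t} s * C" for i using G(2) by (auto simp: indicator_def)
qed (use G g in simp_all)

lemma tint_set_integral:
 fixes g :: "real => real"
 assumes "set_integrable lborel {0..t} g"
 shows "(LINT s:{0..t}|lborel. g s) = tint 0 t g"
proof -
 have m: "(%s. indicator {0..t} s * g s) : Borel borel" using assms unfolding set_integrable_def by (auto dest: borel_measurable_integrable)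
 hence "(%s. indicator {0<..t} s * (indicator {0..t} s * g s)) : Borel borel" by measurable
 moreover have "(%s. indicator {0<..t} s * (indicator {0..t} s * g s)) = (%s. indicator {0<..t} s * g s)" by (auto simp: fun_eq_iff indicator_def)
 ultimately have m': "(%s. indicator {0<..t} s * g s) : Borel borel" by simp
 have "AE s in lborel. s \<noteq> (0::real)" by (rule AE_lborel_singleton)
 hence ae: "AE s in lborel. indicator {0..t} s *\<^sub>R g s = indicator {0<..t} s * g s" by eventually_elim (auto simp: indicator_def)
 thus ?thesis unfolding set_lebesgue_integral_def tint_def by (rule integral_cong_AE[rotated 2]) (use m m' in auto)
qed

lemma integral_le_nn_integral:
 fixes u :: "'a => real"
 assumes "u : Borel M" "!!z. z : space M ==> 0 <= u z"
  "(\<integral>\<^sup>+z. ennreal (u z) \<partial>M) <= ennreal C" "0 <= C"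
 shows "(\<integral>z. u z \<partial>M) <= C" using assms by (subst integral_eq_nn_integral) (auto intro!: enn2real_leI AE_I2)

lemma AE_of_null_space: "emeasure M (space M) = 0 ==> AE x in M. P x" by (rule AE_I[of _ _ "space M"]) auto

text \<open>Summing over \<open>n\<close> equal subintervals bounds the increment by a constant over \<open>n\<close>.\<close>
lemma quadratic_increments_zero:
 fixes D :: "real => real"
 assumes ab: "t0 <= t" and inc: "!!s s'. t0 <= s ==> s <= s' ==> s' <= t ==> \<bar>D s' - D s\<bar> <= C * (s' - s)\<^sup>2"
 shows "D t = D t0"
proof (rule ccontr)
 assume "D t \<noteq> D t0"
 define e where "e = \<bar>D t - D t0\<bar>"
 have e: "e > 0" using \<open>D t \<noteq> D t0\<close> by (simp add: e_def)
 have bound: "e <= C * (t - t0)\<^sup>2 / real n" if n: "n > 0" for n :: nat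
 proof -
  define h where "h = (t - t0) / real n"
  define u where "u i = t0 + real i * h" for i :: nat
  have h: "0 <= h" "real n * h = t - t0" using n ab by (auto simp: h_def)
  have *: "\<bar>D (u i) - D t0\<bar> <= real i * (C * h\<^sup>2)" if "i <= n" for i using that
  proof (induction i)
   case (Suc i)
   have "real (Suc i) * h <= real n * h" using Suc.prems h(1) by (intro mult_right_mono) auto
   hence "\<bar>D (u (Suc i)) - D (u i)\<bar> <= C * (u (Suc i) - u i)\<^sup>2" using h by (intro inc) (auto simp: u_def algebra_simps)
   also have "u (Suc i) - u i = h" by (simp add: u_def algebra_simps)
   finally have "\<bar>D (u (Suc i)) - D (u i)\<bar> <= C * h\<^sup>2" .
   thus ?case using Suc.IH Suc.prems by (simp add: distrib_right)
  qed (simp add: u_def)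
  have "e <= real n * (C * h\<^sup>2)" using *[of n] h(2) by (simp add: u_def e_def)
  also have "... = C * (t - t0)\<^sup>2 / real n" using n by (simp add: h_def power_divide power2_eq_square)
  finally show ?thesis .
 qed
 obtain n :: nat where n: "\<bar>C * (t - t0)\<^sup>2\<bar> / e < real n" using reals_Archimedean2 by blast
 hence n0: "real n > 0" using e by (smt (verit) divide_nonneg_pos)
 have "C * (t - t0)\<^sup>2 / real n < e"
 proof -
  have "\<bar>C * (t - t0)\<^sup>2\<bar> < real n * e" using n e by (simp add: pos_divide_less_eq)
  thus ?thesis using n0 by (simp add: pos_divide_less_eq mult.commute)
 qed
 thus False using bound[of n] n0 by simp
qed

context coagulation_path
begin

definition num :: "real => (real \<times> real => real) => real" where
 "num s f = (\<integral>z. f z \<partial>N s)"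

definition gl :: "(real \<times> real => real) => real \<times> real \<times> real => real" where
 "gl f z = f (fst z, fst (snd z) + snd (snd z)) - f (fst z, fst (snd z)) - f (fst z, snd (snd z))"

definition coll :: "real => (real \<times> real => real) => real" where
 "coll s f = (\<integral>z. gl f z \<partial>q s)"

lemma gl_measurable [measurable]:
 assumes [measurable]: "f : Borel TH"
 shows "gl f : Borel THH"
proof -
 have "(%z. f (fst z, fst (snd z) + snd (snd z))) : Borel THH" using measurable_compose[OF measurable_merge_mass assms] by simp
 thus ?thesis unfolding gl_def[abs_def] by measurable
qed

lemma nk_outside: "s \<notin> {0..T} ==> nk s = (%_. null_measure halfline)" by (auto simp: nk_def good_def fun_eq_iff)

lemma emeasure_N_outside: "s \<notin> {0..T} ==> emeasure (N s) (space (N s)) = 0" using nn_integral_N[of "%_. 1" s] by (simp add: nk_outside)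

lemma num_outside: "s \<notin> {0..T} ==> num s f = 0"
proof -
 assume "s \<notin> {0..T}"
 hence "AE z in N s. f z = 0" by (intro AE_of_null_space emeasure_N_outside)
 thus ?thesis unfolding num_def by (simp add: integral_eq_zero_AE)
qed

lemma coll_outside: "s \<notin> {0..T} ==> coll s f = 0"
proof -
 assume s: "s \<notin> {0..T}"
 have "emeasure (q s) (space (q s)) = (\<integral>\<^sup>+z. 1 \<partial>q s)" by simp
 also have "... <= ennreal K * (\<integral>\<^sup>+z. ennreal (om (snd z)) * 1 \<partial>N s)" by (rule q_le_fst) simp
 also have "(\<integral>\<^sup>+z. ennreal (om (snd z)) * 1 \<partial>N s) = 0" using nn_integral_N[of "%z. ennreal (om (snd z)) * 1" s] s by (simp add: nk_outside)
 finally have "emeasure (q s) (space (q s)) = 0" by simp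
 hence "AE z in q s. gl f z = 0" by (rule AE_of_null_space)
 thus ?thesis unfolding coll_def by (simp add: integral_eq_zero_AE)
qed

lemma integrable_N_om:
 assumes [measurable]: "f : Borel TH" and b: "!!z. z : space TH ==> \<bar>f z\<bar> <= C * om (snd z)"
 shows "integrable (N s) f" and "\<bar>num s f\<bar> <= C * K"
proof -
 have C: "0 <= C"
 proof -
  have "0 <= C * om (snd (0::real, 0::real))" using b[of "(0,0)"] by (auto simp: pair_space intro: order_trans[OF abs_ge_zero])
  thus ?thesis using om_ge1[of 0] by (simp add: zero_le_mult_iff)
 qed
 have le: "(\<integral>\<^sup>+z. ennreal \<bar>f z\<bar> \<partial>N s) <= ennreal (C * K)"
 proof -
  have "(\<integral>\<^sup>+z. ennreal \<bar>f z\<bar> \<partial>N s) <= (\<integral>\<^sup>+z. ennreal C * ennreal (om (snd z)) \<partial>N s)"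
   using b C om_ge1 by (intro nn_integral_mono) (auto simp: pair_space ennreal_mult'[symmetric] intro!: ennreal_leI)
  also have "... = ennreal C * (\<integral>\<^sup>+z. ennreal (om (snd z)) \<partial>N s)" by (rule nn_integral_cmult) simp
  also have "... <= ennreal C * ennreal K" by (intro mult_left_mono N_om) auto
  finally show ?thesis using C K1 by (simp add: ennreal_mult)
 qed
 show i: "integrable (N s) f" unfolding integrable_iff_bounded using le by (auto simp: less_top[symmetric] top_unique)
 have "ennreal \<bar>num s f\<bar> <= (\<integral>\<^sup>+z. ennreal \<bar>f z\<bar> \<partial>N s)"
  unfolding num_def using integral_norm_bound_ennreal[OF i] by simp
 with le have "ennreal \<bar>num s f\<bar> <= ennreal (C * K)" by (rule order_trans[rotated])
 thus "\<bar>num s f\<bar> <= C * K" using C K1 by (simp add: ennreal_le_iff)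
qed

lemma bounded_le_om:
 assumes "!!z. z : space TH ==> \<bar>f z\<bar> <= (C::real)"
 shows "!!z. z : space TH ==> \<bar>f z\<bar> <= C * om (snd z)"
proof -
 fix z assume z: "z : space TH"
 have "\<bar>f z\<bar> <= C * 1" using assms[OF z] by simp
 also have "... <= C * om (snd z)" using assms[OF z] om_ge1[of "snd z"] z by (intro mult_left_mono) (auto simp: pair_space)
 finally show "\<bar>f z\<bar> <= C * om (snd z)" .
qed

lemma integrable_q_bounded:
 assumes [measurable]: "f : Borel TH" and b: "!!z. z : space TH ==> \<bar>f z\<bar> <= C"
 shows "integrable (q s) (gl f)" and "\<bar>coll s f\<bar> <= 3 * C * (K * K)"
proof -
 interpret finite_measure "q s" by (rule finite_q)
 have gb: "\<bar>gl f z\<bar> <= 3 * C" if "z : space (q s)" for z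
 proof -
  obtain x m m' where z: "z = (x, m, m')" by (cases z)
  have "(x, m + m') : space TH" "(x, m) : space TH" "(x, m') : space TH" using that z by (auto simp: pair_space)
  from this[THEN b] show ?thesis unfolding gl_def z by simp
 qed
 show i: "integrable (q s) (gl f)" by (rule integrable_const_bound[where B="3 * C"]) (use gb in auto)
 have "0 <= C" using b[of "(0,0)"] by (simp add: pair_space)
 have "\<bar>coll s f\<bar> <= (\<integral>z. \<bar>gl f z\<bar> \<partial>q s)" unfolding coll_def by (rule integral_abs_bound)
 also have "... <= (\<integral>z. 3 * C \<partial>q s)" by (rule integral_mono) (use i gb in auto)
 also have "... = 3 * C * measure (q s) (space (q s))" by simp
 also have "... <= 3 * C * (K * K)"
 proof (rule mult_left_mono)
  have "ennreal (measure (q s) (space (q s))) <= ennreal (K * K)" using q_mass[of s] by (simp add: emeasure_eq_measure)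
  thus "measure (q s) (space (q s)) <= K * K" using K1 by (simp add: ennreal_le_iff)
 qed (use \<open>0 <= C\<close> in simp)
 finally show "\<bar>coll s f\<bar> <= 3 * C * (K * K)" .
qed

lemma om_mass: "0 <= m ==> om m * m <= om m + (1 + c + a 1) * (2 + a 1) * m\<^sup>2"
proof -
 assume m: "0 <= m"
 have pos: "0 < a 1" using a_pos by simp
 show ?thesis
 proof (cases "m <= 1")
  case True
  hence "om m * m <= om m * 1" using om_ge1[OF m] m by (intro mult_left_mono) auto
  moreover have "0 <= (1 + c + a 1) * (2 + a 1) * m\<^sup>2" using pos c_pos by simp
  ultimately show ?thesis by linarith
 next
  case False
  have "m powr p <= m powr 1" using False p_range by (intro powr_mono) auto
  moreover have "a m <= a 1" using a_mono[of 1 m] False by auto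
  ultimately have "m powr p + a m + 1 <= m + a 1 + 1" using m by simp
  also have "... <= (2 + a 1) * m"
  proof -
   have "0 <= (1 + a 1) * (m - 1)" using False pos by simp
   thus ?thesis by (simp add: algebra_simps)
  qed
  finally have "om m <= (1 + c + a 1) * ((2 + a 1) * m)" unfolding om_expand using pos c_pos by (intro mult_left_mono) auto
  hence "om m * m <= (1 + c + a 1) * ((2 + a 1) * m) * m" using m by (intro mult_right_mono) auto
  also have "... = (1 + c + a 1) * (2 + a 1) * m\<^sup>2" by (simp add: power2_eq_square)
  finally show ?thesis using om_ge1[OF m] by linarith
 qed
qed

definition QM :: real where
 "QM = K * (K + (1 + c + a 1) * (2 + a 1) * K)"

lemma QM_nonneg: "0 <= QM" using c_pos a_pos[of 1] K1 by (simp add: QM_def)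

lemma q_mass_le:
 "(\<integral>\<^sup>+z. ennreal (fst (snd z)) \<partial>q s) <= ennreal QM" "(\<integral>\<^sup>+z. ennreal (snd (snd z)) \<partial>q s) <= ennreal QM"
proof -
 define B where "B = (1 + c + a 1) * (2 + a 1)"
 have B: "0 <= B" using c_pos a_pos[of 1] by (simp add: B_def)
 have "(\<integral>\<^sup>+z. ennreal (om (snd z)) * ennreal (snd z) \<partial>N s) <= (\<integral>\<^sup>+z. ennreal (om (snd z)) + ennreal B * ennreal ((snd z)\<^sup>2) \<partial>N s)"
 proof (rule nn_integral_mono)
  fix z assume "z : space (N s)"
  hence m: "0 <= snd z" by auto
  have o: "0 <= om (snd z)" using om_ge1[OF m] by simp
  have "ennreal (om (snd z)) * ennreal (snd z) = ennreal (om (snd z) * snd z)" using m o by (simp add: ennreal_mult)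
  also have "... <= ennreal (om (snd z) + B * (snd z)\<^sup>2)" using om_mass[OF m] by (intro ennreal_leI) (simp add: B_def)
  also have "... = ennreal (om (snd z)) + ennreal B * ennreal ((snd z)\<^sup>2)" using o B by (simp add: ennreal_plus ennreal_mult)
  finally show "ennreal (om (snd z)) * ennreal (snd z) <= ennreal (om (snd z)) + ennreal B * ennreal ((snd z)\<^sup>2)" .
 qed
 also have "... = (\<integral>\<^sup>+z. ennreal (om (snd z)) \<partial>N s) + ennreal B * (\<integral>\<^sup>+z. ennreal ((snd z)\<^sup>2) \<partial>N s)"
  by (subst nn_integral_add) (auto simp: nn_integral_cmult)
 also have "... <= ennreal K + ennreal B * ennreal K" by (intro add_mono mult_left_mono N_om N_mass2) auto
 finally have "ennreal K * (\<integral>\<^sup>+z. ennreal (om (snd z)) * ennreal (snd z) \<partial>N s) <= ennreal K * (ennreal K + ennreal B * ennreal K)"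
  by (intro mult_left_mono) auto
 also have "... = ennreal QM" using K1 B by (simp add: QM_def B_def[symmetric] ennreal_mult ennreal_plus)
 finally have *: "ennreal K * (\<integral>\<^sup>+z. ennreal (om (snd z)) * ennreal (snd z) \<partial>N s) <= ennreal QM" .
 have m: "(%z. ennreal (snd z)) : Borel TH" by measurable
 show "(\<integral>\<^sup>+z. ennreal (fst (snd z)) \<partial>q s) <= ennreal QM" "(\<integral>\<^sup>+z. ennreal (snd (snd z)) \<partial>q s) <= ennreal QM"
  using order_trans[OF q_le_fst[OF m, of s] *] order_trans[OF q_le_snd[OF m, of s] *] by auto
qed

lemma integrable_q_masses:
 "integrable (q s) (%z. fst (snd z))" "integrable (q s) (%z. snd (snd z))"
 "(\<integral>z. fst (snd z) \<partial>q s) <= QM" "(\<integral>z. snd (snd z) \<partial>q s) <= QM"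
proof -
 have 1: "(\<integral>\<^sup>+z. ennreal (norm (fst (snd z))) \<partial>q s) = (\<integral>\<^sup>+z. ennreal (fst (snd z)) \<partial>q s)"
  "(\<integral>\<^sup>+z. ennreal (norm (snd (snd z))) \<partial>q s) = (\<integral>\<^sup>+z. ennreal (snd (snd z)) \<partial>q s)"
  by (intro nn_integral_cong; auto)+
 have 2: "(%z. fst (snd z)) : Borel THH" "(%z. snd (snd z)) : Borel THH" by (intro measurable_halflineD; measurable)+
 show i: "integrable (q s) (%z. fst (snd z))" "integrable (q s) (%z. snd (snd z))"
  unfolding integrable_iff_bounded 1 using q_mass_le[of s] 2 by (auto simp: less_top[symmetric] top_unique)
 show "(\<integral>z. fst (snd z) \<partial>q s) <= QM" "(\<integral>z. snd (snd z) \<partial>q s) <= QM"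
  using q_mass_le[of s] i QM_nonneg by (auto intro!: integral_le_nn_integral)
qed

lemma gl_mass_bound:
 assumes b: "!!z. z : space TH ==> \<bar>f z\<bar> <= C * snd z" and z: "z : space (q s)"
 shows "\<bar>gl f z\<bar> <= 2 * C * (fst (snd z) + snd (snd z))"
proof -
 obtain x m m' where zz: "z = (x, m, m')" by (cases z)
 have "(x, m + m') : space TH" "(x, m) : space TH" "(x, m') : space TH" using z zz by (auto simp: pair_space)
 from this[THEN b] show ?thesis unfolding gl_def zz by (simp add: algebra_simps)
qed

lemma integrable_q_mass:
 assumes [measurable]: "f : Borel TH" and b: "!!z. z : space TH ==> \<bar>f z\<bar> <= C * snd z"
 shows "integrable (q s) (gl f)" and "\<bar>coll s f\<bar> <= 4 * C * QM"
proof -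
 have i2: "integrable (q s) (%z. 2 * C * (fst (snd z) + snd (snd z)))"
  using integrable_q_masses(1,2) by (intro integrable_mult_right Bochner_Integration.integrable_add)
 show i: "integrable (q s) (gl f)"
 proof (rule Bochner_Integration.integrable_bound[OF i2])
  show "AE z in q s. norm (gl f z) <= norm (2 * C * (fst (snd z) + snd (snd z)))"
   using gl_mass_bound[OF b] by (intro AE_I2) (metis abs_ge_self order_trans real_norm_def)
 qed simp
 have C: "0 <= C" using b[of "(0, 1)"] by (auto simp: pair_space intro: order_trans[OF abs_ge_zero])
 have "\<bar>coll s f\<bar> <= (\<integral>z. \<bar>gl f z\<bar> \<partial>q s)" unfolding coll_def by (rule integral_abs_bound)
 also have "... <= (\<integral>z. 2 * C * (fst (snd z) + snd (snd z)) \<partial>q s)" by (rule integral_mono[OF integrable_abs[OF i] i2]) (rule gl_mass_bound[OF b])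
 also have "... = 2 * C * ((\<integral>z. fst (snd z) \<partial>q s) + (\<integral>z. snd (snd z) \<partial>q s))" using integrable_q_masses[of s] by simp
 also have "... <= 2 * C * (QM + QM)" using integrable_q_masses[of s] C by (intro mult_left_mono add_mono) auto
 finally show "\<bar>coll s f\<bar> <= 4 * C * QM" by simp
qed

lemma integral_mu:
 assumes s: "s : {0..T}" and [measurable]: "f : Borel TH"
 shows "(\<integral>z. f z \<partial>\<mu> s) = num s (%z. snd z * f z)"
proof -
 have [measurable]: "snd : Borel TH" by (rule measurable_halflineD) measurable
 show ?thesis unfolding num_def mu_density[OF s] by (subst integral_real_density) auto
qed

lemma inner_collision:
 fixes F :: "real \<times> real => real"
 assumes g: "good s x" and x: "x : space torus" and F: "F : Borel HH"
 shows "(\<integral>z. F z \<partial>(kernel (\<mu> s) x \<Otimes>\<^sub>M kernel (\<mu> s) x)) = (\<integral>z. fst z * snd z * F z \<partial>(nk s x \<Otimes>\<^sub>M nk s x))"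
proof -
 have s: "s : {0..T}" using g by (simp add: good_def)
 interpret u: finite_measure "kernel (\<mu> s) x" by (rule finite_kernelD(2)[OF kernel_mu[OF s] x])
 interpret n: finite_measure "nk s x" by (rule finite_kernelD(2)[OF finite_kernel_nk x])
 have ss: "sets (nk s x \<Otimes>\<^sub>M nk s x) = sets HH" using sets_nk[OF x] by (intro sets_pair_measure_cong)
 have m: "(%m. ennreal m) : Borel (nk s x)" unfolding measurable_cong_sets[OF sets_nk[OF x] refl] by measurable
 have sf: "sigma_finite_measure (density (nk s x) (%m. ennreal m))" using u.sigma_finite_measure_axioms kernel_density[OF g x] by simp
 have [measurable]: "fst : Borel HH" "snd : Borel HH" by (intro measurable_halflineD; measurable)+
 have "kernel (\<mu> s) x \<Otimes>\<^sub>M kernel (\<mu> s) x = density (nk s x \<Otimes>\<^sub>M nk s x) (%(m, m'). ennreal m * ennreal m')"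
  unfolding kernel_density[OF g x] by (rule pair_measure_density[OF m m n.sigma_finite_measure_axioms sf])
 also have "... = density (nk s x \<Otimes>\<^sub>M nk s x) (%z. ennreal (fst z * snd z))"
 proof (rule density_cong)
  show "AE z in nk s x \<Otimes>\<^sub>M nk s x. (case z of (m, m') => ennreal m * ennreal m') = ennreal (fst z * snd z)"
   using space_nk[OF x] by (intro AE_I2) (auto simp: pair_space ennreal_mult)
 qed (auto simp: measurable_cong_sets[OF ss refl] split_beta')
 also have "(\<integral>z. F z \<partial>density (nk s x \<Otimes>\<^sub>M nk s x) (%z. ennreal (fst z * snd z))) = (\<integral>z. fst z * snd z * F z \<partial>(nk s x \<Otimes>\<^sub>M nk s x))"
  by (rule integral_real_density)
   (use space_nk[OF x] F in \<open>auto simp: measurable_cong_sets[OF ss refl] pair_space intro!: AE_I2\<close>)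
 finally show ?thesis by simp
qed

text \<open>Symmetrisation: with \<open>(f(m+m') - f(m))/m'\<close> and densities \<open>m\<close>, \<open>m'\<close> with respect to the number kernel, the integrand becomes
\<open>m (f(m+m') - f(m))\<close>, and averaging with \<open>m\<close> and \<open>m'\<close> exchanged produces \<open>gl\<close> for the function \<open>m f\<close>.\<close>
lemma collision_term_eq:
 assumes s: "s : {0..T}" and fm [measurable]: "f : Borel TH" and b: "!!z. z : space TH ==> \<bar>f z\<bar> <= C"
 shows "collision_term \<Phi> a (%x m. f (x, m)) (\<mu> s) = coll s (%z. snd z * f z)"
proof -
 have C: "0 <= C" using b[of "(0,0)"] by (simp add: pair_space)
 have [measurable]: "snd : Borel TH" by (rule measurable_halflineD) measurable
 have [measurable]: "(%z. fst (snd z)) : Borel THH" "(%z. snd (snd z)) : Borel THH" by (intro measurable_halflineD; measurable)+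
 have [measurable]: "(%z. \<kappa> (fst (snd z)) (snd (snd z))) : Borel THH" using measurable_compose[OF measurable_snd \<kappa>_measurable, of torus] by simp
 have [measurable]: "(%z. f (fst z, fst (snd z) + snd (snd z))) : Borel THH" using measurable_compose[OF measurable_merge_mass fm] by simp
 let ?KK = "kint torus HH (%x. nk s x \<Otimes>\<^sub>M nk s x)"
 note fk2 = finite_kernel_pair[OF finite_kernel_nk, of s]
 define F where "F z = (f (fst z, fst (snd z) + snd (snd z)) - f (fst z, fst (snd z))) / snd (snd z) * \<kappa> (fst (snd z)) (snd (snd z))" for z
 define G where "G z = fst (snd z) * \<kappa> (fst (snd z)) (snd (snd z)) * (f (fst z, fst (snd z) + snd (snd z)) - f (fst z, fst (snd z)))" for z
 define H where "H z = \<kappa> (fst (snd z)) (snd (snd z)) / 2 * gl (%z. snd z * f z) z" for z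
 have Fm: "F : Borel THH" and Gm: "G : Borel THH" and Hm: "H : Borel THH" unfolding F_def[abs_def] G_def[abs_def] H_def[abs_def] by measurable
 have ab: "\<bar>snd z * f z\<bar> <= C * snd z" if "z : space TH" for z
 proof -
  have "0 <= snd z" using that by (auto simp: pair_space)
  thus ?thesis using mult_left_mono[OF b[OF that], of "snd z"] by (simp add: abs_mult mult.commute)
 qed
 have iH: "integrable ?KK H"
 proof -
  have "integrable (q s) (gl (%z. snd z * f z))" by (rule integrable_q_mass[OF _ ab]) auto
  thus ?thesis unfolding q_def H_def[abs_def] by (subst (asm) integrable_real_density)
    (auto simp: pair_space intro!: AE_I2 \<kappa>_nonneg)
 qed
 have iG: "integrable ?KK G"
 proof -
  note i0 = integrable_q_masses(1)[of s]
  have i1: "integrable (q s) (%z. fst (snd z) * 2 * (f (fst z, fst (snd z) + snd (snd z)) - f (fst z, fst (snd z))))"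
  proof (rule Bochner_Integration.integrable_bound[OF integrable_mult_right[OF i0, of "4 * C"]])
   show "AE z in q s. norm (fst (snd z) * 2 * (f (fst z, fst (snd z) + snd (snd z)) - f (fst z, fst (snd z)))) <= norm (4 * C * fst (snd z))"
   proof (rule AE_I2)
    fix z assume z: "z : space (q s)"
    obtain x m m' where zz: "z = (x, m, m')" by (cases z)
    have "(x, m + m') : space TH" "(x, m) : space TH" and m: "0 <= m" using z zz by (auto simp: pair_space)
    from this(1,2)[THEN b] have "\<bar>f (x, m + m') - f (x, m)\<bar> <= 2 * C" by linarith
    hence "m * 2 * \<bar>f (x, m + m') - f (x, m)\<bar> <= m * 2 * (2 * C)" using m by (intro mult_left_mono) auto
    thus "norm (fst (snd z) * 2 * (f (fst z, fst (snd z) + snd (snd z)) - f (fst z, fst (snd z)))) <= norm (4 * C * fst (snd z))"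
     using m C zz by (simp add: abs_mult mult.commute mult.left_commute)
   qed
  qed measurable
  have "G = (%z. \<kappa> (fst (snd z)) (snd (snd z)) / 2 * (fst (snd z) * 2 * (f (fst z, fst (snd z) + snd (snd z)) - f (fst z, fst (snd z)))))"
   by (simp add: G_def fun_eq_iff)
  thus ?thesis using i1 unfolding q_def by (subst (asm) integrable_real_density)
    (auto simp: pair_space intro!: AE_I2 \<kappa>_nonneg)
 qed
 have "collision_term \<Phi> a (%x m. f (x, m)) (\<mu> s) = (\<integral>x. (\<integral>z. F (x, z) \<partial>(kernel (\<mu> s) x \<Otimes>\<^sub>M kernel (\<mu> s) x)) \<partial>torus)"
  unfolding collision_term_def F_def by (simp add: split_beta')
 also have "... = (\<integral>x. (\<integral>z. H (x, z) \<partial>(nk s x \<Otimes>\<^sub>M nk s x)) \<partial>torus)"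
 proof (rule integral_cong_AE)
  show "(%x. \<integral>z. F (x, z) \<partial>(kernel (\<mu> s) x \<Otimes>\<^sub>M kernel (\<mu> s) x)) : Borel torus"
   by (rule finite_kernel_integral[OF finite_kernel_pair[OF kernel_mu[OF s]] Fm])
  show "(%x. \<integral>z. H (x, z) \<partial>(nk s x \<Otimes>\<^sub>M nk s x)) : Borel torus" by (rule finite_kernel_integral[OF fk2 Hm])
  show "AE x in torus. (\<integral>z. F (x, z) \<partial>(kernel (\<mu> s) x \<Otimes>\<^sub>M kernel (\<mu> s) x)) = (\<integral>z. H (x, z) \<partial>(nk s x \<Otimes>\<^sub>M nk s x))"
   using AE_good[OF s] AE_space integral_kint(2)[OF fk2 iG]
  proof eventually_elim
   case (elim x)
   hence g: "good s x" and x: "x : space torus" and iGx: "integrable (nk s x \<Otimes>\<^sub>M nk s x) (%z. G (x, z))" by auto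
   interpret n: finite_measure "nk s x" by (rule finite_kernelD(2)[OF finite_kernel_nk x])
   interpret nn: pair_sigma_finite "nk s x" "nk s x" ..
   have Fx: "(%z. F (x, z)) : Borel HH" using measurable_compose[OF measurable_Pair1'[OF x] Fm] by simp
   have sp: "0 <= fst z & 0 <= snd z" if "z : space (nk s x \<Otimes>\<^sub>M nk s x)" for z using that space_nk[OF x] by (auto simp: pair_space)
   have "(\<integral>z. F (x, z) \<partial>(kernel (\<mu> s) x \<Otimes>\<^sub>M kernel (\<mu> s) x)) = (\<integral>z. fst z * snd z * F (x, z) \<partial>(nk s x \<Otimes>\<^sub>M nk s x))"
    by (rule inner_collision[OF g x Fx])
   also have "... = (\<integral>z. G (x, z) \<partial>(nk s x \<Otimes>\<^sub>M nk s x))"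
   proof (rule bochner_cong[OF refl])
    fix z assume "z : space (nk s x \<Otimes>\<^sub>M nk s x)"
    from sp[OF this] show "fst z * snd z * F (x, z) = G (x, z)" using \<kappa>_zero[of "fst z" "snd z"] by (cases "snd z = 0") (auto simp: F_def G_def)
   qed
   finally have e1: "(\<integral>z. F (x, z) \<partial>(kernel (\<mu> s) x \<Otimes>\<^sub>M kernel (\<mu> s) x)) = (\<integral>z. G (x, z) \<partial>(nk s x \<Otimes>\<^sub>M nk s x))" .
   have iGs: "integrable (nk s x \<Otimes>\<^sub>M nk s x) (%z. G (x, snd z, fst z))" using nn.integrable_product_swap[OF iGx] by (simp add: split_beta')
   have e2: "(\<integral>z. G (x, snd z, fst z) \<partial>(nk s x \<Otimes>\<^sub>M nk s x)) = (\<integral>z. G (x, z) \<partial>(nk s x \<Otimes>\<^sub>M nk s x))"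
    using nn.integral_product_swap[of "%z. G (x, z)"] iGx by (simp add: split_beta' borel_measurable_integrable)
   have "(\<integral>z. H (x, z) \<partial>(nk s x \<Otimes>\<^sub>M nk s x)) = (\<integral>z. 1/2 * (G (x, z) + G (x, snd z, fst z)) \<partial>(nk s x \<Otimes>\<^sub>M nk s x))"
   proof (rule bochner_cong[OF refl])
    fix z assume "z : space (nk s x \<Otimes>\<^sub>M nk s x)"
    from sp[OF this] show "H (x, z) = 1/2 * (G (x, z) + G (x, snd z, fst z))" using \<kappa>_sym[of "fst z" "snd z"] by (simp add: H_def G_def gl_def algebra_simps)
   qed
   also have "... = (\<integral>z. G (x, z) \<partial>(nk s x \<Otimes>\<^sub>M nk s x))" using iGx iGs e2 by simp
   finally show ?case using e1 by simp
  qed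
 qed
 also have "... = (\<integral>z. H z \<partial>?KK)" by (rule integral_kint(1)[OF fk2 iH, symmetric])
 also have "... = coll s (%z. snd z * f z)" unfolding coll_def q_def H_def[abs_def]
  by (subst integral_real_density) (auto simp: pair_space intro!: AE_I2 \<kappa>_nonneg)
 finally show ?thesis .
qed

end
section \<open>The equation tested with waves\<close>

definition wave :: "int => real => real => real" where
 "wave k th x = cos (2 * pi * of_int k * x + th)"

definition tens :: "(real => real) => (real => real) => real \<times> real => real" where
 "tens g ps = (%z. g (fst z) * ps (snd z))"

definition freq :: "int => real" where
 "freq k = 2 * pi\<^sup>2 * (of_int k)\<^sup>2"

lemma wave_bound: "\<bar>wave k th x\<bar> <= 1" by (simp add: wave_def)

lemma wave_measurable [measurable]: "wave k th : Borel torus" unfolding wave_def[abs_def] by (rule borel_measurable_torus) simp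

lemma tens_measurable [measurable]:
 "g : Borel torus ==> ps : Borel halfline ==> tens g ps : Borel TH" unfolding tens_def
 by (intro borel_measurable_times measurable_compose[OF measurable_fst] measurable_compose[OF measurable_snd])

lemma tens_wave_bound: "\<bar>ps (snd z)\<bar> <= C ==> \<bar>tens (wave k th) ps z\<bar> <= C" unfolding tens_def using wave_bound[of k th "fst z"]
 by (simp add: abs_mult) (meson abs_ge_zero mult_left_le_one_le order_trans)

lemma deriv_x_wave:
 "deriv_x (%x m. wave k th x * ps m) = (%x m. - (2 * pi * of_int k) * wave k (th - pi / 2) x * ps m)"
proof (intro ext)
 fix x m
 have s: "wave k (th - pi / 2) x = sin (2 * pi * of_int k * x + th)" unfolding wave_def add_diff_eq cos_diff by simp
 show "deriv_x (%x m. wave k th x * ps m) x m = - (2 * pi * of_int k) * wave k (th - pi / 2) x * ps m" unfolding deriv_x_def s unfolding wave_def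
  by (rule DERIV_imp_deriv) (auto intro!: derivative_eq_intros)
qed

lemma wave_Cb:
 assumes "continuous_on UNIV ps" "!!m. \<bar>ps m\<bar> <= C"
 shows "(%x m. al * wave k th x * ps m) : Cb" unfolding Cb_def
proof (intro CollectI conjI allI impI)
 show "continuous_on (UNIV \<times> {0..}) (%(x, m). al * wave k th x * ps m)" unfolding split_beta' wave_def
  by (intro continuous_intros continuous_on_compose2[OF assms(1)]) auto
 show "bounded ((%(x, m). al * wave k th x * ps m) ` (UNIV \<times> {0..}))"
 proof (rule boundedI)
  fix y assume "y : (%(x, m). al * wave k th x * ps m) ` (UNIV \<times> {0..})"
  then obtain x m where y: "y = al * wave k th x * ps m" by auto
  have "\<bar>al\<bar> * \<bar>wave k th x\<bar> * \<bar>ps m\<bar> <= \<bar>al\<bar> * 1 * C" by (intro mult_mono wave_bound assms) auto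
  thus "norm y <= \<bar>al\<bar> * C" by (simp add: y abs_mult)
 qed
 fix x m
 have "wave k th (x + 1) = wave k th x"
 proof -
  have "2 * pi * of_int k * (x + 1) + th = (2 * pi * of_int k * x + th) + 2 * pi * of_int k" by (simp add: algebra_simps)
  thus ?thesis unfolding wave_def by (simp only: cos_add cos_int_2pin sin_int_2pin) simp
 qed
 thus "al * wave k th (x + 1) * ps m = al * wave k th x * ps m" by simp
qed

lemma wave_differentiable: "(%x. al * wave k th x * c) differentiable at x"
 unfolding wave_def real_differentiable_def by (rule exI) (auto intro!: derivative_eq_intros)

lemma deriv_x_wave':
 "deriv_x (%x m. al * wave k th x * ps m) = (%x m. (al * - (2 * pi * of_int k)) * wave k (th - pi / 2) x * ps m)"
proof -
 have "(%x m. al * wave k th x * ps m) = (%x m. wave k th x * (al * ps m))" by (simp add: fun_eq_iff)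
 thus ?thesis by (simp only: deriv_x_wave) (simp add: fun_eq_iff mult_ac)
qed

lemma wave_shift_pi: "wave k (th - pi) x = - wave k th x" unfolding wave_def add_diff_eq cos_diff by simp

lemma wave_Cb2:
 assumes "continuous_on UNIV ps" "!!m. \<bar>ps m\<bar> <= C"
 shows "(%x m. 1 * wave k th x * ps m) : Cb2" unfolding Cb2_def mem_Collect_eq deriv_x_wave' by (intro conjI allI impI wave_Cb[OF assms] wave_differentiable)

lemma deriv2_wave:
 "deriv_x (deriv_x (%x m. 1 * wave k th x * ps m)) = (%x m. - (2 * freq k) * wave k th x * ps m)" unfolding deriv_x_wave' using wave_shift_pi[of k th]
 by (simp add: freq_def power2_eq_square mult_ac)

context coagulation_path
begin

lemma om_nonneg: "0 <= m ==> 0 <= om m" using om_ge1[of m] by linarith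

lemma integrable_N_dom:
 assumes [measurable]: "f : Borel TH" and b: "!!z. z : space TH ==> \<bar>f z\<bar> <= C * (om (snd z) + (snd z)\<^sup>2)"
 shows "integrable (N s) f" and "\<bar>num s f\<bar> <= C * (2 * K)"
proof -
 have "0 <= C * (om 0 + 0\<^sup>2)" using order_trans[OF abs_ge_zero b[of "(0, 0)"]] by (simp add: pair_space)
 hence C: "0 <= C" using om_ge1[of 0] by (simp add: zero_le_mult_iff)
 have mo: "(%z. om (snd z)) : Borel TH" by measurable
 have ms: "(%z. (snd z)\<^sup>2) : Borel TH" by (intro borel_measurable_power measurable_halflineD) measurable
 have "\<bar>om (snd z)\<bar> <= 1 * om (snd z)" if "z : space TH" for z
 proof -
  have "0 <= snd z" using that by (auto simp: pair_space)
  from om_nonneg[OF this] show ?thesis by simp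
 qed
 hence io: "integrable (N s) (%z. om (snd z))" by (rule integrable_N_om(1)[OF mo])
 have im: "integrable (N s) (%z. (snd z)\<^sup>2)" unfolding integrable_iff_bounded using N_mass2[of s] ms by (auto simp: less_top[symmetric] top_unique)
 have vo: "(\<integral>z. om (snd z) \<partial>N s) <= K"
 proof (rule integral_le_nn_integral[OF _ _ N_om])
  show "(%z. om (snd z)) : Borel (N s)" using mo by simp
  show "0 <= om (snd z)" if "z : space (N s)" for z using that by (intro om_nonneg) auto
  show "0 <= K" using K1 by simp
 qed
 have vm: "(\<integral>z. (snd z)\<^sup>2 \<partial>N s) <= K" by (rule integral_le_nn_integral[OF _ _ N_mass2]) (use K1 ms in auto)
 have i2: "integrable (N s) (%z. C * (om (snd z) + (snd z)\<^sup>2))" using io im by (intro integrable_mult_right Bochner_Integration.integrable_add)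
 show i: "integrable (N s) f"
 proof (rule Bochner_Integration.integrable_bound[OF i2])
  show "AE z in N s. norm (f z) <= norm (C * (om (snd z) + (snd z)\<^sup>2))"
  proof (rule AE_I2)
   fix z assume "z : space (N s)"
   hence "\<bar>f z\<bar> <= C * (om (snd z) + (snd z)\<^sup>2)" by (intro b) (auto simp: pair_space)
   thus "norm (f z) <= norm (C * (om (snd z) + (snd z)\<^sup>2))" by simp
  qed
 qed simp
 have "\<bar>num s f\<bar> <= (\<integral>z. \<bar>f z\<bar> \<partial>N s)" unfolding num_def by (rule integral_abs_bound)
 also have "... <= (\<integral>z. C * (om (snd z) + (snd z)\<^sup>2) \<partial>N s)"
  by (rule integral_mono[OF integrable_abs[OF i] i2]) (use b in \<open>auto simp: pair_space\<close>)
 also have "... = C * ((\<integral>z. om (snd z) \<partial>N s) + (\<integral>z. (snd z)\<^sup>2 \<partial>N s))" using io im by simp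
 also have "... <= C * (K + K)" using vo vm C by (intro mult_left_mono add_mono) auto
 finally show "\<bar>num s f\<bar> <= C * (2 * K)" by simp
qed

lemma mass_le_dom: "0 <= m ==> m <= om m + m\<^sup>2"
proof -
 assume m: "0 <= m"
 have "m <= 1 + m\<^sup>2" by (smt (verit) mult_mono power2_eq_square m mult_cancel_left1 zero_le_square mult_left_mono)
 thus ?thesis using om_ge1[OF m] by linarith
qed

lemma amass_le_dom: "0 <= m ==> a m * m <= (1 + a 1) * (om m + m\<^sup>2)"
proof -
 assume m: "0 <= m"
 have a1: "0 < a 1" using a_pos by simp
 have nn: "0 <= om m + m\<^sup>2" using om_ge1[OF m] by (simp add: add_nonneg_nonneg)
 show ?thesis
 proof (cases "m <= 1")
  case True
  have "a m * m <= a m * 1" using True a_nonneg[OF m] by (intro mult_left_mono) auto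
  also have "... <= om m" using om_ge[OF m] powr_ge_zero[of m p] by linarith
  also have "... <= 1 * (om m + m\<^sup>2)" by simp
  also have "... <= (1 + a 1) * (om m + m\<^sup>2)" using nn a1 by (intro mult_right_mono) auto
  finally show ?thesis .
 next
  case False
  have "a m * m <= a 1 * m" using a_mono[of 1 m] False m by (intro mult_right_mono) auto
  also have "... <= (1 + a 1) * (om m + m\<^sup>2)" using mass_le_dom[OF m] m a1 by (intro mult_mono) auto
  finally show ?thesis .
 qed
qed

lemma num_tendsto:
 assumes "!!i::nat. F i : Borel TH" "f : Borel TH"
  and b: "!!i z. z : space TH ==> \<bar>F i z\<bar> <= C * (om (snd z) + (snd z)\<^sup>2)"
  and l: "!!z. z : space TH ==> (%i. F i z) \<longlonglongrightarrow> f z"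
 shows "(%i. num s (F i)) \<longlonglongrightarrow> num s f" unfolding num_def
proof (rule integral_dominated_convergence)
 have "0 <= C * (om 0 + 0\<^sup>2)" using order_trans[OF abs_ge_zero b[of "(0, 0)" 0]] by (simp add: pair_space)
 hence C: "0 <= C" using om_ge1[of 0] by (simp add: zero_le_mult_iff)
 have m: "(%z. C * (om (snd z) + (snd z)\<^sup>2)) : Borel TH"
 proof (intro borel_measurable_times borel_measurable_const borel_measurable_add)
  show "(%z. om (snd z)) : Borel TH" by measurable
  show "(%z. (snd z)\<^sup>2) : Borel TH" by (intro borel_measurable_power measurable_halflineD) measurable
 qed
 show "integrable (N s) (%z. C * (om (snd z) + (snd z)\<^sup>2))"
 proof (rule integrable_N_dom[OF m, where C=C])
  fix z assume "z : space TH"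
  hence "0 <= snd z" by (auto simp: pair_space)
  from om_nonneg[OF this] have "0 <= om (snd z) + (snd z)\<^sup>2" by simp
  thus "\<bar>C * (om (snd z) + (snd z)\<^sup>2)\<bar> <= C * (om (snd z) + (snd z)\<^sup>2)" using C by simp
 qed
 show "AE z in N s. (%i. F i z) \<longlonglongrightarrow> f z" using l by (intro AE_I2) (auto simp: pair_space)
 show "AE z in N s. norm (F i z) <= C * (om (snd z) + (snd z)\<^sup>2)" for i using b by (intro AE_I2) (auto simp: pair_space)
qed (use assms in auto)

lemma gl_tendsto:
 assumes l: "!!z. z : space TH ==> (%i. F i z) \<longlonglongrightarrow> f z" and z: "z : space (q s)"
 shows "(%i. gl (F i) z) \<longlonglongrightarrow> gl f z"
proof -
 obtain x m m' where zz: "z = (x, m, m')" by (cases z)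
 have "(x, m + m') : space TH" "(x, m) : space TH" "(x, m') : space TH" using z zz by (auto simp: pair_space)
 thus ?thesis unfolding gl_def zz by (auto intro!: tendsto_intros l)
qed

lemma coll_tendsto_mass:
 assumes F: "!!i::nat. F i : Borel TH" and f: "f : Borel TH"
  and b: "!!i z. z : space TH ==> \<bar>F i z\<bar> <= C * snd z"
  and l: "!!z. z : space TH ==> (%i. F i z) \<longlonglongrightarrow> f z"
 shows "(%i. coll s (F i)) \<longlonglongrightarrow> coll s f" unfolding coll_def
proof (rule integral_dominated_convergence)
 show "integrable (q s) (%z. 2 * C * (fst (snd z) + snd (snd z)))" using integrable_q_masses(1,2) by (intro integrable_mult_right Bochner_Integration.integrable_add)
 show "AE z in q s. (%i. gl (F i) z) \<longlonglongrightarrow> gl f z" using gl_tendsto[OF l] by (intro AE_I2)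
 show "AE z in q s. norm (gl (F i) z) <= 2 * C * (fst (snd z) + snd (snd z))" for i using gl_mass_bound[OF b] by (intro AE_I2) auto
qed (use F f in auto)

lemma coll_tendsto:
 assumes F: "!!i::nat. F i : Borel TH" and f: "f : Borel TH"
  and b: "!!i z. z : space TH ==> \<bar>F i z\<bar> <= C"
  and l: "!!z. z : space TH ==> (%i. F i z) \<longlonglongrightarrow> f z"
 shows "(%i. coll s (F i)) \<longlonglongrightarrow> coll s f" unfolding coll_def
proof (rule integral_dominated_convergence)
 interpret finite_measure "q s" by (rule finite_q)
 show "integrable (q s) (%z. 3 * C)" by simp
 show "AE z in q s. (%i. gl (F i) z) \<longlonglongrightarrow> gl f z" using gl_tendsto[OF l] by (intro AE_I2)
 show "AE z in q s. norm (gl (F i) z) <= 3 * C" for i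
 proof (rule AE_I2)
  fix z assume z: "z : space (q s)"
  obtain x m m' where zz: "z = (x, m, m')" by (cases z)
  have "(x, m + m') : space TH" "(x, m) : space TH" "(x, m') : space TH" using z zz by (auto simp: pair_space)
  from this[THEN b[of _ i]] show "norm (gl (F i) z) <= 3 * C" unfolding gl_def zz by simp
 qed
qed (use F f in auto)

lemma AE_N_pos: "AE z in N s. 0 < snd z"
proof (rule AE_I')
 have A: "space torus \<times> {0} : sets TH" by (intro pair_measureI sets.top) (simp add: sets_halfline_iff)
 have z: "emeasure (nk s x) {0} = 0" if x: "x : space torus" for x
 proof (cases "good s x")
  case True
  have "emeasure (nk s x) {0} = (\<integral>\<^sup>+m. indicator {0} m \<partial>nk s x)" using sets_nk[OF x] by (simp add: sets_halfline_iff)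
  also have "... = (\<integral>\<^sup>+m. ennreal (1 / m) * indicator {0} m \<partial>kernel (\<mu> s) x)"
   by (rule nn_integral_nk[OF True x]) (auto simp: sets_halfline_iff)
  also have "... = (\<integral>\<^sup>+m. 0 \<partial>kernel (\<mu> s) x)" by (intro nn_integral_cong) (auto simp: indicator_def)
  finally show ?thesis by simp
 qed (simp add: nk_def)
 have "emeasure (N s) (space torus \<times> {0}) = (\<integral>\<^sup>+x. emeasure (nk s x) (Pair x -` (space torus \<times> {0})) \<partial>torus)"
  unfolding N_def by (rule emeasure_kint[OF finite_kernel_nk A])
 also have "... = (\<integral>\<^sup>+x. 0 \<partial>torus)" using z by (intro nn_integral_cong) (auto simp: vimage_def)
 finally show "space torus \<times> {0} : null_sets (N s)" using A by auto
qed auto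

lemma num_cong:
 assumes "f : Borel TH" "g : Borel TH"
  and "!!x m. x : {0..<1} ==> 0 < m ==> f (x, m) = g (x, m)"
 shows "num s f = num s g" unfolding num_def
proof (rule integral_cong_AE)
 show "AE z in N s. f z = g z" using AE_N_pos AE_space by eventually_elim (use assms(3) in auto)
qed (use assms in auto)

lemma coll_cong:
 assumes "f : Borel TH" "g : Borel TH"
  and "!!x m. x : {0..<1} ==> 0 < m ==> f (x, m) = g (x, m)"
 shows "coll s f = coll s g" unfolding coll_def
proof (rule integral_cong_AE)
 show "AE z in q s. gl f z = gl g z" using AE_q_pos AE_space by eventually_elim (use assms(3) in \<open>auto simp: gl_def\<close>)
qed (use assms in auto)

lemma num_linear:
 assumes "integrable (N s) f" "integrable (N s) g"
 shows "num s (%z. al * f z + \<beta> * g z) = al * num s f + \<beta> * num s g" unfolding num_def using assms by simp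

lemma coll_linear:
 assumes "integrable (q s) (gl f)" "integrable (q s) (gl g)"
 shows "coll s (%z. al * f z + \<beta> * g z) = al * coll s f + \<beta> * coll s g"
proof -
 have "gl (%z. al * f z + \<beta> * g z) = (%z. al * gl f z + \<beta> * gl g z)" by (simp add: gl_def fun_eq_iff algebra_simps)
 thus ?thesis unfolding coll_def using assms by simp
qed

end

locale coagulation_solution = coagulation_path +
 fixes \<nu> :: "(real \<times> real) measure"
 assumes sol: "solves \<Phi> a \<nu> T \<mu>"
begin

text \<open>The integrated equation for a single wave. The factor \<open>m\<close> is kept in the mass weight because the equation is stated for mass and not for number.\<close>
definition weak_ok :: "int => real => (real => real) => bool" where
 "weak_ok k th ps \<longleftrightarrow>
  (%s. - freq k * num s (tens (wave k th) (%m. a m * (m * ps m)))) : Borel borel \<and>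
  (%s. coll s (tens (wave k th) (%m. m * ps m))) : Borel borel \<and>
  (\<forall>t\<in>{0..T}. num t (tens (wave k th) (%m. m * ps m)) - num 0 (tens (wave k th) (%m. m * ps m))
    = tint 0 t (%s. - freq k * num s (tens (wave k th) (%m. a m * (m * ps m)))
      + coll s (tens (wave k th) (%m. m * ps m))))"

lemma borel_of_restricted:
 fixes g :: "real => real"
 assumes "set_integrable lborel {0..T} g" "!!s. s : {0..T} ==> g s = h s" "!!s. s \<notin> {0..T} ==> h s = 0"
 shows "h : Borel borel"
proof -
 have "(%s. indicator {0..T} s *\<^sub>R g s) : Borel borel" using assms(1) unfolding set_integrable_def by (auto dest: borel_measurable_integrable)
 moreover have "(%s. indicator {0..T} s *\<^sub>R g s) = h" using assms(2,3) by (auto simp: fun_eq_iff indicator_def)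
 ultimately show ?thesis by simp
qed

lemma mass_bounds:
 assumes "!!m. 0 <= m ==> \<bar>ps m\<bar> <= C" and z: "z : space TH"
 shows "\<bar>tens (wave k th) (%m. m * ps m) z\<bar> <= C * snd z"
  and "\<bar>tens (wave k th) (%m. m * ps m) z\<bar> <= C * (om (snd z) + (snd z)\<^sup>2)"
  and "\<bar>tens (wave k th) (%m. a m * (m * ps m)) z\<bar> <= (C * (1 + a 1)) * (om (snd z) + (snd z)\<^sup>2)"
proof -
 have m: "0 <= snd z" using z by (auto simp: pair_space)
 have C: "0 <= C" using assms(1)[of 0] by auto
 show 1: "\<bar>tens (wave k th) (%m. m * ps m) z\<bar> <= C * snd z"
  by (rule tens_wave_bound) (use mult_left_mono[OF assms(1)[OF m] m] m in \<open>simp add: abs_mult mult.commute\<close>)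
 show "\<bar>tens (wave k th) (%m. m * ps m) z\<bar> <= C * (om (snd z) + (snd z)\<^sup>2)"
  by (rule order_trans[OF 1]) (use mass_le_dom[OF m] C in \<open>auto intro: mult_left_mono\<close>)
 show "\<bar>tens (wave k th) (%m. a m * (m * ps m)) z\<bar> <= (C * (1 + a 1)) * (om (snd z) + (snd z)\<^sup>2)"
 proof (rule tens_wave_bound)
  have "\<bar>a (snd z) * (snd z * ps (snd z))\<bar> = (a (snd z) * snd z) * \<bar>ps (snd z)\<bar>" using m a_nonneg[OF m] by (simp add: abs_mult)
  also have "... <= ((1 + a 1) * (om (snd z) + (snd z)\<^sup>2)) * C" by (rule mult_mono[OF amass_le_dom[OF m] assms(1)[OF m]])
    (use om_ge1[OF m] a_pos[of 1] in \<open>auto intro!: mult_nonneg_nonneg add_nonneg_nonneg\<close>)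
  finally show "\<bar>a (snd z) * (snd z * ps (snd z))\<bar> <= C * (1 + a 1) * (om (snd z) + (snd z)\<^sup>2)" by (simp add: mult_ac)
 qed
qed

lemma mass_meas [measurable]:
 assumes [measurable]: "ps : Borel halfline"
 shows "tens (wave k th) (%m. m * ps m) : Borel TH"
  "tens (wave k th) (%m. a m * (m * ps m)) : Borel TH" by measurable

lemma weak_ok_continuous:
 assumes c: "continuous_on UNIV ps" and b: "!!m. \<bar>ps m\<bar> <= C"
 shows "weak_ok k th ps"
proof -
 define f where "f = (%x m. 1 * wave k th x * ps m)"
 have f2: "f : Cb2" unfolding f_def by (rule wave_Cb2[OF c b])
 have psim [measurable]: "ps : Borel halfline" by (rule borel_measurable_halfline[OF borel_measurable_continuous_onI[OF c]])
 have C: "0 <= C" using b[of 0] by auto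
 have tm: "tens (wave k th) ps : Borel TH" by measurable
 have tb: "\<bar>tens (wave k th) ps z\<bar> <= C" for z by (rule tens_wave_bound[OF b])
 have p: "pairing f (\<mu> s) = num s (tens (wave k th) (%m. m * ps m))" if s: "s : {0..T}" for s
 proof -
  have "pairing f (\<mu> s) = (\<integral>z. tens (wave k th) ps z \<partial>\<mu> s)" unfolding pairing_def f_def tens_def by (simp add: split_beta')
  also have "... = num s (%z. snd z * tens (wave k th) ps z)" by (rule integral_mu[OF s tm])
  finally show ?thesis by (simp add: tens_def mult_ac)
 qed
 have d: "diffusion_term a f (\<mu> s) = - freq k * num s (tens (wave k th) (%m. a m * (m * ps m)))"
  if s: "s : {0..T}" for s
 proof -
  have "diffusion_term a f (\<mu> s) = (\<integral>z. - freq k * tens (wave k th) (%m. a m * ps m) z \<partial>\<mu> s)"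
   unfolding diffusion_term_def pairing_def f_def deriv2_wave tens_def by (simp add: split_beta' mult_ac)
  also have "... = num s (%z. snd z * (- freq k * tens (wave k th) (%m. a m * ps m) z))" by (rule integral_mu[OF s]) measurable
  also have "... = num s (%z. - freq k * tens (wave k th) (%m. a m * (m * ps m)) z)" by (simp add: tens_def mult_ac)
  finally show ?thesis by (simp add: num_def)
 qed
 have cc: "collision_term \<Phi> a f (\<mu> s) = coll s (tens (wave k th) (%m. m * ps m))" if s: "s : {0..T}" for s
 proof -
  have "collision_term \<Phi> a (%x m. tens (wave k th) ps (x, m)) (\<mu> s) = coll s (%z. snd z * tens (wave k th) ps z)" by (rule collision_term_eq[OF s tm tb])
  thus ?thesis by (simp add: f_def tens_def mult_ac)
 qed
 note S = sol[unfolded solves_def, rule_format, OF f2]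
 have T: "T : {0..T}" using T0 by simp
 define D where "D s = num s (tens (wave k th) (%m. a m * (m * ps m)))" for s
 define Q where "Q s = coll s (tens (wave k th) (%m. m * ps m))" for s
 have m1: "(%s. - freq k * D s) : Borel borel"
  by (rule borel_of_restricted[of "%s. diffusion_term a f (\<mu> s)"]) (use S[OF T] d num_outside in \<open>auto simp: D_def\<close>)
 have m2: "Q : Borel borel"
  by (rule borel_of_restricted[of "%s. collision_term \<Phi> a f (\<mu> s)"]) (use S[OF T] cc coll_outside in \<open>auto simp: Q_def\<close>)
 have b1: "\<bar>- freq k * D s\<bar> <= \<bar>freq k\<bar> * ((C * (1 + a 1)) * (2 * K))" for s unfolding abs_mult abs_minus D_def
  by (intro mult_left_mono integrable_N_dom(2) mass_bounds(3)) (use b in auto)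
 have b2: "\<bar>Q s\<bar> <= 4 * C * QM" for s unfolding Q_def by (intro integrable_q_mass(2) mass_bounds(1)) (use b in auto)
 have eq: "num t (tens (wave k th) (%m. m * ps m)) - num 0 (tens (wave k th) (%m. m * ps m))
    = tint 0 t (%s. - freq k * D s + Q s)" if t: "t : {0..T}" for t
 proof -
  have "0 : {0..T}" using T0 by simp
  note S0 = S[OF this]
  have t00: "tint 0 0 g = 0" for g by (simp add: tint_def)
  from S0 have "(LINT s:{0..0}|lborel. diffusion_term a f (\<mu> s)) = 0" "(LINT s:{0..0}|lborel. collision_term \<Phi> a f (\<mu> s)) = 0"
   by (simp_all only: tint_set_integral t00)
  with S0 have p0: "pairing f (\<mu> 0) = pairing f \<nu>" by linarith
  have "num t (tens (wave k th) (%m. m * ps m)) - num 0 (tens (wave k th) (%m. m * ps m)) = pairing f (\<mu> t) - pairing f \<nu>"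
   using p[OF t] p[OF \<open>0 : {0..T}\<close>] p0 by simp
  also have "... = (LINT s:{0..t}|lborel. diffusion_term a f (\<mu> s)) + (LINT s:{0..t}|lborel. collision_term \<Phi> a f (\<mu> s))" using S[OF t] by simp
  also have "... = tint 0 t (%s. diffusion_term a f (\<mu> s)) + tint 0 t (%s. collision_term \<Phi> a f (\<mu> s))" using S[OF t] by (simp add: tint_set_integral)
  also have "tint 0 t (%s. diffusion_term a f (\<mu> s)) = tint 0 t (%s. - freq k * D s)"
   unfolding tint_def by (intro bochner_cong) (use d t in \<open>auto simp: indicator_def D_def\<close>)
  also have "tint 0 t (%s. collision_term \<Phi> a f (\<mu> s)) = tint 0 t Q"
   unfolding tint_def by (intro bochner_cong) (use cc t in \<open>auto simp: indicator_def Q_def\<close>)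
  also have "tint 0 t (%s. - freq k * D s) + tint 0 t Q = tint 0 t (%s. 1 * (- freq k * D s) + 1 * Q s)" using tint_linear[OF m1 b1 m2 b2, of 0 t 1 1] by simp
  finally show ?thesis by simp
 qed
 show ?thesis unfolding weak_ok_def using m1 m2 eq by (simp add: D_def[abs_def] Q_def[abs_def])
qed

end
context coagulation_solution
begin

lemma weak_ok_bounded:
 assumes "ps : Borel halfline" "!!m. 0 <= m ==> \<bar>ps m\<bar> <= C"
 shows "weak_ok k th ps"
proof -
 let ?w = "wave k th"
 define P where "P ps \<longleftrightarrow> ps : Borel halfline & (\<exists>C. \<forall>m\<ge>0. \<bar>ps m\<bar> <= C) & weak_ok k th ps" for ps
 have "P ps"
 proof (rule halfline_functional_closure[where P=P and C=C])
  show "P ps" if "continuous_on UNIV ps" "!!m. \<bar>ps m\<bar> <= 1" for ps unfolding P_def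
   using borel_measurable_halfline[OF borel_measurable_continuous_onI[OF that(1)]] weak_ok_continuous[OF that] that(2) by blast
  show "closed_class halfline P"
  proof (rule closed_classI)
   fix f g al \<beta>
   assume Pf: "P f" and Pg: "P g"
   from Pf obtain Cf where f: "f : Borel halfline" "!!m. 0 <= m ==> \<bar>f m\<bar> <= Cf" "weak_ok k th f" unfolding P_def by blast
   from Pg obtain Cg where g: "g : Borel halfline" "!!m. 0 <= m ==> \<bar>g m\<bar> <= Cg" "weak_ok k th g" unfolding P_def by blast
   let ?h = "%m. al * f m + \<beta> * g m"
   have h1: "?h : Borel halfline" using f(1) g(1) by measurable
   have h2: "\<bar>?h m\<bar> <= \<bar>al\<bar> * Cf + \<bar>\<beta>\<bar> * Cg" if "0 <= m" for m using f(2)[OF that] g(2)[OF that]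
    by (intro order_trans[OF abs_triangle_ineq] add_mono) (auto simp: abs_mult intro!: mult_left_mono)
   have e1: "tens ?w (%m. a m * (m * ?h m)) = (%z. al * tens ?w (%m. a m * (m * f m)) z + \<beta> * tens ?w (%m. a m * (m * g m)) z)"
    and e2: "tens ?w (%m. m * ?h m) = (%z. al * tens ?w (%m. m * f m) z + \<beta> * tens ?w (%m. m * g m) z)" by (simp_all add: tens_def fun_eq_iff algebra_simps)
   define Df where "Df s = - freq k * num s (tens ?w (%m. a m * (m * f m)))" for s
   define Dg where "Dg s = - freq k * num s (tens ?w (%m. a m * (m * g m)))" for s
   define Qf where "Qf s = coll s (tens ?w (%m. m * f m))" for s
   define Qg where "Qg s = coll s (tens ?w (%m. m * g m))" for s
   have nD: "- freq k * num s (tens ?w (%m. a m * (m * ?h m))) = al * Df s + \<beta> * Dg s" for s unfolding e1 Df_def Dg_def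
    by (subst num_linear[OF integrable_N_dom(1)[OF mass_meas(2)[OF f(1)] mass_bounds(3)[OF f(2)]]
      integrable_N_dom(1)[OF mass_meas(2)[OF g(1)] mass_bounds(3)[OF g(2)]]])
     (simp_all add: algebra_simps)
   have nN: "num s (tens ?w (%m. m * ?h m)) = al * num s (tens ?w (%m. m * f m)) + \<beta> * num s (tens ?w (%m. m * g m))" for s unfolding e2
    by (subst num_linear[OF integrable_N_dom(1)[OF mass_meas(1)[OF f(1)] mass_bounds(2)[OF f(2)]]
      integrable_N_dom(1)[OF mass_meas(1)[OF g(1)] mass_bounds(2)[OF g(2)]]]) simp_all
   have nQ: "coll s (tens ?w (%m. m * ?h m)) = al * Qf s + \<beta> * Qg s" for s unfolding e2 Qf_def Qg_def
    by (subst coll_linear[OF integrable_q_mass(1)[OF mass_meas(1)[OF f(1)] mass_bounds(1)[OF f(2)]]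
      integrable_q_mass(1)[OF mass_meas(1)[OF g(1)] mass_bounds(1)[OF g(2)]]]) simp_all
   have mf: "Df : Borel borel" "Qf : Borel borel"
    and mg: "Dg : Borel borel" "Qg : Borel borel"
    using f(3) g(3) unfolding weak_ok_def by (simp_all add: Df_def[abs_def] Dg_def[abs_def] Qf_def[abs_def] Qg_def[abs_def])
   have bD: "\<bar>Df s\<bar> <= freq k * ((Cf * (1 + a 1)) * (2 * K))" "\<bar>Dg s\<bar> <= freq k * ((Cg * (1 + a 1)) * (2 * K))" for s
    using mult_left_mono[OF integrable_N_dom(2)[OF mass_meas(2)[OF f(1)] mass_bounds(3)[OF f(2)]], of "freq k" s]
     mult_left_mono[OF integrable_N_dom(2)[OF mass_meas(2)[OF g(1)] mass_bounds(3)[OF g(2)]], of "freq k" s] by (auto simp: Df_def Dg_def abs_mult freq_def)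
   have bQ: "\<bar>Qf s\<bar> <= 4 * Cf * QM" "\<bar>Qg s\<bar> <= 4 * Cg * QM" for s unfolding Qf_def Qg_def
    using integrable_q_mass(2)[OF mass_meas(1)[OF f(1)] mass_bounds(1)[OF f(2)]]
     integrable_q_mass(2)[OF mass_meas(1)[OF g(1)] mass_bounds(1)[OF g(2)]] by auto
   have mF: "(%s. Df s + Qf s) : Borel borel" "(%s. Dg s + Qg s) : Borel borel" using mf mg by measurable
   have bF: "\<bar>Df s + Qf s\<bar> <= freq k * ((Cf * (1 + a 1)) * (2 * K)) + 4 * Cf * QM"
    "\<bar>Dg s + Qg s\<bar> <= freq k * ((Cg * (1 + a 1)) * (2 * K)) + 4 * Cg * QM" for s using bD[of s] bQ[of s] by linarith+
   have "weak_ok k th ?h" unfolding weak_ok_def nD nN nQ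
   proof (intro conjI ballI)
    show "(%s. al * Df s + \<beta> * Dg s) : Borel borel" using mf mg by measurable
    show "(%s. al * Qf s + \<beta> * Qg s) : Borel borel" using mf mg by measurable
    fix t assume t: "t : {0..T}"
    have 1: "num t (tens ?w (%m. m * f m)) - num 0 (tens ?w (%m. m * f m)) = tint 0 t (%s. Df s + Qf s)"
     "num t (tens ?w (%m. m * g m)) - num 0 (tens ?w (%m. m * g m)) = tint 0 t (%s. Dg s + Qg s)"
     using f(3) g(3) t unfolding weak_ok_def Df_def Dg_def Qf_def Qg_def by blast+
    have "tint 0 t (%s. al * Df s + \<beta> * Dg s + (al * Qf s + \<beta> * Qg s)) = tint 0 t (%s. al * (Df s + Qf s) + \<beta> * (Dg s + Qg s))"
     by (simp add: algebra_simps)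
    also have "... = al * tint 0 t (%s. Df s + Qf s) + \<beta> * tint 0 t (%s. Dg s + Qg s)" by (rule tint_linear[OF mF(1) bF(1) mF(2) bF(2)])
    finally show "al * num t (tens ?w (%m. m * f m)) + \<beta> * num t (tens ?w (%m. m * g m)) -
     (al * num 0 (tens ?w (%m. m * f m)) + \<beta> * num 0 (tens ?w (%m. m * g m))) =
     tint 0 t (%s. al * Df s + \<beta> * Dg s + (al * Qf s + \<beta> * Qg s))" unfolding 1[symmetric] by (simp add: algebra_simps)
   qed
   thus "P ?h" unfolding P_def using h1 h2 by blast
  next
   fix F :: "nat => real => real" and f and C :: real
   assume PF: "!!i. P (F i)" and Fm: "!!i. F i : Borel halfline"
    and Fb0: "!!i m. m : space halfline ==> \<bar>F i m\<bar> <= C"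
    and l0: "!!m. m : space halfline ==> (%i. F i m) \<longlonglongrightarrow> f m"
   have Fb: "!!i m. 0 <= m ==> \<bar>F i m\<bar> <= C" and l: "!!m. 0 <= m ==> (%i. F i m) \<longlonglongrightarrow> f m" using Fb0 l0 by auto
   have fm: "f : Borel halfline" by (rule borel_measurable_LIMSEQ_real[OF l0 Fm])
   have fb: "\<bar>f m\<bar> <= C" if "0 <= m" for m by (rule LIMSEQ_le_const2[OF tendsto_rabs[OF l[OF that]]]) (use Fb that in auto)
   define D where "D i s = - freq k * num s (tens ?w (%m. a m * (m * F i m)))" for i s
   define Q where "Q i s = coll s (tens ?w (%m. m * F i m))" for i s
   define D' where "D' s = - freq k * num s (tens ?w (%m. a m * (m * f m)))" for s
   define Q' where "Q' s = coll s (tens ?w (%m. m * f m))" for s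
   have zl: "(%i. F i (snd z)) \<longlonglongrightarrow> f (snd z)" if "z : space TH" for z using l that by (auto simp: pair_space)
   have lD: "(%i. D i s) \<longlonglongrightarrow> D' s" for s unfolding D_def D'_def
    by (intro tendsto_mult tendsto_const num_tendsto[where C="C * (1 + a 1)"] mass_meas mass_bounds(3) Fm fm Fb)
     (auto simp: tens_def intro!: tendsto_intros zl)
   have lQ: "(%i. Q i s) \<longlonglongrightarrow> Q' s" for s unfolding Q_def Q'_def by (intro coll_tendsto_mass[where C=C] mass_meas mass_bounds(1) Fm fm Fb)
     (auto simp: tens_def intro!: tendsto_intros zl)
   have lN: "(%i. num s (tens ?w (%m. m * F i m))) \<longlonglongrightarrow> num s (tens ?w (%m. m * f m))" for s
    by (intro num_tendsto[where C=C] mass_meas mass_bounds(2) Fm fm Fb)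
     (auto simp: tens_def intro!: tendsto_intros zl)
   have mD: "D i : Borel borel" and mQ: "Q i : Borel borel" for i using PF[of i] unfolding P_def weak_ok_def by (simp_all add: D_def[abs_def] Q_def[abs_def])
   have mD': "D' : Borel borel" by (rule borel_measurable_LIMSEQ_real[OF lD mD])
   have mQ': "Q' : Borel borel" by (rule borel_measurable_LIMSEQ_real[OF lQ mQ])
   have bD: "\<bar>D i s\<bar> <= freq k * ((C * (1 + a 1)) * (2 * K))" for i s
    using mult_left_mono[OF integrable_N_dom(2)[OF mass_meas(2)[OF Fm] mass_bounds(3)[OF Fb]], of "freq k" s k th] by (auto simp: D_def abs_mult freq_def)
   have bQ: "\<bar>Q i s\<bar> <= 4 * C * QM" for i s unfolding Q_def by (rule integrable_q_mass(2)[OF mass_meas(1)[OF Fm] mass_bounds(1)[OF Fb]])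
   have "weak_ok k th f" unfolding weak_ok_def
   proof (intro conjI ballI)
    show "(%s. - freq k * num s (tens ?w (%m. a m * (m * f m)))) : Borel borel" using mD' by (simp add: D'_def[abs_def])
    show "(%s. coll s (tens ?w (%m. m * f m))) : Borel borel" using mQ' by (simp add: Q'_def[abs_def])
    fix t assume t: "t : {0..T}"
    have eq: "num t (tens ?w (%m. m * F i m)) - num 0 (tens ?w (%m. m * F i m)) = tint 0 t (%s. D i s + Q i s)" for i
     using PF[of i] t unfolding P_def weak_ok_def D_def Q_def by blast
    have "(%i. tint 0 t (%s. D i s + Q i s)) \<longlonglongrightarrow> tint 0 t (%s. D' s + Q' s)"
    proof (rule tint_tendsto)
     show "(%s. D i s + Q i s) : Borel borel" for i using mD mQ by measurable
     show "\<bar>D i s + Q i s\<bar> <= freq k * ((C * (1 + a 1)) * (2 * K)) + 4 * C * QM" for i s using bD[of i s] bQ[of i s] by linarith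
     show "(%s. D' s + Q' s) : Borel borel" using mD' mQ' by measurable
     show "(%i. D i s + Q i s) \<longlonglongrightarrow> D' s + Q' s" for s by (intro tendsto_add lD lQ)
    qed
    hence "(%i. num t (tens ?w (%m. m * F i m)) - num 0 (tens ?w (%m. m * F i m))) \<longlonglongrightarrow> tint 0 t (%s. D' s + Q' s)" unfolding eq .
    moreover have "(%i. num t (tens ?w (%m. m * F i m)) - num 0 (tens ?w (%m. m * F i m))) \<longlonglongrightarrow>
      num t (tens ?w (%m. m * f m)) - num 0 (tens ?w (%m. m * f m))" by (intro tendsto_diff lN)
    ultimately show "num t (tens ?w (%m. m * f m)) - num 0 (tens ?w (%m. m * f m)) =
     tint 0 t (%s. - freq k * num s (tens ?w (%m. a m * (m * f m))) + coll s (tens ?w (%m. m * f m)))" unfolding D'_def Q'_def by (rule LIMSEQ_unique[rotated])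
   qed
   thus "P f" unfolding P_def using fm fb by blast
  qed
  show "ps : Borel halfline" by fact
  show "\<bar>ps m\<bar> <= C" if "m : space halfline" for m using assms(2) that by simp
 qed
 thus ?thesis unfolding P_def by blast
qed

text \<open>A weight vanishing below \<open>e\<close> can be divided by the mass, which removes the factor \<open>m\<close> from \<open>weak_ok\<close>.\<close>
lemma weak_form:
 assumes ps: "ps : Borel halfline" "!!m. 0 <= m ==> \<bar>ps m\<bar> <= C"
  and e: "0 < e" "!!m. 0 <= m ==> m < e ==> ps m = 0"
 shows "(%s. - freq k * num s (tens (wave k th) (%m. a m * ps m))) : Borel borel"
  and "(%s. coll s (tens (wave k th) ps)) : Borel borel"
  and "0 <= t0 ==> t0 <= t ==> t <= T ==> num t (tens (wave k th) ps) - num t0 (tens (wave k th) ps)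
    = tint t0 t (%s. - freq k * num s (tens (wave k th) (%m. a m * ps m)) + coll s (tens (wave k th) ps))"
proof -
 define ph where "ph m = ps m / m" for m
 have fm: "ph : Borel halfline" unfolding ph_def[abs_def] by (intro borel_measurable_divide ps(1) measurable_ident_halfline)
 have C: "0 <= C" using ps(2)[of 0] by auto
 have fb: "\<bar>ph m\<bar> <= C / e" if m: "0 <= m" for m
 proof (cases "m < e")
  case True
  thus ?thesis using e m C by (simp add: ph_def)
 next
  case False
  thus ?thesis using e m C ps(2)[OF m] by (auto simp: ph_def abs_divide intro!: frac_le)
 qed
 have eq: "m * ph m = ps m" if "0 <= m" for m using e(1) e(2)[of 0] that by (cases "m = 0") (auto simp: ph_def)
 note W = weak_ok_bounded[OF fm fb, of k th, unfolded weak_ok_def]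
 have m1: "tens (wave k th) ps : Borel TH" "tens (wave k th) (%m. m * ph m) : Borel TH"
  "tens (wave k th) (%m. a m * ps m) : Borel TH" "tens (wave k th) (%m. a m * (m * ph m)) : Borel TH"
  using ps(1) fm mass_meas by (auto intro!: tens_measurable borel_measurable_times)
 have c1: "num s (tens (wave k th) (%m. a m * (m * ph m))) = num s (tens (wave k th) (%m. a m * ps m))" for s by (rule num_cong[OF m1(4,3)]) (simp add: tens_def eq)
 have c2: "num s (tens (wave k th) (%m. m * ph m)) = num s (tens (wave k th) ps)" for s by (rule num_cong[OF m1(2,1)]) (simp add: tens_def eq)
 have c3: "coll s (tens (wave k th) (%m. m * ph m)) = coll s (tens (wave k th) ps)" for s by (rule coll_cong[OF m1(2,1)]) (simp add: tens_def eq)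
 note W = W[unfolded c1 c2 c3]
 show M1: "(%s. - freq k * num s (tens (wave k th) (%m. a m * ps m))) : Borel borel"
  and M2: "(%s. coll s (tens (wave k th) ps)) : Borel borel" using W by auto
 assume t: "0 <= t0" "t0 <= t" "t <= T"
 let ?g = "%s. - freq k * num s (tens (wave k th) (%m. a m * ps m)) + coll s (tens (wave k th) ps)"
 have gm: "?g : Borel borel" using M1 M2 by measurable
 have b1: "\<bar>num s (tens (wave k th) (%m. a m * ps m))\<bar> <= (C / e * (1 + a 1)) * (2 * K)" for s
  unfolding c1[symmetric] by (rule integrable_N_dom(2)[OF m1(4) mass_bounds(3)[OF fb]])
 have b2: "\<bar>coll s (tens (wave k th) ps)\<bar> <= 4 * (C / e) * QM" for s unfolding c3[symmetric] by (rule integrable_q_mass(2)[OF m1(2) mass_bounds(1)[OF fb]])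
 have gb: "\<bar>?g s\<bar> <= freq k * ((C / e * (1 + a 1)) * (2 * K)) + 4 * (C / e) * QM" for s
 proof -
  have "\<bar>?g s\<bar> <= freq k * \<bar>num s (tens (wave k th) (%m. a m * ps m))\<bar> + \<bar>coll s (tens (wave k th) ps)\<bar>"
   by (rule order_trans[OF abs_triangle_ineq]) (simp add: abs_mult freq_def)
  also have "... <= freq k * ((C / e * (1 + a 1)) * (2 * K)) + 4 * (C / e) * QM" by (intro add_mono mult_left_mono b1 b2) (simp add: freq_def)
  finally show ?thesis .
 qed
 have "num t (tens (wave k th) ps) - num 0 (tens (wave k th) ps) = tint 0 t ?g"
  "num t0 (tens (wave k th) ps) - num 0 (tens (wave k th) ps) = tint 0 t0 ?g" using W t by auto
 moreover have "tint 0 t ?g = tint 0 t0 ?g + tint t0 t ?g" by (rule tint_combine[OF gm gb t(1,2)])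
 ultimately show "num t (tens (wave k th) ps) - num t0 (tens (wave k th) ps) = tint t0 t ?g" by linarith
qed

end
context coagulation_solution
begin

lemma heat_tens:
 assumes "0 <= m" "0 <= r"
 shows "heat a r (tens (wave k th) ps) (x, m) = tens (wave k th) (%m. exp (- (freq k * (a m * r))) * ps m) (x, m)"
proof -
 have "heat a r (tens (wave k th) ps) (x, m) = smooth (a m * r) (%y. ps m * cos (2 * pi * of_int k * y + th)) x"
  by (simp add: heat_def tens_def wave_def mult.commute)
 also have "... = ps m * (exp (- (2 * pi\<^sup>2 * (of_int k)\<^sup>2 * (a m * r))) * cos (2 * pi * of_int k * x + th))"
  unfolding smooth_cmult by (subst smooth_cos) (use assms a_nonneg in auto)
 finally show ?thesis by (simp add: tens_def wave_def freq_def mult_ac)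
qed

lemma exp_decay_bounds:
 fixes y :: real
 assumes "0 <= y"
 shows "0 <= 1 - exp (- y)" "1 - exp (- y) <= y" "\<bar>1 - exp (- y) - y * exp (- y)\<bar> <= y\<^sup>2"
proof -
 have e: "1 - y <= exp (- y)" "exp (- y) <= 1" using exp_ge_add_one_self[of "- y"] assms by auto
 thus "0 <= 1 - exp (- y)" "1 - exp (- y) <= y" by auto
 have "exp (- y) * (1 + y) <= 1"
 proof -
  have "exp (- y) * (1 + y) <= exp (- y) * exp y" by (intro mult_left_mono exp_ge_add_one_self) simp
  thus ?thesis by (simp flip: exp_add)
 qed
 moreover have "(1 - y) * (1 + y) <= exp (- y) * (1 + y)" using e assms by (intro mult_right_mono) auto
 ultimately show "\<bar>1 - exp (- y) - y * exp (- y)\<bar> <= y\<^sup>2" by (simp add: algebra_simps power2_eq_square abs_le_iff)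
qed

text \<open>Consider \<open>s \<mapsto> num s (wave * E(t-s))\<close> minus the time integral of the source. In an increment of length \<open>h\<close> the first order terms from the decaying
exponential and from the weak equation cancel, and the rest is of order \<open>h\<^sup>2\<close> because \<open>a\<close> is bounded on the support of the weight; so the function is
constant. Measurability in \<open>s\<close> comes from freezing the exponential on a grid.\<close>
lemma duhamel_wave:
 fixes k :: int and th :: real
 assumes ps: "ps : Borel halfline" "!!m. 0 <= m ==> \<bar>ps m\<bar> <= C"
  and e: "0 < e" "!!m. 0 <= m ==> m < e ==> ps m = 0"
 defines "E \<equiv> %r m. exp (- (freq k * (a m * r))) * ps m"
 shows "(%s. coll s (tens (wave k th) (E (max 0 (t - s))))) : Borel borel"
  and "0 <= t0 ==> t0 <= t ==> t <= T ==> num t (tens (wave k th) ps)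
    = num t0 (tens (wave k th) (E (t - t0))) + tint t0 t (%s. coll s (tens (wave k th) (E (max 0 (t - s)))))"
proof -
 let ?w = "wave k th"
 define \<Lambda> where "\<Lambda> = freq k * a e"
 have fr: "0 <= freq k" by (simp add: freq_def)
 have C: "0 <= C" using ps(2)[of 0] by auto
 have \<Lambda>: "0 <= \<Lambda>" using fr a_pos[OF e(1)] by (simp add: \<Lambda>_def)
 have ae: "0 <= freq k * a m & freq k * a m <= \<Lambda> & a m <= a e" if "e <= m" for m
  using a_mono[OF e(1) that] a_pos[of m] e(1) that fr unfolding \<Lambda>_def by (auto intro: mult_left_mono)
 have Em [measurable]: "E r : Borel halfline" for r unfolding E_def using ps(1) by measurable
 have Ez: "E r m = 0" if "0 <= m" "m < e" for r m using e(2)[OF that] by (simp add: E_def)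
 have Eb: "\<bar>E r m\<bar> <= C" if r: "0 <= r" and m: "0 <= m" for r m
 proof -
  have "exp (- (freq k * (a m * r))) <= 1" using fr a_nonneg[OF m] r by simp
  hence "exp (- (freq k * (a m * r))) * \<bar>ps m\<bar> <= 1 * C" using ps(2)[OF m] by (intro mult_mono) auto
  thus ?thesis by (simp add: E_def abs_mult)
 qed
 have Esplit: "E (r + h) m = exp (- (freq k * a m * h)) * E r m" for r h m by (simp add: E_def algebra_simps flip: exp_add)
 have Edm: "(%m. E r m - E r' m) : Borel halfline" for r r' by measurable
 have Ed: "\<bar>E r m - E (r + h) m\<bar> <= \<Lambda> * h * C" if r: "0 <= r" "0 <= h" and m: "0 <= m" for r h m
 proof (cases "m < e")
  case True
  thus ?thesis using Ez m \<Lambda> r C by simp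
 next
  case False
  hence A: "0 <= freq k * a m" "freq k * a m <= \<Lambda>" using ae[of m] by auto
  define y where "y = freq k * a m * h"
  have y: "0 <= y" "y <= \<Lambda> * h" using A r by (auto simp: y_def intro: mult_right_mono)
  have "\<bar>E r m - E (r + h) m\<bar> = (1 - exp (- y)) * \<bar>E r m\<bar>"
  proof -
   have "E r m - E (r + h) m = (1 - exp (- y)) * E r m" unfolding Esplit y_def by (simp add: algebra_simps)
   thus ?thesis using exp_decay_bounds(1)[OF y(1)] by (simp add: abs_mult)
  qed
  also have "... <= (\<Lambda> * h) * C" using exp_decay_bounds[OF y(1)] y Eb[OF r(1) m] C \<Lambda> r by (intro mult_mono) auto
  finally show ?thesis .
 qed
 have tb: "\<bar>tens ?w g z\<bar> <= B" if "!!m. 0 <= m ==> \<bar>g m\<bar> <= B" "z : space TH" for g B z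
  by (rule tens_wave_bound) (use that in \<open>auto simp: pair_space\<close>)
 have cb: "\<bar>coll s (tens ?w g)\<bar> <= 3 * B * (K * K)" if "g : Borel halfline" "!!m. 0 <= m ==> \<bar>g m\<bar> <= B" for s g B
  by (rule integrable_q_bounded(2)[OF _ tb[OF that(2)]]) (use that(1) in measurable)
 have ci: "integrable (q s) (gl (tens ?w g))" if "g : Borel halfline" "!!m. 0 <= m ==> \<bar>g m\<bar> <= B" for s g B
  by (rule integrable_q_bounded(1)[OF _ tb[OF that(2)]]) (use that(1) in measurable)
 have nb: "\<bar>num s (tens ?w g)\<bar> <= B * K" if "g : Borel halfline" "!!m. 0 <= m ==> \<bar>g m\<bar> <= B" for s g B
  by (rule integrable_N_om(2)[OF _ bounded_le_om[OF tb[OF that(2)]]]) (use that(1) in measurable)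
 have ni: "integrable (N s) (tens ?w g)" if "g : Borel halfline" "!!m. 0 <= m ==> \<bar>g m\<bar> <= B" for s g B
  by (rule integrable_N_om(1)[OF _ bounded_le_om[OF tb[OF that(2)]]]) (use that(1) in measurable)
 let ?Q = "%s. coll s (tens ?w (E (max 0 (t - s))))"
 have Qb: "\<bar>?Q s\<bar> <= 3 * C * (K * K)" for s by (rule cb[OF Em Eb]) auto
 show Qm: "?Q : Borel borel"
 proof (rule borel_measurable_LIMSEQ_real)
  define \<rho> where "\<rho> j s = real_of_int \<lfloor>real (Suc j) * s\<rfloor> / real (Suc j)" for j :: nat and s
  show "(%s. coll s (tens ?w (E (max 0 (t - \<rho> j s))))) : Borel borel" for j
  proof -
   have 1: "(%s. coll s (tens ?w (E (max 0 (t - real_of_int i / real (Suc j)))))) : Borel borel" for i :: int by (rule weak_form(2)[OF Em Eb e(1) Ez]) auto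
   have 2: "(%s. \<lfloor>real (Suc j) * s\<rfloor>) : measurable borel (count_space UNIV)" by measurable
   show ?thesis unfolding \<rho>_def by (rule measurable_compose_countable[OF 1 2])
  qed
  fix s
  have \<rho>l: "(%j. \<rho> j s) \<longlonglongrightarrow> s"
  proof -
   have "\<bar>\<rho> j s - s\<bar> <= 1 / real (Suc j)" for j
   proof -
    have "\<rho> j s - s = (real_of_int \<lfloor>real (Suc j) * s\<rfloor> - real (Suc j) * s) / real (Suc j)" by (simp add: \<rho>_def field_simps)
    moreover have "\<bar>real_of_int \<lfloor>real (Suc j) * s\<rfloor> - real (Suc j) * s\<bar> <= 1" by linarith
    ultimately show ?thesis by (simp add: divide_right_mono)
   qed
   hence "(%j. \<rho> j s - s) \<longlonglongrightarrow> 0" by (intro Lim_null_comparison[OF _ LIMSEQ_Suc[OF lim_1_over_n]]) auto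
   thus ?thesis by (simp add: LIM_zero_iff)
  qed
  show "(%j. coll s (tens ?w (E (max 0 (t - \<rho> j s))))) \<longlonglongrightarrow> ?Q s"
  proof (rule coll_tendsto)
   show "tens ?w (E (max 0 (t - \<rho> j s))) : Borel TH" for j by (intro tens_measurable wave_measurable Em)
   show "tens ?w (E (max 0 (t - s))) : Borel TH" by (intro tens_measurable wave_measurable Em)
   show "\<bar>tens ?w (E (max 0 (t - \<rho> j s))) z\<bar> <= C" if "z : space TH" for j z by (rule tb[OF Eb that]) auto
   show "(%j. tens ?w (E (max 0 (t - \<rho> j s))) z) \<longlonglongrightarrow> tens ?w (E (max 0 (t - s))) z" for z
    unfolding tens_def E_def by (intro tendsto_intros \<rho>l)
  qed
 qed
 assume t: "0 <= t0" "t0 <= t" "t <= T"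
 define ph where "ph s = num s (tens ?w (E (t - s)))" for s
 define D where "D s = ph s - tint t0 s ?Q" for s
 have ab: "\<bar>a m * E r m\<bar> <= a e * C" if r: "0 <= r" and m: "0 <= m" for r m
 proof (cases "m < e")
  case True thus ?thesis using Ez m C a_pos[OF e(1)] by simp
 next
  case False
  hence "a m <= a e" "0 <= a m" using ae[of m] a_nonneg[OF m] by auto
  hence "\<bar>a m\<bar> * \<bar>E r m\<bar> <= a e * C" using Eb[OF r m] a_pos[OF e(1)] by (intro mult_mono) auto
  thus ?thesis by (simp add: abs_mult)
 qed
 have aab: "\<bar>a m * (a m * E r m)\<bar> <= a e * (a e * C)" if r: "0 <= r" and m: "0 <= m" for r m
 proof (cases "m < e")
  case True thus ?thesis using Ez m C a_pos[OF e(1)] by simp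
 next
  case False
  hence "a m <= a e" "0 <= a m" using ae[of m] a_nonneg[OF m] by auto
  hence "\<bar>a m\<bar> * \<bar>a m * E r m\<bar> <= a e * (a e * C)" using ab[OF r m] a_pos[OF e(1)] by (intro mult_mono) auto
  thus ?thesis by (simp add: abs_mult)
 qed
 have aEm: "(%m. a m * E r m) : Borel halfline" "(%m. a m * (a m * E r m)) : Borel halfline" for r by measurable
 define L' where "L' = freq k * ((a e * (a e * C)) * K) + 3 * (a e * C) * (K * K)"
 have lip: "\<bar>num s' (tens ?w (%m. a m * E r m)) - num s (tens ?w (%m. a m * E r m))\<bar> <= L' * (s' - s)"
  if r: "0 <= r" and s: "0 <= s" "s <= s'" "s' <= T" for r s s'
 proof -
  have Ez': "a m * E r m = 0" if "0 <= m" "m < e" for m using Ez[OF that] by simp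
  let ?g = "%\<tau>. - freq k * num \<tau> (tens ?w (%m. a m * (a m * E r m))) + coll \<tau> (tens ?w (%m. a m * E r m))"
  note W = weak_form[OF aEm(1) ab[OF r] e(1) Ez', where k=k and th=th]
  have gb: "\<bar>?g \<tau>\<bar> <= L'" for \<tau>
  proof -
   have "\<bar>?g \<tau>\<bar> <= freq k * \<bar>num \<tau> (tens ?w (%m. a m * (a m * E r m)))\<bar> + \<bar>coll \<tau> (tens ?w (%m. a m * E r m))\<bar>"
    by (rule order_trans[OF abs_triangle_ineq]) (simp add: abs_mult fr)
   also have "... <= L'" unfolding L'_def by (intro add_mono mult_left_mono nb[OF aEm(2) aab[OF r]] cb[OF aEm(1) ab[OF r]] fr)
   finally show ?thesis .
  qed
  have gm: "?g : Borel borel" using W(1,2) by measurable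
  have "num s' (tens ?w (%m. a m * E r m)) - num s (tens ?w (%m. a m * E r m)) = tint s s' ?g" by (rule W(3)) (use s in auto)
  thus ?thesis using tint_abs_le[OF gm gb s(2) gb] by simp
 qed
 define CC where "CC = \<Lambda>\<^sup>2 * C * K + freq k * L' + 3 * (\<Lambda> * C) * (K * K)"
 have inc: "\<bar>D s' - D s\<bar> <= CC * (s' - s)\<^sup>2" if s: "t0 <= s" "s <= s'" "s' <= t" for s s'
 proof -
  define h where "h = s' - s"
  define r where "r = t - s'"
  have h: "0 <= h" and r: "0 <= r" and rh: "t - s = r + h" using s by (auto simp: h_def r_def)
  have rh0: "0 <= r + h" using r h by simp
  have sT: "0 <= s" "s' <= T" using s t by auto
  let ?G = "E (r + h)"
  let ?D = "%\<tau>. num \<tau> (tens ?w (%m. a m * ?G m))"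
  have Ez'': "?G m = 0" if "0 <= m" "m < e" for m by (rule Ez[OF that])
  note W = weak_form[OF Em[of "r + h"] Eb[OF rh0] e(1) Ez'', where k=k and th=th]
  have mD: "(%\<tau>. - freq k * ?D \<tau>) : Borel borel" by (rule W(1))
  have mC: "(%\<tau>. coll \<tau> (tens ?w ?G)) : Borel borel" by (rule W(2))
  have bD: "\<bar>- freq k * ?D \<tau>\<bar> <= freq k * (a e * C * K)" for \<tau> unfolding abs_mult abs_minus abs_of_nonneg[OF fr]
   by (intro mult_left_mono nb[OF aEm(1) ab[OF rh0]] fr)
  have bC: "\<bar>coll \<tau> (tens ?w ?G)\<bar> <= 3 * C * (K * K)" for \<tau> by (rule cb[OF Em Eb[OF rh0]])
  \<comment> \<open>first-order error of the exponential\<close>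
  have gm: "(%m. E r m - ?G m - freq k * h * (a m * ?G m)) : Borel halfline" using aEm(1)[of "r + h"] Em[of r] Em[of "r + h"] by measurable
  have g1: "\<bar>E r m - ?G m - freq k * h * (a m * ?G m)\<bar> <= \<Lambda>\<^sup>2 * C * h\<^sup>2" if m: "0 <= m" for m
  proof (cases "m < e")
   case True
   thus ?thesis using Ez[OF m] C by simp
  next
   case False
   hence A: "0 <= freq k * a m" "freq k * a m <= \<Lambda>" using ae[of m] by auto
   define y where "y = freq k * a m * h"
   have y: "0 <= y" "y <= \<Lambda> * h" using A h by (auto simp: y_def intro: mult_right_mono)
   have "E r m - ?G m - freq k * h * (a m * ?G m) = (1 - exp (- y) - y * exp (- y)) * E r m" unfolding Esplit y_def by (simp add: algebra_simps)
   hence "\<bar>E r m - ?G m - freq k * h * (a m * ?G m)\<bar> = \<bar>1 - exp (- y) - y * exp (- y)\<bar> * \<bar>E r m\<bar>" by (simp add: abs_mult)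
   also have "... <= (\<Lambda> * h)\<^sup>2 * C" using exp_decay_bounds(3)[OF y(1)] power_mono[OF y(2,1), of 2] Eb[OF r m] by (intro mult_mono) auto
   finally show ?thesis by (simp add: power_mult_distrib mult_ac)
  qed
  have 1: "\<bar>num s' (tens ?w (%m. E r m - ?G m - freq k * h * (a m * ?G m)))\<bar> <= \<Lambda>\<^sup>2 * C * h\<^sup>2 * K" by (rule nb[OF gm g1])
  have lin1: "num s' (tens ?w (%m. E r m - ?G m - freq k * h * (a m * ?G m)))
    = num s' (tens ?w (E r)) - num s' (tens ?w ?G) - freq k * h * ?D s'"
  proof -
   have eq: "tens ?w (%m. E r m - ?G m - freq k * h * (a m * ?G m))
     = (%z. 1 * (1 * tens ?w (E r) z + (-1) * tens ?w ?G z) + (- (freq k * h)) * tens ?w (%m. a m * ?G m) z)" by (simp add: tens_def fun_eq_iff algebra_simps)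
   note i1 = ni[OF Em Eb[OF r], of s'] and i2 = ni[OF Em Eb[OF rh0], of s'] and i3 = ni[OF aEm(1) ab[OF rh0], of s']
   have "integrable (N s') (%z. 1 * tens ?w (E r) z + (-1) * tens ?w ?G z)" by (intro Bochner_Integration.integrable_add integrable_mult_right i1 i2)
   from num_linear[OF this i3, of 1 "- (freq k * h)"] num_linear[OF i1 i2, of 1 "-1"]
   show ?thesis unfolding eq by simp
  qed
  have 2: "num s' (tens ?w ?G) - num s (tens ?w ?G) = tint s s' (%\<tau>. - freq k * ?D \<tau>) + tint s s' (%\<tau>. coll \<tau> (tens ?w ?G))"
   using W(3)[of s s'] sT s tint_linear[OF mD bD mC bC, of s s' 1 1] by simp
  have 3: "\<bar>freq k * h * ?D s' + tint s s' (%\<tau>. - freq k * ?D \<tau>)\<bar> <= (freq k * L' * h) * h"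
  proof -
   have "freq k * h * ?D s' + tint s s' (%\<tau>. - freq k * ?D \<tau>)
     = tint s s' (%\<tau>. 1 * (freq k * ?D s') + 1 * (- freq k * ?D \<tau>))" using tint_const[OF s(2), of "freq k * ?D s'"]
     tint_linear[OF borel_measurable_const order_refl mD bD, of s s' 1 "freq k * ?D s'" 1] by (simp add: h_def mult_ac)
   also have "\<bar>...\<bar> <= (freq k * L' * h) * (s' - s)"
   proof (rule tint_abs_le[OF _ _ s(2)])
    show "(%\<tau>. 1 * (freq k * ?D s') + 1 * (- freq k * ?D \<tau>)) : Borel borel"
     using borel_measurable_add[OF borel_measurable_const mD, of "freq k * ?D s'"] by simp
    show "\<bar>1 * (freq k * ?D s') + 1 * (- freq k * ?D \<tau>)\<bar> <= freq k * (a e * C * K) + freq k * (a e * C * K)" for \<tau>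
     by (rule order_trans[OF abs_triangle_ineq], rule add_mono) (use bD[of \<tau>] bD[of s'] in simp_all)
    fix \<tau> assume \<tau>: "s < \<tau>" "\<tau> <= s'"
    have "\<bar>?D s' - ?D \<tau>\<bar> <= L' * (s' - \<tau>)" by (rule lip[OF rh0]) (use \<tau> sT in auto)
    also have "... <= L' * h"
    proof (rule mult_left_mono)
     show "0 <= L'" unfolding L'_def using fr C K1 a_pos[OF e(1)] by simp
    qed (use \<tau> in \<open>simp add: h_def\<close>)
    finally have "freq k * \<bar>?D s' - ?D \<tau>\<bar> <= freq k * (L' * h)" by (rule mult_left_mono[OF _ fr])
    moreover have "1 * (freq k * ?D s') + 1 * (- freq k * ?D \<tau>) = freq k * (?D s' - ?D \<tau>)" by (simp add: algebra_simps)
    ultimately show "\<bar>1 * (freq k * ?D s') + 1 * (- freq k * ?D \<tau>)\<bar> <= freq k * L' * h" using fr by (simp add: abs_mult)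
   qed
   finally show ?thesis by (simp add: h_def)
  qed
  have 4: "\<bar>tint s s' (%\<tau>. coll \<tau> (tens ?w ?G)) - tint s s' ?Q\<bar> <= (3 * (\<Lambda> * h * C) * (K * K)) * h"
  proof -
   have "tint s s' (%\<tau>. coll \<tau> (tens ?w ?G)) - tint s s' ?Q = tint s s' (%\<tau>. 1 * coll \<tau> (tens ?w ?G) + (-1) * ?Q \<tau>)"
    using tint_linear[OF mC bC Qm Qb, of s s' 1 "-1"] by simp
   also have "\<bar>...\<bar> <= (3 * (\<Lambda> * h * C) * (K * K)) * (s' - s)"
   proof (rule tint_abs_le[OF _ _ s(2)])
    show "(%\<tau>. 1 * coll \<tau> (tens ?w ?G) + (-1) * ?Q \<tau>) : Borel borel"
     using mC Qm by (intro borel_measurable_add borel_measurable_times borel_measurable_const) auto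
    show "\<bar>1 * coll \<tau> (tens ?w ?G) + (-1) * ?Q \<tau>\<bar> <= 3 * C * (K * K) + 3 * C * (K * K)" for \<tau>
     by (rule order_trans[OF abs_triangle_ineq], rule add_mono) (use bC[of \<tau>] Qb[of \<tau>] in simp_all)
    fix \<tau> assume \<tau>: "s < \<tau>" "\<tau> <= s'"
    define r' where "r' = t - \<tau>"
    have r': "0 <= r'" "max 0 (t - \<tau>) = r'" "r + h = r' + (\<tau> - s)" "\<tau> - s <= h" "0 <= \<tau> - s" using \<tau> s by (auto simp: r'_def r_def h_def)
    have eq: "tens ?w (%m. ?G m - E r' m) = (%z. 1 * tens ?w ?G z + (-1) * tens ?w (E r') z)" by (simp add: tens_def fun_eq_iff algebra_simps)
    have "coll \<tau> (tens ?w (%m. ?G m - E r' m)) = 1 * coll \<tau> (tens ?w ?G) + (-1) * ?Q \<tau>"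
     unfolding eq r'(2) by (rule coll_linear[OF ci[OF Em Eb[OF rh0]] ci[OF Em Eb[OF r'(1)]]])
    moreover have "\<bar>coll \<tau> (tens ?w (%m. ?G m - E r' m))\<bar> <= 3 * (\<Lambda> * h * C) * (K * K)"
    proof (rule cb[OF Edm])
     fix m :: real assume m: "0 <= m"
     have "\<bar>?G m - E r' m\<bar> <= \<Lambda> * (\<tau> - s) * C" using Ed[OF r'(1) r'(5) m] unfolding r'(3) by (simp add: abs_minus_commute)
     also have "... <= \<Lambda> * h * C" using r'(4) \<Lambda> C by (intro mult_right_mono mult_left_mono) auto
     finally show "\<bar>?G m - E r' m\<bar> <= \<Lambda> * h * C" .
    qed
    ultimately show "\<bar>1 * coll \<tau> (tens ?w ?G) + (-1) * ?Q \<tau>\<bar> <= 3 * (\<Lambda> * h * C) * (K * K)" by simp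
   qed
   finally show ?thesis by (simp add: h_def)
  qed
  have "tint t0 s' ?Q = tint t0 s ?Q + tint s s' ?Q" by (rule tint_combine[OF Qm Qb s(1,2)])
  hence "D s' - D s = num s' (tens ?w (%m. E r m - ?G m - freq k * h * (a m * ?G m)))
    + (freq k * h * ?D s' + tint s s' (%\<tau>. - freq k * ?D \<tau>))
    + (tint s s' (%\<tau>. coll \<tau> (tens ?w ?G)) - tint s s' ?Q)" unfolding D_def ph_def rh lin1 r_def[symmetric] using 2 by linarith
  hence "\<bar>D s' - D s\<bar> <= \<Lambda>\<^sup>2 * C * h\<^sup>2 * K + (freq k * L' * h) * h + (3 * (\<Lambda> * h * C) * (K * K)) * h" using 1 3 4 by linarith
  also have "... = CC * h\<^sup>2" by (simp add: CC_def power2_eq_square algebra_simps)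
  finally show ?thesis by (simp add: h_def)
 qed
 have "D t = D t0" by (rule quadratic_increments_zero[OF t(2) inc])
 moreover have "tint t0 t0 ?Q = 0" by (simp add: tint_def)
 moreover have "E 0 = ps" by (simp add: E_def fun_eq_iff)
 ultimately show "num t (tens ?w ps) = num t0 (tens ?w (E (t - t0))) + tint t0 t ?Q" by (simp add: D_def ph_def)
qed

text \<open>The maximum only serves to give the integrand a meaning, as a measurable function, for times beyond \<open>t\<close>.\<close>
definition mild :: "(real \<times> real => real) => bool" where
 "mild f \<longleftrightarrow> (\<forall>t. (%s. coll s (heat a (max 0 (t - s)) f)) : Borel borel) \<and>
  (\<forall>t0 t. 0 <= t0 --> t0 <= t --> t <= T \<longrightarrow>
   num t f = num t0 (heat a (t - t0) f) + tint t0 t (%s. coll s (heat a (max 0 (t - s)) f)))"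

lemma heat_bound:
 assumes "!!x. x : {0..<1} ==> \<bar>f (x, m)\<bar> <= C"
 shows "\<bar>heat a r f (x, m)\<bar> <= C" unfolding heat_def using smooth_bound[of "%y. f (y, m)" C] assms by simp

lemma slice_measurable:
 "f : Borel TH ==> 0 <= m ==> (%y. f (y, m)) : Borel torus" using measurable_compose[OF measurable_Pair2'[of m halfline torus], of f borel] by simp

lemma heat_tendsto:
 fixes C :: real
 assumes F: "!!i::nat. F i : Borel TH" and f: "f : Borel TH"
  and b: "!!i x. x : {0..<1} ==> \<bar>F i (x, m)\<bar> <= C"
  and l: "!!x. x : {0..<1} ==> (%i. F i (x, m)) \<longlonglongrightarrow> f (x, m)" and m: "0 <= m"
 shows "(%i. heat a r (F i) (x, m)) \<longlonglongrightarrow> heat a r f (x, m)" unfolding heat_def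
 using smooth_lim[of "%i y. F i (y, m)" C "%y. f (y, m)"] slice_measurable[OF F m] slice_measurable[OF f m] b l by simp

lemma heat_linear:
 fixes C C' :: real
 assumes "f : Borel TH" "!!x. x : {0..<1} ==> \<bar>f (x, m)\<bar> <= C"
  "g : Borel TH" "!!x. x : {0..<1} ==> \<bar>g (x, m)\<bar> <= C'" and m: "0 <= m"
 shows "heat a r (%z. al * f z + \<beta> * g z) (x, m) = al * heat a r f (x, m) + \<beta> * heat a r g (x, m)" unfolding heat_def
 using smooth_linear[OF slice_measurable[OF assms(1) m] assms(2) slice_measurable[OF assms(3) m] assms(4)] by simp

text \<open>Both sides are linear and continuous under bounded pointwise limits, and the wave times a mass weight is an eigenfunction of the heat flow; so \<open>duhamel_wave\<close>
suffices. Weights that do not vanish near mass zero are reached by truncation.\<close>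
lemma mild_bounded:
 assumes f: "f : Borel TH" "!!z. z : space TH ==> \<bar>f z\<bar> <= C"
 shows "mild f"
proof -
 define P where "P f \<longleftrightarrow> f : Borel TH & (\<exists>C. \<forall>z\<in>space TH. \<bar>f z\<bar> <= C) & mild f" for f
 have sl: "(x, m) : space TH" if "x : {0..<1}" "0 <= m" for x m :: real using that by (auto simp: pair_space)
 have hb: "\<bar>heat a r f z\<bar> <= C" if "!!z. z : space TH ==> \<bar>f z\<bar> <= C" "z : space TH" for f r z and C :: real
 proof -
  obtain x m where z: "z = (x, m)" by (cases z)
  show ?thesis unfolding z by (rule heat_bound) (use that z in \<open>auto simp: pair_space\<close>)
 qed
 have ib: "integrable (N s) u" if "u : Borel TH" "!!z. z : space TH ==> \<bar>u z\<bar> <= B" for s u and B :: real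
  by (rule integrable_N_om(1)[OF that(1)]) (rule bounded_le_om[OF that(2)])
 have cl: "closed_class TH P"
 proof (rule closed_classI)
  fix f g al \<beta>
  assume "P f" "P g"
  then obtain Cf Cg where f: "f : Borel TH" "!!z. z : space TH ==> \<bar>f z\<bar> <= Cf" "mild f"
   and g: "g : Borel TH" "!!z. z : space TH ==> \<bar>g z\<bar> <= Cg" "mild g" unfolding P_def by blast
  let ?h = "%z. al * f z + \<beta> * g z"
  have h1: "?h : Borel TH" using f(1) g(1) by measurable
  have h2: "\<bar>?h z\<bar> <= \<bar>al\<bar> * Cf + \<bar>\<beta>\<bar> * Cg" if "z : space TH" for z using f(2)[OF that] g(2)[OF that]
   by (intro order_trans[OF abs_triangle_ineq] add_mono) (auto simp: abs_mult intro!: mult_left_mono)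
  have hl: "heat a r ?h (x, m) = al * heat a r f (x, m) + \<beta> * heat a r g (x, m)" if m: "0 <= m" for r x m
   by (rule heat_linear[where C=Cf and C'=Cg, OF f(1) _ g(1) _ m]) (use f(2) g(2) sl m in auto)
  have hm: "(%z. al * heat a r f z + \<beta> * heat a r g z) : Borel TH" for r
   using f(1) g(1) by (intro borel_measurable_add borel_measurable_times borel_measurable_const heat_measurable a_measurable)
  have if1: "integrable (q s) (gl (heat a r f))" "\<bar>coll s (heat a r f)\<bar> <= 3 * Cf * (K * K)" for s r
   using integrable_q_bounded[OF heat_measurable[OF a_measurable f(1)] hb[OF f(2)]] by auto
  have ig1: "integrable (q s) (gl (heat a r g))" "\<bar>coll s (heat a r g)\<bar> <= 3 * Cg * (K * K)" for s r
   using integrable_q_bounded[OF heat_measurable[OF a_measurable g(1)] hb[OF g(2)]] by auto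
  have if2: "integrable (N s) (heat a r f)" "integrable (N s) f" for s r using ib[OF heat_measurable[OF a_measurable f(1)] hb[OF f(2)]] ib[OF f(1,2)] by blast+
  have ig2: "integrable (N s) (heat a r g)" "integrable (N s) g" for s r using ib[OF heat_measurable[OF a_measurable g(1)] hb[OF g(2)]] ib[OF g(1,2)] by blast+
  have cc: "coll s (heat a r ?h) = al * coll s (heat a r f) + \<beta> * coll s (heat a r g)" for s r by (subst coll_linear[OF if1(1) ig1(1), symmetric])
    (rule coll_cong[OF heat_measurable[OF a_measurable h1] hm], rule hl, simp)
  have nn: "num s (heat a r ?h) = al * num s (heat a r f) + \<beta> * num s (heat a r g)" for s r by (subst num_linear[OF if2(1) ig2(1), symmetric])
    (rule num_cong[OF heat_measurable[OF a_measurable h1] hm], rule hl, simp)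
  have mm: "(%s. coll s (heat a (max 0 (t - s)) f)) : Borel borel" "(%s. coll s (heat a (max 0 (t - s)) g)) : Borel borel" for t
   using f(3) g(3) by (auto simp: mild_def)
  have "mild ?h" unfolding mild_def cc
  proof (intro conjI allI impI)
   show "(%s. al * coll s (heat a (max 0 (t - s)) f) + \<beta> * coll s (heat a (max 0 (t - s)) g)) : Borel borel" for t using mm[of t] by measurable
   fix t0 t assume t: "0 <= t0" "t0 <= t" "t <= T"
   have "num t f = num t0 (heat a (t - t0) f) + tint t0 t (%s. coll s (heat a (max 0 (t - s)) f))"
    "num t g = num t0 (heat a (t - t0) g) + tint t0 t (%s. coll s (heat a (max 0 (t - s)) g))" using f(3) g(3) t by (auto simp: mild_def)
   thus "num t ?h = num t0 (heat a (t - t0) ?h) +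
     tint t0 t (%s. al * coll s (heat a (max 0 (t - s)) f) + \<beta> * coll s (heat a (max 0 (t - s)) g))"
    unfolding nn num_linear[OF if2(2) ig2(2)] tint_linear[OF mm(1) if1(2) mm(2) ig1(2)] by (simp add: algebra_simps)
  qed
  thus "P ?h" unfolding P_def using h1 h2 by blast
 next
  fix F :: "nat => real \<times> real => real" and f and C :: real
  assume PF: "!!i. P (F i)" and Fm: "!!i. F i : Borel TH"
   and Fb: "!!i z. z : space TH ==> \<bar>F i z\<bar> <= C"
   and l: "!!z. z : space TH ==> (%i. F i z) \<longlonglongrightarrow> f z"
  have fm: "f : Borel TH" by (rule borel_measurable_LIMSEQ_real[OF l Fm])
  have fb: "\<bar>f z\<bar> <= C" if "z : space TH" for z by (rule LIMSEQ_le_const2[OF tendsto_rabs[OF l[OF that]]]) (use Fb that in auto)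
  have hl: "(%i. heat a r (F i) z) \<longlonglongrightarrow> heat a r f z" if z: "z : space TH" for r z
  proof -
   obtain x m where zz: "z = (x, m)" by (cases z)
   have m: "0 <= m" using z zz by (auto simp: pair_space)
   show ?thesis unfolding zz by (rule heat_tendsto[OF Fm fm Fb l m]) (use sl m in auto)
  qed
  have lc: "(%i. coll s (heat a r (F i))) \<longlonglongrightarrow> coll s (heat a r f)" for s r
   by (rule coll_tendsto[OF heat_measurable[OF a_measurable Fm] heat_measurable[OF a_measurable fm] hb[OF Fb] hl])
  have ln: "(%i. num s (G i)) \<longlonglongrightarrow> num s g"
   if "!!i. G i : Borel TH" "g : Borel TH" "!!i z. z : space TH ==> \<bar>G i z\<bar> <= C"
    "!!z. z : space TH ==> (%i. G i z) \<longlonglongrightarrow> g z" for s g and G :: "nat => real \<times> real => real"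
  proof (rule num_tendsto[OF that(1,2) _ that(4)])
   show "\<bar>G i z\<bar> <= C * (om (snd z) + (snd z)\<^sup>2)" if z: "z : space TH" for i z
   proof -
    have C: "0 <= C" using order_trans[OF abs_ge_zero Fb[OF z]] .
    have "\<bar>G i z\<bar> <= C * om (snd z)" by (rule bounded_le_om[OF _ z]) fact
    also have "... <= C * (om (snd z) + (snd z)\<^sup>2)" using C by (intro mult_left_mono) auto
    finally show ?thesis .
   qed
  qed
  have mm: "(%s. coll s (heat a (max 0 (t - s)) (F i))) : Borel borel" for t i using PF[of i] by (auto simp: P_def mild_def)
  have mf: "(%s. coll s (heat a (max 0 (t - s)) f)) : Borel borel" for t by (rule borel_measurable_LIMSEQ_real[OF lc mm])
  have bb: "\<bar>coll s (heat a r (F i))\<bar> <= 3 * C * (K * K)" for s r i by (rule integrable_q_bounded(2)[OF heat_measurable[OF a_measurable Fm] hb[OF Fb]])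
  have "mild f" unfolding mild_def
  proof (intro conjI allI impI)
   show "(%s. coll s (heat a (max 0 (t - s)) f)) : Borel borel" for t by (rule mf)
   fix t0 t assume t: "0 <= t0" "t0 <= t" "t <= T"
   have eq: "num t (F i) = num t0 (heat a (t - t0) (F i)) + tint t0 t (%s. coll s (heat a (max 0 (t - s)) (F i)))" for i
    using PF[of i] t by (auto simp: P_def mild_def)
   have l1: "(%i. num t (F i)) \<longlonglongrightarrow> num t f" by (rule ln[OF Fm fm Fb l])
   have l2: "(%i. num t0 (heat a (t - t0) (F i))) \<longlonglongrightarrow> num t0 (heat a (t - t0) f)"
    by (rule ln[OF heat_measurable[OF a_measurable Fm] heat_measurable[OF a_measurable fm] hb[OF Fb] hl])
   have l3: "(%i. tint t0 t (%s. coll s (heat a (max 0 (t - s)) (F i)))) \<longlonglongrightarrow> tint t0 t (%s. coll s (heat a (max 0 (t - s)) f))"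
    by (rule tint_tendsto[OF mm bb mf lc])
   show "num t f = num t0 (heat a (t - t0) f) + tint t0 t (%s. coll s (heat a (max 0 (t - s)) f))"
    using LIMSEQ_unique[OF l1] tendsto_add[OF l2 l3] unfolding eq by blast
  qed
  thus "P f" unfolding P_def using fm fb by blast
 qed
 have gen0: "P (tens (wave k th) ps)"
  if ps: "ps : Borel halfline" "!!m. 0 <= m ==> \<bar>ps m\<bar> <= C" and e: "0 < e" "!!m. 0 <= m ==> m < e ==> ps m = 0"
  for k th ps e and C :: real
 proof -
  have m1: "tens (wave k th) ps : Borel TH" using ps(1) by measurable
  have m2: "tens (wave k th) (%m. exp (- (freq k * (a m * r))) * ps m) : Borel TH" for r using ps(1) by measurable
  have h1: "coll s (heat a r (tens (wave k th) ps)) = coll s (tens (wave k th) (%m. exp (- (freq k * (a m * r))) * ps m))" if "0 <= r" for s r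
   by (rule coll_cong[OF heat_measurable[OF a_measurable m1] m2]) (use that in \<open>auto intro!: heat_tens\<close>)
  have h2: "num s (heat a r (tens (wave k th) ps)) = num s (tens (wave k th) (%m. exp (- (freq k * (a m * r))) * ps m))" if "0 <= r" for s r
   by (rule num_cong[OF heat_measurable[OF a_measurable m1] m2]) (use that in \<open>auto intro!: heat_tens\<close>)
  have "mild (tens (wave k th) ps)" unfolding mild_def using duhamel_wave[OF ps e] by (simp add: h1 h2)
  moreover have "\<bar>tens (wave k th) ps z\<bar> <= C" if "z : space TH" for z by (rule tens_wave_bound) (use that ps(2) in \<open>auto simp: pair_space\<close>)
  ultimately show ?thesis unfolding P_def using m1 by blast
 qed
 have "P f"
 proof (rule TH_functional_closure[where P=P and C=C])
  show "closed_class TH P" by (rule cl)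
  fix k th B assume B: "B : sets halfline"
  have Bi: "indicator (B \<inter> {e..}) : Borel halfline" for e :: real using B by (intro borel_measurable_indicator) (auto simp: sets_halfline_iff)
  have mi: "indicator B : Borel halfline" "indicator (B \<inter> {0<..}) : Borel halfline"
   using B by (auto simp: sets_halfline_iff intro!: borel_measurable_indicator)
  have "P (tens (wave k th) (indicator (B \<inter> {0<..})))"
  proof (rule closed_class_limit[OF cl, of "%i. tens (wave k th) (indicator (B \<inter> {1 / real (Suc i)..}))" 1])
   show "P (tens (wave k th) (indicator (B \<inter> {1 / real (Suc i)..})))" for i
    by (rule gen0[where C=1 and e="1 / real (Suc i)", OF Bi]) (auto simp: indicator_def)
   show "tens (wave k th) (indicator (B \<inter> {1 / real (Suc i)..})) : Borel TH" for i by (intro tens_measurable wave_measurable Bi)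
   show "\<bar>tens (wave k th) (indicator (B \<inter> {1 / real (Suc i)..})) z\<bar> <= 1" for i z by (rule tens_wave_bound) (simp add: indicator_def)
   show "(%i. tens (wave k th) (indicator (B \<inter> {1 / real (Suc i)..})) z) \<longlonglongrightarrow> tens (wave k th) (indicator (B \<inter> {0<..})) z" for z
    unfolding tens_def
   proof (intro tendsto_mult tendsto_const)
    show "(%i. indicator (B \<inter> {1 / real (Suc i)..}) (snd z) :: real) \<longlonglongrightarrow> indicator (B \<inter> {0<..}) (snd z)"
    proof (cases "0 < snd z")
     case True
     have "\<forall>\<^sub>F i in sequentially. 1 / real (Suc i) < snd z" by (rule order_tendstoD(2)[OF LIMSEQ_Suc[OF lim_1_over_n] True])
     hence "\<forall>\<^sub>F i in sequentially. (indicator (B \<inter> {1 / real (Suc i)..}) (snd z) :: real) = indicator (B \<inter> {0<..}) (snd z)"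
      by eventually_elim (use True in \<open>auto simp: indicator_def\<close>)
     thus ?thesis by (rule tendsto_eventually)
    next
     case False
     have "\<not> 1 / real (Suc i) <= snd z" for i using False by (smt (verit) divide_pos_pos of_nat_0_less_iff zero_less_Suc)
     thus ?thesis using False by (simp add: indicator_def)
    qed
   qed
  qed
  hence p: "mild (tens (wave k th) (indicator (B \<inter> {0<..})))" unfolding P_def by blast
  have m1: "tens (wave k th) (indicator B) : Borel TH" "tens (wave k th) (indicator (B \<inter> {0<..})) : Borel TH" using mi by (auto intro!: tens_measurable)
  have hh: "heat a r (tens (wave k th) (indicator B)) (x, m) = heat a r (tens (wave k th) (indicator (B \<inter> {0<..}))) (x, m)" if "0 < m" for r x m
   using that by (simp add: heat_def tens_def indicator_def)
  have c1: "coll s (heat a r (tens (wave k th) (indicator B))) = coll s (heat a r (tens (wave k th) (indicator (B \<inter> {0<..}))))" for s r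
   by (rule coll_cong) (use m1 hh in \<open>auto intro!: heat_measurable\<close>)
  have c2: "num s (heat a r (tens (wave k th) (indicator B))) = num s (heat a r (tens (wave k th) (indicator (B \<inter> {0<..}))))" for s r
   by (rule num_cong) (use m1 hh in \<open>auto intro!: heat_measurable\<close>)
  have c3: "num s (tens (wave k th) (indicator B)) = num s (tens (wave k th) (indicator (B \<inter> {0<..})))" for s
   by (rule num_cong) (use m1 in \<open>auto simp: tens_def indicator_def\<close>)
  have "mild (tens (wave k th) (indicator B))" using p unfolding mild_def c1 c2 c3 .
  moreover have "\<bar>tens (wave k th) (indicator B) z\<bar> <= 1" for z by (rule tens_wave_bound) (simp add: indicator_def)
  moreover have "(%(x, m). cos (2 * pi * of_int k * x + th) * indicator B m) = tens (wave k th) (indicator B)" by (simp add: tens_def wave_def fun_eq_iff)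
  ultimately show "P (%(x, m). cos (2 * pi * of_int k * x + th) * indicator B m)" unfolding P_def using m1(1) by metis
 qed (use f in auto)
 thus ?thesis unfolding P_def by blast
qed

end
section \<open>The initial measure and decreasing weights\<close>

locale coagulation_cauchy = coagulation_solution +
 fixes \<nu>s :: "real measure"
 assumes nu: "\<nu> : probability_measures"
  and nustar: "sets \<nu>s = sets halfline" "finite_measure \<nu>s"
  and nu_le: "!!A. A : sets \<nu> ==> emeasure \<nu> A <= emeasure (torus \<Otimes>\<^sub>M \<nu>s) A"
  and nustar_moment: "(\<integral>\<^sup>+m. ennreal m + ennreal ((a m)\<^sup>2) / ennreal m \<partial>\<nu>s) < \<infinity>"
begin

lemma initial_pairing: "f : Cb2 ==> pairing f (\<mu> 0) = pairing f \<nu>"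
proof -
 assume f: "f : Cb2"
 have "0 : {0..T}" using T0 by simp
 note S0 = sol[unfolded solves_def, rule_format, OF f this]
 have t00: "tint 0 0 g = 0" for g by (simp add: tint_def)
 from S0 have "(LINT s:{0..0}|lborel. diffusion_term a f (\<mu> s)) = 0" "(LINT s:{0..0}|lborel. collision_term \<Phi> a f (\<mu> s)) = 0"
  by (simp_all only: tint_set_integral t00)
 with S0 show ?thesis by linarith
qed

text \<open>The equation at time \<open>0\<close> identifies the two measures on products of waves and continuous weights, which are determining.\<close>
lemma initial_measure: "\<mu> 0 = \<nu>"
proof -
 have sets: "sets (\<mu> 0) = sets TH" "sets \<nu> = sets TH" using fin[of 0] T0 nu by (auto simp: finite_measures_def probability_measures_def)
 hence sp: "space (\<mu> 0) = space TH" "space \<nu> = space TH" by (auto dest: sets_eq_imp_space_eq)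
 have f0: "finite_measure (\<mu> 0)" using fin[of 0] T0 by (auto simp: finite_measures_def)
 have f1: "finite_measure \<nu>" using nu by (auto simp: probability_measures_def prob_space.finite_measure)
 interpret m0: finite_measure "\<mu> 0" by fact
 interpret n0: finite_measure \<nu> by fact
 define P where "P f \<longleftrightarrow> f : Borel TH & (\<exists>C. \<forall>z\<in>space TH. \<bar>f z\<bar> <= C) & (\<integral>z. f z \<partial>\<mu> 0) = (\<integral>z. f z \<partial>\<nu>)" for f :: "real \<times> real => real"
 have int: "integrable (\<mu> 0) f" "integrable \<nu> f" if "f : Borel TH" "\<forall>z\<in>space TH. \<bar>f z\<bar> <= C" for f :: "real \<times> real => real" and C
 proof -
  have m: "f : Borel (\<mu> 0)" "f : Borel \<nu>" using that(1) sets measurable_cong_sets by blast+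
  show "integrable (\<mu> 0) f" by (rule m0.integrable_const_bound[where B=C, OF _ m(1)]) (use that sp in auto)
  show "integrable \<nu> f" by (rule n0.integrable_const_bound[where B=C, OF _ m(2)]) (use that sp in auto)
 qed
 have cl: "closed_class TH P"
 proof (rule closed_classI)
  fix f g :: "real \<times> real => real" and al \<beta> :: real
  assume "P f" "P g"
  then obtain Cf Cg where f: "f : Borel TH" "\<forall>z\<in>space TH. \<bar>f z\<bar> <= Cf" "(\<integral>z. f z \<partial>\<mu> 0) = (\<integral>z. f z \<partial>\<nu>)"
   and g: "g : Borel TH" "\<forall>z\<in>space TH. \<bar>g z\<bar> <= Cg" "(\<integral>z. g z \<partial>\<mu> 0) = (\<integral>z. g z \<partial>\<nu>)"
   unfolding P_def by blast
  let ?h = "%z. al * f z + \<beta> * g z"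
  have "?h : Borel TH" using f(1) g(1) by measurable
  moreover have "\<forall>z\<in>space TH. \<bar>?h z\<bar> <= \<bar>al\<bar> * Cf + \<bar>\<beta>\<bar> * Cg" using f(2) g(2)
   by (intro ballI order_trans[OF abs_triangle_ineq] add_mono) (auto simp: abs_mult intro!: mult_left_mono)
  moreover have "(\<integral>z. ?h z \<partial>\<mu> 0) = (\<integral>z. ?h z \<partial>\<nu>)" using int[OF f(1,2)] int[OF g(1,2)] f(3) g(3) by simp
  ultimately show "P ?h" unfolding P_def by blast
 next
  fix F :: "nat => real \<times> real => real" and f and C :: real
  assume PF: "!!i. P (F i)" and Fm: "!!i. F i : Borel TH"
   and Fb: "!!i z. z : space TH ==> \<bar>F i z\<bar> <= C"
   and l: "!!z. z : space TH ==> (%i. F i z) \<longlonglongrightarrow> f z"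
  have fm: "f : Borel TH" by (rule borel_measurable_LIMSEQ_real[OF l Fm])
  have fb: "\<bar>f z\<bar> <= C" if "z : space TH" for z by (rule LIMSEQ_le_const2[OF tendsto_rabs[OF l[OF that]]]) (use Fb that in auto)
  have lim: "(%i. \<integral>z. F i z \<partial>M) \<longlonglongrightarrow> (\<integral>z. f z \<partial>M)" if M: "sets M = sets TH" "finite_measure M" for M
  proof (rule integral_dominated_convergence[where w="%_. C"])
   interpret finite_measure M by fact
   have sM: "space M = space TH" using sets_eq_imp_space_eq[OF M(1)] .
   show "f : Borel M" "!!i. F i : Borel M" using fm Fm measurable_cong_sets[OF M(1) refl] by blast+
   show "integrable M (%_. C)" by simp
   show "AE z in M. (%i. F i z) \<longlonglongrightarrow> f z" "!!i. AE z in M. norm (F i z) <= C" using l Fb by (auto intro!: AE_I2 simp: sM)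
  qed
  have "(\<integral>z. f z \<partial>\<mu> 0) = (\<integral>z. f z \<partial>\<nu>)"
  proof (rule LIMSEQ_unique[OF lim[OF sets(1) f0]])
   show "(%i. \<integral>z. F i z \<partial>\<mu> 0) \<longlonglongrightarrow> (\<integral>z. f z \<partial>\<nu>)"
    using lim[OF sets(2) f1] PF unfolding P_def by simp
  qed
  thus "P f" unfolding P_def using fm fb by blast
 qed
 have gen: "P (tens (wave k th) ps)" if "ps : Borel halfline" "!!m. m : space halfline ==> \<bar>ps m\<bar> <= C" for k th ps and C :: real
 proof (rule halfline_functional_closure[where C=C and P="%ps. P (tens (wave k th) ps)", OF _ _ that])
  fix ps :: "real => real" assume c: "continuous_on UNIV ps" and b: "!!m. \<bar>ps m\<bar> <= 1"
  have "ps : Borel halfline" by (rule borel_measurable_halfline[OF borel_measurable_continuous_onI[OF c]])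
  hence "tens (wave k th) ps : Borel TH" by (intro tens_measurable wave_measurable)
  moreover have "\<bar>tens (wave k th) ps z\<bar> <= 1" for z by (rule tens_wave_bound[OF b])
  moreover have "(\<integral>z. tens (wave k th) ps z \<partial>\<mu> 0) = (\<integral>z. tens (wave k th) ps z \<partial>\<nu>)"
   using initial_pairing[OF wave_Cb2[OF c b, of k th]] by (simp add: pairing_def tens_def split_beta')
  ultimately show "P (tens (wave k th) ps)" unfolding P_def by blast
 next
  show "closed_class halfline (%ps. P (tens (wave k th) ps))"
  proof (rule closed_classI)
   fix f g :: "real => real" and al \<beta> :: real
   assume *: "P (tens (wave k th) f)" "P (tens (wave k th) g)" "f : Borel halfline" "g : Borel halfline"
   have eq: "tens (wave k th) (%m. al * f m + \<beta> * g m) = (%z. al * tens (wave k th) f z + \<beta> * tens (wave k th) g z)"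
    by (simp add: tens_def fun_eq_iff algebra_simps)
   show "P (tens (wave k th) (%m. al * f m + \<beta> * g m))" unfolding eq
    by (rule closed_class_linear[OF cl, OF *(1,2)]; intro tens_measurable wave_measurable *(3,4))
  next
   fix F :: "nat => real => real" and f and C :: real
   assume *: "!!i. P (tens (wave k th) (F i))" "!!i. F i : Borel halfline"
    "!!i m. m : space halfline ==> \<bar>F i m\<bar> <= C" "!!m. m : space halfline ==> (%i. F i m) \<longlonglongrightarrow> f m"
   show "P (tens (wave k th) f)"
   proof (rule closed_class_limit[OF cl, OF *(1), where C=C])
    show "tens (wave k th) (F i) : Borel TH" for i using *(2) by (intro tens_measurable wave_measurable)
    fix z assume "z : space TH"
    hence m: "snd z : space halfline" by (auto simp: pair_space)
    show "\<bar>tens (wave k th) (F i) z\<bar> <= C" for i by (rule tens_wave_bound) (rule *(3)[OF m])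
    show "(%i. tens (wave k th) (F i) z) \<longlonglongrightarrow> tens (wave k th) f z" unfolding tens_def by (intro tendsto_mult tendsto_const *(4)[OF m])
   qed
  qed
 qed
 have all: "P f" if "f : Borel TH" "!!z. z : space TH ==> \<bar>f z\<bar> <= C" for f and C :: real
 proof (rule TH_functional_closure[where P=P and C=C, OF _ cl that])
  fix k th B assume "B : sets halfline"
  hence "P (tens (wave k th) (indicator B))" by (intro gen[where C=1]) (auto simp: indicator_def)
  moreover have "(%(x, m). cos (2 * pi * of_int k * x + th) * indicator B m) = tens (wave k th) (indicator B)" by (simp add: tens_def wave_def fun_eq_iff)
  ultimately show "P (%(x, m). cos (2 * pi * of_int k * x + th) * indicator B m)" by simp
 qed
 show ?thesis
 proof (rule measure_eqI)
  show "sets (\<mu> 0) = sets \<nu>" using sets by simp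
  fix A assume A: "A : sets (\<mu> 0)"
  have "P (indicator A)" by (rule all[where C=1]) (use A sets in \<open>auto simp: indicator_def\<close>)
  hence "measure (\<mu> 0) A = measure \<nu> A" unfolding P_def using A sets sp sets.sets_into_space[OF A] by (simp add: Int_absorb2)
  thus "emeasure (\<mu> 0) A = emeasure \<nu> A" by (simp add: m0.emeasure_eq_measure n0.emeasure_eq_measure)
 qed
qed

lemma N0_le:
 assumes f: "f : Borel TH"
 shows "(\<integral>\<^sup>+z. f z \<partial>N 0) <= (\<integral>\<^sup>+m. ennreal (1 / m) * (\<integral>\<^sup>+x. f (x, m) \<partial>torus) \<partial>\<nu>s)"
proof -
 note [measurable] = f
 have 0: "0 : {0..T}" using T0 by simp
 let ?g = "%z. ennreal (1 / snd z) * f z"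
 have gm: "?g : Borel TH" by measurable
 interpret ns: finite_measure \<nu>s by (rule nustar)
 interpret tn: pair_sigma_finite torus \<nu>s ..
 have sT: "sets (torus \<Otimes>\<^sub>M \<nu>s) = sets TH" by (intro sets_pair_measure_cong refl nustar)
 have sn: "sets \<nu> = sets TH" using nu by (auto simp: probability_measures_def)
 have gm': "?g : Borel (torus \<Otimes>\<^sub>M \<nu>s)" using gm measurable_cong_sets[OF sT refl] by blast
 have "(\<integral>\<^sup>+z. f z \<partial>N 0) = (\<integral>\<^sup>+z. ennreal (snd z) * ?g z \<partial>N 0)"
 proof (rule nn_integral_cong_AE)
  show "AE z in N 0. f z = ennreal (snd z) * ?g z" using AE_N_pos by eventually_elim (simp add: mult.assoc[symmetric] ennreal_mult[symmetric])
 qed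
 also have "... = (\<integral>\<^sup>+z. ?g z \<partial>\<nu>)" using nn_integral_mu[OF 0 gm] initial_measure by simp
 also have "... <= (\<integral>\<^sup>+z. ?g z \<partial>(torus \<Otimes>\<^sub>M \<nu>s))"
  by (rule nn_integral_mono_measure) (use nu_le sn sT in \<open>auto simp: le_measure\<close>)
 also have "... = (\<integral>\<^sup>+m. \<integral>\<^sup>+x. ?g (x, m) \<partial>torus \<partial>\<nu>s)" using tn.nn_integral_snd[of ?g] gm' by simp
 also have "... = (\<integral>\<^sup>+m. ennreal (1 / m) * (\<integral>\<^sup>+x. f (x, m) \<partial>torus) \<partial>\<nu>s)"
 proof (rule nn_integral_cong)
  fix m assume "m : space \<nu>s"
  hence m: "m : space halfline" using sets_eq_imp_space_eq[OF nustar(1)] by simp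
  have "(%x. f (x, m)) : Borel torus" using measurable_compose[OF measurable_Pair2'[OF m] f] by simp
  thus "(\<integral>\<^sup>+x. ?g (x, m) \<partial>torus) = ennreal (1 / m) * (\<integral>\<^sup>+x. f (x, m) \<partial>torus)" by (simp add: nn_integral_cmult)
 qed
 finally show ?thesis .
qed

definition C3 :: real where
 "C3 = (1 + c + a 1)\<^sup>2 * ((2 + a 1)\<^sup>2 + (2 / a 1 + 1)\<^sup>2)"

lemma C3_pos: "0 < C3"
proof -
 have "0 < a 1" using a_pos by simp
 thus ?thesis unfolding C3_def using c_pos by (intro mult_pos_pos add_pos_pos zero_less_power) auto
qed

text \<open>For \<open>m \<ge> 1\<close> one has \<open>m powr p \<le> sqrt m\<close>, and for \<open>m \<le> 1\<close> every term of \<open>om\<close> is at most a constant times \<open>a m\<close>.\<close>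
lemma om_sq_le:
 assumes m: "0 < m"
 shows "(om m)\<^sup>2 <= C3 * (m + (a m)\<^sup>2)"
proof -
 have a1: "0 < a 1" using a_pos by simp
 define c0 where "c0 = 1 + c + a 1"
 have c0: "0 < c0" using a1 c_pos by (simp add: c0_def)
 have om0: "0 <= om m" using om_ge1[of m] m by simp
 show ?thesis
 proof (cases "m <= 1")
  case True
  have am: "a 1 <= a m" using a_mono[of m 1] m True by simp
  have "m powr p <= 1" using m True p_range by (simp add: powr_le1)
  hence "om m <= c0 * (2 + a m)" unfolding om_expand c0_def[symmetric] using c0 by (intro mult_left_mono) auto
  also have "... <= c0 * ((2 / a 1 + 1) * a m)"
  proof (rule mult_left_mono)
   have "2 = 2 / a 1 * a 1" using a1 by simp
   also have "... <= 2 / a 1 * a m" using am a1 by (intro mult_left_mono) auto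
   finally show "2 + a m <= (2 / a 1 + 1) * a m" by (simp add: distrib_right)
  qed (use c0 in simp)
  finally have "(om m)\<^sup>2 <= (c0 * ((2 / a 1 + 1) * a m))\<^sup>2" using om0 by (intro power_mono) auto
  also have "... = c0\<^sup>2 * ((2 / a 1 + 1)\<^sup>2) * (a m)\<^sup>2" by (simp add: power_mult_distrib)
  also have "... <= C3 * (m + (a m)\<^sup>2)" unfolding C3_def c0_def[symmetric] using m by (intro mult_mono mult_left_mono) auto
  finally show ?thesis .
 next
  case False
  have "m powr p <= m powr (1/2)" using False p_range by (intro powr_mono) auto
  hence r: "m powr p <= sqrt m" using m by (simp add: powr_half_sqrt)
  have s1: "1 <= sqrt m" using False by simp
  have "a m <= a 1" using a_mono[of 1 m] False by auto
  hence "m powr p + a m + 1 <= sqrt m + a 1 * 1 + 1" using r by simp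
  also have "... <= sqrt m + a 1 * sqrt m + sqrt m" using s1 a1 by (intro add_mono mult_left_mono) auto
  finally have "m powr p + a m + 1 <= (2 + a 1) * sqrt m" by (simp add: algebra_simps)
  hence "om m <= c0 * ((2 + a 1) * sqrt m)" unfolding om_expand c0_def[symmetric] using c0 by (intro mult_left_mono) auto
  hence "(om m)\<^sup>2 <= (c0 * ((2 + a 1) * sqrt m))\<^sup>2" using om0 by (intro power_mono) auto
  also have "... = c0\<^sup>2 * (2 + a 1)\<^sup>2 * m" using m by (simp add: power_mult_distrib)
  also have "... <= C3 * (m + (a m)\<^sup>2)" unfolding C3_def c0_def[symmetric] using m by (intro mult_mono mult_left_mono) auto
  finally show ?thesis .
 qed
qed

definition M2 :: real where
 "M2 = enn2real (\<integral>\<^sup>+m. ennreal (1 / m) * ennreal ((om m)\<^sup>2) \<partial>\<nu>s)"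

lemma initial_moment: "(\<integral>\<^sup>+m. ennreal (1 / m) * ennreal ((om m)\<^sup>2) \<partial>\<nu>s) = ennreal M2"
proof -
 have sp: "space \<nu>s = {0..}" using sets_eq_imp_space_eq[OF nustar(1)] by simp
 interpret ns: finite_measure \<nu>s by (rule nustar)
 have mm: "(%m. ennreal m + ennreal ((a m)\<^sup>2) / ennreal m) : Borel \<nu>s" unfolding measurable_cong_sets[OF nustar(1) refl] by measurable
 have "(\<integral>\<^sup>+m. ennreal (1 / m) * ennreal ((om m)\<^sup>2) \<partial>\<nu>s) <= (\<integral>\<^sup>+m. ennreal C3 * (1 + (ennreal m + ennreal ((a m)\<^sup>2) / ennreal m)) \<partial>\<nu>s)"
 proof (rule nn_integral_mono)
  fix m assume "m : space \<nu>s"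
  hence m: "0 <= m" using sp by simp
  show "ennreal (1 / m) * ennreal ((om m)\<^sup>2) <= ennreal C3 * (1 + (ennreal m + ennreal ((a m)\<^sup>2) / ennreal m))"
  proof (cases "m = 0")
   case False
   with m have pos: "0 < m" by simp
   have "ennreal (1 / m) * ennreal ((om m)\<^sup>2) = ennreal (1 / m * (om m)\<^sup>2)" using pos by (subst ennreal_mult) simp_all
   also have "... <= ennreal (1 / m * (C3 * (m + (a m)\<^sup>2)))" using om_sq_le[OF pos] pos by (intro ennreal_leI mult_left_mono) auto
   also have "... = ennreal (C3 * (1 + (a m)\<^sup>2 / m))" using pos by (simp add: field_simps)
   also have "... = ennreal C3 * (1 + ennreal ((a m)\<^sup>2) / ennreal m)" using pos C3_pos by (simp add: ennreal_mult divide_ennreal ennreal_plus)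
   also have "... <= ennreal C3 * (1 + (ennreal m + ennreal ((a m)\<^sup>2) / ennreal m))" by (intro mult_left_mono add_left_mono) auto
   finally show ?thesis .
  qed simp
 qed
 also have "... = ennreal C3 * (emeasure \<nu>s (space \<nu>s) + (\<integral>\<^sup>+m. ennreal m + ennreal ((a m)\<^sup>2) / ennreal m \<partial>\<nu>s))"
  using mm by (simp add: nn_integral_cmult nn_integral_add)
 also have "... < \<infinity>"
 proof -
  have "emeasure \<nu>s (space \<nu>s) < \<infinity>" using ns.emeasure_finite[of "space \<nu>s"] by (simp add: less_top[symmetric])
  thus ?thesis using nustar_moment by (simp add: ennreal_mult_less_top)
 qed
 finally show ?thesis unfolding M2_def by simp
qed

lemma M2_nonneg: "0 <= M2" by (simp add: M2_def)

lemma moment_le_M2: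
 assumes "!!m. 0 < m ==> ph m <= (om m)\<^sup>2"
 shows "(\<integral>\<^sup>+m. ennreal (1 / m) * ennreal (ph m) \<partial>\<nu>s) <= ennreal M2" unfolding initial_moment[symmetric]
proof (rule nn_integral_mono)
 fix m assume "m : space \<nu>s"
 hence "0 <= m" using sets_eq_imp_space_eq[OF nustar(1)] by simp
 thus "ennreal (1 / m) * ennreal (ph m) <= ennreal (1 / m) * ennreal ((om m)\<^sup>2)" using assms[of m] by (cases "m = 0") (auto intro!: mult_left_mono ennreal_leI)
qed

lemma integrable_N_bounded:
 fixes f :: "real \<times> real => real" and C :: real
 assumes "f : Borel TH" "!!z. z : space TH ==> \<bar>f z\<bar> <= C"
 shows "integrable (N s) f" by (rule integrable_N_om(1)[OF assms(1)]) (rule bounded_le_om[OF assms(2)])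

lemma smooth_const: "smooth b (%_. C) x = C" using gauss.prob_space by (simp add: smooth_def)

lemma coll_nonpos:
 assumes "!!x m m'. x : {0..<1} ==> 0 < m ==> 0 < m' ==> f (x, m + m') <= f (x, m) + f (x, m')"
 shows "coll s f <= 0"
proof -
 have "AE z in q s. 0 <= - gl f z" using AE_q_pos AE_space
 proof eventually_elim
  case (elim z)
  thus ?case using assms[of "fst z" "fst (snd z)" "snd (snd z)"] by (auto simp: gl_def)
 qed
 hence "0 <= (\<integral>z. - gl f z \<partial>q s)" by (rule integral_nonneg_AE)
 thus ?thesis by (simp add: coll_def)
qed

text \<open>A function of the mass alone is fixed by the heat flow, and a nonincreasing nonnegative one satisfies \<open>ph(m+m') \<le> ph(m) + ph(m')\<close>, so collisions lower its integral.
Applied to \<open>a\<^sup>2\<close> it gives the integrability needed for test functions of size \<open>om\<close>; applied near mass zero it gives a tail bound uniform in time.\<close>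
lemma decreasing_weight:
 assumes ph: "ph : Borel halfline" "!!m. 0 < m ==> 0 <= ph m"
  and anti: "!!m m'. 0 < m ==> m <= m' ==> ph m' <= ph m" and s: "s : {0..T}"
 shows "(\<integral>\<^sup>+z. ennreal (ph (snd z)) \<partial>N s) <= (\<integral>\<^sup>+m. ennreal (1 / m) * ennreal (ph m) \<partial>\<nu>s)"
proof -
 define f where "f n z = indicator {0<..} (snd z) * min (ph (snd z)) (real n)" for n :: nat and z :: "real \<times> real"
 have fm: "f n : Borel TH" for n
 proof -
  have "indicator {0<..} : Borel halfline" by (rule borel_measurable_halfline) simp
  thus ?thesis unfolding f_def by (intro borel_measurable_times borel_measurable_min borel_measurable_const
     measurable_compose[OF measurable_snd ph(1)] measurable_compose[OF measurable_snd])
 qed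
 have fb: "\<bar>f n z\<bar> <= real n" if "z : space TH" for n z using ph(2)[of "snd z"] by (auto simp: f_def indicator_def)
 have fn: "0 <= f n z" for n z using ph(2)[of "snd z"] by (auto simp: f_def indicator_def)
 have hf: "heat a r (f n) = f n" for r n by (simp add: heat_def f_def smooth_const fun_eq_iff)
 have main: "(\<integral>\<^sup>+z. ennreal (f n z) \<partial>N s) <= (\<integral>\<^sup>+m. ennreal (1 / m) * ennreal (ph m) \<partial>\<nu>s)" for n
 proof -
  have cm: "(%\<tau>. coll \<tau> (f n)) : Borel borel" using mild_bounded[OF fm fb, of n] unfolding mild_def hf by blast
  have "num s (f n) = num 0 (f n) + tint 0 s (%\<tau>. coll \<tau> (f n))" using mild_bounded[OF fm fb, of n] s unfolding mild_def hf by auto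
  moreover have "tint 0 s (%\<tau>. coll \<tau> (f n)) <= 0 * (s - 0)"
  proof (rule tint_le[OF cm integrable_q_bounded(2)[OF fm fb]])
   show "coll \<tau> (f n) <= 0" for \<tau>
   proof (rule coll_nonpos)
    fix x m m' :: real assume m: "0 < m" "0 < m'"
    have "min (ph (m + m')) (real n) <= min (ph m) (real n)" using anti[of m "m + m'"] m by (simp add: min_def)
    moreover have "0 <= min (ph m') (real n)" using ph(2)[OF m(2)] by simp
    ultimately show "f n (x, m + m') <= f n (x, m) + f n (x, m')" using m by (simp add: f_def)
   qed
  qed (use s in auto)
  ultimately have le: "num s (f n) <= num 0 (f n)" by simp
  have nn: "(\<integral>\<^sup>+z. ennreal (f n z) \<partial>N \<tau>) = ennreal (num \<tau> (f n))" for \<tau> unfolding num_def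
   by (rule nn_integral_eq_integral[OF integrable_N_bounded[OF fm fb]]) (use fn in auto)
  have "(\<integral>\<^sup>+z. ennreal (f n z) \<partial>N s) <= (\<integral>\<^sup>+z. ennreal (f n z) \<partial>N 0)" unfolding nn using le by (rule ennreal_leI)
  also have "... <= (\<integral>\<^sup>+m. ennreal (1 / m) * (\<integral>\<^sup>+x. ennreal (f n (x, m)) \<partial>torus) \<partial>\<nu>s)"
   by (rule N0_le) (use fm in measurable)
  also have "... <= (\<integral>\<^sup>+m. ennreal (1 / m) * ennreal (ph m) \<partial>\<nu>s)"
  proof (rule nn_integral_mono)
   fix m assume "m : space \<nu>s"
   hence m: "0 <= m" using sets_eq_imp_space_eq[OF nustar(1)] by simp
   have "(\<integral>\<^sup>+x. ennreal (f n (x, m)) \<partial>torus) = ennreal (f n (0, m))" using torus.emeasure_space_1 by (simp add: f_def)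
   moreover have "ennreal (1 / m) * ennreal (f n (0, m)) <= ennreal (1 / m) * ennreal (ph m)"
    using m by (cases "m = 0") (auto simp: f_def intro!: mult_left_mono ennreal_leI)
   ultimately show "ennreal (1 / m) * (\<integral>\<^sup>+x. ennreal (f n (x, m)) \<partial>torus) <= ennreal (1 / m) * ennreal (ph m)" by simp
  qed
  finally show ?thesis .
 qed
 have "(\<integral>\<^sup>+z. ennreal (ph (snd z)) \<partial>N s) = (\<integral>\<^sup>+z. (SUP n. ennreal (f n z)) \<partial>N s)"
 proof (rule nn_integral_cong_AE)
  show "AE z in N s. ennreal (ph (snd z)) = (SUP n. ennreal (f n z))" using AE_N_pos
  proof eventually_elim
   case (elim z)
   obtain n0 :: nat where n0: "ph (snd z) <= real n0" using real_arch_simple by blast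
   show ?case
   proof (rule antisym)
    have "ennreal (ph (snd z)) = ennreal (f n0 z)" using n0 elim by (simp add: f_def min_def)
    also have "... <= (SUP n. ennreal (f n z))" by (rule SUP_upper) simp
    finally show "ennreal (ph (snd z)) <= (SUP n. ennreal (f n z))" .
    show "(SUP n. ennreal (f n z)) <= ennreal (ph (snd z))" using elim by (intro SUP_least ennreal_leI) (simp add: f_def)
   qed
  qed
 qed
 also have "... = (SUP n. \<integral>\<^sup>+z. ennreal (f n z) \<partial>N s)"
 proof (rule nn_integral_monotone_convergence_SUP)
  show "incseq (%n z. ennreal (f n z))" by (auto simp: incseq_def le_fun_def f_def indicator_def intro!: ennreal_leI)
  show "(%z. ennreal (f n z)) : Borel (N s)" for n using fm by simp
 qed
 also have "... <= (\<integral>\<^sup>+m. ennreal (1 / m) * ennreal (ph m) \<partial>\<nu>s)" by (rule SUP_least) (rule main)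
 finally show ?thesis .
qed

lemma a_le_om: "0 <= m ==> a m <= om m" using om_ge[of m] powr_ge_zero[of m p] by linarith

lemma N_a_sq: "(\<integral>\<^sup>+z. ennreal ((a (snd z))\<^sup>2) \<partial>N s) <= ennreal M2"
proof (cases "s : {0..T}")
 case True
 have "(\<integral>\<^sup>+z. ennreal ((a (snd z))\<^sup>2) \<partial>N s) <= (\<integral>\<^sup>+m. ennreal (1 / m) * ennreal ((a m)\<^sup>2) \<partial>\<nu>s)"
 proof (rule decreasing_weight[where ph="%m. (a m)\<^sup>2"])
  show "(%m. (a m)\<^sup>2) : Borel halfline" by (intro borel_measurable_power a_measurable)
  fix m m' :: real assume m: "0 < m" "m <= m'"
  show "(a m')\<^sup>2 <= (a m)\<^sup>2" by (rule power_mono[OF a_mono[OF m]]) (use m a_nonneg[of m'] in linarith)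
 qed (use True in simp_all)
 also have "... <= ennreal M2"
 proof (rule moment_le_M2)
  fix m :: real assume "0 < m"
  hence m: "0 <= m" by simp
  show "(a m)\<^sup>2 <= (om m)\<^sup>2" by (rule power_mono[OF a_le_om[OF m] a_nonneg[OF m]])
 qed
 finally show ?thesis .
next
 case False
 hence "(\<integral>\<^sup>+z. ennreal ((a (snd z))\<^sup>2) \<partial>N s) = 0"
  using nn_integral_N[of "%z. ennreal ((a (snd z))\<^sup>2)" s] by (simp add: nk_outside)
 thus ?thesis by simp
qed

end
section \<open>The mild formulation for functions of size om\<close>

lemma integral_le_nn_bound:
 fixes f u :: "'a => real"
 assumes f: "integrable M f" and le: "AE x in M. f x <= u x" and u: "(\<integral>\<^sup>+x. ennreal (u x) \<partial>M) <= ennreal V" "0 <= V"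
 shows "(\<integral>x. f x \<partial>M) <= V"
proof -
 have "(\<integral>\<^sup>+x. ennreal (f x) \<partial>M) <= (\<integral>\<^sup>+x. ennreal (u x) \<partial>M)"
  by (rule nn_integral_mono_AE) (use le in \<open>auto intro: ennreal_leI\<close>)
 hence "enn2real (\<integral>\<^sup>+x. ennreal (f x) \<partial>M) <= V" using u by (intro enn2real_leI) auto
 moreover have "0 <= enn2real (\<integral>\<^sup>+x. ennreal (- f x) \<partial>M)" by simp
 ultimately show ?thesis unfolding real_lebesgue_integral_def[OF f] by linarith
qed

lemma tint_exp_le:
 assumes "0 < \<beta>" "0 <= s"
 shows "tint 0 s (%\<tau>. D * exp (\<beta> * \<tau>) * indicator {0..s} \<tau>) = D * (exp (\<beta> * s) - 1) / \<beta>"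
proof -
 have "(\<integral>\<tau>. indicator {0..s} \<tau> *\<^sub>R (D * exp (\<beta> * \<tau>)) \<partial>lborel) = D * exp (\<beta> * s) / \<beta> - D * exp (\<beta> * 0) / \<beta>"
 proof (rule integral_FTC_atLeastAtMost[OF assms(2)])
  show "((%\<tau>. D * exp (\<beta> * \<tau>) / \<beta>) has_vector_derivative D * exp (\<beta> * \<tau>)) (at \<tau> within {0..s})" for \<tau>
   unfolding has_real_derivative_iff_has_vector_derivative[symmetric] using assms(1) by (auto intro!: derivative_eq_intros)
  show "continuous_on {0..s} (%\<tau>. D * exp (\<beta> * \<tau>))" by (intro continuous_intros)
 qed
 moreover have "tint 0 s (%\<tau>. D * exp (\<beta> * \<tau>) * indicator {0..s} \<tau>) = (\<integral>\<tau>. indicator {0..s} \<tau> *\<^sub>R (D * exp (\<beta> * \<tau>)) \<partial>lborel)"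
  unfolding tint_def
 proof (rule integral_cong_AE)
  have "AE \<tau> in lborel. \<tau> \<noteq> (0::real)" by (rule AE_lborel_singleton)
  thus "AE \<tau> in lborel. indicator {0<..s} \<tau> * (D * exp (\<beta> * \<tau>) * indicator {0..s} \<tau>) = indicator {0..s} \<tau> *\<^sub>R (D * exp (\<beta> * \<tau>))"
   by eventually_elim (auto simp: indicator_def)
 qed simp_all
 ultimately show ?thesis by (simp add: diff_divide_distrib right_diff_distrib)
qed

lemma AE_le_of_weighted_integrals:
 fixes F :: "'a => ennreal"
 assumes M: "finite_measure M" and F: "F : Borel M"
  and le: "!!A. A : sets M ==> (\<integral>\<^sup>+x. indicator A x * F x \<partial>M) <= ennreal C * emeasure M A"
 shows "AE x in M. F x <= ennreal C"
proof -
 interpret finite_measure M by fact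
 note [measurable] = F
 define A where "A = {x : space M. ennreal C < F x}"
 have A [measurable]: "A : sets M" unfolding A_def by measurable
 have "(\<integral>\<^sup>+x. indicator A x * F x \<partial>M) = (\<integral>\<^sup>+x. indicator A x * (F x - ennreal C) + ennreal C * indicator A x \<partial>M)"
  by (intro nn_integral_cong) (auto simp: A_def indicator_def diff_add_cancel_ennreal less_imp_le)
 also have "... = (\<integral>\<^sup>+x. indicator A x * (F x - ennreal C) \<partial>M) + ennreal C * emeasure M A"
  by (subst nn_integral_add) (auto simp: nn_integral_cmult)
 finally have "(\<integral>\<^sup>+x. indicator A x * (F x - ennreal C) \<partial>M) + ennreal C * emeasure M A <= 0 + ennreal C * emeasure M A"
  using le[OF A] by simp
 moreover have "ennreal C * emeasure M A \<noteq> \<infinity>" using emeasure_finite[of A] by (simp add: ennreal_mult_eq_top_iff)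
 ultimately have "(\<integral>\<^sup>+x. indicator A x * (F x - ennreal C) \<partial>M) = 0"
  by (metis add.commute ennreal_add_left_cancel_le le_zero_eq infinity_ennreal_def)
 hence "AE x in M. indicator A x * (F x - ennreal C) = 0" by (subst (asm) nn_integral_0_iff_AE) auto
 thus ?thesis
 proof (rule AE_mp, intro AE_I2 impI)
  fix x assume x: "x : space M" "indicator A x * (F x - ennreal C) = 0"
  show "F x <= ennreal C"
  proof (cases "x : A")
   case True
   hence "F x - ennreal C = 0" using x(2) by simp
   thus ?thesis by (rule ennreal_minus_eq_0)
  next
   case False
   thus ?thesis using x(1) by (simp add: A_def)
  qed
 qed
qed

context coagulation_cauchy
begin

definition K3 :: real where "K3 = C3 * (2 * K + M2)"

lemma K3_nonneg: "0 <= K3" using C3_pos K1 M2_nonneg by (simp add: K3_def)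

lemma N_mass1: "(\<integral>\<^sup>+z. ennreal (snd z) \<partial>N s) <= ennreal (2 * K)"
proof -
 have "(\<integral>\<^sup>+z. ennreal (snd z) \<partial>N s) <= (\<integral>\<^sup>+z. ennreal (om (snd z)) + ennreal ((snd z)\<^sup>2) \<partial>N s)"
 proof (rule nn_integral_mono)
  fix z assume "z : space (N s)"
  hence m: "0 <= snd z" by auto
  have "ennreal (snd z) <= ennreal (om (snd z) + (snd z)\<^sup>2)" by (rule ennreal_leI[OF mass_le_dom[OF m]])
  also have "... = ennreal (om (snd z)) + ennreal ((snd z)\<^sup>2)" by (rule ennreal_plus) (use om_nonneg[OF m] in auto)
  finally show "ennreal (snd z) <= ennreal (om (snd z)) + ennreal ((snd z)\<^sup>2)" .
 qed
 also have "... = (\<integral>\<^sup>+z. ennreal (om (snd z)) \<partial>N s) + (\<integral>\<^sup>+z. ennreal ((snd z)\<^sup>2) \<partial>N s)"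
  by (rule nn_integral_add) measurable
 also have "... <= ennreal K + ennreal K" by (intro add_mono N_om N_mass2)
 also have "... = ennreal (2 * K)" using K1 by (subst ennreal_plus[symmetric]) auto
 finally show ?thesis .
qed

lemma N_om_sq: "(\<integral>\<^sup>+z. ennreal ((om (snd z))\<^sup>2) \<partial>N s) <= ennreal K3"
proof -
 have "(\<integral>\<^sup>+z. ennreal ((om (snd z))\<^sup>2) \<partial>N s) <= (\<integral>\<^sup>+z. ennreal C3 * (ennreal (snd z) + ennreal ((a (snd z))\<^sup>2)) \<partial>N s)"
 proof (rule nn_integral_mono_AE)
  show "AE z in N s. ennreal ((om (snd z))\<^sup>2) <= ennreal C3 * (ennreal (snd z) + ennreal ((a (snd z))\<^sup>2))" using AE_N_pos
  proof eventually_elim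
   case (elim z)
   have "ennreal C3 * (ennreal (snd z) + ennreal ((a (snd z))\<^sup>2)) = ennreal (C3 * (snd z + (a (snd z))\<^sup>2))"
    using elim C3_pos by (subst ennreal_plus[symmetric]) (auto simp: ennreal_mult)
   thus ?case using om_sq_le[OF elim] by (simp add: ennreal_leI)
  qed
 qed
 also have "... = ennreal C3 * ((\<integral>\<^sup>+z. ennreal (snd z) \<partial>N s) + (\<integral>\<^sup>+z. ennreal ((a (snd z))\<^sup>2) \<partial>N s))"
  by (subst nn_integral_cmult) (simp_all add: nn_integral_add)
 also have "... <= ennreal C3 * (ennreal (2 * K) + ennreal M2)" by (intro mult_left_mono add_mono N_mass1 N_a_sq) auto
 also have "... = ennreal K3" using C3_pos K1 M2_nonneg by (subst ennreal_plus[symmetric]) (auto simp: K3_def ennreal_mult)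
 finally show ?thesis .
qed

lemma q_om:
 "(\<integral>\<^sup>+z. ennreal (om (fst (snd z))) \<partial>q s) <= ennreal (K * K3)" "(\<integral>\<^sup>+z. ennreal (om (snd (snd z))) \<partial>q s) <= ennreal (K * K3)"
proof -
 have m: "(%z. ennreal (om (snd z))) : Borel TH" by measurable
 have "ennreal K * (\<integral>\<^sup>+z. ennreal (om (snd z)) * ennreal (om (snd z)) \<partial>N s) = ennreal K * (\<integral>\<^sup>+z. ennreal ((om (snd z))\<^sup>2) \<partial>N s)"
  by (intro arg_cong[where f="(*) (ennreal K)"] nn_integral_cong) (auto simp: power2_eq_square ennreal_mult om_nonneg)
 also have "... <= ennreal K * ennreal K3" by (intro mult_left_mono N_om_sq) simp
 also have "... = ennreal (K * K3)" using K1 K3_nonneg by (simp add: ennreal_mult)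
 finally have *: "ennreal K * (\<integral>\<^sup>+z. ennreal (om (snd z)) * ennreal (om (snd z)) \<partial>N s) <= ennreal (K * K3)" .
 show "(\<integral>\<^sup>+z. ennreal (om (fst (snd z))) \<partial>q s) <= ennreal (K * K3)" "(\<integral>\<^sup>+z. ennreal (om (snd (snd z))) \<partial>q s) <= ennreal (K * K3)"
  using order_trans[OF q_le_fst[OF m, of s] *] order_trans[OF q_le_snd[OF m, of s] *] by auto
qed

lemma om_THH_measurable:
 "(%z. om (fst (snd z))) : Borel THH" "(%z. om (snd (snd z))) : Borel THH" by (rule measurable_compose[OF _ om_measurable], measurable)+

lemma integrable_q_oms:
 "integrable (q s) (%z. om (fst (snd z)))" "integrable (q s) (%z. om (snd (snd z)))"
 "(\<integral>z. om (fst (snd z)) \<partial>q s) <= K * K3" "(\<integral>z. om (snd (snd z)) \<partial>q s) <= K * K3"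
proof -
 have 1: "(\<integral>\<^sup>+z. ennreal (norm (om (fst (snd z)))) \<partial>q s) = (\<integral>\<^sup>+z. ennreal (om (fst (snd z))) \<partial>q s)"
  by (intro nn_integral_cong) (simp add: om_nonneg mem_Times_iff)
 have 2: "(\<integral>\<^sup>+z. ennreal (norm (om (snd (snd z)))) \<partial>q s) = (\<integral>\<^sup>+z. ennreal (om (snd (snd z))) \<partial>q s)"
  by (intro nn_integral_cong) (simp add: om_nonneg mem_Times_iff)
 show "integrable (q s) (%z. om (fst (snd z)))" "integrable (q s) (%z. om (snd (snd z)))" unfolding integrable_iff_bounded 1 2 using q_om[of s] om_THH_measurable
  by (auto simp: less_top[symmetric] top_unique)
 show "(\<integral>z. om (fst (snd z)) \<partial>q s) <= K * K3"
  by (rule integral_le_nn_integral[OF _ _ q_om(1)]) (use om_THH_measurable K1 K3_nonneg in \<open>auto simp: om_nonneg\<close>)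
 show "(\<integral>z. om (snd (snd z)) \<partial>q s) <= K * K3"
  by (rule integral_le_nn_integral[OF _ _ q_om(2)]) (use om_THH_measurable K1 K3_nonneg in \<open>auto simp: om_nonneg\<close>)
qed

lemma gl_om_bound:
 assumes b: "!!z. z : space TH ==> \<bar>f z\<bar> <= C * om (snd z)"
 shows "AE z in q s. \<bar>gl f z\<bar> <= 2 * C * (om (fst (snd z)) + om (snd (snd z)))" using AE_q_pos AE_space
proof eventually_elim
 case (elim z)
 obtain x m m' where zz: "z = (x, m, m')" by (cases z)
 have m: "0 < m" "0 < m'" and x: "x : {0..<1}" using elim zz by auto
 have "(x, m + m') : space TH" "(x, m) : space TH" "(x, m') : space TH" using m x by (auto simp: pair_space)
 from this[THEN b] have 1: "\<bar>f (x, m + m')\<bar> <= C * om (m + m')" "\<bar>f (x, m)\<bar> <= C * om m" "\<bar>f (x, m')\<bar> <= C * om m'" by auto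
 have "0 <= C * om m" using 1(2) by linarith
 hence C: "0 <= C" using om_ge1[of m] m by (simp add: zero_le_mult_iff)
 have "C * om (m + m') <= C * (om m + om m')" using om_subadditive[OF m] C by (rule mult_left_mono)
 thus ?case using 1 unfolding gl_def zz by (simp add: algebra_simps)
qed

lemma integrable_q_om:
 assumes f: "f : Borel TH" and b: "!!z. z : space TH ==> \<bar>f z\<bar> <= C * om (snd z)"
 shows "integrable (q s) (gl f)" and "\<bar>coll s f\<bar> <= 4 * C * (K * K3)"
proof -
 have "0 <= C * om 0" using order_trans[OF abs_ge_zero b[of "(0, 0)"]] by (simp add: pair_space)
 hence C: "0 <= C" using om_ge1[of 0] by (simp add: zero_le_mult_iff)
 have i2: "integrable (q s) (%z. 2 * C * (om (fst (snd z)) + om (snd (snd z))))"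
  using integrable_q_oms(1,2) by (intro integrable_mult_right Bochner_Integration.integrable_add)
 show i: "integrable (q s) (gl f)"
 proof (rule Bochner_Integration.integrable_bound[OF i2])
  have "AE z in q s. \<bar>gl f z\<bar> <= 2 * C * (om (fst (snd z)) + om (snd (snd z)))" by (rule gl_om_bound[OF b])
  thus "AE z in q s. norm (gl f z) <= norm (2 * C * (om (fst (snd z)) + om (snd (snd z))))" by eventually_elim (metis abs_ge_self order_trans real_norm_def)
 qed (use f in simp)
 have "\<bar>coll s f\<bar> <= (\<integral>z. \<bar>gl f z\<bar> \<partial>q s)" unfolding coll_def by (rule integral_abs_bound)
 also have "... <= (\<integral>z. 2 * C * (om (fst (snd z)) + om (snd (snd z))) \<partial>q s)"
  by (rule integral_mono_AE[OF integrable_abs[OF i] i2 gl_om_bound[OF b]])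
 also have "... = 2 * C * ((\<integral>z. om (fst (snd z)) \<partial>q s) + (\<integral>z. om (snd (snd z)) \<partial>q s))" using integrable_q_oms[of s] by simp
 also have "... <= 2 * C * (K * K3 + K * K3)" using integrable_q_oms[of s] C by (intro mult_left_mono add_mono) auto
 finally show "\<bar>coll s f\<bar> <= 4 * C * (K * K3)" by simp
qed

lemma coll_tendsto_om:
 assumes F: "!!i::nat. F i : Borel TH" and f: "f : Borel TH"
  and b: "!!i z. z : space TH ==> \<bar>F i z\<bar> <= C * om (snd z)"
  and l: "!!z. z : space TH ==> (%i. F i z) \<longlonglongrightarrow> f z"
 shows "(%i. coll s (F i)) \<longlonglongrightarrow> coll s f" unfolding coll_def
proof (rule integral_dominated_convergence)
 show "integrable (q s) (%z. 2 * C * (om (fst (snd z)) + om (snd (snd z))))"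
  using integrable_q_oms(1,2) by (intro integrable_mult_right Bochner_Integration.integrable_add)
 show "AE z in q s. (%i. gl (F i) z) \<longlonglongrightarrow> gl f z" using gl_tendsto[OF l] by (intro AE_I2)
 show "AE z in q s. norm (gl (F i) z) <= 2 * C * (om (fst (snd z)) + om (snd (snd z)))" for i using gl_om_bound[OF b] by simp
qed (use F f in auto)

lemma heat_om_bound:
 assumes b: "!!z. z : space TH ==> \<bar>f z\<bar> <= C * om (snd z)" and z: "z : space TH"
 shows "\<bar>heat a r f z\<bar> <= C * om (snd z)"
proof -
 obtain x m where zz: "z = (x, m)" by (cases z)
 have "\<bar>f (y, m)\<bar> <= C * om m" if "y : {0..<1}" for y using b[of "(y, m)"] that z zz by (auto simp: pair_space)
 thus ?thesis unfolding zz snd_conv by (rule heat_bound)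
qed

lemma heat_cmult: "heat a r (%z. ph (snd z) * f z) = (%z. ph (snd z) * heat a r f z)" by (auto simp: heat_def smooth_cmult fun_eq_iff)

text \<open>Truncation to a band of masses gives bounded functions, and the second moment bounds dominate both the numbers and the collision terms.\<close>
lemma mild_om:
 assumes f: "f : Borel TH" and b: "!!z. z : space TH ==> \<bar>f z\<bar> <= C * om (snd z)"
 shows "mild f"
proof -
 have "0 <= C * om 0" using order_trans[OF abs_ge_zero b[of "(0, 0)"]] by (simp add: pair_space)
 hence C: "0 <= C" using om_ge1[of 0] by (simp add: zero_le_mult_iff)
 define I where "I i = {1 / real (Suc i)..real (Suc i)}" for i
 define F where "F i z = indicator (I i) (snd z) * f z" for i z
 define f0 where "f0 z = indicator {0<..} (snd z) * f z" for z
 have im: "(%z. indicator A (snd z) * f z) : Borel TH" if "A : sets borel" for A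
 proof -
  have "(indicator A :: real => real) : Borel halfline" by (rule borel_measurable_halfline) (use that in simp)
  thus ?thesis by (intro borel_measurable_times f measurable_compose[OF measurable_snd])
 qed
 have Fm: "F i : Borel TH" for i unfolding F_def by (rule im) (simp add: I_def)
 have f0m: "f0 : Borel TH" unfolding f0_def by (rule im) simp
 have Fo: "\<bar>F i z\<bar> <= C * om (snd z)" if "z : space TH" for i z
 proof -
  have "\<bar>F i z\<bar> <= \<bar>f z\<bar>" by (auto simp: F_def indicator_def)
  thus ?thesis using b[OF that] by linarith
 qed
 have Fb: "\<exists>B. \<forall>z\<in>space TH. \<bar>F i z\<bar> <= B" for i
 proof (intro exI ballI)
  fix z assume z: "z : space TH"
  let ?B = "C * ((1 + c + a 1) * (real (Suc i) powr p + a (1 / real (Suc i)) + 1))"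
  show "\<bar>F i z\<bar> <= ?B"
  proof (cases "snd z : I i")
   case True
   hence m: "1 / real (Suc i) <= snd z" "snd z <= real (Suc i)" by (auto simp: I_def)
   have pos: "0 < 1 / real (Suc i)" by simp
   have "om (snd z) <= (1 + c + a 1) * (real (Suc i) powr p + a (1 / real (Suc i)) + 1)" unfolding om_expand
   proof (intro mult_left_mono add_mono)
    show "snd z powr p <= real (Suc i) powr p" by (rule powr_mono2) (use m pos p_range in linarith)+
    show "a (snd z) <= a (1 / real (Suc i))" by (rule a_mono[OF pos m(1)])
   qed (use c_pos a_pos[of 1] in auto)
   hence "C * om (snd z) <= ?B" using C by (rule mult_left_mono)
   thus ?thesis using Fo[OF z, of i] by linarith
  next
   case False
   have "0 <= a (1 / real (Suc i))" by (rule a_nonneg) simp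
   thus ?thesis using False C c_pos a_pos[of 1] by (simp add: F_def)
  qed
 qed
 have Fl: "(%i. F i z) \<longlonglongrightarrow> f0 z" for z unfolding F_def f0_def
 proof (intro tendsto_mult tendsto_const)
  show "(%i. indicator (I i) (snd z) :: real) \<longlonglongrightarrow> indicator {0<..} (snd z)"
  proof (cases "0 < snd z")
   case True
   have 1: "\<forall>\<^sub>F i in sequentially. 1 / real (Suc i) < snd z" by (rule order_tendstoD(2)[OF LIMSEQ_Suc[OF lim_1_over_n] True])
   obtain n0 :: nat where n0: "snd z <= real n0" using real_arch_simple by blast
   have 2: "\<forall>\<^sub>F i in sequentially. snd z <= real (Suc i)" by (rule eventually_sequentiallyI[of n0]) (use n0 in linarith)
   have "\<forall>\<^sub>F i in sequentially. (indicator (I i) (snd z) :: real) = indicator {0<..} (snd z)"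
    using 1 2 by eventually_elim (use True in \<open>auto simp: indicator_def I_def\<close>)
   thus ?thesis by (rule tendsto_eventually)
  next
   case False
   have "\<not> 1 / real (Suc i) <= snd z" for i using False by (smt (verit) divide_pos_pos of_nat_0_less_iff zero_less_Suc)
   thus ?thesis using False by (simp add: indicator_def I_def)
  qed
 qed
 have f0o: "\<bar>f0 z\<bar> <= C * om (snd z)" if "z : space TH" for z by (rule LIMSEQ_le_const2[OF tendsto_rabs[OF Fl]]) (use Fo that in auto)
 have hF: "heat a r (F i) = (%z. indicator (I i) (snd z) * heat a r f z)" for r i unfolding F_def[abs_def] by (rule heat_cmult)
 have hf0: "heat a r f0 = (%z. indicator {0<..} (snd z) * heat a r f z)" for r unfolding f0_def[abs_def] by (rule heat_cmult)
 have hl: "(%i. heat a r (F i) z) \<longlonglongrightarrow> heat a r f0 z" if z: "z : space TH" for r z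
 proof -
  obtain x m where zz: "z = (x, m)" by (cases z)
  have m: "0 <= m" using z zz by (auto simp: pair_space)
  show ?thesis unfolding zz
  proof (rule heat_tendsto[OF Fm f0m _ Fl m, where C="C * om m"])
   fix i y assume "y : {0..<1::real}"
   thus "\<bar>F i (y, m)\<bar> <= C * om m" using Fo[of "(y, m)" i] m by (simp add: pair_space)
  qed
 qed
 note hm = heat_measurable[OF a_measurable]
 have dom: "\<bar>u\<bar> <= C * (om (snd z) + (snd z)\<^sup>2)" if "\<bar>u\<bar> <= C * om (snd z)" for u :: real and z :: "real \<times> real"
 proof -
  have "C * om (snd z) <= C * (om (snd z) + (snd z)\<^sup>2)" using C by (intro mult_left_mono) auto
  with that show ?thesis by linarith
 qed
 have mF: "mild (F i)" for i
 proof -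
  obtain B where "\<forall>z\<in>space TH. \<bar>F i z\<bar> <= B" using Fb by blast
  thus ?thesis by (intro mild_bounded[OF Fm, of i B]) auto
 qed
 have lc: "(%i. coll s (heat a r (F i))) \<longlonglongrightarrow> coll s (heat a r f0)" for s r
  by (rule coll_tendsto_om[OF hm[OF Fm] hm[OF f0m] heat_om_bound[OF Fo] hl])
 have mm: "(%s. coll s (heat a (max 0 (t - s)) (F i))) : Borel borel" for t i using mF[of i] by (auto simp: mild_def)
 have mf: "(%s. coll s (heat a (max 0 (t - s)) f0)) : Borel borel" for t by (rule borel_measurable_LIMSEQ_real[OF lc mm])
 have bb: "\<bar>coll s (heat a r (F i))\<bar> <= 4 * C * (K * K3)" for s r i by (rule integrable_q_om(2)[OF hm[OF Fm] heat_om_bound[OF Fo]])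
 have "mild f0" unfolding mild_def
 proof (intro conjI allI impI)
  show "(%s. coll s (heat a (max 0 (t - s)) f0)) : Borel borel" for t by (rule mf)
  fix t0 t assume t: "0 <= t0" "t0 <= t" "t <= T"
  have eq: "num t (F i) = num t0 (heat a (t - t0) (F i)) + tint t0 t (%s. coll s (heat a (max 0 (t - s)) (F i)))" for i using mF[of i] t by (auto simp: mild_def)
  have l1: "(%i. num t (F i)) \<longlonglongrightarrow> num t f0" by (rule num_tendsto[OF Fm f0m dom[OF Fo] Fl])
  have l2: "(%i. num t0 (heat a (t - t0) (F i))) \<longlonglongrightarrow> num t0 (heat a (t - t0) f0)"
   by (rule num_tendsto[OF hm[OF Fm] hm[OF f0m] dom[OF heat_om_bound[OF Fo]] hl])
  have l3: "(%i. tint t0 t (%s. coll s (heat a (max 0 (t - s)) (F i)))) \<longlonglongrightarrow> tint t0 t (%s. coll s (heat a (max 0 (t - s)) f0))"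
   by (rule tint_tendsto[OF mm bb mf lc])
  show "num t f0 = num t0 (heat a (t - t0) f0) + tint t0 t (%s. coll s (heat a (max 0 (t - s)) f0))"
   using LIMSEQ_unique[OF l1] tendsto_add[OF l2 l3] unfolding eq by blast
 qed
 moreover have "coll s (heat a r f0) = coll s (heat a r f)" for s r by (rule coll_cong[OF hm[OF f0m] hm[OF f]]) (simp add: hf0)
 moreover have "num s (heat a r f0) = num s (heat a r f)" for s r by (rule num_cong[OF hm[OF f0m] hm[OF f]]) (simp add: hf0)
 moreover have "num s f0 = num s f" for s by (rule num_cong[OF f0m f]) (simp add: f0_def)
 ultimately show ?thesis unfolding mild_def by simp
qed

lemma mild_equation:
 assumes "f : Borel TH" "!!z. z : space TH ==> \<bar>f z\<bar> <= C * om (snd z)"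
  and "0 <= t0" "t0 <= t" "t <= T"
 shows "num t f = num t0 (heat a (t - t0) f) + tint t0 t (%s. coll s (heat a (max 0 (t - s)) f))"
  and "(%s. coll s (heat a (max 0 (t - s)) f)) : Borel borel"
  and "\<bar>coll s (heat a (max 0 (t - s)) f)\<bar> <= 4 * C * (K * K3)"
proof -
 show "num t f = num t0 (heat a (t - t0) f) + tint t0 t (%s. coll s (heat a (max 0 (t - s)) f))"
  "(%s. coll s (heat a (max 0 (t - s)) f)) : Borel borel" using mild_om[OF assms(1,2)] assms(3-) unfolding mild_def by auto
 show "\<bar>coll s (heat a (max 0 (t - s)) f)\<bar> <= 4 * C * (K * K3)"
  by (rule integrable_q_om(2)[OF heat_measurable[OF a_measurable assms(1)] heat_om_bound[OF assms(2)]])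
qed

lemma heat_heat:
 fixes C :: real
 assumes f: "f : Borel TH" and b: "!!x. x : {0..<1} ==> \<bar>f (x, m)\<bar> <= C"
  and "0 <= r" "0 <= r'" "0 <= m"
 shows "heat a r (heat a r' f) (x, m) = heat a (r + r') f (x, m)"
proof -
 have "heat a r (heat a r' f) (x, m) = smooth (a m * r) (smooth (a m * r') (%y. f (y, m))) x" by (simp add: heat_def)
 also have "... = smooth (a m * r + a m * r') (%y. f (y, m)) x"
  by (rule smooth_smooth[OF slice_measurable[OF f \<open>0 <= m\<close>] b]) (use assms a_nonneg in auto)
 finally show ?thesis by (simp add: heat_def distrib_left)
qed

lemma heat_0: "x : {0..<1} ==> heat a 0 f (x, m) = f (x, m)" by (simp add: heat_def smooth_0)

end
context coagulation_cauchy
begin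

section \<open>Bounds uniform in the space variable\<close>

definition weight :: "(real => real) => real => bool" where
 "weight g C \<longleftrightarrow> g : Borel torus & (\<forall>x\<in>{0..<1}. 0 <= g x & g x <= C)"

lemma weightD:
 assumes "weight g C"
 shows "g : Borel torus" "x : {0..<1} ==> 0 <= g x" "x : {0..<1} ==> \<bar>g x\<bar> <= C" using assms by (auto simp: weight_def)

definition sm :: "(real => real) => real => real => real => real" where
 "sm g r x m = smooth (a m * r) g x"

lemma heat_tens_sm: "heat a r (tens g ph) z = ph (snd z) * sm g r (fst z) (snd z)"
 by (cases z) (simp add: heat_def tens_def sm_def mult.commute[of "g _"] smooth_cmult)

lemma sm_nonneg: "weight g C ==> 0 <= sm g r x m" unfolding sm_def by (rule smooth_nonneg) (rule weightD(2))

lemma sm_le: "weight g C ==> \<bar>sm g r x m\<bar> <= C" unfolding sm_def by (rule smooth_bound) (rule weightD(3))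

lemma sm_measurable: "weight g C ==> (%z. sm g r (fst z) (snd z)) : Borel TH"
proof -
 assume "weight g C"
 hence "heat a r (tens g (%_. 1)) : Borel TH" by (intro heat_measurable a_measurable tens_measurable weightD(1)) auto
 moreover have "heat a r (tens g (%_. 1)) = (%z. sm g r (fst z) (snd z))" by (rule ext) (simp add: heat_tens_sm)
 ultimately show ?thesis by simp
qed

lemma tens_weight_measurable: "weight g C ==> ph : Borel halfline ==> tens g ph : Borel TH" by (intro tens_measurable weightD(1))

lemma sm_antitone:
 assumes g: "weight g C" and r: "0 <= r" and m: "0 < m" "m <= m'"
 shows "sqrt (a m') * sm g r x m' <= sqrt (a m) * sm g r x m"
proof (cases "r = 0")
 case True
 have "sm g r x m' = sm g r x m" by (simp add: sm_def True)
 thus ?thesis using a_mono[OF m] sm_nonneg[OF g] by (auto intro!: mult_right_mono)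
next
 case False
 with r have rp: "0 < r" by simp
 have am: "0 < a m'" "a m' <= a m" using a_pos[of m'] a_mono[OF m] m by auto
 have "sqrt (a m' * r) * smooth (a m' * r) g x <= sqrt (a m * r) * smooth (a m * r) g x"
  by (rule smooth_compare[OF weightD(1)[OF g] weightD(3)[OF g] weightD(2)[OF g]])
   (use am rp in \<open>auto intro: mult_right_mono\<close>)
 hence "sqrt r * (sqrt (a m') * smooth (a m' * r) g x) <= sqrt r * (sqrt (a m) * smooth (a m * r) g x)" by (simp only: real_sqrt_mult mult_ac)
 moreover have "0 < sqrt r" using rp by simp
 ultimately have "sqrt (a m') * smooth (a m' * r) g x <= sqrt (a m) * smooth (a m * r) g x" by (simp only: mult_le_cancel_left_pos)
 thus ?thesis by (simp only: sm_def)
qed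

text \<open>The weights to which the comparison of heat kernels applies; the subadditivity assumption says that \<open>om\<close> is one of them.\<close>
definition tame :: "(real => real) => bool" where
 "tame ph \<longleftrightarrow> (\<forall>m m'. 0 < m --> 0 < m' --> ph (m + m') / sqrt (a (m + m')) <= ph m / sqrt (a m) + ph m' / sqrt (a m'))"

lemma tame_om: "tame om" unfolding tame_def
proof (intro allI impI)
 fix m m' :: real assume m: "0 < m" "0 < m'"
 have e: "a y powr (-1/2) * om y = om y / sqrt (a y)" if "0 < y" for y
 proof -
  have "a y powr (- (1/2)) = inverse (a y powr (1/2))" by (rule powr_minus)
  also have "a y powr (1/2) = sqrt (a y)" by (rule powr_half_sqrt) (use a_pos[OF that] in simp)
  finally have i: "a y powr (-1/2) = inverse (sqrt (a y))" by simp
  show ?thesis unfolding i by (simp add: divide_inverse)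
 qed
 show "om (m + m') / sqrt (a (m + m')) <= om m / sqrt (a m) + om m' / sqrt (a m')" using subadditive[OF m] unfolding e[OF m(1)] e[OF m(2)] e[OF add_pos_pos[OF m]] .
qed

text \<open>Write \<open>ph * P g\<close> as \<open>(ph / sqrt a) * (sqrt a * P g)\<close>. The first factor is subadditive and the second is nonincreasing in the mass, since \<open>a\<close> is nonincreasing.\<close>
lemma merge_le:
 assumes g: "weight g C" and r: "0 <= r" and m: "0 < m" "0 < m'"
  and ph: "tame ph" "!!m. 0 < m ==> 0 <= ph m"
 shows "ph (m + m') * sm g r x (m + m') <= ph m * sm g r x m + ph m' * sm g r x m'"
proof -
 define S where "S y = ph y / sqrt (a y)" for y
 define W where "W y = sqrt (a y) * sm g r x y" for y
 have SW: "ph y * sm g r x y = S y * W y" if "0 < y" for y using a_pos[OF that] by (simp add: S_def W_def)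
 have S0: "0 <= S y" if "0 < y" for y using ph(2)[OF that] a_pos[OF that] by (simp add: S_def)
 have W0: "0 <= W y" if "0 < y" for y using sm_nonneg[OF g] a_pos[OF that] by (simp add: W_def)
 have W1: "W (m + m') <= W m" "W (m + m') <= W m'" unfolding W_def by (rule sm_antitone[OF g r]; use m in simp)+
 have "S (m + m') * W (m + m') <= (S m + S m') * W (m + m')" using ph(1) m W0[of "m + m'"] unfolding tame_def S_def by (intro mult_right_mono) auto
 also have "... = S m * W (m + m') + S m' * W (m + m')" by (simp add: distrib_right)
 also have "... <= S m * W m + S m' * W m'" by (intro add_mono mult_left_mono W1 S0 m)
 finally show ?thesis using SW[of m] SW[of m'] SW[of "m + m'"] m by simp
qed

text \<open>Testing with \<open>ph P\<^sub>r g\<close> for all nonnegative \<open>g\<close> expresses a bound on the density in \<open>x\<close>. All \<open>r\<close> are included because the mild equation moves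
\<open>r\<close> to \<open>r + t\<close>.\<close>
definition bnd :: "(real => real) => (real => real) => bool" where
 "bnd ph B \<longleftrightarrow> (\<forall>s\<in>{0..T}. \<forall>r\<ge>0. \<forall>g C. weight g C \<longrightarrow>
   (\<integral>\<^sup>+z. ennreal (heat a r (tens g ph) z) \<partial>N s) <= ennreal (B s) * (total g))"

lemma bndD: "bnd ph B ==> s : {0..T} ==> 0 <= r ==> weight g C ==>
  (\<integral>\<^sup>+z. ennreal (heat a r (tens g ph) z) \<partial>N s) <= ennreal (B s) * (total g)" unfolding bnd_def by blast

lemma bnd_le:
 assumes "bnd ph B" "!!s. s : {0..T} ==> B s <= B' s"
 shows "bnd ph B'" unfolding bnd_def
proof (intro ballI allI impI)
 fix s r g C assume *: "s : {0..T}" "0 <= (r::real)" "weight g C"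
 have "ennreal (B s) * (total g) <= ennreal (B' s) * (total g)" using assms(2)[OF *(1)] by (intro mult_right_mono ennreal_leI) auto
 thus "(\<integral>\<^sup>+z. ennreal (heat a r (tens g ph) z) \<partial>N s) <= ennreal (B' s) * (total g)" by (rule order_trans[OF bndD[OF assms(1) *]])
qed

lemma bnd_dominated:
 assumes ps: "bnd ps B" "ps : Borel halfline" and ph: "!!m. 0 < m ==> ph m <= D * ps m" and D: "0 <= D"
 shows "bnd ph (%s. D * B s)" unfolding bnd_def
proof (intro ballI allI impI)
 fix s r g C assume *: "s : {0..T}" "0 <= (r::real)" "weight g C"
 have "(\<integral>\<^sup>+z. ennreal (heat a r (tens g ph) z) \<partial>N s) <= (\<integral>\<^sup>+z. ennreal D * ennreal (heat a r (tens g ps) z) \<partial>N s)"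
 proof (rule nn_integral_mono_AE)
  show "AE z in N s. ennreal (heat a r (tens g ph) z) <= ennreal D * ennreal (heat a r (tens g ps) z)" using AE_N_pos
  proof eventually_elim
   case (elim z)
   have "ph (snd z) * sm g r (fst z) (snd z) <= D * ps (snd z) * sm g r (fst z) (snd z)" by (rule mult_right_mono[OF ph[OF elim] sm_nonneg[OF *(3)]])
   thus ?case using D by (simp add: heat_tens_sm ennreal_mult'[symmetric] mult.assoc ennreal_leI)
  qed
 qed
 also have "... = ennreal D * (\<integral>\<^sup>+z. ennreal (heat a r (tens g ps) z) \<partial>N s)"
 proof (rule nn_integral_cmult)
  have "heat a r (tens g ps) : Borel TH" by (intro heat_measurable a_measurable tens_weight_measurable[OF *(3)] ps(2))
  thus "(%z. ennreal (heat a r (tens g ps) z)) : Borel (N s)" by simp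
 qed
 also have "... <= ennreal D * (ennreal (B s) * (total g))" by (intro mult_left_mono bndD[OF ps(1) *]) simp
 finally show "(\<integral>\<^sup>+z. ennreal (heat a r (tens g ph) z) \<partial>N s) <= ennreal (D * B s) * (total g)"
  using D by (simp add: ennreal_mult' mult.assoc)
qed

lemma bnd_add:
 assumes ph: "bnd ph B" "ph : Borel halfline" "!!m. 0 < m ==> 0 <= ph m" "!!s. 0 <= B s"
  and ps: "bnd ps B'" "ps : Borel halfline" "!!m. 0 < m ==> 0 <= ps m" "!!s. 0 <= B' s"
 shows "bnd (%m. ph m + ps m) (%s. B s + B' s)" unfolding bnd_def
proof (intro ballI allI impI)
 fix s r g C assume *: "s : {0..T}" "0 <= (r::real)" "weight g C"
 have m: "(%z. ennreal (heat a r (tens g h) z)) : Borel (N s)" if "h : Borel halfline" for h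
 proof -
  have "heat a r (tens g h) : Borel TH" by (intro heat_measurable a_measurable tens_weight_measurable[OF *(3)] that)
  thus ?thesis by simp
 qed
 have "(\<integral>\<^sup>+z. ennreal (heat a r (tens g (%m. ph m + ps m)) z) \<partial>N s)
   = (\<integral>\<^sup>+z. ennreal (heat a r (tens g ph) z) + ennreal (heat a r (tens g ps) z) \<partial>N s)"
 proof (rule nn_integral_cong_AE)
  show "AE z in N s. ennreal (heat a r (tens g (%m. ph m + ps m)) z) = ennreal (heat a r (tens g ph) z) + ennreal (heat a r (tens g ps) z)" using AE_N_pos
  proof eventually_elim
   case (elim z)
   show ?case using ph(3)[OF elim] ps(3)[OF elim] sm_nonneg[OF *(3)] by (simp add: heat_tens_sm distrib_right)
  qed
 qed
 also have "... = (\<integral>\<^sup>+z. ennreal (heat a r (tens g ph) z) \<partial>N s) + (\<integral>\<^sup>+z. ennreal (heat a r (tens g ps) z) \<partial>N s)"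
  by (rule nn_integral_add[OF m[OF ph(2)] m[OF ps(2)]])
 also have "... <= ennreal (B s) * (total g) + ennreal (B' s) * (total g)" by (intro add_mono bndD[OF ph(1) *] bndD[OF ps(1) *])
 also have "... = ennreal (B s + B' s) * (total g)" using ph(4) ps(4) by (simp add: distrib_right)
 finally show "(\<integral>\<^sup>+z. ennreal (heat a r (tens g (%m. ph m + ps m)) z) \<partial>N s) <= ennreal (B s + B' s) * (total g)" .
qed

lemma bnd_sup:
 fixes ph :: "nat => real => real"
 assumes b: "!!n. bnd (ph n) B" and m: "!!n. ph n : Borel halfline"
  and inc: "!!n y. 0 < y ==> ph n y <= ph (Suc n) y" and le: "!!n y. 0 < y ==> ph n y <= ps y"
  and ev: "!!y. 0 < y ==> \<exists>n. ph n y = ps y"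
 shows "bnd ps B" unfolding bnd_def
proof (intro ballI allI impI)
 fix s r g C assume *: "s : {0..T}" "0 <= (r::real)" "weight g C"
 define F where "F n z = ennreal (indicator {0<..} (snd z) * heat a r (tens g (ph n)) z)" for n z
 have Fm: "F n : Borel (N s)" for n
 proof -
  have "(indicator {0<..} :: real => real) : Borel halfline" by (rule borel_measurable_halfline) simp
  hence "(%z. indicator {0<..} (snd z) * heat a r (tens g (ph n)) z) : Borel TH"
   by (intro borel_measurable_times measurable_compose[OF measurable_snd] heat_measurable a_measurable tens_weight_measurable[OF *(3)] m)
  thus ?thesis unfolding F_def by simp
 qed
 have Finc: "incseq F"
 proof (rule incseq_SucI, rule le_funI)
  fix n z
  show "F n z <= F (Suc n) z"
  proof (cases "0 < snd z")
   case True
   thus ?thesis using inc[OF True] sm_nonneg[OF *(3)] by (auto simp: F_def heat_tens_sm intro!: ennreal_leI mult_right_mono)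
  qed (simp add: F_def)
 qed
 have "(\<integral>\<^sup>+z. ennreal (heat a r (tens g ps) z) \<partial>N s) = (\<integral>\<^sup>+z. (SUP n. F n z) \<partial>N s)"
 proof (rule nn_integral_cong_AE)
  show "AE z in N s. ennreal (heat a r (tens g ps) z) = (SUP n. F n z)" using AE_N_pos
  proof eventually_elim
   case (elim z)
   obtain n where n: "ph n (snd z) = ps (snd z)" using ev[OF elim] by blast
   show ?case
   proof (rule antisym)
    have "ennreal (heat a r (tens g ps) z) = F n z" using elim n by (simp add: F_def heat_tens_sm)
    also have "... <= (SUP n. F n z)" by (rule SUP_upper) simp
    finally show "ennreal (heat a r (tens g ps) z) <= (SUP n. F n z)" .
    show "(SUP n. F n z) <= ennreal (heat a r (tens g ps) z)" using le[OF elim] sm_nonneg[OF *(3)] elim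
     by (intro SUP_least) (auto simp: F_def heat_tens_sm intro!: ennreal_leI mult_right_mono)
   qed
  qed
 qed
 also have "... = (SUP n. \<integral>\<^sup>+z. F n z \<partial>N s)" by (rule nn_integral_monotone_convergence_SUP[OF Finc Fm])
 also have "... <= ennreal (B s) * (total g)"
 proof (rule SUP_least)
  fix n
  have "(\<integral>\<^sup>+z. F n z \<partial>N s) = (\<integral>\<^sup>+z. ennreal (heat a r (tens g (ph n)) z) \<partial>N s)"
   by (rule nn_integral_cong_AE) (use AE_N_pos in eventually_elim, simp add: F_def)
  thus "(\<integral>\<^sup>+z. F n z \<partial>N s) <= ennreal (B s) * (total g)" using bndD[OF b *] by simp
 qed
 finally show "(\<integral>\<^sup>+z. ennreal (heat a r (tens g ps) z) \<partial>N s) <= ennreal (B s) * (total g)" .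
qed

lemma bnd_AE:
 assumes b: "bnd ph B" and ph: "ph : Borel halfline" and s: "s : {0..T}"
 shows "AE x in torus. (\<integral>\<^sup>+m. ennreal (ph m) \<partial>nk s x) <= ennreal (B s)"
proof (rule AE_le_of_weighted_integrals)
 have m: "(%z. ennreal (ph (snd z))) : Borel TH" using measurable_compose[OF measurable_snd ph, of torus] by simp
 show F: "(%x. \<integral>\<^sup>+m. ennreal (ph m) \<partial>nk s x) : Borel torus" using finite_kernel_nn_integral[OF finite_kernel_nk m] by simp
 show "finite_measure torus" by (rule torus.finite_measure_axioms)
 fix A assume A: "A : sets torus"
 have w: "weight (indicator A) 1" using A by (auto simp: weight_def indicator_def)
 have hm: "(%z. ennreal (heat a 0 (tens (indicator A) ph) z)) : Borel TH"
 proof -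
  have "heat a 0 (tens (indicator A) ph) : Borel TH" by (intro heat_measurable a_measurable tens_weight_measurable[OF w] ph)
  thus ?thesis by simp
 qed
 have "(\<integral>\<^sup>+x. indicator A x * (\<integral>\<^sup>+m. ennreal (ph m) \<partial>nk s x) \<partial>torus) = (\<integral>\<^sup>+x. \<integral>\<^sup>+m. ennreal (heat a 0 (tens (indicator A) ph) (x, m)) \<partial>nk s x \<partial>torus)"
 proof (rule nn_integral_cong)
  fix x assume x: "x : space torus"
  have "(\<integral>\<^sup>+m. ennreal (heat a 0 (tens (indicator A) ph) (x, m)) \<partial>nk s x) = (\<integral>\<^sup>+m. indicator A x * ennreal (ph m) \<partial>nk s x)"
  proof (rule nn_integral_cong)
   fix m
   have "heat a 0 (tens (indicator A) ph) (x, m) = tens (indicator A) ph (x, m)" by (rule heat_0) (use x in simp)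
   thus "ennreal (heat a 0 (tens (indicator A) ph) (x, m)) = indicator A x * ennreal (ph m)" by (simp add: tens_def indicator_def)
  qed
  also have "... = indicator A x * (\<integral>\<^sup>+m. ennreal (ph m) \<partial>nk s x)"
   using finite_kernel_measurable[OF finite_kernel_nk x m, of s] by (intro nn_integral_cmult) simp
  finally show "indicator A x * (\<integral>\<^sup>+m. ennreal (ph m) \<partial>nk s x) = (\<integral>\<^sup>+m. ennreal (heat a 0 (tens (indicator A) ph) (x, m)) \<partial>nk s x)" by simp
 qed
 also have "... = (\<integral>\<^sup>+z. ennreal (heat a 0 (tens (indicator A) ph) z) \<partial>N s)" by (rule nn_integral_N[OF hm, symmetric])
 also have "... <= ennreal (B s) * (\<integral>\<^sup>+x. ennreal (indicator A x) \<partial>torus)" by (rule bndD[OF b s _ w]) simp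
 also have "(\<integral>\<^sup>+x. ennreal (indicator A x) \<partial>torus) = emeasure torus A" using A by (simp add: ennreal_indicator)
 finally show "(\<integral>\<^sup>+x. indicator A x * (\<integral>\<^sup>+m. ennreal (ph m) \<partial>nk s x) \<partial>torus) <= ennreal (B s) * emeasure torus A" .
qed

lemma initial_bound:
 assumes ph: "ph : Borel halfline" "!!m. 0 < m ==> 0 <= ph m"
  and M: "(\<integral>\<^sup>+m. ennreal (1 / m) * ennreal (ph m) \<partial>\<nu>s) <= ennreal M" and g: "weight g C"
 shows "(\<integral>\<^sup>+z. ennreal (heat a r (tens g ph) z) \<partial>N 0) <= ennreal M * (total g)"
proof -
 have hm: "(%z. ennreal (heat a r (tens g ph) z)) : Borel TH"
 proof -
  have "heat a r (tens g ph) : Borel TH" by (intro heat_measurable a_measurable tens_weight_measurable[OF g] ph)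
  thus ?thesis by simp
 qed
 have "(\<integral>\<^sup>+z. ennreal (heat a r (tens g ph) z) \<partial>N 0)
   <= (\<integral>\<^sup>+m. ennreal (1 / m) * (\<integral>\<^sup>+x. ennreal (heat a r (tens g ph) (x, m)) \<partial>torus) \<partial>\<nu>s)"
  by (rule N0_le[OF hm])
 also have "... = (\<integral>\<^sup>+m. (ennreal (1 / m) * ennreal (ph m)) * (total g) \<partial>\<nu>s)"
 proof (rule nn_integral_cong)
  fix m assume "m : space \<nu>s"
  hence m: "0 <= m" using sets_eq_imp_space_eq[OF nustar(1)] by simp
  show "ennreal (1 / m) * (\<integral>\<^sup>+x. ennreal (heat a r (tens g ph) (x, m)) \<partial>torus)
    = (ennreal (1 / m) * ennreal (ph m)) * (total g)"
  proof (cases "m = 0")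
   case False
   hence p: "0 <= ph m" using ph(2)[of m] m by simp
   have mm: "(%x. ennreal (smooth (a m * r) g x)) : Borel torus"
    using measurable_compose[OF measurable_Pair2'[of m halfline torus] sm_measurable[OF g]] m by (simp add: sm_def)
   have "(\<integral>\<^sup>+x. ennreal (heat a r (tens g ph) (x, m)) \<partial>torus) = (\<integral>\<^sup>+x. ennreal (ph m) * ennreal (smooth (a m * r) g x) \<partial>torus)"
    using p by (simp add: heat_tens_sm sm_def ennreal_mult')
   also have "... = ennreal (ph m) * (\<integral>\<^sup>+x. ennreal (smooth (a m * r) g x) \<partial>torus)" by (rule nn_integral_cmult[OF mm])
   also have "(\<integral>\<^sup>+x. ennreal (smooth (a m * r) g x) \<partial>torus) = (total g)"
    by (rule nn_integral_torus_smooth[OF weightD(1)[OF g] weightD(3)[OF g] weightD(2)[OF g]])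
   finally show ?thesis by (simp add: mult.assoc)
  qed simp
 qed
 also have "... = (\<integral>\<^sup>+m. ennreal (1 / m) * ennreal (ph m) \<partial>\<nu>s) * (total g)"
 proof (rule nn_integral_multc)
  have "(%m. ennreal (1 / m) * ennreal (ph m)) : Borel halfline" using ph(1) by measurable
  thus "(%m. ennreal (1 / m) * ennreal (ph m)) : Borel \<nu>s" unfolding measurable_cong_sets[OF nustar(1) refl] .
 qed
 also have "... <= ennreal M * (total g)" by (rule mult_right_mono[OF M]) simp
 finally show ?thesis .
qed

lemma heat_tens_om:
 assumes ph: "!!m. 0 <= m ==> 0 <= ph m & ph m <= D * om m" and g: "weight g C" and z: "z : space TH"
 shows "0 <= heat a r (tens g ph) z" and "\<bar>heat a r (tens g ph) z\<bar> <= (D * C) * om (snd z)"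
proof -
 have m: "0 <= snd z" using z by (auto simp: pair_space)
 show 1: "0 <= heat a r (tens g ph) z" unfolding heat_tens_sm using ph[OF m] sm_nonneg[OF g] by simp
 have "ph (snd z) * sm g r (fst z) (snd z) <= (D * om (snd z)) * C" using ph[OF m] sm_le[OF g] sm_nonneg[OF g]
  by (intro mult_mono) (auto simp: abs_le_iff intro: order_trans)
 thus "\<bar>heat a r (tens g ph) z\<bar> <= (D * C) * om (snd z)" using 1 by (simp add: heat_tens_sm mult_ac)
qed

text \<open>The mild equation from time zero, with the initial term estimated by the majorant \<open>\<nu>s\<close> and the source by the assumed gain.\<close>
lemma bnd_propagate:
 assumes ph: "ph : Borel halfline" "!!m. 0 <= m ==> 0 <= ph m & ph m <= D * om m"
  and M: "(\<integral>\<^sup>+m. ennreal (1 / m) * ennreal (ph m) \<partial>\<nu>s) <= ennreal M" "0 <= M"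
  and gain: "!!g C \<tau> r. weight g C ==> \<tau> : {0..T} ==> 0 <= r ==>
    coll \<tau> (heat a r (tens g ph)) <= b \<tau> * enn2real (total g)"
  and b: "b : Borel borel" "!!\<tau>. \<bar>b \<tau>\<bar> <= Bb" and Bs: "!!s. s : {0..T} ==> M + tint 0 s b <= B s" "!!s. 0 <= B s"
 shows "bnd ph B" unfolding bnd_def
proof (intro ballI allI impI)
 fix s r g C assume *: "s : {0..T}" "0 <= (r::real)" and g: "weight g C"
 define G where "G = enn2real (total g)"
 have Gfin: "(total g) = ennreal G"
 proof -
  have "(total g) <= (\<integral>\<^sup>+x. ennreal C \<partial>torus)" using weightD(3)[OF g] by (intro nn_integral_mono ennreal_leI) (auto simp: abs_le_iff)
  also have "... < \<infinity>" using torus.emeasure_space_1 by simp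
  finally show ?thesis by (simp add: G_def)
 qed
 have G0: "0 <= G" by (simp add: G_def)
 let ?f = "%r. heat a r (tens g ph)"
 have fm: "?f r : Borel TH" for r by (intro heat_measurable a_measurable tens_weight_measurable[OF g] ph(1))
 note fb = heat_tens_om[OF ph(2) g]
 have nn: "(\<integral>\<^sup>+z. ennreal (?f r z) \<partial>N \<tau>) = ennreal (num \<tau> (?f r))" for r \<tau> unfolding num_def
 proof (rule nn_integral_eq_integral)
  show "integrable (N \<tau>) (?f r)" by (rule integrable_N_om(1)[OF fm fb(2)])
  show "AE z in N \<tau>. 0 <= ?f r z" using fb(1) by (intro AE_I2) (auto simp: pair_space)
 qed
 have semi: "heat a r' (?f r) (x, m) = ?f (r' + r) (x, m)" if "0 <= r'" "0 <= m" for r' x m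
 proof (rule heat_heat[OF tens_weight_measurable[OF g ph(1)] _ that(1) *(2) that(2)])
  fix x :: real assume "x : {0..<1}"
  thus "\<bar>tens g ph (x, m)\<bar> <= C * \<bar>ph m\<bar>" using weightD(3)[OF g] by (simp add: tens_def abs_mult mult_right_mono)
 qed
 have s0: "0 <= s" "s <= T" using *(1) by auto
 have cs: "coll \<tau> (heat a r' (?f r)) = coll \<tau> (?f (r' + r))" if "0 <= r'" for \<tau> r'
  by (rule coll_cong[OF heat_measurable[OF a_measurable fm] fm]) (rule semi[OF that], simp)
 have ns: "num \<tau> (heat a r' (?f r)) = num \<tau> (?f (r' + r))" if "0 <= r'" for \<tau> r'
  by (rule num_cong[OF heat_measurable[OF a_measurable fm] fm]) (rule semi[OF that], simp)
 have e1: "num s (?f r) = num 0 (heat a (s - 0) (?f r)) + tint 0 s (%\<tau>. coll \<tau> (heat a (max 0 (s - \<tau>)) (?f r)))"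
  by (rule mild_equation(1)[OF fm fb(2) order_refl s0])
 have e2: "num 0 (heat a (s - 0) (?f r)) = num 0 (?f (s + r))" unfolding diff_zero by (rule ns[OF s0(1)])
 have e3: "tint 0 s (%\<tau>. coll \<tau> (heat a (max 0 (s - \<tau>)) (?f r))) <= tint 0 s (%\<tau>. b \<tau> * G)"
 proof (rule tint_mono)
  show "(%\<tau>. coll \<tau> (heat a (max 0 (s - \<tau>)) (?f r))) : Borel borel" by (rule mild_equation(2)[OF fm fb(2), of 0 s]) (use s0 in auto)
  show "\<bar>coll \<tau> (heat a (max 0 (s - \<tau>)) (?f r))\<bar> <= 4 * (D * C) * (K * K3)" for \<tau>
   by (rule mild_equation(3)[OF fm fb(2), of 0 s]) (use s0 in auto)
  show "(%\<tau>. b \<tau> * G) : Borel borel" by (rule borel_measurable_times[OF b(1) borel_measurable_const])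
  show "\<bar>b \<tau> * G\<bar> <= Bb * G" for \<tau> unfolding abs_mult abs_of_nonneg[OF G0] by (rule mult_right_mono[OF b(2) G0])
  fix \<tau> assume \<tau>: "0 < \<tau>" "\<tau> <= s"
  have "coll \<tau> (heat a (max 0 (s - \<tau>)) (?f r)) = coll \<tau> (?f (max 0 (s - \<tau>) + r))" by (rule cs) simp
  also have "... <= b \<tau> * G" unfolding G_def by (rule gain[OF g]) (use \<tau> s0 *(2) in auto)
  finally show "coll \<tau> (heat a (max 0 (s - \<tau>)) (?f r)) <= b \<tau> * G" .
 qed
 have e4: "tint 0 s (%\<tau>. b \<tau> * G) = G * tint 0 s b"
 proof -
  have "tint 0 s (%\<tau>. G * b \<tau> + 0 * b \<tau>) = G * tint 0 s b + 0 * tint 0 s b" by (rule tint_linear[OF b b])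
  thus ?thesis by (simp only: mult_zero_left add_0_right mult.commute[of G "b _"])
 qed
 have 1: "num s (?f r) <= num 0 (?f (s + r)) + G * tint 0 s b" unfolding e1 e2 by (rule add_left_mono[OF e3[unfolded e4]])
 have "ennreal (num 0 (?f (s + r))) <= ennreal M * ennreal G" using initial_bound[OF ph(1) _ M(1) g, of "s + r"] ph(2) unfolding nn Gfin by (simp add: less_imp_le)
 hence "num 0 (?f (s + r)) <= M * G" using M(2) G0 by (simp add: ennreal_mult[symmetric] ennreal_le_iff)
 hence "num s (?f r) <= (M + tint 0 s b) * G" using 1 by (simp add: algebra_simps)
 also have "... <= B s * G" using Bs(1)[OF *(1)] G0 by (rule mult_right_mono)
 finally show "(\<integral>\<^sup>+z. ennreal (?f r z) \<partial>N s) <= ennreal (B s) * (total g)"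
  unfolding nn Gfin using Bs(2)[of s] G0 by (simp add: ennreal_mult[symmetric] ennreal_leI)
qed

lemma bnd_tame:
 assumes ph: "ph : Borel halfline" "!!m. 0 <= m ==> 0 <= ph m & ph m <= D * om m" "tame ph"
  and le: "!!m. 0 < m ==> ph m <= (om m)\<^sup>2"
 shows "bnd ph (%_. M2)"
proof (rule bnd_propagate[OF ph(1,2) moment_le_M2[OF le] M2_nonneg, where b="%_. 0" and Bb=0])
 fix g C \<tau> r assume g: "weight g C" and r: "0 <= (r::real)"
 show "coll \<tau> (heat a r (tens g ph)) <= 0 * enn2real (total g)" unfolding mult_zero_left
 proof (rule coll_nonpos)
  fix x m m' :: real assume m: "0 < m" "0 < m'"
  show "heat a r (tens g ph) (x, m + m') <= heat a r (tens g ph) (x, m) + heat a r (tens g ph) (x, m')" unfolding heat_tens_sm fst_conv snd_conv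
   by (rule merge_le[OF g r m ph(3)]) (use ph(2) in \<open>simp add: less_imp_le\<close>)
 qed
qed (auto simp: tint_def M2_nonneg)

lemma om_le_sq: "0 <= m ==> om m <= (om m)\<^sup>2" using om_ge1[of m] mult_left_mono[of 1 "om m" "om m"] by (simp add: power2_eq_square)

lemma bnd_om: "bnd om (%_. M2)"
proof (rule bnd_tame[where D=1])
 show "0 <= om m & om m <= 1 * om m" if "0 <= m" for m using om_nonneg[OF that] by simp
 show "om m <= (om m)\<^sup>2" if "0 < m" for m by (rule om_le_sq) (use that in simp)
qed (rule om_measurable tame_om)+

text \<open>The truncation \<open>a * min a n\<close> is dominated by a multiple of \<open>om\<close>, and \<open>sqrt a * min a n\<close> is nonincreasing, hence subadditive.\<close>
lemma bnd_a_sq: "bnd (%m. (a m)\<^sup>2) (%_. M2)"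
proof (rule bnd_sup[where ph="%n m. a m * min (a m) (real n)"])
 fix n :: nat
 show "bnd (%m. a m * min (a m) (real n)) (%_. M2)"
 proof (rule bnd_tame[where D="real n"])
  show "0 <= a m * min (a m) (real n) & a m * min (a m) (real n) <= real n * om m" if m: "0 <= m" for m
  proof
   show "0 <= a m * min (a m) (real n)" using a_nonneg[OF m] by simp
   have "a m * min (a m) (real n) <= om m * real n" by (rule mult_mono[OF a_le_om[OF m]]) (use a_nonneg[OF m] om_nonneg[OF m] in auto)
   thus "a m * min (a m) (real n) <= real n * om m" by (simp add: mult.commute)
  qed
  show "tame (%m. a m * min (a m) (real n))" unfolding tame_def
  proof (intro allI impI)
   fix m m' :: real assume m: "0 < m" "0 < m'"
   have e: "a y * min (a y) (real n) / sqrt (a y) = sqrt (a y) * min (a y) (real n)" if "0 < y" for y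
    using a_pos[OF that] by (simp add: field_simps flip: mult.assoc)
   have am: "a (m + m') <= a m" using a_mono[of m "m + m'"] m by simp
   have "sqrt (a (m + m')) * min (a (m + m')) (real n) <= sqrt (a m) * min (a m) (real n)" using am a_pos[of "m + m'"] m by (intro mult_mono) auto
   moreover have "0 <= sqrt (a m') * min (a m') (real n)" using a_pos[OF m(2)] by simp
   ultimately show "a (m + m') * min (a (m + m')) (real n) / sqrt (a (m + m'))
     <= a m * min (a m) (real n) / sqrt (a m) + a m' * min (a m') (real n) / sqrt (a m')" using e[OF m(1)] e[OF m(2)] e[of "m + m'"] m by simp
  qed
  show "a m * min (a m) (real n) <= (om m)\<^sup>2" if m: "0 < m" for m
  proof -
   have "a m * min (a m) (real n) <= om m * om m" by (intro mult_mono) (use a_le_om[of m] a_nonneg[of m] om_nonneg[of m] m in auto)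
   thus ?thesis by (simp add: power2_eq_square)
  qed
 qed measurable
 show "(%m. a m * min (a m) (real n)) : Borel halfline" by measurable
 fix y :: real assume y: "0 < y"
 show "a y * min (a y) (real n) <= a y * min (a y) (real (Suc n))" using a_pos[OF y] by (intro mult_left_mono) auto
 show "a y * min (a y) (real n) <= (a y)\<^sup>2" using a_pos[OF y] by (simp add: power2_eq_square mult_left_mono)
next
 fix y :: real
 obtain n :: nat where "a y <= real n" using real_arch_simple by blast
 thus "\<exists>n. a y * min (a y) (real n) = (a y)\<^sup>2" by (intro exI[of _ n]) (simp add: power2_eq_square)
qed

end
lemma ennreal_bilinear:
 assumes "0 <= A" "0 <= u" "0 <= v" "0 <= w" "0 <= z"
 shows "ennreal (A * (u * v + w * z)) = ennreal A * (ennreal u * ennreal v + ennreal w * ennreal z)" using assms by (simp add: ennreal_mult)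

context coagulation_cauchy
begin

section \<open>The second moment of the weight\<close>

definition psi :: "real => real" where "psi m = om m + (a m)\<^sup>2"

definition hR :: "real => real => real" where "hR R m = min (m powr p) R"

definition phiR :: "real => real => real" where "phiR R m = om m * hR R m"

definition c0 :: real where "c0 = 1 + c + a 1"

definition C4 :: real where "C4 = c * (a 1 + 2 * (1 + a 1) + 2 * (c0 * (2 + a 1)))"

definition beta :: real where "beta = 4 * (C4 * (2 * M2)) + 1"

lemma psi_measurable [measurable]: "psi : Borel halfline" unfolding psi_def[abs_def] by measurable

lemma hR_measurable [measurable]: "hR R : Borel halfline"
 unfolding hR_def[abs_def] by (intro borel_measurable_min borel_measurable_const borel_measurable_halfline) measurable

lemma phiR_measurable [measurable]: "phiR R : Borel halfline" unfolding phiR_def[abs_def] by measurable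

lemma hR_bounds: "0 <= R ==> 0 <= hR R m" "hR R m <= R" "hR R m <= m powr p" by (simp_all add: hR_def)

lemma phiR_nonneg: "0 <= R ==> 0 <= m ==> 0 <= phiR R m" unfolding phiR_def by (intro mult_nonneg_nonneg om_nonneg hR_bounds)

lemma om_le_psi: "om m <= psi m" by (simp add: psi_def)

lemma psi_nonneg: "0 <= m ==> 0 <= psi m" using om_le_psi[of m] om_nonneg[of m] by linarith

lemma bnd_psi: "bnd psi (%_. 2 * M2)"
proof -
 have "bnd (%m. om m + (a m)\<^sup>2) (%_. M2 + M2)"
 proof (rule bnd_add[OF bnd_om om_measurable _ M2_nonneg bnd_a_sq _ _ M2_nonneg])
  show "(%m. (a m)\<^sup>2) : Borel halfline" by measurable
  show "0 <= om m" if "0 < m" for m using om_nonneg[of m] that by simp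
 qed simp
 moreover have "(%m. om m + (a m)\<^sup>2) = psi" by (simp add: psi_def fun_eq_iff)
 ultimately show ?thesis by simp
qed

lemma a1_pos: "0 < a 1" using a_pos by simp

lemma c0_ge1: "1 <= c0" using c_pos a1_pos by (simp add: c0_def)

lemma C4_nonneg: "0 <= C4" unfolding C4_def using c_pos a1_pos c0_ge1 by (intro mult_nonneg_nonneg add_nonneg_nonneg) auto

lemma beta_pos: "0 < beta"
proof -
 have "0 <= C4 * (2 * M2)" using C4_nonneg M2_nonneg by simp
 thus ?thesis by (simp add: beta_def)
qed

lemma a_om_le_psi: "0 < m ==> a m * om m <= (c0 * (2 + a 1)) * psi m"
proof -
 assume m: "0 < m"
 have A: "0 < a m" using a_pos[OF m] .
 have X: "0 <= m powr p" by simp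
 have "a m * om m = c0 * (m powr p * a m + (a m)\<^sup>2 + a m)" unfolding om_expand c0_def[symmetric] by (simp add: algebra_simps power2_eq_square)
 also have "... <= c0 * ((2 + a 1) * (m powr p + a m + 1 + (a m)\<^sup>2))"
 proof (rule mult_left_mono)
  have "0 <= a 1 * a m" "0 <= a 1 * (a m)\<^sup>2" using A a1_pos by auto
  moreover have "(2 + a 1) * (m powr p + a m + 1 + (a m)\<^sup>2)
   = 2 * m powr p + 2 * a m + 2 + 2 * (a m)\<^sup>2 + a 1 * m powr p + a 1 * a m + a 1 + a 1 * (a m)\<^sup>2" by (simp add: algebra_simps)
  moreover have "0 <= (a m)\<^sup>2" by simp
  ultimately show "m powr p * a m + (a m)\<^sup>2 + a m <= (2 + a 1) * (m powr p + a m + 1 + (a m)\<^sup>2)" using powr_times_a[OF m] X A a1_pos by linarith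
 qed (use c0_ge1 in simp)
 also have "... <= c0 * ((2 + a 1) * psi m)" using om_ge[of m] m c0_ge1 a1_pos by (intro mult_left_mono) (auto simp: psi_def)
 finally show ?thesis by (simp add: mult.assoc)
qed

text \<open>The increment of \<open>hR\<close> is at most \<open>hR m'\<close> by subadditivity and vanishes once \<open>m powr p\<close> has reached \<open>R\<close>; in the remaining case \<open>hR m\<close> equals \<open>m powr p\<close>.
Expanding the kernel bound, each product then contains one factor \<open>hR\<close>, so the estimate is linear in the truncated quantity with constants
independent of \<open>R\<close>. This is where \<open>psi\<close>, which includes \<open>a\<^sup>2\<close>, enters.\<close>
lemma collision_gain_le:
 assumes m: "0 < m" "0 < m'" and R: "0 <= R"
 shows "\<kappa> m m' * (om m * (hR R (m + m') - hR R m)) <= C4 * (phiR R m * psi m' + psi m * phiR R m')"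
proof -
 define X Y A B d h h' O1 O2 P1 P2 where "X = m powr p" and "Y = m' powr p" and "A = a m" and "B = a m'"
  and "d = hR R (m + m') - hR R m" and "h = hR R m" and "h' = hR R m'" and "O1 = om m" and "O2 = om m'"
  and "P1 = psi m" and "P2 = psi m'"
 define e where "e = c0 * (2 + a 1)"
 have a1: "0 < a 1" by (rule a1_pos)
 have e0: "0 <= e" unfolding e_def using c0_ge1 a1 by simp
 have pos: "0 <= X" "0 <= Y" "0 < A" "0 < B" "0 <= h" "0 <= h'"
  using a_pos[OF m(1)] a_pos[OF m(2)] hR_bounds(1)[OF R] by (simp_all add: X_def Y_def A_def B_def h_def h'_def)
 have XY: "(m + m') powr p <= X + Y" "X <= (m + m') powr p"
  unfolding X_def Y_def by (rule powr_subadditive[OF m]; use p_range in simp) (rule powr_mono2; use p_range m in simp)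
 have d: "0 <= d" "d <= h'" and dz: "R <= X ==> d = 0" and hX: "X <= R ==> h = X"
  using XY R pos(1,2) unfolding d_def h_def h'_def hR_def X_def[symmetric] Y_def[symmetric] by (auto simp: min_def)
 have O: "1 <= O1" "1 <= O2" "X + A + 1 <= O1" "Y + B + 1 <= O2" "O1 <= P1" "O2 <= P2"
  using om_ge1[of m] om_ge1[of m'] om_ge[of m] om_ge[of m'] om_le_psi[of m] om_le_psi[of m'] m by (simp_all add: X_def Y_def A_def B_def O1_def O2_def P1_def P2_def)
 have hY: "h' <= Y" unfolding h'_def Y_def by (rule hR_bounds)
 have XA: "X * A <= A + a 1 * X" unfolding X_def A_def by (rule powr_times_a[OF m(1)])
 have YB: "Y * B <= (1 + a 1) * O2"
 proof -
  have "Y * B <= B + a 1 * Y" unfolding Y_def B_def by (rule powr_times_a[OF m(2)])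
  also have "... <= O2 + a 1 * O2" using O(4) pos a1 by (intro add_mono mult_left_mono) auto
  finally show ?thesis by (simp add: distrib_right)
 qed
 have AO: "A * O1 <= e * P1" unfolding A_def O1_def e_def P1_def by (rule a_om_le_psi[OF m(1)])
 \<comment> \<open>the four products coming from expanding the kernel bound\<close>
 have main: "(X + Y) * (A + B) * (O1 * d) <= (a 1 + 2 * (1 + a 1) + 2 * e) * (O1 * h * P2 + P1 * (O2 * h'))"
 proof (cases "R <= X")
  case True
  hence "d = 0" by (rule dz)
  thus ?thesis using e0 a1 pos O by (auto intro!: mult_nonneg_nonneg add_nonneg_nonneg)
 next
  case False
  hence h: "h = X" using hX by simp
  have Od: "0 <= O1 * d" using O d by simp
  have d2: "d <= P2" using d hY O pos by linarith
  have AOd: "A * O1 * d <= e * (P1 * (O2 * h'))"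
  proof -
   have "A * O1 * d <= e * P1 * (O2 * h')"
   proof (rule mult_mono[OF AO])
    have "1 * h' <= O2 * h'" using O pos by (intro mult_right_mono) auto
    thus "d <= O2 * h'" using d by simp
   qed (use e0 O d in auto)
   thus ?thesis by (simp add: mult.assoc)
  qed
  have T1: "X * A * (O1 * d) <= e * (P1 * (O2 * h')) + a 1 * (O1 * h * P2)"
  proof -
   have "X * A * (O1 * d) <= (A + a 1 * X) * (O1 * d)" by (rule mult_right_mono[OF XA Od])
   also have "... = A * O1 * d + a 1 * (O1 * h * d)" by (simp add: h algebra_simps)
   also have "... <= e * (P1 * (O2 * h')) + a 1 * (O1 * h * P2)" using AOd d2 a1 O pos by (intro add_mono mult_left_mono) auto
   finally show ?thesis .
  qed
  have T2: "X * B * (O1 * d) <= (1 + a 1) * (O1 * h * P2)"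
  proof -
   have "B * d <= B * Y" using d hY pos by (intro mult_left_mono) auto
   also have "... <= (1 + a 1) * O2" using YB by (simp add: mult.commute)
   also have "... <= (1 + a 1) * P2" using O a1 by (intro mult_left_mono) auto
   finally have "O1 * h * (B * d) <= O1 * h * ((1 + a 1) * P2)" using O pos by (intro mult_left_mono) auto
   thus ?thesis by (simp add: h mult_ac)
  qed
  have T3: "Y * A * (O1 * d) <= e * (P1 * (O2 * h'))"
  proof -
   have "A * O1 * (Y * d) <= e * P1 * (O2 * h')"
   proof (rule mult_mono[OF AO])
    show "Y * d <= O2 * h'" by (rule mult_mono) (use d O pos in linarith)+
   qed (use O pos d e0 in auto)
   thus ?thesis by (simp add: mult_ac)
  qed
  have T4: "Y * B * (O1 * d) <= (1 + a 1) * (P1 * (O2 * h'))"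
  proof -
   have "Y * B * (O1 * d) <= (1 + a 1) * O2 * (P1 * h')"
   proof (rule mult_mono[OF YB])
    show "O1 * d <= P1 * h'" by (rule mult_mono) (use d O pos in linarith)+
   qed (use O d a1 in auto)
   thus ?thesis by (simp add: mult_ac)
  qed
  define U V where "U = O1 * h * P2" and "V = P1 * (O2 * h')"
  have UV: "0 <= U" "0 <= V" using O pos by (auto simp: U_def V_def)
  have "(X + Y) * (A + B) * (O1 * d) = X * A * (O1 * d) + X * B * (O1 * d) + Y * A * (O1 * d) + Y * B * (O1 * d)" by (simp add: algebra_simps)
  also have "... <= (e * V + a 1 * U) + (1 + a 1) * U + e * V + (1 + a 1) * V" using T1 T2 T3 T4 unfolding U_def V_def by linarith
  also have "... = (a 1 + (1 + a 1)) * U + (2 * e + (1 + a 1)) * V" by (simp add: algebra_simps)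
  also have "... <= (a 1 + 2 * (1 + a 1) + 2 * e) * U + (a 1 + 2 * (1 + a 1) + 2 * e) * V"
  proof (rule add_mono)
   show "(a 1 + (1 + a 1)) * U <= (a 1 + 2 * (1 + a 1) + 2 * e) * U" by (intro mult_right_mono UV) (use a1 e0 in \<open>smt (verit)\<close>)
   show "(2 * e + (1 + a 1)) * V <= (a 1 + 2 * (1 + a 1) + 2 * e) * V" by (intro mult_right_mono UV) (use a1 e0 in \<open>smt (verit)\<close>)
  qed
  finally show ?thesis by (simp add: distrib_left U_def V_def)
 qed
 have "\<kappa> m m' * (O1 * d) <= c * (X + Y) * (A + B) * (O1 * d)" using \<kappa>_le'[OF m] O d unfolding X_def Y_def A_def B_def by (intro mult_right_mono) auto
 also have "... = c * ((X + Y) * (A + B) * (O1 * d))" by (simp only: mult.assoc)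
 also have "... <= c * ((a 1 + 2 * (1 + a 1) + 2 * e) * (O1 * h * P2 + P1 * (O2 * h')))" using main c_pos by (intro mult_left_mono) auto
 finally show ?thesis unfolding C4_def phiR_def O1_def d_def h_def h'_def O2_def P1_def P2_def e_def by (simp only: mult.assoc)
qed

lemma gain_split:
 assumes g: "weight g C" and r: "0 <= r" and m: "0 < m" "0 < m'" and R: "0 <= R"
 shows "gl (heat a r (tens g (phiR R))) (x, m, m')
   <= om m * (hR R (m + m') - hR R m) * sm g r x m + om m' * (hR R (m' + m) - hR R m') * sm g r x m'"
proof -
 have "om (m + m') * sm g r x (m + m') <= om m * sm g r x m + om m' * sm g r x m'" by (rule merge_le[OF g r m tame_om]) (simp add: om_nonneg less_imp_le)
 from mult_right_mono[OF this hR_bounds(1)[OF R, of "m + m'"]] show ?thesis unfolding gl_def heat_tens_sm phiR_def fst_conv snd_conv by (simp add: algebra_simps)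
qed

lemma gain_integral_le:
 assumes b: "bnd (phiR R) B" "!!s. 0 <= B s" and g: "weight g C" and r: "0 <= r" and s: "s : {0..T}" and R: "0 <= R"
 shows "(\<integral>\<^sup>+z. ennreal (om (fst (snd z)) * (hR R (fst (snd z) + snd (snd z)) - hR R (fst (snd z))) * sm g r (fst z) (fst (snd z))) \<partial>q s)
   <= ennreal (C4 * (2 * M2) * B s) * (total g)"
  (is "(\<integral>\<^sup>+z. ennreal (?F z) \<partial>q s) <= _")
proof -
 let ?P = "%z. ennreal (heat a r (tens g (phiR R)) z)" and ?S = "%z. ennreal (heat a r (tens g psi) z)"
 have Pm: "?P : Borel TH" and Sm: "?S : Borel TH"
  by (intro measurable_compose[OF heat_measurable[OF a_measurable tens_weight_measurable[OF g]] measurable_ennreal] phiR_measurable psi_measurable)+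
 have smm: "(%z. sm g r (fst z) (fst (snd z))) : Borel THH"
 proof -
  have "(%z. (fst z, fst (snd z))) : measurable THH TH" by measurable
  from measurable_compose[OF this sm_measurable[OF g]] show ?thesis by simp
 qed
 have hm: "(%z. hR R (fst (snd z) + snd (snd z))) : Borel THH"
  using measurable_compose[OF measurable_merge_mass measurable_compose[OF measurable_snd hR_measurable]] by simp
 have hm2: "(%z. hR R (fst (snd z))) : Borel THH" by (rule measurable_compose[OF _ hR_measurable]) measurable
 have "?F : Borel THH" by (intro borel_measurable_times borel_measurable_diff om_THH_measurable(1) hm hm2 smm)
 hence Fm: "(%z. ennreal (?F z)) : Borel THH" by simp
 have AEp: "AE m in nk s x. 0 < m" if x: "x : space torus" for x
 proof (cases "good s x")
  case True
  have m1: "(%m. ennreal (1 / m)) : Borel (kernel (\<mu> s) x)" by (rule measurable_kernel_mu[OF True x]) measurable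
  show ?thesis unfolding nk_def using True AE_kernel_pos[OF True x] by (simp add: AE_density[OF m1])
 qed (simp add: nk_def AE_of_null_space)
 have "(\<integral>\<^sup>+z. ennreal (?F z) \<partial>q s) = (\<integral>\<^sup>+x. \<integral>\<^sup>+m. \<integral>\<^sup>+m'. ennreal (\<kappa> m m' / 2) * ennreal (?F (x, m, m')) \<partial>nk s x \<partial>nk s x \<partial>torus)"
  by (rule nn_integral_q[OF Fm])
 also have "... <= (\<integral>\<^sup>+x. ennreal (C4 / 2) * (ennreal (2 * M2) * (\<integral>\<^sup>+m. ?P (x, m) \<partial>nk s x) + ennreal (B s) * (\<integral>\<^sup>+m. ?S (x, m) \<partial>nk s x)) \<partial>torus)"
 proof (rule nn_integral_mono_AE)
  show "AE x in torus. (\<integral>\<^sup>+m. \<integral>\<^sup>+m'. ennreal (\<kappa> m m' / 2) * ennreal (?F (x, m, m')) \<partial>nk s x \<partial>nk s x)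
    <= ennreal (C4 / 2) * (ennreal (2 * M2) * (\<integral>\<^sup>+m. ?P (x, m) \<partial>nk s x) + ennreal (B s) * (\<integral>\<^sup>+m. ?S (x, m) \<partial>nk s x))"
   using bnd_AE[OF bnd_psi psi_measurable s] bnd_AE[OF b(1) phiR_measurable s] AE_space
  proof eventually_elim
   case (elim x)
   note x = elim(3)
   have mk: "f : Borel (nk s x)" if "f : Borel halfline" for f :: "real => ennreal" unfolding measurable_cong_sets[OF sets_nk[OF x] refl] by (rule that)
   have pm: "(%m. ennreal (psi m)) : Borel (nk s x)" "(%m. ennreal (phiR R m)) : Borel (nk s x)" by (rule mk; measurable)+
   have Px: "(%m. ?P (x, m)) : Borel (nk s x)" "(%m. ?S (x, m)) : Borel (nk s x)"
    by (rule finite_kernel_measurable[OF finite_kernel_nk x Pm]) (rule finite_kernel_measurable[OF finite_kernel_nk x Sm])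
   have "(\<integral>\<^sup>+m. \<integral>\<^sup>+m'. ennreal (\<kappa> m m' / 2) * ennreal (?F (x, m, m')) \<partial>nk s x \<partial>nk s x)
    <= (\<integral>\<^sup>+m. ennreal (C4 / 2) * (ennreal (2 * M2) * ?P (x, m) + ennreal (B s) * ?S (x, m)) \<partial>nk s x)"
   proof (rule nn_integral_mono_AE)
    show "AE m in nk s x. (\<integral>\<^sup>+m'. ennreal (\<kappa> m m' / 2) * ennreal (?F (x, m, m')) \<partial>nk s x)
     <= ennreal (C4 / 2) * (ennreal (2 * M2) * ?P (x, m) + ennreal (B s) * ?S (x, m))" using AEp[OF x]
    proof eventually_elim
     case m: (elim m)
     have "(\<integral>\<^sup>+m'. ennreal (\<kappa> m m' / 2) * ennreal (?F (x, m, m')) \<partial>nk s x)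
      <= (\<integral>\<^sup>+m'. ennreal (C4 / 2) * (?P (x, m) * ennreal (psi m') + ?S (x, m) * ennreal (phiR R m')) \<partial>nk s x)"
     proof (rule nn_integral_mono_AE)
      show "AE m' in nk s x. ennreal (\<kappa> m m' / 2) * ennreal (?F (x, m, m'))
      <= ennreal (C4 / 2) * (?P (x, m) * ennreal (psi m') + ?S (x, m) * ennreal (phiR R m'))" using AEp[OF x]
      proof eventually_elim
      case m': (elim m')
      have nn: "0 <= phiR R m * sm g r x m" "0 <= psi m * sm g r x m" "0 <= psi m'" "0 <= phiR R m'"
      using phiR_nonneg[OF R] psi_nonneg sm_nonneg[OF g] m m' by (simp_all add: less_imp_le)
      have "\<kappa> m m' / 2 * ?F (x, m, m') = (\<kappa> m m' * (om m * (hR R (m + m') - hR R m))) * (sm g r x m / 2)" by (simp add: mult_ac)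
      also have "... <= (C4 * (phiR R m * psi m' + psi m * phiR R m')) * (sm g r x m / 2)"
      by (rule mult_right_mono[OF collision_gain_le[OF m m' R]]) (use sm_nonneg[OF g] in simp)
      also have "... = C4 / 2 * ((phiR R m * sm g r x m) * psi m' + (psi m * sm g r x m) * phiR R m')" by (simp add: algebra_simps)
      finally have "ennreal (\<kappa> m m' / 2 * ?F (x, m, m')) <= ennreal (C4 / 2 * ((phiR R m * sm g r x m) * psi m' + (psi m * sm g r x m) * phiR R m'))"
      by (rule ennreal_leI)
      moreover have "ennreal (\<kappa> m m' / 2 * ?F (x, m, m')) = ennreal (\<kappa> m m' / 2) * ennreal (?F (x, m, m'))"
      by (rule ennreal_mult') (use \<kappa>_nonneg[of m m'] m m' in simp)
      moreover have "ennreal (C4 / 2 * ((phiR R m * sm g r x m) * psi m' + (psi m * sm g r x m) * phiR R m'))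
      = ennreal (C4 / 2) * (?P (x, m) * ennreal (psi m') + ?S (x, m) * ennreal (phiR R m'))" unfolding heat_tens_sm fst_conv snd_conv
      by (rule ennreal_bilinear) (use nn C4_nonneg in simp_all)
      ultimately show ?case by simp
      qed
     qed
     also have "... = ennreal (C4 / 2) * (?P (x, m) * (\<integral>\<^sup>+m'. ennreal (psi m') \<partial>nk s x) + ?S (x, m) * (\<integral>\<^sup>+m'. ennreal (phiR R m') \<partial>nk s x))"
      using pm by (simp add: nn_integral_cmult nn_integral_add)
     also have "... <= ennreal (C4 / 2) * (?P (x, m) * ennreal (2 * M2) + ?S (x, m) * ennreal (B s))" by (intro mult_left_mono add_mono elim(1) elim(2)) simp_all
     finally show ?case by (simp only: mult.commute)
    qed
   qed
   also have "... = ennreal (C4 / 2) * (ennreal (2 * M2) * (\<integral>\<^sup>+m. ?P (x, m) \<partial>nk s x) + ennreal (B s) * (\<integral>\<^sup>+m. ?S (x, m) \<partial>nk s x))"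
    using Px by (simp add: nn_integral_cmult nn_integral_add)
   finally show ?case .
  qed
 qed
 also have "... = ennreal (C4 / 2) * (ennreal (2 * M2) * (\<integral>\<^sup>+z. ?P z \<partial>N s) + ennreal (B s) * (\<integral>\<^sup>+z. ?S z \<partial>N s))"
  unfolding nn_integral_N[OF Pm] nn_integral_N[OF Sm]
  using finite_kernel_nn_integral[OF finite_kernel_nk Pm, of s] finite_kernel_nn_integral[OF finite_kernel_nk Sm, of s]
  by (simp add: nn_integral_cmult nn_integral_add)
 also have "... <= ennreal (C4 / 2) * (ennreal (2 * M2) * (ennreal (B s) * (total g))
    + ennreal (B s) * (ennreal (2 * M2) * (total g)))" by (intro mult_left_mono add_mono bndD[OF b(1) s r g] bndD[OF bnd_psi s r g]) simp_all
 also have "... = ennreal (C4 / 2) * (ennreal 2 * (ennreal (2 * M2) * ennreal (B s))) * (total g)" by (simp add: mult_ac distrib_left flip: mult_2)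
 also have "ennreal (C4 / 2) * (ennreal 2 * (ennreal (2 * M2) * ennreal (B s))) = ennreal (C4 / 2 * (2 * (2 * M2 * B s)))"
  using C4_nonneg M2_nonneg b(2)[of s] by (simp only: ennreal_mult'[symmetric] mult_nonneg_nonneg divide_nonneg_nonneg zero_le_numeral)
 also have "C4 / 2 * (2 * (2 * M2 * B s)) = C4 * (2 * M2) * B s" by simp
 finally show ?thesis .
qed

lemma coll_phiR_le:
 assumes b: "bnd (phiR R) B" "!!s. 0 <= B s" and g: "weight g C" and r: "0 <= r" and s: "s : {0..T}" and R: "0 <= R"
 shows "coll s (heat a r (tens g (phiR R))) <= 4 * (C4 * M2) * B s * enn2real (total g)"
proof -
 define G where "G = enn2real (total g)"
 have Gfin: "(total g) = ennreal G"
 proof -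
  have "(total g) <= (\<integral>\<^sup>+x. ennreal C \<partial>torus)" using weightD(3)[OF g] by (intro nn_integral_mono ennreal_leI) (auto simp: abs_le_iff)
  also have "... < \<infinity>" using torus.emeasure_space_1 by simp
  finally show ?thesis by (simp add: G_def)
 qed
 have G0: "0 <= G" by (simp add: G_def)
 define F where "F z = om (fst (snd z)) * (hR R (fst (snd z) + snd (snd z)) - hR R (fst (snd z))) * sm g r (fst z) (fst (snd z))" for z
 define V where "V = C4 * (2 * M2) * B s * G"
 have V0: "0 <= V" unfolding V_def using C4_nonneg M2_nonneg b(2) G0 by simp
 have smm: "(%z. sm g r (fst z) (fst (snd z))) : Borel THH"
 proof -
  have "(%z. (fst z, fst (snd z))) : measurable THH TH" by measurable
  from measurable_compose[OF this sm_measurable[OF g]] show ?thesis by simp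
 qed
 have hm: "(%z. hR R (fst (snd z) + snd (snd z))) : Borel THH"
  using measurable_compose[OF measurable_merge_mass measurable_compose[OF measurable_snd hR_measurable]] by simp
 have hm2: "(%z. hR R (fst (snd z))) : Borel THH" by (rule measurable_compose[OF _ hR_measurable]) measurable
 have "F : Borel THH" unfolding F_def[abs_def] by (intro borel_measurable_times borel_measurable_diff om_THH_measurable(1) hm hm2 smm)
 hence Fm: "(%z. ennreal (F z)) : Borel THH" by simp
 have "(%z. (fst z, snd (snd z), fst (snd z))) : measurable THH THH" by measurable
 from measurable_compose[OF this Fm] have Fm': "(%z. ennreal (F (fst z, snd (snd z), fst (snd z)))) : Borel THH" .
 have F1: "(\<integral>\<^sup>+z. ennreal (F z) \<partial>q s) <= ennreal V" using gain_integral_le[OF b g r s R] C4_nonneg M2_nonneg b(2)[of s] G0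
  unfolding F_def V_def Gfin by (simp add: ennreal_mult')
 have F2: "(\<integral>\<^sup>+z. ennreal (F (fst z, snd (snd z), fst (snd z))) \<partial>q s) <= ennreal V" using q_swap[OF Fm, of s] F1 by simp
 have fb: "\<bar>heat a r (tens g (phiR R)) z\<bar> <= (R * C) * om (snd z)" if "z : space TH" for z
 proof (rule heat_tens_om(2)[OF _ g that])
  fix m :: real assume m: "0 <= m"
  show "0 <= phiR R m & phiR R m <= R * om m" using phiR_nonneg[OF R m] mult_left_mono[OF hR_bounds(2)[of R m] om_nonneg[OF m]] by (simp add: phiR_def mult.commute)
 qed
 have fm: "heat a r (tens g (phiR R)) : Borel TH" by (intro heat_measurable a_measurable tens_weight_measurable[OF g] phiR_measurable)
 have "coll s (heat a r (tens g (phiR R))) <= V + V" unfolding coll_def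
 proof (rule integral_le_nn_bound[OF integrable_q_om(1)[OF fm fb]])
  show "AE z in q s. gl (heat a r (tens g (phiR R))) z <= F z + F (fst z, snd (snd z), fst (snd z))" using AE_q_pos
  proof eventually_elim
   case (elim z)
   show ?case using gain_split[OF g r _ _ R, of "fst (snd z)" "snd (snd z)" "fst z"] elim by (simp add: F_def)
  qed
  have "(\<integral>\<^sup>+z. ennreal (F z + F (fst z, snd (snd z), fst (snd z))) \<partial>q s)
    <= (\<integral>\<^sup>+z. ennreal (F z) + ennreal (F (fst z, snd (snd z), fst (snd z))) \<partial>q s)"
  proof (rule nn_integral_mono)
   fix z
   show "ennreal (F z + F (fst z, snd (snd z), fst (snd z))) <= ennreal (F z) + ennreal (F (fst z, snd (snd z), fst (snd z)))"
    by (simp add: ennreal_plus_if ennreal_leI)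
  qed
  also have "... = (\<integral>\<^sup>+z. ennreal (F z) \<partial>q s) + (\<integral>\<^sup>+z. ennreal (F (fst z, snd (snd z), fst (snd z))) \<partial>q s)"
   by (rule nn_integral_add) (use Fm Fm' in simp_all)
  also have "... <= ennreal V + ennreal V" by (rule add_mono[OF F1 F2])
  finally show "(\<integral>\<^sup>+z. ennreal (F z + F (fst z, snd (snd z), fst (snd z))) \<partial>q s) <= ennreal (V + V)" unfolding ennreal_plus[OF V0 V0] .
  show "0 <= V + V" using V0 by simp
 qed
 also have "V + V = 4 * (C4 * M2) * B s * G" unfolding V_def by algebra
 finally show ?thesis by (simp only: G_def)
qed

text \<open>The gain integrated against \<open>exp (beta * s)\<close> costs a factor at most \<open>1/2\<close>, because \<open>beta\<close> is more than twice the rate. Iterating from any a priori bound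
leads to one that does not depend on \<open>R\<close>.\<close>
lemma bnd_phiR_improve:
 assumes b: "bnd (phiR R) (%s. B * exp (beta * s))" and B: "0 <= B" and R: "0 <= R"
  and le: "!!m. 0 < m ==> phiR R m <= (om m)\<^sup>2"
 shows "bnd (phiR R) (%s. (M2 + B / 2) * exp (beta * s))"
proof -
 define D where "D = 4 * (C4 * M2) * B"
 have CM: "0 <= C4 * M2" using C4_nonneg M2_nonneg by simp
 have D0: "0 <= D" unfolding D_def using CM B by simp
 have D1: "D / beta <= B / 2"
 proof -
  have "2 * D <= beta * B" unfolding D_def beta_def using B CM by (simp add: algebra_simps)
  thus ?thesis using beta_pos by (simp add: field_simps)
 qed
 let ?b = "%\<tau>. D * exp (beta * \<tau>) * indicator {0..T} \<tau>"
 show ?thesis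
 proof (rule bnd_propagate[where b="?b" and Bb="D * exp (beta * T)" and D=R])
  show "phiR R : Borel halfline" by measurable
  show "0 <= phiR R m & phiR R m <= R * om m" if m: "0 <= m" for m using phiR_nonneg[OF R m] mult_left_mono[OF hR_bounds(2)[of R m] om_nonneg[OF m]]
   by (simp add: phiR_def mult.commute)
  show "(\<integral>\<^sup>+m. ennreal (1 / m) * ennreal (phiR R m) \<partial>\<nu>s) <= ennreal M2" by (rule moment_le_M2[OF le])
  show "coll \<tau> (heat a r (tens g (phiR R))) <= ?b \<tau> * enn2real (total g)"
   if g: "weight g C" and \<tau>: "\<tau> : {0..T}" and r: "0 <= r" for g C \<tau> r
  proof -
   have "coll \<tau> (heat a r (tens g (phiR R))) <= 4 * (C4 * M2) * (B * exp (beta * \<tau>)) * enn2real (total g)"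
    by (rule coll_phiR_le[OF b _ g r \<tau> R]) (use B in simp)
   thus ?thesis using \<tau> by (simp add: D_def mult.assoc)
  qed
  show "?b : Borel borel" by measurable
  show "\<bar>?b \<tau>\<bar> <= D * exp (beta * T)" for \<tau> using D0 beta_pos by (auto simp: indicator_def abs_mult intro!: mult_left_mono)
  show "M2 + tint 0 s ?b <= (M2 + B / 2) * exp (beta * s)" if s: "s : {0..T}" for s
  proof -
   have "tint 0 s ?b = tint 0 s (%\<tau>. D * exp (beta * \<tau>) * indicator {0..s} \<tau>)"
    unfolding tint_def by (rule bochner_cong) (use s in \<open>auto simp: indicator_def\<close>)
   also have "... = D * (exp (beta * s) - 1) / beta" by (rule tint_exp_le[OF beta_pos]) (use s in simp)
   also have "... = D / beta * (exp (beta * s) - 1)" by simp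
   also have "... <= B / 2 * (exp (beta * s) - 1)" using D1 beta_pos s by (intro mult_right_mono) auto
   also have "... <= B / 2 * exp (beta * s)" using B by (intro mult_left_mono) auto
   finally have "tint 0 s ?b <= B / 2 * exp (beta * s)" .
   moreover have "M2 * 1 <= M2 * exp (beta * s)" using M2_nonneg beta_pos s by (intro mult_left_mono) auto
   ultimately show ?thesis by (simp add: distrib_right)
  qed
  show "0 <= (M2 + B / 2) * exp (beta * s)" for s using M2_nonneg B by simp
 qed (rule M2_nonneg)
qed

lemma bnd_phiR:
 assumes R: "0 <= R"
 shows "bnd (phiR R) (%s. (2 * M2 + 1) * exp (beta * s))"
proof -
 have le: "phiR R m <= (om m)\<^sup>2" if m: "0 < m" for m
 proof -
  have "hR R m <= om m" using hR_bounds(3)[of R m] om_ge[of m] a_nonneg[of m] m by linarith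
  thus ?thesis unfolding phiR_def power2_eq_square using om_nonneg[of m] m by (intro mult_left_mono) auto
 qed
 have RM: "0 <= R * M2" using R M2_nonneg by simp
 have it: "bnd (phiR R) (%s. (2 * M2 + R * M2 / 2 ^ j) * exp (beta * s))" for j :: nat
 proof (induction j)
  case 0
  have "bnd (phiR R) (%_. R * M2)"
  proof (rule bnd_dominated[OF bnd_om om_measurable _ R])
   fix m :: real assume m: "0 < m"
   show "phiR R m <= R * om m" using mult_left_mono[OF hR_bounds(2)[of R m] om_nonneg[of m]] m by (simp add: phiR_def mult.commute)
  qed
  thus ?case
  proof (rule bnd_le)
   fix s assume s: "s : {0..T}"
   have "R * M2 * 1 <= (2 * M2 + R * M2 / 2 ^ 0) * exp (beta * s)" by (rule mult_mono) (use RM M2_nonneg beta_pos s in auto)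
   thus "R * M2 <= (2 * M2 + R * M2 / 2 ^ 0) * exp (beta * s)" by simp
  qed
 next
  case (Suc j)
  have "bnd (phiR R) (%s. (M2 + (2 * M2 + R * M2 / 2 ^ j) / 2) * exp (beta * s))"
  proof (rule bnd_phiR_improve[OF Suc _ R le])
   have "0 <= R * M2 / 2 ^ j" using RM by simp
   thus "0 <= 2 * M2 + R * M2 / 2 ^ j" using M2_nonneg by linarith
  qed
  moreover have "M2 + (2 * M2 + R * M2 / 2 ^ j) / 2 = 2 * M2 + R * M2 / 2 ^ Suc j" by (simp add: field_simps)
  ultimately show ?case by (simp only:)
 qed
 obtain j where j: "R * M2 < 2 ^ j" using real_arch_pow[of 2 "R * M2"] by auto
 show ?thesis
 proof (rule bnd_le[OF it[of j]])
  fix s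
  have "R * M2 / 2 ^ j <= 1" using j by simp
  thus "(2 * M2 + R * M2 / 2 ^ j) * exp (beta * s) <= (2 * M2 + 1) * exp (beta * s)" by (intro mult_right_mono) auto
 qed
qed

definition K4 :: real where
 "K4 = c0 * (c0 * (2 + a 1) + 1) * ((2 * M2 + 1) * exp (beta * T) + 2 * M2)"

lemma K4_nonneg: "0 <= K4" unfolding K4_def using c0_ge1 a1_pos M2_nonneg by (intro mult_nonneg_nonneg add_nonneg_nonneg) auto

lemma kernel_om_sq:
 assumes s: "s : {0..T}"
 shows "AE x in torus. (\<integral>\<^sup>+m. ennreal ((om m)\<^sup>2) \<partial>nk s x) <= ennreal K4"
proof -
 define C5 where "C5 = c0 * (c0 * (2 + a 1) + 1)"
 have C5: "0 <= C5" unfolding C5_def using c0_ge1 a1_pos by simp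
 have pm: "(%m. om m * m powr p) : Borel halfline" by (intro borel_measurable_times om_measurable borel_measurable_halfline) measurable
 have 1: "bnd (%m. om m * m powr p) (%s. (2 * M2 + 1) * exp (beta * s))"
 proof (rule bnd_sup[where ph="%n. phiR (real n)"])
  show "bnd (phiR (real n)) (%s. (2 * M2 + 1) * exp (beta * s))" for n by (rule bnd_phiR) simp
  show "phiR (real n) : Borel halfline" for n by measurable
  fix y :: real assume y: "0 < y"
  have o: "0 <= om y" using om_nonneg[of y] y by simp
  show "phiR (real n) y <= phiR (real (Suc n)) y" for n unfolding phiR_def by (intro mult_left_mono o) (simp add: hR_def)
  show "phiR (real n) y <= om y * y powr p" for n unfolding phiR_def by (intro mult_left_mono o hR_bounds)
  obtain n :: nat where "y powr p <= real n" using real_arch_simple by blast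
  thus "\<exists>n. phiR (real n) y = om y * y powr p" by (intro exI[of _ n]) (simp add: phiR_def hR_def)
 qed
 have 2: "bnd (%m. om m * m powr p + psi m) (%s. (2 * M2 + 1) * exp (beta * s) + 2 * M2)"
 proof (rule bnd_add[OF 1 pm _ _ bnd_psi psi_measurable])
  show "0 <= om m * m powr p" if "0 < m" for m using om_nonneg[of m] that by simp
  show "0 <= psi m" if "0 < m" for m using psi_nonneg[of m] that by simp
 qed (use M2_nonneg in simp_all)
 have 3: "bnd (%m. (om m)\<^sup>2) (%s. C5 * ((2 * M2 + 1) * exp (beta * s) + 2 * M2))"
 proof (rule bnd_dominated[OF 2 _ _ C5])
  show "(%m. om m * m powr p + psi m) : Borel halfline" by (intro borel_measurable_add pm psi_measurable)
  fix m :: real assume m: "0 < m"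
  have "(om m)\<^sup>2 = c0 * (om m * m powr p + a m * om m + om m)" unfolding power2_eq_square by (subst om_expand) (simp add: c0_def algebra_simps)
  also have "... <= c0 * (om m * m powr p + (c0 * (2 + a 1) + 1) * psi m)"
   using a_om_le_psi[OF m] om_le_psi[of m] c0_ge1 by (intro mult_left_mono) (simp_all add: distrib_right)
  also have "... <= c0 * ((c0 * (2 + a 1) + 1) * (om m * m powr p) + (c0 * (2 + a 1) + 1) * psi m)"
  proof -
   have "0 <= c0 * (2 + a 1)" using c0_ge1 a1_pos by simp
   hence "1 * (om m * m powr p) <= (c0 * (2 + a 1) + 1) * (om m * m powr p)" using om_nonneg[of m] m by (intro mult_right_mono) auto
   thus ?thesis using c0_ge1 by (intro mult_left_mono) auto
  qed
  also have "... = C5 * (om m * m powr p + psi m)" unfolding C5_def by algebra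
  finally show "(om m)\<^sup>2 <= C5 * (om m * m powr p + psi m)" .
 qed
 have 4: "bnd (%m. (om m)\<^sup>2) (%_. K4)"
 proof (rule bnd_le[OF 3])
  fix s assume s: "s : {0..T}"
  have "exp (beta * s) <= exp (beta * T)" using s beta_pos by simp
  thus "C5 * ((2 * M2 + 1) * exp (beta * s) + 2 * M2) <= K4" unfolding K4_def C5_def[symmetric] using C5 M2_nonneg by (intro mult_left_mono add_right_mono) auto
 qed
 have "(%m. (om m)\<^sup>2) : Borel halfline" by measurable
 from bnd_AE[OF 4 this s] show ?thesis .
qed

end
lemma AE_kint_fst:
 assumes k: "finite_kernel M N k" and P: "AE x in M. P x"
 shows "AE z in kint M N k. P (fst z)"
proof -
 from P obtain A where A: "{x : space M. \<not> P x} \<subseteq> A" "emeasure M A = 0" "A : sets M" by (auto elim!: AE_E)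
 have s: "A \<times> space N : sets (M \<Otimes>\<^sub>M N)" using A(3) by simp
 have "emeasure (kint M N k) (A \<times> space N) = (\<integral>\<^sup>+x. emeasure (k x) (Pair x -` (A \<times> space N)) \<partial>M)" by (rule emeasure_kint[OF k s])
 also have "... = (\<integral>\<^sup>+x. 0 \<partial>M)"
 proof (rule nn_integral_cong_AE)
  have "AE x in M. x \<notin> A" using A by (intro AE_not_in) auto
  thus "AE x in M. emeasure (k x) (Pair x -` (A \<times> space N)) = 0" by eventually_elim auto
 qed
 finally have "emeasure (kint M N k) (A \<times> space N) = 0" by simp
 thus ?thesis by (intro AE_I[of _ _ "A \<times> space N"]) (use A s in auto)
qed

section \<open>Collisions as a linear operator\<close>

definition slot :: "(real => real measure) => (real \<times> real \<times> real => real) => real \<times> real => real" where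
 "slot k F z = (\<integral>m'. F (fst z, snd z, m') \<partial>k (fst z))"

lemma slot_measurable:
 assumes k: "finite_kernel torus halfline k" and F: "F : Borel THH"
 shows "slot k F : Borel TH"
proof -
 have "finite_kernel TH halfline (%z. k (fst z))" unfolding finite_kernel_def
  using finite_kernelD[OF k] measurable_compose[OF measurable_fst finite_kernelD(4)[OF k]] by (auto simp: pair_space)
 moreover have "(%w. F (fst (fst w), snd (fst w), snd w)) : Borel (TH \<Otimes>\<^sub>M halfline)" by (rule measurable_compose[OF _ F]) measurable
 ultimately have "(%z. \<integral>m'. F (fst (fst (z, m')), snd (fst (z, m')), snd (z, m')) \<partial>k (fst z)) : Borel TH" by (rule finite_kernel_integral)
 thus ?thesis by (simp add: slot_def[abs_def])
qed

context coagulation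
begin

definition om_kernel :: "(real => real measure) => real => bool" where
 "om_kernel k K \<longleftrightarrow> finite_kernel torus halfline k & (\<forall>x\<in>{0..<1}. (\<integral>\<^sup>+m. ennreal (om m) \<partial>k x) <= ennreal K) & 0 <= K"

definition dom2 :: "(real \<times> real \<times> real => real) => real => bool" where
 "dom2 F C \<longleftrightarrow> F : Borel THH & 0 <= C \<and>
   (\<forall>x\<in>{0..<1}. \<forall>m\<ge>0. \<forall>m'\<ge>0. \<bar>F (x, m, m')\<bar> <= C * (om m * om m'))"

lemma dom2D: "dom2 F C ==> x : {0..<1} ==> 0 <= m ==> 0 <= m' ==> \<bar>F (x, m, m')\<bar> <= C * (om m * om m')" by (auto simp: dom2_def)

lemma om_ge0: "0 <= m ==> 0 <= om m" using om_ge1[of m] by linarith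

lemma om_kernelD:
 assumes k: "om_kernel k K" and x: "x : {0..<1}"
 shows "sets (k x) = sets halfline" "space (k x) = {0..}" "finite_measure (k x)"
  "integrable (k x) om" "(\<integral>m. om m \<partial>k x) <= K" "f : Borel halfline ==> f : Borel (k x)"
proof -
 have fk: "finite_kernel torus halfline k" and b: "(\<integral>\<^sup>+m. ennreal (om m) \<partial>k x) <= ennreal K" and K: "0 <= K"
  using k x by (auto simp: om_kernel_def)
 have xs: "x : space torus" using x by simp
 show s: "sets (k x) = sets halfline" by (rule finite_kernelD(1)[OF fk xs])
 show sp: "space (k x) = {0..}" using finite_kernelD(3)[OF fk xs] by simp
 show "finite_measure (k x)" by (rule finite_kernelD(2)[OF fk xs])
 have m: "om : Borel (k x)" unfolding measurable_cong_sets[OF s refl] by (rule om_measurable)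
 have n: "(\<integral>\<^sup>+m. ennreal (norm (om m)) \<partial>k x) = (\<integral>\<^sup>+m. ennreal (om m) \<partial>k x)"
  by (rule nn_integral_cong) (simp add: sp om_ge0)
 show "integrable (k x) om"
 proof (rule integrableI_bounded[OF m])
  show "(\<integral>\<^sup>+m. ennreal (norm (om m)) \<partial>k x) < \<infinity>" unfolding n using b by (rule le_less_trans) simp
 qed
 show "(\<integral>m. om m \<partial>k x) <= K" by (rule integral_le_nn_integral[OF m _ b K]) (simp add: sp om_ge0)
 show "f : Borel (k x)" if "f : Borel halfline" unfolding measurable_cong_sets[OF s refl] by (rule that)
qed

lemma section_measurable:
 assumes "F : Borel THH" "x : {0..<1}"
 shows "(%z. F (x, fst z, snd z)) : Borel HH"
  and "0 <= m ==> (%m'. F (x, m, m')) : Borel halfline"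
proof -
 have x: "x : space torus" using assms(2) by simp
 have "(%z. (x, fst z, snd z)) : measurable HH THH" using x by measurable
 from measurable_compose[OF this assms(1)] show "(%z. F (x, fst z, snd z)) : Borel HH" .
 assume "0 <= m"
 hence m: "m : space halfline" by simp
 have "(%m'. (x, m, m')) : measurable halfline THH" using x m by measurable
 from measurable_compose[OF this assms(1)] show "(%m'. F (x, m, m')) : Borel halfline" .
qed

lemma slot_integrable:
 assumes k: "om_kernel k K" and F: "dom2 F C" and x: "x : {0..<1}" and m: "0 <= m"
 shows "integrable (k x) (%m'. F (x, m, m'))"
proof (rule Bochner_Integration.integrable_bound)
 show "integrable (k x) (%m'. C * om m * om m')" using om_kernelD(4)[OF k x] by simp
 show "(%m'. F (x, m, m')) : Borel (k x)" by (rule om_kernelD(6)[OF k x]) (rule section_measurable(2)[OF _ x m], use F in \<open>simp add: dom2_def\<close>)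
 show "AE m' in k x. norm (F (x, m, m')) <= norm (C * om m * om m')"
 proof (rule AE_I2)
  fix m' assume "m' : space (k x)"
  hence m': "0 <= m'" using om_kernelD(2)[OF k x] by simp
  have "\<bar>F (x, m, m')\<bar> <= C * (om m * om m')" by (rule dom2D[OF F x m m'])
  also have "... <= \<bar>C * om m * om m'\<bar>" by (simp add: mult.assoc)
  finally show "norm (F (x, m, m')) <= norm (C * om m * om m')" by simp
 qed
qed

lemma slot_bound:
 assumes k: "om_kernel k K" and F: "dom2 F C" and x: "x : {0..<1}" and m: "0 <= m"
 shows "\<bar>slot k F (x, m)\<bar> <= C * K * om m"
proof -
 have "\<bar>slot k F (x, m)\<bar> <= (\<integral>m'. \<bar>F (x, m, m')\<bar> \<partial>k x)" unfolding slot_def by simp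
 also have "... <= (\<integral>m'. C * om m * om m' \<partial>k x)"
 proof (rule integral_mono)
  show "integrable (k x) (%m'. \<bar>F (x, m, m')\<bar>)" using slot_integrable[OF k F x m] by simp
  show "integrable (k x) (%m'. C * om m * om m')" using om_kernelD(4)[OF k x] by simp
  fix m' assume "m' : space (k x)"
  hence m': "0 <= m'" using om_kernelD(2)[OF k x] by simp
  show "\<bar>F (x, m, m')\<bar> <= C * om m * om m'" using dom2D[OF F x m m'] by (simp add: mult.assoc)
 qed
 also have "... = C * om m * (\<integral>m'. om m' \<partial>k x)" by simp
 also have "... <= C * om m * K" using F om_ge0[OF m] by (intro mult_left_mono om_kernelD(5)[OF k x]) (auto simp: dom2_def)
 finally show ?thesis by (simp add: mult_ac)
qed

lemma pair_integrable:
 assumes k: "om_kernel k K" and k': "om_kernel k' K'" and F: "dom2 F C" and x: "x : {0..<1}"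
 shows "integrable (k x \<Otimes>\<^sub>M k' x) (%z. F (x, fst z, snd z))"
proof -
 interpret a: finite_measure "k x" by (rule om_kernelD(3)[OF k x])
 interpret b: finite_measure "k' x" by (rule om_kernelD(3)[OF k' x])
 interpret ab: pair_sigma_finite "k x" "k' x" ..
 have ss: "sets (k x \<Otimes>\<^sub>M k' x) = sets HH" by (rule sets_pair_measure_cong[OF om_kernelD(1)[OF k x] om_kernelD(1)[OF k' x]])
 have m: "(%z. F (x, fst z, snd z)) : Borel (k x \<Otimes>\<^sub>M k' x)"
  unfolding measurable_cong_sets[OF ss refl] by (rule section_measurable(1)[OF _ x]) (use F in \<open>simp add: dom2_def\<close>)
 have "integrable (k x \<Otimes>\<^sub>M k' x) (%(m, m'). F (x, m, m'))"
 proof (rule ab.Fubini_integrable)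
  show "(%(m, m'). F (x, m, m')) : Borel (k x \<Otimes>\<^sub>M k' x)" using m by (simp add: case_prod_beta')
  show "AE m in k x. integrable (k' x) (%m'. case (m, m') of (m, m') => F (x, m, m'))"
  proof (rule AE_I2)
   fix m assume "m : space (k x)"
   hence "0 <= m" using om_kernelD(2)[OF k x] by simp
   from slot_integrable[OF k' F x this] show "integrable (k' x) (%m'. case (m, m') of (m, m') => F (x, m, m'))" by simp
  qed
  show "integrable (k x) (%m. \<integral>m'. norm (case (m, m') of (m, m') => F (x, m, m')) \<partial>k' x)"
  proof (rule Bochner_Integration.integrable_bound)
   show "integrable (k x) (%m. C * K' * om m)" using om_kernelD(4)[OF k x] by simp
   have F': "dom2 (%z. \<bar>F z\<bar>) C" using F by (auto simp: dom2_def)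
   have eq: "(%m. \<integral>m'. norm (case (m, m') of (m, m') => F (x, m, m')) \<partial>k' x) = (%m. slot k' (%z. \<bar>F z\<bar>) (x, m))" by (simp add: slot_def)
   have "slot k' (%z. \<bar>F z\<bar>) : Borel TH" by (rule slot_measurable) (use k' F' in \<open>auto simp: om_kernel_def dom2_def\<close>)
   from finite_kernel_measurable[OF _ _ this, of k x] k x
   show "(%m. \<integral>m'. norm (case (m, m') of (m, m') => F (x, m, m')) \<partial>k' x) : Borel (k x)" unfolding eq by (simp add: om_kernel_def)
   show "AE m in k x. norm (\<integral>m'. norm (case (m, m') of (m, m') => F (x, m, m')) \<partial>k' x) <= norm (C * K' * om m)"
   proof (rule AE_I2)
    fix m assume "m : space (k x)"
    hence m: "0 <= m" using om_kernelD(2)[OF k x] by simp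
    show "norm (\<integral>m'. norm (case (m, m') of (m, m') => F (x, m, m')) \<partial>k' x) <= norm (C * K' * om m)"
     using slot_bound[OF k' F' x m] unfolding slot_def by simp
   qed
  qed
 qed
 thus ?thesis by (simp add: case_prod_beta')
qed

text \<open>Fubini in each fibre and the symmetry of \<open>F\<close>. It cancels the mixed terms when two solutions are subtracted.\<close>
lemma integral_slot_swap:
 assumes k: "om_kernel k K" and k': "om_kernel k' K'" and F: "dom2 F C"
  and sym: "!!x m m'. 0 <= m ==> 0 <= m' ==> F (x, m, m') = F (x, m', m)"
  and i: "integrable (kint torus halfline k) (slot k' F)" "integrable (kint torus halfline k') (slot k F)"
 shows "(\<integral>z. slot k' F z \<partial>kint torus halfline k) = (\<integral>z. slot k F z \<partial>kint torus halfline k')"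
proof -
 have fk: "finite_kernel torus halfline k" "finite_kernel torus halfline k'" using k k' by (auto simp: om_kernel_def)
 have "(\<integral>m. slot k' F (x, m) \<partial>k x) = (\<integral>m. slot k F (x, m) \<partial>k' x)" if x: "x : space torus" for x
 proof -
  have x': "x : {0..<1}" using x by simp
  interpret a: finite_measure "k x" by (rule om_kernelD(3)[OF k x'])
  interpret b: finite_measure "k' x" by (rule om_kernelD(3)[OF k' x'])
  interpret ab: pair_sigma_finite "k x" "k' x" ..
  have pi: "integrable (k x \<Otimes>\<^sub>M k' x) (%(m, m'). F (x, m, m'))" using pair_integrable[OF k k' F x'] by (simp add: case_prod_beta')
  have "(\<integral>m. slot k' F (x, m) \<partial>k x) = (\<integral>m. \<integral>m'. F (x, m, m') \<partial>k' x \<partial>k x)" by (simp add: slot_def)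
  also have "... = (\<integral>m'. \<integral>m. F (x, m, m') \<partial>k x \<partial>k' x)" by (rule ab.Fubini_integral[OF pi, symmetric])
  also have "... = (\<integral>m'. slot k F (x, m') \<partial>k' x)" unfolding slot_def fst_conv snd_conv using om_kernelD(2)[OF k x'] om_kernelD(2)[OF k' x']
   by (intro bochner_cong refl sym) auto
  finally show ?thesis .
 qed
 thus ?thesis unfolding integral_kint(1)[OF fk(1) i(1)] integral_kint(1)[OF fk(2) i(2)] by (rule bochner_cong[OF refl])
qed

end

context coagulation_cauchy
begin

lemma om_kernel_nk: "om_kernel (nk s) K" unfolding om_kernel_def using finite_kernel_nk nk_om K1 by auto

lemma integrable_N_om_sq:
 assumes "f : Borel TH" "!!z. z : space TH ==> \<bar>f z\<bar> <= C * (om (snd z))\<^sup>2"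
 shows "integrable (N s) f"
proof (rule Bochner_Integration.integrable_bound)
 have m: "(%z. (om (snd z))\<^sup>2) : Borel (N s)" by measurable
 have "(\<integral>\<^sup>+z. ennreal (norm ((om (snd z))\<^sup>2)) \<partial>N s) <= ennreal K3" using N_om_sq[of s] by simp
 hence "integrable (N s) (%z. (om (snd z))\<^sup>2)" by (intro integrableI_bounded m) (auto intro: le_less_trans)
 thus "integrable (N s) (%z. C * (om (snd z))\<^sup>2)" by simp
 show "f : Borel (N s)" using assms(1) by simp
 show "AE z in N s. norm (f z) <= norm (C * (om (snd z))\<^sup>2)" using assms(2) by (intro AE_I2) (auto simp: pair_space intro: order_trans[OF _ abs_ge_self])
qed

definition kgl :: "(real \<times> real => real) => real \<times> real \<times> real => real" where
 "kgl u z = \<kappa> (fst (snd z)) (snd (snd z)) / 2 * gl u z"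

lemma \<kappa>_THH: "(%z. \<kappa> (fst (snd z)) (snd (snd z))) : Borel THH" using measurable_compose[OF measurable_snd \<kappa>_measurable, of torus] by simp

lemma dom2_\<kappa>:
 assumes G: "G : Borel THH" and b: "!!x m m'. x : {0..<1} ==> 0 <= m ==> 0 <= m' ==> \<bar>G (x, m, m')\<bar> <= C" and C: "0 <= C"
 shows "dom2 (%z. \<kappa> (fst (snd z)) (snd (snd z)) / 2 * G z) (C / 2)" unfolding dom2_def
proof (intro conjI ballI allI impI)
 show "(%z. \<kappa> (fst (snd z)) (snd (snd z)) / 2 * G z) : Borel THH"
  by (intro borel_measurable_times borel_measurable_divide \<kappa>_THH G borel_measurable_const)
 fix x m m' :: real assume h: "x : {0..<1}" "0 <= m" "0 <= m'"
 have "\<kappa> m m' / 2 * \<bar>G (x, m, m')\<bar> <= (om m * om m') / 2 * C"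
  using b[OF h] \<kappa>_le[OF h(2,3)] \<kappa>_nonneg[OF h(2,3)] om_nonneg[OF h(2)] om_nonneg[OF h(3)] by (intro mult_mono) auto
 thus "\<bar>\<kappa> (fst (snd (x, m, m'))) (snd (snd (x, m, m'))) / 2 * G (x, m, m')\<bar> <= C / 2 * (om m * om m')"
  using \<kappa>_nonneg[OF h(2,3)] by (simp add: abs_mult mult_ac)
qed (use C in simp)

lemma dom2_kgl:
 assumes u: "u : Borel TH" "!!z. z : space TH ==> \<bar>u z\<bar> <= C" and C: "0 <= C"
 shows "dom2 (kgl u) (3 * C / 2)" unfolding kgl_def[abs_def]
proof (rule dom2_\<kappa>[OF gl_measurable[OF u(1)]])
 fix x m m' :: real assume h: "x : {0..<1}" "0 <= m" "0 <= m'"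
 have "(x, m + m') : space TH" "(x, m) : space TH" "(x, m') : space TH" using h by (auto simp: pair_space)
 from this[THEN u(2)] show "\<bar>gl u (x, m, m')\<bar> <= 3 * C" by (simp add: gl_def)
qed (use C in simp)

lemma kgl_sym: "0 <= m ==> 0 <= m' ==> kgl u (x, m, m') = kgl u (x, m', m)" by (simp add: kgl_def gl_def \<kappa>_sym[of m m'] add.commute)

lemma integrable_slot:
 assumes k: "om_kernel k K'" and F: "dom2 F C"
 shows "integrable (N s) (slot k F)"
proof (rule integrable_N_om(1))
 show "slot k F : Borel TH" by (rule slot_measurable) (use k F in \<open>auto simp: om_kernel_def dom2_def\<close>)
 show "\<bar>slot k F z\<bar> <= C * K' * om (snd z)" if "z : space TH" for z using slot_bound[OF k F, of "fst z" "snd z"] that by (auto simp: pair_space)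
qed

lemma coll_slot:
 assumes u: "u : Borel TH" "!!z. z : space TH ==> \<bar>u z\<bar> <= C" and C: "0 <= C"
 shows "coll s u = num s (slot (nk s) (kgl u))"
proof -
 let ?Q = "kint torus HH (%x. nk s x \<Otimes>\<^sub>M nk s x)"
 note D = dom2_kgl[OF u C]
 have km: "(%z. \<kappa> (fst (snd z)) (snd (snd z)) / 2) : Borel ?Q" using borel_measurable_divide[OF \<kappa>_THH borel_measurable_const, of 2] by simp
 have gm: "gl u : Borel ?Q" using gl_measurable[OF u(1)] by simp
 have pos: "AE z in ?Q. 0 <= \<kappa> (fst (snd z)) (snd (snd z)) / 2" using \<kappa>_nonneg by (intro AE_I2) (auto simp: pair_space)
 have i: "integrable ?Q (%z. \<kappa> (fst (snd z)) (snd (snd z)) / 2 * gl u z)"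
 proof -
  have "integrable (q s) (gl u)" by (rule integrable_q_bounded(1)[OF u])
  thus ?thesis unfolding q_def by (simp only: integrable_real_density[OF km pos gm])
 qed
 have "coll s u = (\<integral>z. \<kappa> (fst (snd z)) (snd (snd z)) / 2 * gl u z \<partial>?Q)"
  unfolding coll_def q_def by (rule integral_real_density[OF km pos gm])
 also have "... = (\<integral>x. \<integral>w. kgl u (x, w) \<partial>(nk s x \<Otimes>\<^sub>M nk s x) \<partial>torus)"
  unfolding kgl_def by (rule integral_kint(1)[OF finite_kernel_pair[OF finite_kernel_nk] i])
 also have "... = (\<integral>x. \<integral>m. slot (nk s) (kgl u) (x, m) \<partial>nk s x \<partial>torus)"
 proof (rule bochner_cong[OF refl])
  fix x assume x: "x : space torus"
  hence x': "x : {0..<1}" by simp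
  interpret a: finite_measure "nk s x" by (rule finite_kernelD(2)[OF finite_kernel_nk x])
  interpret aa: pair_sigma_finite "nk s x" "nk s x" ..
  have "integrable (nk s x \<Otimes>\<^sub>M nk s x) (%z. kgl u (x, z))" using pair_integrable[OF om_kernel_nk om_kernel_nk D x', of s s] by simp
  from aa.integral_fst'[OF this] show "(\<integral>w. kgl u (x, w) \<partial>(nk s x \<Otimes>\<^sub>M nk s x)) = (\<integral>m. slot (nk s) (kgl u) (x, m) \<partial>nk s x)"
   by (simp add: slot_def)
 qed
 also have "... = num s (slot (nk s) (kgl u))" using integrable_slot[OF om_kernel_nk D, of s s] unfolding num_def N_def
  by (rule integral_kint(1)[OF finite_kernel_nk, symmetric])
 finally show ?thesis .
qed

section \<open>Uniform tails\<close>

definition cut :: "real => real => real" where "cut k m = indicator {1 / k..k} m"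

definition tail :: "real => real" where
 "tail k = C3 * (1 + (a 1)\<^sup>2) * K / k
   + C3 * (1 + 1 / (a 1)\<^sup>2) * enn2real (\<integral>\<^sup>+m. ennreal (1 / m) * ennreal ((a m)\<^sup>2 * indicator {..<1 / k} m) \<partial>\<nu>s)"

lemma cut_measurable [measurable]: "cut k : Borel halfline" unfolding cut_def[abs_def] by (rule borel_measurable_halfline) measurable

lemma small_mass_moment_le: "(\<integral>\<^sup>+m. ennreal (1 / m) * ennreal ((a m)\<^sup>2 * indicator {..<1 / k} m) \<partial>\<nu>s) <= ennreal M2"
proof (rule moment_le_M2)
 fix m :: real assume m: "0 < m"
 have "(a m)\<^sup>2 <= (om m)\<^sup>2" using a_le_om[of m] a_nonneg[of m] m by (intro power_mono) auto
 thus "(a m)\<^sup>2 * indicator {..<1 / k} m <= (om m)\<^sup>2" by (auto simp: indicator_def)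
qed

text \<open>Large masses are controlled by \<open>m\<^sup>2 / k\<close>, whose integral is the total mass over \<open>k\<close>, and small masses by \<open>a\<^sup>2\<close>.\<close>
lemma om_sq_tail:
 assumes k: "1 <= k" and m: "0 < m"
 shows "(om m)\<^sup>2 * (1 - cut k m) <= C3 * (1 + (a 1)\<^sup>2) / k * m\<^sup>2 + C3 * (1 + 1 / (a 1)\<^sup>2) * ((a m)\<^sup>2 * indicator {..<1 / k} m)"
proof -
 have a1: "0 < a 1" by (rule a1_pos)
 have nn: "0 <= C3 * (1 + (a 1)\<^sup>2) / k * m\<^sup>2" "0 <= C3 * (1 + 1 / (a 1)\<^sup>2) * ((a m)\<^sup>2 * indicator {..<1 / k} m)"
  using C3_pos k by (auto intro!: mult_nonneg_nonneg divide_nonneg_nonneg add_nonneg_nonneg)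
 consider "m < 1 / k" | "1 / k <= m" "m <= k" | "k < m" by linarith
 thus ?thesis
 proof cases
  case 1
  have "1 / k <= 1" using k by simp
  hence m1: "m <= 1" using 1 by linarith
  have "(a 1)\<^sup>2 <= (a m)\<^sup>2" using a_mono[OF m m1] a1 by (intro power_mono) auto
  hence "1 <= (a m)\<^sup>2 / (a 1)\<^sup>2" using a1 by simp
  hence "m <= 1 / (a 1)\<^sup>2 * (a m)\<^sup>2" using m1 by simp
  hence "C3 * (m + (a m)\<^sup>2) <= C3 * ((1 + 1 / (a 1)\<^sup>2) * (a m)\<^sup>2)" using C3_pos by (intro mult_left_mono) (auto simp: distrib_right)
  thus ?thesis using om_sq_le[OF m] nn(1) 1 by (simp add: cut_def mult.assoc)
 next
  case 2
  thus ?thesis using nn by (simp add: cut_def)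
 next
  case 3
  have m1: "1 <= m" using 3 k by linarith
  have "(a m)\<^sup>2 <= (a 1)\<^sup>2" using a_mono[of 1 m] a_nonneg[of m] m1 by (intro power_mono) auto
  also have "... <= (a 1)\<^sup>2 * m" using m1 by (simp add: mult_le_cancel_left1)
  finally have am: "(a m)\<^sup>2 <= (a 1)\<^sup>2 * m" .
  have "m <= m\<^sup>2 / k" using 3 k m by (simp add: power2_eq_square pos_le_divide_eq mult_left_mono)
  hence "(1 + (a 1)\<^sup>2) * m <= (1 + (a 1)\<^sup>2) * (m\<^sup>2 / k)" by (intro mult_left_mono) (auto intro: add_nonneg_nonneg)
  hence "m + (a m)\<^sup>2 <= (1 + (a 1)\<^sup>2) * (m\<^sup>2 / k)" using am by (simp add: distrib_right)
  hence "C3 * (m + (a m)\<^sup>2) <= C3 * ((1 + (a 1)\<^sup>2) * (m\<^sup>2 / k))" using C3_pos by (intro mult_left_mono) auto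
  thus ?thesis using om_sq_le[OF m] nn(2) 3 by (simp add: cut_def)
 qed
qed

lemma num_tail:
 assumes k: "1 <= k" and s: "s : {0..T}"
 shows "num s (%z. (om (snd z))\<^sup>2 * (1 - cut k (snd z))) <= tail k"
proof -
 define R where "R = enn2real (\<integral>\<^sup>+m. ennreal (1 / m) * ennreal ((a m)\<^sup>2 * indicator {..<1 / k} m) \<partial>\<nu>s)"
 define A B where "A = C3 * (1 + (a 1)\<^sup>2) / k" and "B = C3 * (1 + 1 / (a 1)\<^sup>2)"
 have R: "(\<integral>\<^sup>+m. ennreal (1 / m) * ennreal ((a m)\<^sup>2 * indicator {..<1 / k} m) \<partial>\<nu>s) = ennreal R"
  unfolding R_def using le_less_trans[OF small_mass_moment_le[of k], of top] by simp
 have AB: "0 <= A" "0 <= B" unfolding A_def B_def using C3_pos k by (auto intro!: mult_nonneg_nonneg divide_nonneg_nonneg add_nonneg_nonneg)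
 have R0: "0 <= R" by (simp add: R_def)
 have im: "(indicator {..<1 / k} :: real => real) : Borel halfline" by (rule borel_measurable_halfline) simp
 have pm: "(%m. (a m)\<^sup>2 * indicator {..<1 / k} m) : Borel halfline" by (intro borel_measurable_times borel_measurable_power a_measurable im)
 have sq: "(%z. ennreal ((snd z)\<^sup>2)) : Borel (N s)"
 proof -
  have "snd : Borel TH" by (rule measurable_halflineD) measurable
  thus ?thesis by simp
 qed
 have pz: "(%z. ennreal ((a (snd z))\<^sup>2 * indicator {..<1 / k} (snd z))) : Borel (N s)"
  using measurable_compose[OF measurable_compose[OF measurable_snd pm, of torus] measurable_ennreal] by simp
 have "num s (%z. (om (snd z))\<^sup>2 * (1 - cut k (snd z))) <= A * K + B * R" unfolding num_def
 proof (rule integral_le_nn_bound)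
  show "integrable (N s) (%z. (om (snd z))\<^sup>2 * (1 - cut k (snd z)))"
  proof (rule integrable_N_om_sq)
   show "(%z. (om (snd z))\<^sup>2 * (1 - cut k (snd z))) : Borel TH" by measurable
   show "\<bar>(om (snd z))\<^sup>2 * (1 - cut k (snd z))\<bar> <= 1 * (om (snd z))\<^sup>2" for z by (simp add: cut_def indicator_def)
  qed
  show "AE z in N s. (om (snd z))\<^sup>2 * (1 - cut k (snd z)) <= A * (snd z)\<^sup>2 + B * ((a (snd z))\<^sup>2 * indicator {..<1 / k} (snd z))"
   using AE_N_pos by eventually_elim (simp only: A_def B_def om_sq_tail[OF k])
  have "(\<integral>\<^sup>+z. ennreal (A * (snd z)\<^sup>2 + B * ((a (snd z))\<^sup>2 * indicator {..<1 / k} (snd z))) \<partial>N s)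
    = (\<integral>\<^sup>+z. ennreal A * ennreal ((snd z)\<^sup>2) + ennreal B * ennreal ((a (snd z))\<^sup>2 * indicator {..<1 / k} (snd z)) \<partial>N s)"
   using AB by (intro nn_integral_cong) (simp add: ennreal_mult)
  also have "... = ennreal A * (\<integral>\<^sup>+z. ennreal ((snd z)\<^sup>2) \<partial>N s) + ennreal B * (\<integral>\<^sup>+z. ennreal ((a (snd z))\<^sup>2 * indicator {..<1 / k} (snd z)) \<partial>N s)"
   using sq pz by (simp add: nn_integral_add nn_integral_cmult)
  also have "... <= ennreal A * ennreal K + ennreal B * ennreal R"
  proof (intro add_mono mult_left_mono N_mass2)
   show "(\<integral>\<^sup>+z. ennreal ((a (snd z))\<^sup>2 * indicator {..<1 / k} (snd z)) \<partial>N s) <= ennreal R" unfolding R[symmetric]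
   proof (rule decreasing_weight[where ph="%m. (a m)\<^sup>2 * indicator {..<1 / k} m", OF pm _ _ s])
    fix m m' :: real assume m: "0 < m" "m <= m'"
    have "(a m')\<^sup>2 <= (a m)\<^sup>2" using a_mono[OF m] a_nonneg[of m'] m by (intro power_mono) auto
    thus "(a m')\<^sup>2 * indicator {..<1 / k} m' <= (a m)\<^sup>2 * indicator {..<1 / k} m" using m(2) by (auto simp: indicator_def)
   qed simp
  qed simp_all
  also have "... = ennreal (A * K + B * R)" using AB R0 K1 by (simp add: ennreal_mult)
  finally show "(\<integral>\<^sup>+z. ennreal (A * (snd z)\<^sup>2 + B * ((a (snd z))\<^sup>2 * indicator {..<1 / k} (snd z))) \<partial>N s) <= ennreal (A * K + B * R)" .
  show "0 <= A * K + B * R" using AB R0 K1 by simp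
 qed
 thus ?thesis by (simp add: tail_def A_def B_def R_def)
qed

lemma tail_nonneg: "1 <= k ==> 0 <= tail k" unfolding tail_def using C3_pos K1 by (intro add_nonneg_nonneg mult_nonneg_nonneg divide_nonneg_nonneg) auto

lemma tail_tendsto: "(%n. tail (real (Suc n))) \<longlonglongrightarrow> 0"
proof -
 define F where "F n m = ennreal (1 / m) * ennreal ((a m)\<^sup>2 * indicator {..<1 / real (Suc n)} m)" for n :: nat and m :: real
 have Fm: "F n : Borel \<nu>s" for n
 proof -
  have "(indicator {..<1 / real (Suc n)} :: real => real) : Borel halfline" by (rule borel_measurable_halfline) simp
  hence "F n : Borel halfline" unfolding F_def[abs_def] by measurable
  thus ?thesis unfolding measurable_cong_sets[OF nustar(1) refl] .
 qed
 have "(%n. \<integral>\<^sup>+m. F n m \<partial>\<nu>s) \<longlonglongrightarrow> (\<integral>\<^sup>+m. 0 \<partial>\<nu>s)"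
 proof (rule nn_integral_dominated_convergence[where w="F 0"])
  show "AE m in \<nu>s. F n m <= F 0 m" for n
  proof (rule AE_I2)
   fix m
   have "(indicator {..<1 / real (Suc n)} m :: real) <= indicator {..<1 / real (Suc 0)} m"
   proof -
    have b: "1 / real (Suc n) <= 1" by simp
    have "m < 1" if "m < 1 / real (Suc n)" by (rule less_le_trans[OF that b])
    thus ?thesis by (auto simp: indicator_def simp del: of_nat_Suc)
   qed
   thus "F n m <= F 0 m" unfolding F_def by (intro mult_left_mono ennreal_leI) auto
  qed
  show "(\<integral>\<^sup>+m. F 0 m \<partial>\<nu>s) < \<infinity>" unfolding F_def by (rule le_less_trans[OF small_mass_moment_le]) simp
  show "AE m in \<nu>s. (%n. F n m) \<longlonglongrightarrow> 0"
  proof (rule AE_I2)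
   fix m assume "m : space \<nu>s"
   hence m: "0 <= m" using sets_eq_imp_space_eq[OF nustar(1)] by simp
   show "(%n. F n m) \<longlonglongrightarrow> 0"
   proof (cases "m = 0")
    case False
    hence mp: "0 < m" using m by simp
    then obtain n0 where n0: "1 / real (Suc n0) < m" using reals_Archimedean[of m] by (auto simp: inverse_eq_divide)
    have "F n m = 0" if "n >= n0" for n
    proof -
     have "1 / real (Suc n) <= 1 / real (Suc n0)" using that by (simp add: frac_le)
     thus ?thesis using n0 by (simp add: F_def)
    qed
    hence "eventually (%n. F n m = 0) sequentially" using eventually_sequentially by blast
    thus ?thesis by (rule tendsto_eventually)
   qed (simp add: F_def)
  qed
 qed (use Fm in auto)
 hence "(%n. \<integral>\<^sup>+m. F n m \<partial>\<nu>s) \<longlonglongrightarrow> ennreal 0" by simp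
 hence 1: "(%n. enn2real (\<integral>\<^sup>+m. F n m \<partial>\<nu>s)) \<longlonglongrightarrow> 0" by (rule tendsto_enn2real) simp
 have 2: "(%n. C3 * (1 + (a 1)\<^sup>2) * K / real (Suc n)) \<longlonglongrightarrow> 0" by (rule LIMSEQ_Suc[OF lim_const_over_n])
 show ?thesis using tendsto_add[OF 2 tendsto_mult_left[OF 1, of "C3 * (1 + 1 / (a 1)\<^sup>2)"]] by (simp only: tail_def F_def mult_zero_right add_0_left)
qed

end
section \<open>The difference of two solutions\<close>

lemma integral_mono_measure_on:
 fixes f :: "'a => real"
 assumes s: "sets N = sets M" and Y: "Y : sets M" and le: "!!X. X : sets M ==> X \<subseteq> Y ==> emeasure N X <= emeasure M X"
  and i: "integrable N f" "integrable M f" and f: "!!x. x : Y ==> 0 <= f x"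
 shows "(\<integral>x. indicator Y x * f x \<partial>N) <= (\<integral>x. indicator Y x * f x \<partial>M)"
proof -
 have Y': "Y : sets N" using s Y by simp
 have sp: "space N = space M" using s by (rule sets_eq_imp_space_eq)
 have fm: "f : Borel M" "f : Borel N" using i by auto
 have d: "(\<integral>\<^sup>+x. ennreal (indicator Y x * f x) \<partial>P) = (\<integral>\<^sup>+x. ennreal (f x) \<partial>density P (indicator Y))"
  if "Y : sets P" "f : Borel P" for P using that by (subst nn_integral_density) (auto intro!: nn_integral_cong simp: indicator_def)
 have "density N (indicator Y) <= density M (indicator Y)"
 proof (subst le_measure)
  show "sets (density N (indicator Y)) = sets (density M (indicator Y))" using s by simp
  show "\<forall>X\<in>sets (density N (indicator Y)). emeasure (density N (indicator Y)) X <= emeasure (density M (indicator Y)) X"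
  proof
   fix X assume "X : sets (density N (indicator Y))"
   hence X: "X : sets N" "X : sets M" using s by simp_all
   show "emeasure (density N (indicator Y)) X <= emeasure (density M (indicator Y)) X" using le[of "Y \<inter> X"] X Y by (simp add: emeasure_restricted Y')
  qed
 qed
 hence "(\<integral>\<^sup>+x. ennreal (indicator Y x * f x) \<partial>N) <= (\<integral>\<^sup>+x. ennreal (indicator Y x * f x) \<partial>M)"
  unfolding d[OF Y' fm(2)] d[OF Y fm(1)] by (intro nn_integral_mono_measure) (simp_all add: s)
 moreover have fin: "(\<integral>\<^sup>+x. ennreal (indicator Y x * f x) \<partial>M) < \<infinity>"
 proof -
  have "(\<integral>\<^sup>+x. ennreal (indicator Y x * f x) \<partial>M) <= (\<integral>\<^sup>+x. ennreal (norm (f x)) \<partial>M)"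
   by (intro nn_integral_mono ennreal_leI) (auto simp: indicator_def)
  thus ?thesis using i(2) by (auto simp: integrable_iff_bounded intro: le_less_trans)
 qed
 have e: "(\<integral>x. indicator Y x * f x \<partial>P) = enn2real (\<integral>\<^sup>+x. ennreal (indicator Y x * f x) \<partial>P)"
  if "Y : sets P" "f : Borel P" for P using that f by (intro integral_eq_nn_integral AE_I2) (auto simp: indicator_def)
 show ?thesis unfolding e[OF Y' fm(2)] e[OF Y fm(1)] using calculation fin by (intro enn2real_mono) auto
qed

locale coagulation_pair =
 A: coagulation_cauchy \<Phi> a c p \<mu> T K \<nu> \<nu>s + B: coagulation_cauchy \<Phi> a c p \<mu>' T K \<nu> \<nu>s
 for \<Phi> a c p \<mu> \<mu>' T K \<nu> \<nu>s
begin

definition D :: "real => (real \<times> real => real) => real" where "D s f = A.num s f - B.num s f"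

definition L :: real where "L = 8 * (K * A.K3)"

definition w :: "real => real => real" where "w k m = A.om m * A.cut k m"

definition V :: "real => (real \<times> real => real) set" where
 "V k = {v : Borel TH. \<forall>z\<in>space TH. \<bar>v z\<bar> <= w k (snd z)}"

text \<open>The truncated norm of the difference, as a supremum over test functions so that it is compatible with the heat flow.\<close>
definition NB :: "real => real => real" where "NB k t = (SUP v\<in>V k. D t v)"

definition dq :: "(real \<times> real => real) => bool" where
 "dq f \<longleftrightarrow> f : Borel TH & (\<exists>C. \<forall>z\<in>space TH. \<bar>f z\<bar> <= C * (A.om (snd z))\<^sup>2)"

lemma TH_mass: "z : space TH ==> 0 <= snd z" by (auto simp: pair_space)

lemma L_nonneg: "0 <= L" using A.K1 A.K3_nonneg by (simp add: L_def)

lemma dqI: "f : Borel TH ==> (!!z. z : space TH ==> \<bar>f z\<bar> <= C * (A.om (snd z))\<^sup>2) ==> dq f" unfolding dq_def by blast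

lemma dq_om:
 assumes "f : Borel TH" "!!z. z : space TH ==> \<bar>f z\<bar> <= C * A.om (snd z)"
 shows "dq f"
proof (rule dqI[OF assms(1)])
 fix z assume z: "z : space TH"
 have "0 <= C * A.om (snd z)" using order_trans[OF abs_ge_zero assms(2)[OF z]] .
 hence C: "0 <= C" using A.om_ge1[OF TH_mass[OF z]] by (simp add: zero_le_mult_iff)
 have "\<bar>f z\<bar> <= C * A.om (snd z)" by (rule assms(2)[OF z])
 also have "... <= C * (A.om (snd z))\<^sup>2" by (rule mult_left_mono[OF A.om_le_sq[OF TH_mass[OF z]] C])
 finally show "\<bar>f z\<bar> <= C * (A.om (snd z))\<^sup>2" .
qed

lemma dqD:
 assumes "dq f"
 shows "f : Borel TH" "integrable (A.N s) f" "integrable (B.N s) f"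
proof -
 show m: "f : Borel TH" using assms by (simp add: dq_def)
 obtain C where C: "!!z. z : space TH ==> \<bar>f z\<bar> <= C * (A.om (snd z))\<^sup>2" using assms unfolding dq_def by blast
 show "integrable (A.N s) f" by (rule A.integrable_N_om_sq[OF m C])
 show "integrable (B.N s) f" by (rule B.integrable_N_om_sq[OF m C])
qed

lemma dq_add:
 assumes f: "dq f" and g: "dq g" shows "dq (%z. al * f z + \<beta> * g z)"
proof -
 obtain C where C: "!!z. z : space TH ==> \<bar>f z\<bar> <= C * (A.om (snd z))\<^sup>2" using f unfolding dq_def by blast
 obtain C' where C': "!!z. z : space TH ==> \<bar>g z\<bar> <= C' * (A.om (snd z))\<^sup>2" using g unfolding dq_def by blast
 show ?thesis
 proof (rule dqI[where C="\<bar>al\<bar> * C + \<bar>\<beta>\<bar> * C'"])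
  show "(%z. al * f z + \<beta> * g z) : Borel TH" by (intro borel_measurable_add borel_measurable_times borel_measurable_const dqD(1) f g)
  fix z assume z: "z : space TH"
  have "\<bar>al * f z + \<beta> * g z\<bar> <= \<bar>al\<bar> * \<bar>f z\<bar> + \<bar>\<beta>\<bar> * \<bar>g z\<bar>" by (simp add: abs_mult[symmetric])
  also have "... <= \<bar>al\<bar> * (C * (A.om (snd z))\<^sup>2) + \<bar>\<beta>\<bar> * (C' * (A.om (snd z))\<^sup>2)"
   by (intro add_mono mult_left_mono C C' z) auto
  finally show "\<bar>al * f z + \<beta> * g z\<bar> <= (\<bar>al\<bar> * C + \<bar>\<beta>\<bar> * C') * (A.om (snd z))\<^sup>2" by (simp add: algebra_simps)
 qed
qed

lemma dq_sign:
 assumes "dq f" "X : sets TH"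
 shows "dq (%z. (2 * indicator X z - 1) * f z)"
proof -
 obtain C where C: "!!z. z : space TH ==> \<bar>f z\<bar> <= C * (A.om (snd z))\<^sup>2" using assms unfolding dq_def by blast
 show ?thesis
 proof (rule dqI)
  show "(%z. (2 * indicator X z - 1) * f z) : Borel TH" using assms(2) dqD(1)[OF assms(1)] by measurable
  show "\<bar>(2 * indicator X z - 1) * f z\<bar> <= C * (A.om (snd z))\<^sup>2" if "z : space TH" for z using C[OF that] by (simp add: indicator_def abs_mult)
 qed
qed

lemma D_linear:
 assumes f: "dq f" and g: "dq g"
 shows "D s (%z. al * f z + \<beta> * g z) = al * D s f + \<beta> * D s g"
 unfolding D_def A.num_linear[OF dqD(2)[OF f] dqD(2)[OF g]] B.num_linear[OF dqD(3)[OF f] dqD(3)[OF g]] by algebra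

text \<open>Replacing the time \<open>s\<close> by \<open>t\<close> in a test function costs the length of the interval; the mild equation supplies the rate.\<close>
lemma flow:
 assumes v: "v : Borel TH" "!!z. z : space TH ==> \<bar>v z\<bar> <= C * A.om (snd z)"
  and t: "0 <= t" "t <= s" "s <= T"
 shows "\<bar>D s v - D t (heat a (s - t) v)\<bar> <= C * L * (s - t)"
proof -
 have 1: "\<bar>tint t s (%r. A.coll r (heat a (max 0 (s - r)) v))\<bar> <= 4 * C * (K * A.K3) * (s - t)"
  by (rule tint_abs_le[OF A.mild_equation(2)[OF v t] A.mild_equation(3)[OF v t] t(2) A.mild_equation(3)[OF v t]])
 have 2: "\<bar>tint t s (%r. B.coll r (heat a (max 0 (s - r)) v))\<bar> <= 4 * C * (K * A.K3) * (s - t)"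
  by (rule tint_abs_le[OF B.mild_equation(2)[OF v t] B.mild_equation(3)[OF v t] t(2) B.mild_equation(3)[OF v t]])
 have "C * L * (s - t) = 4 * C * (K * A.K3) * (s - t) + 4 * C * (K * A.K3) * (s - t)" unfolding L_def by algebra
 thus ?thesis using 1 2 A.mild_equation(1)[OF v t] B.mild_equation(1)[OF v t] unfolding D_def by linarith
qed

lemma w_bounds: "0 <= m ==> 0 <= w k m" "0 <= m ==> w k m <= A.om m" using A.om_nonneg[of m] by (auto simp: w_def A.cut_def indicator_def)

lemma w_measurable: "w k : Borel halfline" unfolding w_def[abs_def] by (intro borel_measurable_times A.om_measurable A.cut_measurable)

lemma VD:
 assumes "v : V k"
 shows "v : Borel TH" "z : space TH ==> \<bar>v z\<bar> <= w k (snd z)" "z : space TH ==> \<bar>v z\<bar> <= 1 * A.om (snd z)"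
 using assms w_bounds(2)[OF TH_mass, of z k] by (auto simp: V_def)

lemma V_dq: "v : V k ==> dq v" by (rule dq_om[OF VD(1) VD(3)])

lemma V_zero: "(%_. 0) : V k" using w_bounds(1)[OF TH_mass] by (simp add: V_def)

lemma D_le:
 assumes "v : Borel TH" "!!z. z : space TH ==> \<bar>v z\<bar> <= C * A.om (snd z)"
 shows "D t v <= 2 * (C * K)" using A.integrable_N_om(2)[OF assms, of t] B.integrable_N_om(2)[OF assms, of t] unfolding D_def by linarith

lemma NB_upper: "v : V k ==> D t v <= NB k t" unfolding NB_def
proof (rule cSUP_upper)
 show "bdd_above (D t ` V k)"
 proof (rule bdd_aboveI2)
  show "D t v <= 2 * (1 * K)" if "v : V k" for v by (rule D_le[OF VD(1)[OF that] VD(3)[OF that]])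
 qed
qed

lemma NB_least: "(!!v. v : V k ==> D t v <= M) ==> NB k t <= M" unfolding NB_def by (rule cSUP_least) (use V_zero in auto)

lemma heat_V:
 assumes v: "v : V k" shows "heat a r v : V k" unfolding V_def
proof (intro CollectI conjI ballI)
 show "heat a r v : Borel TH" by (rule heat_measurable[OF A.a_measurable VD(1)[OF v]])
 fix z assume z: "z : space TH"
 obtain x m where zz: "z = (x, m)" by (cases z)
 have "\<bar>v (y, m)\<bar> <= w k m" if "y : {0..<1}" for y using VD(2)[OF v, of "(y, m)"] z that zz by (auto simp: pair_space)
 thus "\<bar>heat a r v z\<bar> <= w k (snd z)" unfolding zz snd_conv by (rule A.heat_bound)
qed

lemma NB_flow:
 assumes t: "0 <= t" "t <= s" "s <= T"
 shows "NB k s <= NB k t + L * (s - t)"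
proof (rule NB_least)
 fix v assume v: "v : V k"
 have "\<bar>D s v - D t (heat a (s - t) v)\<bar> <= 1 * L * (s - t)" by (rule flow[OF VD(1)[OF v] VD(3)[OF v] t])
 thus "D s v <= NB k t + L * (s - t)" using NB_upper[OF heat_V[OF v], of t "s - t"] by simp
qed

lemma NB_0: "NB k 0 <= 0"
proof (rule NB_least)
 fix v assume v: "v : V k"
 have z0: "0 : {0..T}" using A.T0 by simp
 have eq: "A.num 0 f = B.num 0 f" if "f : Borel TH" "!!x m. (x, m) : space TH ==> f (x, m) = m * f' (x, m)" "f' : Borel TH" for f f'
 proof -
  have "A.num 0 f = A.num 0 (%z. snd z * f' z)" unfolding A.num_def by (rule bochner_cong) (use that(2) in \<open>auto simp: pair_space\<close>)
  also have "... = (\<integral>z. f' z \<partial>\<mu> 0)" by (rule A.integral_mu[OF z0 that(3), symmetric])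
  also have "... = (\<integral>z. f' z \<partial>\<mu>' 0)" by (simp only: A.initial_measure B.initial_measure)
  also have "... = B.num 0 (%z. snd z * f' z)" by (rule B.integral_mu[OF z0 that(3)])
  also have "... = B.num 0 f" unfolding B.num_def by (rule bochner_cong) (use that(2) in \<open>auto simp: pair_space\<close>)
  finally show ?thesis .
 qed
 have s: "snd : Borel TH" by (rule measurable_halflineD) measurable
 define f where "f z = (if snd z = 0 then 0 else v z)" for z
 have fm: "f : Borel TH" unfolding f_def[abs_def] using s VD(1)[OF v] by measurable
 have "A.num 0 f = B.num 0 f"
 proof (rule eq[OF fm])
  show "(%z. f z / snd z) : Borel TH" by (rule borel_measurable_divide[OF fm s])
  show "f (x, m) = m * (f (x, m) / snd (x, m))" for x m by (simp add: f_def)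
 qed
 moreover have "A.num 0 f = A.num 0 v" by (rule A.num_cong[OF fm VD(1)[OF v]]) (simp add: f_def)
 moreover have "B.num 0 f = B.num 0 v" by (rule B.num_cong[OF fm VD(1)[OF v]]) (simp add: f_def)
 ultimately show "D 0 v <= 0" by (simp add: D_def)
qed

text \<open>The Hahn set of the difference maximises the pairing among functions of given absolute value.\<close>
lemma sign_set:
 obtains X where "X : sets TH"
  "!!f g. dq f ==> dq g ==> AE z in A.N s. \<bar>f z\<bar> <= g z ==> AE z in B.N s. \<bar>f z\<bar> <= g z ==>
    D s f <= D s (%z. (2 * indicator X z - 1) * g z)"
proof -
 have sN: "sets (B.N s) = sets (A.N s)" by simp
 obtain X where X: "X : sets (A.N s)" and X1: "!!Y. Y : sets (A.N s) ==> Y \<subseteq> X ==> emeasure (B.N s) Y <= emeasure (A.N s) Y"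
  and X2: "!!Y. Y : sets (A.N s) ==> Y \<inter> X = {} ==> emeasure (A.N s) Y <= emeasure (B.N s) Y"
  using finite_unsigned_Hahn_decomposition[OF A.finite_N B.finite_N sN] by blast
 have XT: "X : sets TH" using X by simp
 define X' where "X' = space TH - X"
 have X'T: "X' : sets TH" unfolding X'_def using XT by auto
 have pos: "0 <= D s ps" if ps: "dq ps" and p: "!!z. z : X ==> 0 <= ps z" and n: "!!z. z : space TH ==> z \<notin> X ==> ps z <= 0" for ps
 proof -
  have iA: "integrable (A.N s) ps" and iB: "integrable (B.N s) ps" by (rule dqD(2)[OF ps], rule dqD(3)[OF ps])
  have 1: "(\<integral>z. indicator X z * ps z \<partial>B.N s) <= (\<integral>z. indicator X z * ps z \<partial>A.N s)"
   by (rule integral_mono_measure_on[OF sN X X1 iB iA p])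
  have 2: "(\<integral>z. indicator X' z * (- ps z) \<partial>A.N s) <= (\<integral>z. indicator X' z * (- ps z) \<partial>B.N s)"
  proof (rule integral_mono_measure_on)
   show "sets (A.N s) = sets (B.N s)" by simp
   show "X' : sets (B.N s)" using X'T by simp
   show "emeasure (A.N s) Y <= emeasure (B.N s) Y" if "Y : sets (B.N s)" "Y \<subseteq> X'" for Y by (rule X2) (use that in \<open>auto simp: X'_def\<close>)
   show "0 <= - ps z" if "z : X'" for z using n[of z] that by (simp add: X'_def)
  qed (use iA iB in simp_all)
  have sp: "(\<integral>z. ps z \<partial>P) = (\<integral>z. indicator X z * ps z \<partial>P) - (\<integral>z. indicator X' z * (- ps z) \<partial>P)"
   if "integrable P ps" "sets P = sets TH" for P
  proof -
   have "integrable P (%z. indicator X z * ps z)" "integrable P (%z. indicator X' z * (- ps z))"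
    using that XT X'T integrable_real_mult_indicator[of X P ps] integrable_real_mult_indicator[of X' P "%z. - ps z"] by (simp_all add: mult.commute)
   hence "(\<integral>z. indicator X z * ps z \<partial>P) - (\<integral>z. indicator X' z * (- ps z) \<partial>P) = (\<integral>z. indicator X z * ps z - indicator X' z * (- ps z) \<partial>P)"
    by (rule Bochner_Integration.integral_diff[symmetric])
   also have "... = (\<integral>z. ps z \<partial>P)" by (rule bochner_cong[OF refl])
     (use sets_eq_imp_space_eq[OF that(2)] in \<open>auto simp: X'_def indicator_def\<close>)
   finally show ?thesis ..
  qed
  show ?thesis unfolding D_def A.num_def B.num_def using 1 2 sp[OF iA] sp[OF iB] by simp
 qed
 show thesis
 proof (rule that[OF XT])
  fix f g assume f: "dq f" and g: "dq g" and le: "AE z in A.N s. \<bar>f z\<bar> <= g z" "AE z in B.N s. \<bar>f z\<bar> <= g z"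
  define g' where "g' z = max (g z) \<bar>f z\<bar>" for z
  have g': "dq g'"
  proof -
   obtain C where C: "!!z. z : space TH ==> \<bar>f z\<bar> <= C * (A.om (snd z))\<^sup>2" using f unfolding dq_def by blast
   obtain C' where C': "!!z. z : space TH ==> \<bar>g z\<bar> <= C' * (A.om (snd z))\<^sup>2" using g unfolding dq_def by blast
   show ?thesis
   proof (rule dqI[where C="C + C'"])
    show "g' : Borel TH" unfolding g'_def[abs_def] using dqD(1)[OF f] dqD(1)[OF g] by measurable
    fix z assume z: "z : space TH"
    have "\<bar>g' z\<bar> <= \<bar>f z\<bar> + \<bar>g z\<bar>" by (auto simp: g'_def)
    thus "\<bar>g' z\<bar> <= (C + C') * (A.om (snd z))\<^sup>2" using C[OF z] C'[OF z] by (simp add: distrib_right)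
   qed
  qed
  let ?S = "%z. 2 * indicator X z - 1 :: real"
  have "D s (%z. ?S z * g z) = D s (%z. ?S z * g' z)"
  proof -
   have m: "(%z. ?S z * g z) : Borel TH" "(%z. ?S z * g' z) : Borel TH" by (rule dqD(1)[OF dq_sign[OF g XT]], rule dqD(1)[OF dq_sign[OF g' XT]])
   have "AE z in A.N s. ?S z * g z = ?S z * g' z" using le(1) by eventually_elim (simp add: g'_def)
   moreover have "AE z in B.N s. ?S z * g z = ?S z * g' z" using le(2) by eventually_elim (simp add: g'_def)
   ultimately show ?thesis unfolding D_def A.num_def B.num_def using m by (intro arg_cong2[where f="(-)"] integral_cong_AE) simp_all
  qed
  moreover have "0 <= D s (%z. 1 * (?S z * g' z) + (-1) * f z)"
  proof (rule pos)
   show "dq (%z. 1 * (?S z * g' z) + (-1) * f z)" by (rule dq_add[OF dq_sign[OF g' XT] f])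
   show "0 <= 1 * (?S z * g' z) + (-1) * f z" if "z : X" for z using that abs_ge_self[of "f z"] by (simp add: g'_def le_max_iff_disj)
   show "1 * (?S z * g' z) + (-1) * f z <= 0" if "z : space TH" "z \<notin> X" for z using that by (simp add: g'_def)
  qed
  moreover have "D s (%z. 1 * (?S z * g' z) + (-1) * f z) = 1 * D s (%z. ?S z * g' z) + (-1) * D s f" by (rule D_linear[OF dq_sign[OF g' XT] f])
  ultimately show "D s f <= D s (%z. ?S z * g z)" by linarith
 qed
qed

end
context coagulation_pair
begin

section \<open>Growth of the truncated norm and uniqueness\<close>

definition Sg :: "real => (real \<times> real \<times> real => real) => real \<times> real => real" where
 "Sg s F z = slot (A.nk s) F z + slot (B.nk s) F z"

definition rate :: "real \<times> real \<times> real => real" where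
 "rate z = A.\<kappa> (fst (snd z)) (snd (snd z)) / 2 * 1"

definition lam :: "real => real \<times> real => real" where "lam s = Sg s rate"

definition F1 :: "(real \<times> real => real) => real \<times> real \<times> real => real" where
 "F1 u z = A.\<kappa> (fst (snd z)) (snd (snd z)) / 2 * (u (fst z, fst (snd z) + snd (snd z)) - u (fst z, snd (snd z)))"

definition W :: "real => real" where "W k = A.c0 * (k powr p + a (1 / k) + 1)"

lemma D_cong:
 assumes "!!z. z : space TH ==> f z = g z" shows "D s f = D s g"
proof -
 have "A.num s f = A.num s g" unfolding A.num_def by (rule bochner_cong) (use assms in \<open>auto simp: pair_space\<close>)
 moreover have "B.num s f = B.num s g" unfolding B.num_def by (rule bochner_cong) (use assms in \<open>auto simp: pair_space\<close>)
 ultimately show ?thesis by (simp add: D_def)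
qed

lemma slot_dq:
 assumes k: "A.om_kernel k K'" and F: "A.dom2 F C"
 shows "dq (slot k F)"
proof (rule dq_om)
 show "slot k F : Borel TH" by (rule slot_measurable) (use k F in \<open>auto simp: A.om_kernel_def A.dom2_def\<close>)
 show "\<bar>slot k F z\<bar> <= C * K' * A.om (snd z)" if "z : space TH" for z using A.slot_bound[OF k F, of "fst z" "snd z"] that by (auto simp: pair_space)
qed

lemma Sg_dq:
 assumes F: "A.dom2 F C" shows "dq (Sg s F)"
proof -
 have "dq (%z. 1 * slot (A.nk s) F z + 1 * slot (B.nk s) F z)" by (rule dq_add[OF slot_dq[OF A.om_kernel_nk F] slot_dq[OF B.om_kernel_nk F]])
 moreover have "(%z. 1 * slot (A.nk s) F z + 1 * slot (B.nk s) F z) = Sg s F" by (simp add: Sg_def fun_eq_iff)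
 ultimately show ?thesis by simp
qed

lemma collision_difference:
 assumes u: "u : Borel TH" "!!z. z : space TH ==> \<bar>u z\<bar> <= C" and C: "0 <= C"
 shows "A.coll s u - B.coll s u = D s (Sg s (A.kgl u))"
proof -
 let ?F = "A.kgl u"
 note F = A.dom2_kgl[OF u C]
 have x: "A.num s (slot (B.nk s) ?F) = B.num s (slot (A.nk s) ?F)" using A.integral_slot_swap[OF A.om_kernel_nk B.om_kernel_nk F A.kgl_sym, of s s]
   A.integrable_slot[OF B.om_kernel_nk F, of s s] B.integrable_slot[OF A.om_kernel_nk F, of s s] unfolding A.num_def B.num_def A.N_def B.N_def by blast
 have "D s (%z. 1 * slot (A.nk s) ?F z + 1 * slot (B.nk s) ?F z) = 1 * D s (slot (A.nk s) ?F) + 1 * D s (slot (B.nk s) ?F)"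
  by (rule D_linear[OF slot_dq[OF A.om_kernel_nk F] slot_dq[OF B.om_kernel_nk F]])
 moreover have "D s (%z. 1 * slot (A.nk s) ?F z + 1 * slot (B.nk s) ?F z) = D s (Sg s ?F)" by (rule D_cong) (simp add: Sg_def)
 ultimately show ?thesis using x A.coll_slot[OF u C, of s] B.coll_slot[OF u C, of s] unfolding D_def by simp
qed

lemma rate_dom2: "A.dom2 rate (1 / 2)" unfolding rate_def[abs_def] by (rule A.dom2_\<kappa>) simp_all

lemma lam_bounds:
 assumes "x : {0..<1}" "0 <= m"
 shows "0 <= lam s (x, m)" "lam s (x, m) <= K * A.om m"
proof -
 have nn: "0 <= slot k rate (x, m)" if "A.om_kernel k K" for k unfolding slot_def fst_conv snd_conv
  using A.om_kernelD(2)[OF that assms(1)] assms A.\<kappa>_nonneg by (intro integral_nonneg_AE AE_I2) (auto simp: rate_def)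
 show "0 <= lam s (x, m)" using nn[OF A.om_kernel_nk] nn[OF B.om_kernel_nk] by (simp add: lam_def Sg_def)
 have "slot (A.nk s) rate (x, m) <= 1 / 2 * K * A.om m" "slot (B.nk s) rate (x, m) <= 1 / 2 * K * A.om m"
  using A.slot_bound[OF A.om_kernel_nk rate_dom2 assms, of s] A.slot_bound[OF B.om_kernel_nk rate_dom2 assms, of s] by linarith+
 thus "lam s (x, m) <= K * A.om m" by (simp add: lam_def Sg_def)
qed

lemma lam_measurable: "lam s : Borel TH" unfolding lam_def by (rule dqD(1)[OF Sg_dq[OF rate_dom2]])

lemma W_bound:
 assumes k: "1 <= k" and m: "0 <= m" shows "w k m <= W k"
proof (cases "m : {1 / k..k}")
 case True
 have k0: "0 < 1 / k" using k by simp
 have m0: "0 < m" by (rule less_le_trans[OF k0]) (use True in simp)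
 have "m powr p <= k powr p" using True m A.p_range by (intro powr_mono2) auto
 moreover have "a m <= a (1 / k)" using True k0 by (intro A.a_mono) auto
 ultimately have "A.c0 * (m powr p + a m + 1) <= W k" unfolding W_def using A.c0_ge1 by (intro mult_left_mono) auto
 thus ?thesis using True A.om_expand[of m] by (simp add: w_def A.cut_def A.c0_def)
next
 case False
 have "0 <= a (1 / k)" using k by (intro A.a_nonneg) auto
 hence "0 <= W k" unfolding W_def using A.c0_ge1 by (intro mult_nonneg_nonneg add_nonneg_nonneg) auto
 thus ?thesis using False by (simp add: w_def A.cut_def)
qed

lemma W_nonneg: "1 <= k ==> 0 <= W k" using W_bound[of k 0] w_bounds(1)[of 0 k] by simp

lemma V_bound: "1 <= k ==> v : V k ==> z : space TH ==> \<bar>v z\<bar> <= W k" using VD(2)[of v k z] W_bound[OF _ TH_mass[of z], of k] by linarith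

lemma F1_dom2:
 assumes k: "1 <= k" and u: "u : V k" shows "A.dom2 (F1 u) (2 * W k / 2)" unfolding F1_def[abs_def]
proof (rule A.dom2_\<kappa>)
 have "(%z. u (fst z, fst (snd z) + snd (snd z))) : Borel THH" using measurable_compose[OF measurable_merge_mass VD(1)[OF u]] by simp
 moreover have "(%z. u (fst z, snd (snd z))) : Borel THH" by (rule measurable_compose[OF _ VD(1)[OF u]]) measurable
 ultimately show "(%z. u (fst z, fst (snd z) + snd (snd z)) - u (fst z, snd (snd z))) : Borel THH" by (rule borel_measurable_diff)
 fix x m m' :: real assume h: "x : {0..<1}" "0 <= m" "0 <= m'"
 have "(x, m + m') : space TH" "(x, m') : space TH" using h by (auto simp: pair_space)
 from this[THEN V_bound[OF k u]]
 show "\<bar>u (fst (x, m, m'), fst (snd (x, m, m')) + snd (snd (x, m, m'))) - u (fst (x, m, m'), snd (snd (x, m, m')))\<bar> <= 2 * W k" by simp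
qed (use W_nonneg[OF k] in simp)

lemma Sg_kgl:
 assumes k: "1 <= k" and u: "u : V k" and h: "x : {0..<1}" "0 <= m"
 shows "Sg s (A.kgl u) (x, m) = Sg s (F1 u) (x, m) - lam s (x, m) * u (x, m)"
proof -
 have e: "slot kk (A.kgl u) (x, m) = slot kk (F1 u) (x, m) - slot kk rate (x, m) * u (x, m)" if kk: "A.om_kernel kk K" for kk
 proof -
  have "slot kk (A.kgl u) (x, m) = (\<integral>m'. F1 u (x, m, m') - rate (x, m, m') * u (x, m) \<partial>kk x)" unfolding slot_def fst_conv snd_conv
   by (rule bochner_cong[OF refl]) (simp add: A.kgl_def A.gl_def F1_def rate_def algebra_simps)
  also have "... = (\<integral>m'. F1 u (x, m, m') \<partial>kk x) - (\<integral>m'. rate (x, m, m') * u (x, m) \<partial>kk x)"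
   using A.slot_integrable[OF kk F1_dom2[OF k u] h] A.slot_integrable[OF kk rate_dom2 h] by (intro Bochner_Integration.integral_diff integrable_mult_left) auto
  finally show ?thesis by (simp add: slot_def)
 qed
 show ?thesis unfolding lam_def Sg_def e[OF A.om_kernel_nk] e[OF B.om_kernel_nk] by (simp add: algebra_simps)
qed

text \<open>Subadditivity of \<open>om\<close> replaces \<open>om (m+m') + om m'\<close> by \<open>om m + 2 om m'\<close>. The first part is the loss rate, which cancels; the second carries the
second moment of \<open>om\<close>.\<close>
lemma slot_F1_le:
 assumes k: "1 <= k" and u: "u : V k" and h: "x : {0..<1}" "0 <= m" and kk: "A.om_kernel kk K"
  and b: "(\<integral>\<^sup>+m. ennreal ((A.om m)\<^sup>2) \<partial>kk x) <= ennreal A.K4"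
 shows "\<bar>slot kk (F1 u) (x, m)\<bar> <= A.om m * slot kk rate (x, m) + A.K4 * A.om m"
proof -
 have sm: "(%m. (A.om m)\<^sup>2) : Borel (kk x)" by (rule A.om_kernelD(6)[OF kk h(1)]) (intro borel_measurable_power A.om_measurable)
 have sq: "integrable (kk x) (%m. (A.om m)\<^sup>2)" by (rule integrableI_bounded[OF sm]) (use b in \<open>auto intro: le_less_trans\<close>)
 have sq4: "(\<integral>m. (A.om m)\<^sup>2 \<partial>kk x) <= A.K4" by (rule integral_le_nn_integral[OF sm _ b A.K4_nonneg]) simp
 note i1 = A.slot_integrable[OF kk F1_dom2[OF k u] h] and i2 = A.slot_integrable[OF kk rate_dom2 h]
 have "\<bar>slot kk (F1 u) (x, m)\<bar> <= (\<integral>m'. \<bar>F1 u (x, m, m')\<bar> \<partial>kk x)" unfolding slot_def by simp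
 also have "... <= (\<integral>m'. A.om m * rate (x, m, m') + A.om m * (A.om m')\<^sup>2 \<partial>kk x)"
 proof (rule integral_mono)
  show "integrable (kk x) (%m'. \<bar>F1 u (x, m, m')\<bar>)" using i1 by simp
  show "integrable (kk x) (%m'. A.om m * rate (x, m, m') + A.om m * (A.om m')\<^sup>2)" using i2 sq by simp
  fix m' assume "m' : space (kk x)"
  hence m': "0 <= m'" using A.om_kernelD(2)[OF kk h(1)] by simp
  show "\<bar>F1 u (x, m, m')\<bar> <= A.om m * rate (x, m, m') + A.om m * (A.om m')\<^sup>2"
  proof (cases "m = 0 \<or> m' = 0")
   case True
   hence "A.\<kappa> m m' = 0" by (rule A.\<kappa>_zero[OF h(2) m'])
   thus ?thesis using A.om_nonneg[OF h(2)] by (simp add: F1_def rate_def)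
  next
   case False
   hence pos: "0 < m" "0 < m'" using h m' by auto
   have "(x, m + m') : space TH" "(x, m') : space TH" using h m' by (auto simp: pair_space)
   from this[THEN VD(3)[OF u]] have "\<bar>u (x, m + m') - u (x, m')\<bar> <= A.om (m + m') + A.om m'" by simp
   also have "... <= A.om m + 2 * A.om m'" using A.om_subadditive[OF pos] by simp
   finally have ub: "\<bar>u (x, m + m') - u (x, m')\<bar> <= A.om m + 2 * A.om m'" .
   have k0: "0 <= A.\<kappa> m m'" by (rule A.\<kappa>_nonneg[OF h(2) m'])
   have "\<bar>F1 u (x, m, m')\<bar> = A.\<kappa> m m' / 2 * \<bar>u (x, m + m') - u (x, m')\<bar>" using k0 by (simp add: F1_def abs_mult)
   also have "... <= A.\<kappa> m m' / 2 * (A.om m + 2 * A.om m')" using k0 ub by (intro mult_left_mono) auto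
   also have "... = A.om m * rate (x, m, m') + A.\<kappa> m m' * A.om m'" by (simp add: rate_def algebra_simps)
   also have "A.\<kappa> m m' * A.om m' <= (A.om m * A.om m') * A.om m'" by (rule mult_right_mono[OF A.\<kappa>_le[OF h(2) m'] A.om_nonneg[OF m']])
   finally show ?thesis by (simp add: power2_eq_square mult.assoc)
  qed
 qed
 also have "... = A.om m * slot kk rate (x, m) + A.om m * (\<integral>m'. (A.om m')\<^sup>2 \<partial>kk x)" using i2 sq by (simp add: slot_def)
 also have "... <= A.om m * slot kk rate (x, m) + A.om m * A.K4" using A.om_nonneg[OF h(2)] sq4 by (intro add_left_mono mult_left_mono)
 finally show ?thesis by (simp add: mult.commute)
qed

text \<open>Here \<open>v\<close> is \<open>w k\<close> times the sign of the difference. The gain is at most the pairing with this sign of \<open>lam * om\<close> plus a multiple of \<open>om\<close>, up to tails, and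
the loss is \<open>- lam * u\<close>; combining them leaves \<open>lam * (v - u)\<close>.\<close>
lemma coll_diff_le:
 assumes k: "1 <= k" and s: "s : {0..T}" and u: "u : V k"
 obtains v where "v : V k"
  "A.coll s u - B.coll s u <= D s (%z. lam s z * (v z - u z)) + 2 * A.K4 * NB k s + (2 * K + 4 * A.K4) * A.tail k"
proof -
 obtain X where X: "X : sets TH" and sg: "!!f g. dq f ==> dq g ==> AE z in A.N s. \<bar>f z\<bar> <= g z ==> AE z in B.N s. \<bar>f z\<bar> <= g z ==>
    D s f <= D s (%z. (2 * indicator X z - 1) * g z)" using sign_set[of s] by blast
 define S where "S z = 2 * indicator X z - (1::real)" for z
 have S1: "\<bar>S z\<bar> = 1" for z by (simp add: S_def indicator_def)
 have Sm: "S : Borel TH" unfolding S_def[abs_def] using X by measurable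
 define e2 where "e2 z = (A.om (snd z))\<^sup>2 * (1 - A.cut k (snd z))" for z :: "real \<times> real"
 define e1 where "e1 z = A.om (snd z) * (1 - A.cut k (snd z))" for z :: "real \<times> real"
 define wl where "wl z = w k (snd z) * lam s z" for z :: "real \<times> real"
 define v where "v z = S z * w k (snd z)" for z
 have sndm: "(%z. f (snd z)) : Borel TH" if "f : Borel halfline" for f :: "real => real" by (rule measurable_compose[OF measurable_snd that])
 have c01: "0 <= 1 - A.cut k m" "1 - A.cut k m <= 1" for m by (simp_all add: A.cut_def indicator_def)
 have vV: "v : V k" unfolding V_def v_def using S1 w_bounds(1)[OF TH_mass] by (auto simp: abs_mult intro!: borel_measurable_times Sm sndm w_measurable)
 have om_dq: "dq (%z. A.om (snd z))" by (rule dq_om[where C=1]) (use A.om_nonneg[OF TH_mass] in \<open>auto intro!: sndm A.om_measurable\<close>)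
 have e2m: "e2 : Borel TH" unfolding e2_def[abs_def]
  by (intro borel_measurable_times borel_measurable_power borel_measurable_diff borel_measurable_const sndm A.om_measurable A.cut_measurable)
 have e1m: "e1 : Borel TH" unfolding e1_def[abs_def]
  by (intro borel_measurable_times borel_measurable_diff borel_measurable_const sndm A.om_measurable A.cut_measurable)
 have e2_dq: "dq e2" by (rule dqI[OF e2m, where C=1]) (use c01 in \<open>auto simp: e2_def abs_mult mult_left_le\<close>)
 have e1_dq: "dq e1"
 proof (rule dq_om[OF e1m, where C=1])
  fix z assume z: "z : space TH"
  show "\<bar>e1 z\<bar> <= 1 * A.om (snd z)" using c01 A.om_nonneg[OF TH_mass[OF z]] by (simp add: e1_def abs_mult mult_left_le)
 qed
 have wl_dq: "dq wl"
 proof (rule dqI[where C=K])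
  show "wl : Borel TH" unfolding wl_def[abs_def] by (intro borel_measurable_times sndm w_measurable lam_measurable)
  fix z assume z: "z : space TH"
  obtain x m where zz: "z = (x, m)" by (cases z)
  have h: "x : {0..<1}" "0 <= m" using z zz by (auto simp: pair_space)
  have "w k m * lam s (x, m) <= A.om m * (K * A.om m)" by (rule mult_mono[OF w_bounds(2)[OF h(2)] lam_bounds(2)[OF h]]) (use A.om_nonneg h lam_bounds(1) in auto)
  thus "\<bar>wl z\<bar> <= K * (A.om (snd z))\<^sup>2" using w_bounds(1)[OF h(2)] lam_bounds(1)[OF h] by (simp add: wl_def zz power2_eq_square abs_mult mult_ac)
 qed
 have ul_dq: "dq (%z. lam s z * u z)"
 proof (rule dqI[where C=K])
  show "(%z. lam s z * u z) : Borel TH" by (intro borel_measurable_times lam_measurable VD(1)[OF u])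
  fix z assume z: "z : space TH"
  obtain x m where zz: "z = (x, m)" by (cases z)
  have h: "x : {0..<1}" "0 <= m" using z zz by (auto simp: pair_space)
  have "\<bar>lam s (x, m)\<bar> * \<bar>u (x, m)\<bar> <= (K * A.om m) * A.om m"
   using VD(3)[OF u z] lam_bounds[OF h, of s] A.om_nonneg[OF h(2)] A.K1 zz by (intro mult_mono) auto
  thus "\<bar>lam s z * u z\<bar> <= K * (A.om (snd z))\<^sup>2" by (simp add: zz abs_mult power2_eq_square mult.assoc)
 qed
 define g where "g z = 1 * wl z + 1 * (K * e2 z + (2 * A.K4) * A.om (snd z))" for z
 have ge_dq: "dq (%z. K * e2 z + (2 * A.K4) * A.om (snd z))" by (rule dq_add[OF e2_dq om_dq])
 have g_dq: "dq g" unfolding g_def[abs_def] by (rule dq_add[OF wl_dq ge_dq])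
 have ptw: "\<bar>Sg s (F1 u) z\<bar> <= g z"
  if z: "z : space TH" and b: "(\<integral>\<^sup>+m. ennreal ((A.om m)\<^sup>2) \<partial>A.nk s (fst z)) <= ennreal A.K4" "(\<integral>\<^sup>+m. ennreal ((A.om m)\<^sup>2) \<partial>B.nk s (fst z)) <= ennreal A.K4" for z
 proof -
  obtain x m where zz: "z = (x, m)" by (cases z)
  have h: "x : {0..<1}" "0 <= m" using z zz by (auto simp: pair_space)
  have o: "0 <= A.om m" by (rule A.om_nonneg[OF h(2)])
  have "\<bar>Sg s (F1 u) (x, m)\<bar> <= \<bar>slot (A.nk s) (F1 u) (x, m)\<bar> + \<bar>slot (B.nk s) (F1 u) (x, m)\<bar>" by (simp add: Sg_def)
  also have "... <= (A.om m * slot (A.nk s) rate (x, m) + A.K4 * A.om m) + (A.om m * slot (B.nk s) rate (x, m) + A.K4 * A.om m)"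
   by (intro add_mono slot_F1_le[OF k u h A.om_kernel_nk] slot_F1_le[OF k u h B.om_kernel_nk]) (use b zz in auto)
  also have "... = A.om m * lam s (x, m) + 2 * A.K4 * A.om m" by (simp add: lam_def Sg_def algebra_simps)
  also have "A.om m * lam s (x, m) = w k m * lam s (x, m) + (A.om m * (1 - A.cut k m)) * lam s (x, m)" by (simp add: w_def algebra_simps)
  also have "(A.om m * (1 - A.cut k m)) * lam s (x, m) <= (A.om m * (1 - A.cut k m)) * (K * A.om m)" using lam_bounds(2)[OF h] o c01 by (intro mult_left_mono) auto
  finally show ?thesis by (simp add: g_def wl_def e2_def zz power2_eq_square mult_ac)
 qed
 have D1: "D s (Sg s (F1 u)) <= D s (%z. S z * g z)" unfolding S_def
 proof (rule sg[OF Sg_dq[OF F1_dom2[OF k u]] g_dq])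
  have ax: "AE x in torus. (\<integral>\<^sup>+m. ennreal ((A.om m)\<^sup>2) \<partial>A.nk s x) <= ennreal A.K4 & (\<integral>\<^sup>+m. ennreal ((A.om m)\<^sup>2) \<partial>B.nk s x) <= ennreal A.K4"
   using A.kernel_om_sq[OF s] B.kernel_om_sq[OF s] by eventually_elim simp
  have "AE z in A.N s. z : space TH" "AE z in B.N s. z : space TH" by (auto intro!: AE_I2 simp: pair_space)
  moreover have "AE z in A.N s. (\<integral>\<^sup>+m. ennreal ((A.om m)\<^sup>2) \<partial>A.nk s (fst z)) <= ennreal A.K4 & (\<integral>\<^sup>+m. ennreal ((A.om m)\<^sup>2) \<partial>B.nk s (fst z)) <= ennreal A.K4"
   unfolding A.N_def by (rule AE_kint_fst[OF A.finite_kernel_nk ax])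
  moreover have "AE z in B.N s. (\<integral>\<^sup>+m. ennreal ((A.om m)\<^sup>2) \<partial>A.nk s (fst z)) <= ennreal A.K4 & (\<integral>\<^sup>+m. ennreal ((A.om m)\<^sup>2) \<partial>B.nk s (fst z)) <= ennreal A.K4"
   unfolding B.N_def by (rule AE_kint_fst[OF B.finite_kernel_nk ax])
  ultimately show "AE z in A.N s. \<bar>Sg s (F1 u) z\<bar> <= g z" "AE z in B.N s. \<bar>Sg s (F1 u) z\<bar> <= g z" by (auto elim!: eventually_elim2 intro!: ptw)
 qed
 have Sdq: "dq f ==> dq (%z. S z * f z)" for f unfolding S_def by (rule dq_sign[OF _ X])
 have Dsum: "D s (%z. S z * (al * f z + \<beta> * f' z)) = al * D s (%z. S z * f z) + \<beta> * D s (%z. S z * f' z)"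
  if "dq f" "dq f'" for f f' al \<beta>
 proof -
  have "D s (%z. al * (S z * f z) + \<beta> * (S z * f' z)) = al * D s (%z. S z * f z) + \<beta> * D s (%z. S z * f' z)"
   by (rule D_linear[OF Sdq[OF that(1)] Sdq[OF that(2)]])
  moreover have "(%z. S z * (al * f z + \<beta> * f' z)) = (%z. al * (S z * f z) + \<beta> * (S z * f' z))" by (simp add: fun_eq_iff algebra_simps)
  ultimately show ?thesis by simp
 qed
 have small: "D s (%z. S z * e z) <= 2 * A.tail k" if e: "dq e" and le: "!!z. z : space TH ==> 0 <= e z & e z <= e2 z" for e
 proof -
  have "A.num s (%z. S z * e z) <= A.num s e2" unfolding A.num_def
  proof (rule integral_mono[OF dqD(2)[OF Sdq[OF e]] dqD(2)[OF e2_dq]])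
   fix z assume "z : space (A.N s)"
   hence "z : space TH" by (simp add: pair_space)
   from le[OF this] show "S z * e z <= e2 z" using S1[of z] by (auto simp: abs_if split: if_splits)
  qed
  moreover have "- B.num s (%z. S z * e z) <= B.num s e2"
  proof -
   have "(\<integral>z. - (S z * e z) \<partial>B.N s) <= B.num s e2" unfolding B.num_def
   proof (rule integral_mono[OF _ dqD(3)[OF e2_dq]])
    show "integrable (B.N s) (%z. - (S z * e z))" using dqD(3)[OF Sdq[OF e]] by simp
    fix z assume "z : space (B.N s)"
    hence "z : space TH" by (simp add: pair_space)
    from le[OF this] show "- (S z * e z) <= e2 z" using S1[of z] by (auto simp: abs_if split: if_splits)
   qed
   thus ?thesis by (simp add: B.num_def)
  qed
  moreover have "A.num s e2 <= A.tail k" "B.num s e2 <= A.tail k" unfolding e2_def by (rule A.num_tail[OF k s], rule B.num_tail[OF k s])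
  ultimately show ?thesis unfolding D_def by linarith
 qed
 have T2: "D s (%z. S z * e2 z) <= 2 * A.tail k" by (rule small[OF e2_dq]) (use c01 in \<open>auto simp: e2_def\<close>)
 have T1: "D s (%z. S z * e1 z) <= 2 * A.tail k"
 proof (rule small[OF e1_dq])
  fix z assume z: "z : space TH"
  show "0 <= e1 z & e1 z <= e2 z" using mult_right_mono[OF A.om_le_sq[OF TH_mass[OF z]] c01(1)] A.om_nonneg[OF TH_mass[OF z]] c01(1) by (simp add: e1_def e2_def)
 qed
 have Tom: "D s (%z. S z * A.om (snd z)) <= NB k s + 2 * A.tail k"
 proof -
  have w_dq: "dq (%z. w k (snd z))" by (rule dq_om[where C=1]) (use w_bounds[OF TH_mass, of _ k] in \<open>auto intro!: sndm w_measurable\<close>)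
  have "D s (%z. S z * A.om (snd z)) = D s (%z. S z * (1 * w k (snd z) + 1 * e1 z))" by (rule D_cong) (simp add: w_def e1_def algebra_simps)
  also have "... = 1 * D s (%z. S z * w k (snd z)) + 1 * D s (%z. S z * e1 z)" by (rule Dsum[OF w_dq e1_dq])
  also have "D s (%z. S z * w k (snd z)) <= NB k s" using NB_upper[OF vV, of s] unfolding v_def .
  finally show ?thesis using T1 by simp
 qed
 have "D s (%z. S z * g z) = 1 * D s (%z. S z * wl z) + 1 * D s (%z. S z * (K * e2 z + (2 * A.K4) * A.om (snd z)))" unfolding g_def by (rule Dsum[OF wl_dq ge_dq])
 also have "D s (%z. S z * (K * e2 z + (2 * A.K4) * A.om (snd z))) = K * D s (%z. S z * e2 z) + (2 * A.K4) * D s (%z. S z * A.om (snd z))"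
  by (rule Dsum[OF e2_dq om_dq])
 finally have calc: "D s (%z. S z * g z) = 1 * D s (%z. S z * wl z) + 1 * (K * D s (%z. S z * e2 z) + (2 * A.K4) * D s (%z. S z * A.om (snd z)))" .
 have D2: "D s (%z. S z * g z) <= D s (%z. S z * wl z) + (K * (2 * A.tail k) + (2 * A.K4) * (NB k s + 2 * A.tail k))"
 proof -
  have "K * D s (%z. S z * e2 z) + (2 * A.K4) * D s (%z. S z * A.om (snd z)) <= K * (2 * A.tail k) + (2 * A.K4) * (NB k s + 2 * A.tail k)"
   by (intro add_mono mult_left_mono T2 Tom) (use A.K1 A.K4_nonneg in auto)
  thus ?thesis unfolding calc mult_1_left by (rule add_left_mono)
 qed
 have kg: "D s (Sg s (A.kgl u)) = D s (%z. 1 * Sg s (F1 u) z + (-1) * (lam s z * u z))"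
 proof (rule D_cong)
  fix z assume z: "z : space TH"
  obtain x m where zz: "z = (x, m)" by (cases z)
  show "Sg s (A.kgl u) z = 1 * Sg s (F1 u) z + (-1) * (lam s z * u z)" unfolding zz using Sg_kgl[OF k u, of x m s] z zz by (auto simp: pair_space)
 qed
 also have "... = 1 * D s (Sg s (F1 u)) + (-1) * D s (%z. lam s z * u z)" by (rule D_linear[OF Sg_dq[OF F1_dom2[OF k u]] ul_dq])
 finally have D3: "D s (Sg s (A.kgl u)) = D s (Sg s (F1 u)) - D s (%z. lam s z * u z)" by simp
 have "D s (%z. lam s z * (v z - u z)) = D s (%z. 1 * (S z * wl z) + (-1) * (lam s z * u z))" by (rule D_cong) (simp add: v_def wl_def algebra_simps)
 also have "... = 1 * D s (%z. S z * wl z) + (-1) * D s (%z. lam s z * u z)" by (rule D_linear[OF Sdq[OF wl_dq] ul_dq])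
 finally have D4: "D s (%z. lam s z * (v z - u z)) = D s (%z. S z * wl z) - D s (%z. lam s z * u z)" by simp
 have "A.coll s u - B.coll s u = D s (Sg s (A.kgl u))" by (rule collision_difference[OF VD(1)[OF u] V_bound[OF k u] W_nonneg[OF k]])
 also have "... <= D s (%z. lam s z * (v z - u z)) + (K * (2 * A.tail k) + (2 * A.K4) * (NB k s + 2 * A.tail k))" using D1 D2 D3 D4 by linarith
 also have "K * (2 * A.tail k) + (2 * A.K4) * (NB k s + 2 * A.tail k) = 2 * A.K4 * NB k s + (2 * K + 4 * A.K4) * A.tail k" by algebra
 finally show thesis by (intro that[OF vV]) simp
qed

lemma coll_coll_measurable:
 assumes f: "f : V k" and t: "0 <= t" "t <= t'" "t' <= T"
 shows "tint t t' (%s. A.coll s (heat a (max 0 (t' - s)) f)) - tint t t' (%s. B.coll s (heat a (max 0 (t' - s)) f))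
   = tint t t' (%s. 1 * A.coll s (heat a (max 0 (t' - s)) f) + (-1) * B.coll s (heat a (max 0 (t' - s)) f))"
 using tint_linear[OF A.mild_equation(2)[OF VD(1)[OF f] VD(3)[OF f] t] A.mild_equation(3)[OF VD(1)[OF f] VD(3)[OF f] t]
   B.mild_equation(2)[OF VD(1)[OF f] VD(3)[OF f] t] B.mild_equation(3)[OF VD(1)[OF f] VD(3)[OF f] t], of t t' 1 "-1"] by simp

text \<open>For each \<open>s\<close> the source is merged with the transported test function: \<open>u + h lam (v - u)\<close> is a convex combination of \<open>u\<close> and \<open>v\<close>, so it does not leave the
class. The sign depends on \<open>s\<close> without any regularity, which is harmless since the estimate is made before integrating in time.\<close>
lemma NB_step:
 assumes k: "1 <= k" and t: "0 <= t" and h: "0 < h" "t + h <= T" and small: "h * (K * W k) <= 1"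
 shows "NB k (t + h) <= (1 + 2 * A.K4 * h) * NB k t + h * ((2 * K + 4 * A.K4) * A.tail k) + h\<^sup>2 * ((2 * K * W k + 2 * A.K4) * L)"
  (is "_ <= ?Q")
proof (rule NB_least)
 fix f assume f: "f : V k"
 let ?u = "%s. heat a (max 0 (t + h - s)) f"
 have tt: "t <= t + h" using h by simp
 note fb = VD(1)[OF f] VD(3)[OF f]
 define I where "I s = 1 * A.coll s (?u s) + (-1) * B.coll s (?u s)" for s
 have key: "I s <= (?Q - D t (heat a h f)) / h" if s: "t < s" "s <= t + h" for s
 proof -
  define u where "u = ?u s"
  have uV: "u : V k" unfolding u_def by (rule heat_V[OF f])
  have sT: "s : {0..T}" using s t h by auto
  have st: "t <= s" "s <= T" using s h by auto
  obtain v where v: "v : V k"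
   and cd: "A.coll s u - B.coll s u <= D s (%z. lam s z * (v z - u z)) + 2 * A.K4 * NB k s + (2 * K + 4 * A.K4) * A.tail k" using coll_diff_le[OF k sT uV] by blast
  define g where "g z = lam s z * (v z - u z)" for z
  have gm: "g : Borel TH" unfolding g_def[abs_def] by (intro borel_measurable_times borel_measurable_diff lam_measurable VD(1)[OF v] VD(1)[OF uV])
  have gb: "\<bar>g z\<bar> <= (2 * K * W k) * A.om (snd z)" if z: "z : space TH" for z
  proof -
   obtain x m where zz: "z = (x, m)" by (cases z)
   have hm: "x : {0..<1}" "0 <= m" using z zz by (auto simp: pair_space)
   have "\<bar>v z - u z\<bar> <= 2 * W k" using V_bound[OF k v z] V_bound[OF k uV z] by linarith
   moreover have "\<bar>lam s z\<bar> <= K * A.om m" using lam_bounds[OF hm, of s] zz by simp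
   ultimately have "\<bar>lam s z\<bar> * \<bar>v z - u z\<bar> <= (K * A.om m) * (2 * W k)" using A.om_nonneg[OF hm(2)] A.K1 by (intro mult_mono) auto
   thus ?thesis by (simp add: g_def abs_mult zz mult_ac)
  qed
  \<comment> \<open>an explicit Euler step stays in the class because the loss rate is bounded on the band\<close>
  have ugV: "(%z. 1 * u z + h * g z) : V k" unfolding V_def
  proof (intro CollectI conjI ballI)
   show "(%z. 1 * u z + h * g z) : Borel TH" by (intro borel_measurable_add borel_measurable_times borel_measurable_const gm VD(1)[OF uV])
   fix z assume z: "z : space TH"
   obtain x m where zz: "z = (x, m)" by (cases z)
   have hm: "x : {0..<1}" "0 <= m" using z zz by (auto simp: pair_space)
   have uz: "\<bar>u z\<bar> <= w k m" and vz: "\<bar>v z\<bar> <= w k m" using VD(2)[OF uV z] VD(2)[OF v z] zz by simp_all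
   show "\<bar>1 * u z + h * g z\<bar> <= w k (snd z)"
   proof (cases "m : {1 / k..k}")
    case False
    hence "w k m = 0" by (simp add: w_def A.cut_def)
    thus ?thesis using uz vz by (simp add: g_def zz)
   next
    case True
    define th where "th = h * lam s z"
    have "A.om m <= W k" using W_bound[OF k hm(2)] True by (simp add: w_def A.cut_def)
    hence "lam s z <= K * W k" using lam_bounds(2)[OF hm, of s] A.K1 zz by (auto intro: order_trans mult_left_mono)
    hence "th <= h * (K * W k)" unfolding th_def using h by (intro mult_left_mono) auto
    hence th1: "th <= 1" using small by linarith
    have th0: "0 <= th" unfolding th_def using lam_bounds(1)[OF hm, of s] h zz by simp
    have "1 * u z + h * g z = (1 - th) * u z + th * v z" by (simp add: g_def th_def algebra_simps)
    also have "\<bar>...\<bar> <= \<bar>(1 - th) * u z\<bar> + \<bar>th * v z\<bar>" by (rule abs_triangle_ineq)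
    also have "... = (1 - th) * \<bar>u z\<bar> + th * \<bar>v z\<bar>" using th0 th1 by (simp add: abs_mult)
    also have "... <= (1 - th) * w k m + th * w k m" using th0 th1 by (intro add_mono mult_left_mono uz vz) auto
    finally show ?thesis by (simp add: zz algebra_simps)
   qed
  qed
  have rs: "0 <= s - t" using st by simp
  have split: "D t (heat a (s - t) (%z. 1 * u z + h * g z)) = D t (heat a h f) + h * D t (heat a (s - t) g)"
  proof -
   have "D t (heat a (s - t) (%z. 1 * u z + h * g z)) = D t (%z. 1 * heat a h f z + h * heat a (s - t) g z)"
   proof (rule D_cong)
    fix z assume z: "z : space TH"
    obtain x m where zz: "z = (x, m)" by (cases z)
    have hm: "x : {0..<1}" "0 <= m" using z zz by (auto simp: pair_space)
    have sl: "(y, m) : space TH" if "y : {0..<1}" for y using that hm by (auto simp: pair_space)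
    have "heat a (s - t) (%z. 1 * u z + h * g z) (x, m) = 1 * heat a (s - t) u (x, m) + h * heat a (s - t) g (x, m)"
    proof (rule A.heat_linear[OF VD(1)[OF uV] _ gm _ hm(2)])
     show "\<bar>u (y, m)\<bar> <= W k" if "y : {0..<1}" for y by (rule V_bound[OF k uV sl[OF that]])
     show "\<bar>g (y, m)\<bar> <= (2 * K * W k) * A.om m" if "y : {0..<1}" for y using gb[OF sl[OF that]] by simp
    qed
    also have "heat a (s - t) u (x, m) = heat a (s - t + max 0 (t + h - s)) f (x, m)" unfolding u_def
    proof (rule A.heat_heat[OF VD(1)[OF f] _ rs _ hm(2)])
     show "\<bar>f (y, m)\<bar> <= W k" if "y : {0..<1}" for y by (rule V_bound[OF k f sl[OF that]])
    qed simp
    also have "s - t + max 0 (t + h - s) = h" using s by simp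
    finally show "heat a (s - t) (%z. 1 * u z + h * g z) z = 1 * heat a h f z + h * heat a (s - t) g z" unfolding zz .
   qed
   also have "... = 1 * D t (heat a h f) + h * D t (heat a (s - t) g)"
   proof (rule D_linear[OF V_dq[OF heat_V[OF f]]])
    show "dq (heat a (s - t) g)" by (rule dq_om[OF heat_measurable[OF A.a_measurable gm] A.heat_om_bound[OF gb]])
   qed
   finally show ?thesis by simp
  qed
  have 1: "D t (heat a h f) + h * D t (heat a (s - t) g) <= NB k t" using NB_upper[OF heat_V[OF ugV], of t "s - t"] unfolding split .
  have sh: "s - t <= h" using s by simp
  have "\<bar>D s g - D t (heat a (s - t) g)\<bar> <= (2 * K * W k) * L * (s - t)" by (rule flow[OF gm gb t st])
  also have "... <= (2 * K * W k) * L * h" using sh A.K1 W_nonneg[OF k] L_nonneg by (intro mult_left_mono) auto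
  finally have 2: "D s g <= D t (heat a (s - t) g) + (2 * K * W k) * L * h" by linarith
  have "NB k s <= NB k t + L * (s - t)" by (rule NB_flow[OF t st])
  also have "... <= NB k t + L * h" using sh L_nonneg by (intro add_left_mono mult_left_mono) auto
  finally have "2 * A.K4 * NB k s <= 2 * A.K4 * (NB k t + L * h)" using A.K4_nonneg by (intro mult_left_mono) auto
  hence "I s <= D t (heat a (s - t) g) + (2 * K * W k) * L * h + 2 * A.K4 * (NB k t + L * h) + (2 * K + 4 * A.K4) * A.tail k"
   using cd 2 unfolding I_def g_def[abs_def] u_def by linarith
  hence "h * I s <= h * (D t (heat a (s - t) g) + (2 * K * W k) * L * h + 2 * A.K4 * (NB k t + L * h) + (2 * K + 4 * A.K4) * A.tail k)"
   using h by (intro mult_left_mono) auto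
  also have "... = h * D t (heat a (s - t) g) + (h * (2 * A.K4 * NB k t) + h * ((2 * K + 4 * A.K4) * A.tail k) + h\<^sup>2 * ((2 * K * W k + 2 * A.K4) * L))"
   by (simp only: power2_eq_square) algebra
  also have "... <= NB k t - D t (heat a h f) + (h * (2 * A.K4 * NB k t) + h * ((2 * K + 4 * A.K4) * A.tail k) + h\<^sup>2 * ((2 * K * W k + 2 * A.K4) * L))"
   using 1 by linarith
  also have "... = ?Q - D t (heat a h f)" by algebra
  finally show ?thesis using h by (simp add: pos_le_divide_eq mult.commute)
 qed
 have Im: "I : Borel borel" unfolding I_def[abs_def] by (intro borel_measurable_add borel_measurable_times borel_measurable_const
    A.mild_equation(2)[OF fb t tt h(2)] B.mild_equation(2)[OF fb t tt h(2)])
 have Ib: "\<bar>I s\<bar> <= 4 * 1 * (K * A.K3) + 4 * 1 * (K * A.K3)" for s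
  using A.mild_equation(3)[OF fb t tt h(2), of s] B.mild_equation(3)[OF fb t tt h(2), of s] unfolding I_def by linarith
 have "tint t (t + h) I <= (?Q - D t (heat a h f)) / h * (t + h - t)" by (rule tint_le[OF Im Ib tt key])
 hence "tint t (t + h) I <= ?Q - D t (heat a h f)" using h by simp
 moreover have "D (t + h) f = D t (heat a h f) + tint t (t + h) I"
  using A.mild_equation(1)[OF fb t tt h(2)] B.mild_equation(1)[OF fb t tt h(2)] coll_coll_measurable[OF f t tt h(2)] unfolding D_def I_def by simp
 ultimately show "D (t + h) f <= ?Q" by linarith
qed

text \<open>Iterating \<open>NB_step\<close> with step \<open>t / n\<close> and letting \<open>n\<close> tend to infinity removes the quadratic term.\<close>
lemma NB_le:
 assumes k: "1 <= k" and t: "t : {0..T}"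
 shows "NB k t <= exp (2 * A.K4 * t) * (t * ((2 * K + 4 * A.K4) * A.tail k))"
proof (cases "t = 0")
 case True
 thus ?thesis using NB_0[of k] by simp
next
 case False
 hence t0: "0 < t" using t by auto
 define al E Q where "al = 2 * A.K4" and "E = (2 * K + 4 * A.K4) * A.tail k" and "Q = (2 * K * W k + 2 * A.K4) * L"
 have nn: "0 <= al" "0 <= E" "0 <= Q" unfolding al_def E_def Q_def using A.K4_nonneg A.K1 A.tail_nonneg[OF k] W_nonneg[OF k] L_nonneg by auto
 have est: "NB k t <= exp (al * t) * (t * E + t\<^sup>2 * Q / real n)" if n: "0 < n" "t * (K * W k) <= real n" for n :: nat
 proof -
  define h where "h = t / real n"
  have h: "0 < h" "real n * h = t" using t0 n by (simp_all add: h_def)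
  have sm: "h * (K * W k) <= 1" using n by (simp add: h_def field_simps)
  define \<eta> where "\<eta> = h * E + h\<^sup>2 * Q"
  have \<eta>: "0 <= \<eta>" unfolding \<eta>_def using h nn by simp
  have it: "NB k (real j * h) <= real j * (1 + al * h) ^ j * \<eta>" if "j <= n" for j using that
  proof (induction j)
   case 0
   thus ?case using NB_0[of k] by simp
  next
   case (Suc j)
   have "real (Suc j) * h <= real n * h" using Suc.prems h by (intro mult_right_mono) auto
   hence le: "real j * h + h <= T" using h t by (simp add: algebra_simps)
   have "NB k (real j * h + h) <= (1 + al * h) * NB k (real j * h) + h * E + h\<^sup>2 * Q"
    unfolding al_def E_def Q_def by (rule NB_step[OF k _ h(1) le sm]) (use h in simp)
   also have "... <= (1 + al * h) * (real j * (1 + al * h) ^ j * \<eta>) + \<eta>"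
    using mult_left_mono[OF Suc.IH, of "1 + al * h"] Suc.prems nn h by (simp add: \<eta>_def)
   also have "... <= (1 + al * h) * (real j * (1 + al * h) ^ j * \<eta>) + (1 + al * h) ^ Suc j * \<eta>"
   proof -
    have "1 <= (1 + al * h) ^ Suc j" by (rule one_le_power) (use nn h in simp)
    hence "1 * \<eta> <= (1 + al * h) ^ Suc j * \<eta>" using \<eta> by (rule mult_right_mono)
    thus ?thesis by simp
   qed
   also have "... = real (Suc j) * (1 + al * h) ^ Suc j * \<eta>" by (simp add: algebra_simps)
   also have "real j * h + h = real (Suc j) * h" by (simp add: algebra_simps)
   finally show ?case .
  qed
  have "(1 + al * h) ^ n <= exp (al * h) ^ n" using nn h by (intro power_mono exp_ge_add_one_self) auto
  also have "... = exp (real n * (al * h))" by (rule exp_of_nat_mult[symmetric])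
  also have "real n * (al * h) = al * t" unfolding h(2)[symmetric] by simp
  finally have ex: "(1 + al * h) ^ n <= exp (al * t)" .
  have "NB k t <= real n * (1 + al * h) ^ n * \<eta>" using it[of n] h by simp
  also have "... = (1 + al * h) ^ n * (real n * \<eta>)" by simp
  also have "... <= exp (al * t) * (real n * \<eta>)" using ex \<eta> by (intro mult_right_mono) auto
  also have "real n * \<eta> = t * E + t\<^sup>2 * Q / real n" unfolding \<eta>_def h_def using n by (simp add: field_simps power2_eq_square)
  finally show ?thesis .
 qed
 have lim: "(%n. exp (al * t) * (t * E + t\<^sup>2 * Q / real n)) \<longlonglongrightarrow> exp (al * t) * (t * E + 0)" by (intro tendsto_intros lim_const_over_n)
 obtain n0 :: nat where n0: "t * (K * W k) <= real n0" using real_arch_simple by blast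
 have "NB k t <= exp (al * t) * (t * E + t\<^sup>2 * Q / real n)" if "Suc n0 <= n" for n by (rule est) (use that n0 in auto)
 hence "NB k t <= exp (al * t) * (t * E + 0)" by (intro LIMSEQ_le_const[OF lim]) blast
 thus ?thesis by (simp add: al_def E_def)
qed

lemma V_mono: "real j <= real n ==> V (real (Suc j)) \<subseteq> V (real (Suc n))"
proof -
 assume jn: "real j <= real n"
 have "w (real (Suc j)) m <= w (real (Suc n)) m" if m: "0 <= m" for m
 proof -
  have "1 / real (Suc n) <= 1 / real (Suc j)" using jn by (intro divide_left_mono) auto
  hence "A.cut (real (Suc j)) m <= A.cut (real (Suc n)) m" using jn unfolding A.cut_def indicator_def by auto
  thus ?thesis unfolding w_def using A.om_nonneg[OF m] by (rule mult_left_mono)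
 qed
 thus ?thesis unfolding V_def using TH_mass by (auto intro: order_trans)
qed

lemma D_zero:
 assumes f: "f : V (real (Suc j))" and t: "t : {0..T}"
 shows "D t f = 0"
proof -
 have le: "D t g <= 0" if g: "g : V (real (Suc j))" for g
 proof -
  let ?b = "%n. exp (2 * A.K4 * t) * (t * ((2 * K + 4 * A.K4) * A.tail (real (Suc n))))"
  have lim: "?b \<longlonglongrightarrow> exp (2 * A.K4 * t) * (t * ((2 * K + 4 * A.K4) * 0))" by (intro tendsto_intros A.tail_tendsto)
  have "D t g <= ?b n" if n: "j <= n" for n
  proof -
   have "g : V (real (Suc n))" using V_mono[of j n] g n by auto
   hence "D t g <= NB (real (Suc n)) t" by (rule NB_upper)
   also have "... <= ?b n" by (rule NB_le[OF _ t]) simp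
   finally show ?thesis .
  qed
  hence "D t g <= exp (2 * A.K4 * t) * (t * ((2 * K + 4 * A.K4) * 0))" by (intro LIMSEQ_le_const[OF lim]) blast
  thus ?thesis by simp
 qed
 have "(%z. - f z) : V (real (Suc j))" using f by (auto simp: V_def)
 from le[OF this] have "0 <= D t f" by (simp add: D_def A.num_def B.num_def)
 thus ?thesis using le[OF f] by simp
qed

theorem solutions_agree:
 assumes t: "t : {0..T}"
 shows "\<mu> t = \<mu>' t"
proof -
 have "A.N t = B.N t"
 proof (rule measure_eqI)
  fix X assume "X : sets (A.N t)"
  hence X: "X : sets TH" by simp
  define F where "F n z = (indicator X z :: real) * A.cut (real (Suc n)) (snd z)" for n :: nat and z
  define f where "f z = (indicator X z :: real) * indicator {0<..} (snd z)" for z :: "real \<times> real"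
  have cm: "(%z. g (snd z)) : Borel TH" if "g : Borel halfline" for g :: "real => real" by (rule measurable_compose[OF measurable_snd that])
  have Fm: "F n : Borel TH" for n unfolding F_def[abs_def] using X by (intro borel_measurable_times borel_measurable_indicator cm A.cut_measurable)
  have fm: "f : Borel TH" unfolding f_def[abs_def] using X by (intro borel_measurable_times borel_measurable_indicator cm borel_measurable_halfline) simp_all
  have FV: "F n : V (real (Suc n))" for n unfolding V_def
  proof (intro CollectI conjI ballI Fm)
   fix z assume z: "z : space TH"
   show "\<bar>F n z\<bar> <= w (real (Suc n)) (snd z)" using A.om_ge1[OF TH_mass[OF z]] by (auto simp: F_def w_def A.cut_def indicator_def)
  qed
  have lim: "(%n. F n z) \<longlonglongrightarrow> f z" if z: "z : space TH" for z
  proof -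
   have m: "0 <= snd z" by (rule TH_mass[OF z])
   obtain n0 :: nat where n0: "max (snd z) (1 / snd z) <= real n0" using real_arch_simple by blast
   have "F n z = f z" if "n0 <= n" for n
   proof (cases "snd z = 0")
    case True
    have "0 < 1 / real (Suc n)" by simp
    thus ?thesis using True by (simp add: F_def f_def A.cut_def indicator_def)
   next
    case False
    hence mp: "0 < snd z" using m by simp
    have "snd z <= real (Suc n)" "1 / snd z <= real (Suc n)" using n0 that by auto
    moreover from this(2) have "1 / real (Suc n) <= snd z" using mp by (simp add: field_simps)
    ultimately show ?thesis using mp by (simp add: F_def f_def A.cut_def indicator_def)
   qed
   hence "eventually (%n. F n z = f z) sequentially" using eventually_sequentially by blast
   thus ?thesis by (rule tendsto_eventually)
  qed
  have bd: "\<bar>F n z\<bar> <= 1 * (A.om (snd z) + (snd z)\<^sup>2)" if z: "z : space TH" for n z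
  proof -
   have "\<bar>F n z\<bar> <= 1" by (simp add: F_def A.cut_def indicator_def)
   also have "1 <= A.om (snd z)" by (rule A.om_ge1[OF TH_mass[OF z]])
   finally show ?thesis by (simp add: add_increasing2)
  qed
  have lA: "(%n. A.num t (F n)) \<longlonglongrightarrow> A.num t f" by (rule A.num_tendsto[OF Fm fm bd lim])
  have lB: "(%n. B.num t (F n)) \<longlonglongrightarrow> B.num t f" by (rule B.num_tendsto[OF Fm fm bd lim])
  have "A.num t (F n) = B.num t (F n)" for n using D_zero[OF FV t, of n] by (simp add: D_def)
  hence "A.num t f = B.num t f" using LIMSEQ_unique[OF lA] lB by simp
  moreover have "A.num t f = A.num t (indicator X)" by (rule A.num_cong[OF fm]) (use X in \<open>auto simp: f_def\<close>)
  moreover have "B.num t f = B.num t (indicator X)" by (rule B.num_cong[OF fm]) (use X in \<open>auto simp: f_def\<close>)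
  moreover have "X \<inter> ({0..<1} \<times> {0..}) = X" using sets.sets_into_space[OF X] by (auto simp: pair_space)
  ultimately have "measure (A.N t) X = measure (B.N t) X" by (simp add: A.num_def B.num_def)
  thus "emeasure (A.N t) X = emeasure (B.N t) X" using finite_measure.emeasure_eq_measure[OF A.finite_N] finite_measure.emeasure_eq_measure[OF B.finite_N] by simp
 qed simp
 thus ?thesis using A.mu_density[OF t] B.mu_density[OF t] by simp
qed

end
text \<open>The essential supremum and the mass are bounded by one constant, and every larger constant also serves; this lets two solutions share it.\<close>
lemma class_D_bounds:
 assumes "\<eta> : class_D w {0..T}"
 obtains K0 where "!!K s. K0 <= K ==> s : {0..T} ==> \<eta> s : finite_measures"
  "!!K s. K0 <= K ==> s : {0..T} ==> disintegrates (\<eta> s) (kernel (\<eta> s))"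
  "!!K s. K0 <= K ==> s : {0..T} ==> AE x in torus. (\<integral>\<^sup>+m. ennreal (w m) / ennreal m \<partial>kernel (\<eta> s) x) <= ennreal K"
  "!!K s. K0 <= K ==> s : {0..T} ==> (\<integral>\<^sup>+z. ennreal (snd z) \<partial>\<eta> s) <= ennreal K"
proof -
 define S1 where "S1 = (SUP t\<in>{0..T}. esssup torus (%x. \<integral>\<^sup>+m. ennreal (w m) / ennreal m \<partial>kernel (\<eta> t) x))"
 define S2 where "S2 = (SUP t\<in>{0..T} \<inter> {..max T 1}. \<integral>\<^sup>+(x, m). ennreal m \<partial>\<eta> t)"
 have cont: "continuous_map (top_of_set {0..T}) weak_topology \<eta>"
  and dis: "!!t. t : {0..T} ==> \<exists>\<upsilon>. disintegrates (\<eta> t) \<upsilon>"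
  and S1: "S1 < \<infinity>" and S: "!!R. 0 < R ==> (SUP t\<in>{0..T} \<inter> {..R}. \<integral>\<^sup>+(x, m). ennreal m \<partial>\<eta> t) < \<infinity>"
  using assms unfolding class_D_def S1_def by auto
 have S2: "S2 < \<infinity>" unfolding S2_def by (rule S) simp
 have r: "S1 = ennreal (enn2real S1)" "S2 = ennreal (enn2real S2)" using S1 S2 by simp_all
 show thesis
 proof (rule that[of "max (enn2real S1) (enn2real S2)"])
  fix K s assume K: "max (enn2real S1) (enn2real S2) <= K" and s: "s : {0..T}"
  have "\<eta> s : topspace weak_topology" using continuous_map_image_subset_topspace[OF cont] s by auto
  thus "\<eta> s : finite_measures" by (auto simp: weak_topology_def topology_generated_by_topspace)
  show "disintegrates (\<eta> s) (kernel (\<eta> s))" unfolding kernel_def by (rule someI_ex[OF dis[OF s]])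
  have "S1 <= ennreal K" by (subst r(1), rule ennreal_leI) (use K in simp)
  moreover have "esssup torus (%x. \<integral>\<^sup>+m. ennreal (w m) / ennreal m \<partial>kernel (\<eta> s) x) <= S1" unfolding S1_def using s by (rule SUP_upper)
  ultimately have b: "esssup torus (%x. \<integral>\<^sup>+m. ennreal (w m) / ennreal m \<partial>kernel (\<eta> s) x) <= ennreal K" by simp
  have "AE x in torus. (\<integral>\<^sup>+m. ennreal (w m) / ennreal m \<partial>kernel (\<eta> s) x) <= esssup torus (%x. \<integral>\<^sup>+m. ennreal (w m) / ennreal m \<partial>kernel (\<eta> s) x)"
   by (rule esssup_AE)
  thus "AE x in torus. (\<integral>\<^sup>+m. ennreal (w m) / ennreal m \<partial>kernel (\<eta> s) x) <= ennreal K" by eventually_elim (rule order_trans[OF _ b])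
  have "S2 <= ennreal K" by (subst r(2), rule ennreal_leI) (use K in simp)
  moreover have "(\<integral>\<^sup>+(x, m). ennreal m \<partial>\<eta> s) <= S2" unfolding S2_def using s by (intro SUP_upper) auto
  ultimately show "(\<integral>\<^sup>+z. ennreal (snd z) \<partial>\<eta> s) <= ennreal K" by (simp add: case_prod_beta')
 qed
qed

theorem corollary1:
  fixes \<Phi> :: "real \<Rightarrow> real \<Rightarrow> real" and a :: "real \<Rightarrow> real"
    and \<nu> :: "(real \<times> real) measure" and \<nu>star :: "real measure"
    and c p T :: real
    and \<mu> \<mu>' :: "real \<Rightarrow> (real \<times> real) measure"
  assumes Phi_nonneg: "\<And>m m'. m \<ge> 0 \<Longrightarrow> m' \<ge> 0 \<Longrightarrow> \<Phi> m m' \<ge> 0"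
    and Phi_sym: "\<And>m m'. m \<ge> 0 \<Longrightarrow> m' \<ge> 0 \<Longrightarrow> \<Phi> m m' = \<Phi> m' m"
    and Phi_zero: "\<And>m. m \<ge> 0 \<Longrightarrow> \<Phi> m 0 = 0 \<and> \<Phi> 0 m = 0"
    and Phi_Lipschitz: "\<And>L. L > 0 \<Longrightarrow> \<exists>\<Gamma>>0. \<forall>m m' m''. m > L \<longrightarrow> m' \<ge> 0 \<longrightarrow> m'' \<ge> 0 \<longrightarrow>
          \<bar>\<Phi> (m + m'') m' - \<Phi> m m'\<bar> \<le> \<Gamma> * m''"
    and a_pos: "\<And>m. m > 0 \<Longrightarrow> a m > 0"
    and a_antimono: "antimono_on {0<..} a"
    and a_zero: "a 0 = 0"
    and nu: "\<nu> \<in> probability_measures"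
    and p_range: "0 \<le> p" "p \<le> 1/2"
    and c_pos: "c > 0"
    and Phi_bound: "\<And>m m'. m \<ge> 0 \<Longrightarrow> m' \<ge> 0 \<Longrightarrow>
          \<Phi> m m' \<le> c * (m powr p + m' powr p) * of_bool (m > 0 \<and> m' > 0)"
    and subadditive: "\<And>m m'. m > 0 \<Longrightarrow> m' > 0 \<Longrightarrow>
          a (m + m') powr (-1/2) * omega c p a (m + m') \<le>
          a m powr (-1/2) * omega c p a m + a m' powr (-1/2) * omega c p a m'"
    and nustar: "sets \<nu>star = sets halfline" "finite_measure \<nu>star"
    and nu_le: "\<And>A. A \<in> sets \<nu> \<Longrightarrow> emeasure \<nu> A \<le> emeasure (torus \<Otimes>\<^sub>M \<nu>star) A"
    and nustar_moment: "(\<integral>\<^sup>+m. ennreal m + ennreal ((a m)\<^sup>2) / ennreal m \<partial>\<nu>star) < \<infinity>"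
    and T: "T \<ge> 0"
    and mu: "\<mu> \<in> class_D (omega c p a) {0..T}" "solves \<Phi> a \<nu> T \<mu>"
    and mu': "\<mu>' \<in> class_D (omega c p a) {0..T}" "solves \<Phi> a \<nu> T \<mu>'"
  shows "\<forall>t\<in>{0..T}. \<mu> t = \<mu>' t"
proof
 fix t assume t: "t : {0..T}"
 obtain K1 where K1: "!!K s. K1 <= K ==> s : {0..T} ==> \<mu> s : finite_measures"
  "!!K s. K1 <= K ==> s : {0..T} ==> disintegrates (\<mu> s) (kernel (\<mu> s))"
  "!!K s. K1 <= K ==> s : {0..T} ==> AE x in torus. (\<integral>\<^sup>+m. ennreal (omega c p a m) / ennreal m \<partial>kernel (\<mu> s) x) <= ennreal K"
  "!!K s. K1 <= K ==> s : {0..T} ==> (\<integral>\<^sup>+z. ennreal (snd z) \<partial>\<mu> s) <= ennreal K" by (rule class_D_bounds[OF mu(1)]) blast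
 obtain K2 where K2: "!!K s. K2 <= K ==> s : {0..T} ==> \<mu>' s : finite_measures"
  "!!K s. K2 <= K ==> s : {0..T} ==> disintegrates (\<mu>' s) (kernel (\<mu>' s))"
  "!!K s. K2 <= K ==> s : {0..T} ==> AE x in torus. (\<integral>\<^sup>+m. ennreal (omega c p a m) / ennreal m \<partial>kernel (\<mu>' s) x) <= ennreal K"
  "!!K s. K2 <= K ==> s : {0..T} ==> (\<integral>\<^sup>+z. ennreal (snd z) \<partial>\<mu>' s) <= ennreal K" by (rule class_D_bounds[OF mu'(1)]) blast
 define K where "K = max 1 (max K1 K2)"
 have K: "1 <= K" "K1 <= K" "K2 <= K" by (simp_all add: K_def)
 have base: "coagulation \<Phi> a c p"
  by (rule coagulation.intro) (rule Phi_nonneg Phi_sym Phi_Lipschitz a_pos a_antimono a_zero p_range c_pos Phi_bound subadditive; assumption)+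
 note cauchy = coagulation_cauchy.intro[OF coagulation_solution.intro[OF coagulation_path.intro[OF base
  coagulation_path_axioms.intro] coagulation_solution_axioms.intro] coagulation_cauchy_axioms.intro]
 have A: "coagulation_cauchy \<Phi> a c p \<mu> T K \<nu> \<nu>star" by (rule cauchy[OF K(1) T K1[OF K(2)] mu(2) nu nustar nu_le nustar_moment])
 have B: "coagulation_cauchy \<Phi> a c p \<mu>' T K \<nu> \<nu>star" by (rule cauchy[OF K(1) T K2[OF K(3)] mu'(2) nu nustar nu_le nustar_moment])
 show "\<mu> t = \<mu>' t" by (rule coagulation_pair.solutions_agree[OF coagulation_pair.intro[OF A B] t])
qed

end
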